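(* Let $r<s\le N/2$ be positive integers with $\gcd(r,s,N)=1$, and let $\widehat{Q}_N^{(r,s)}$ be the Gale–Robinson quiver $Q_N^{(r,s)}$ with principal coefficients. Starting from the seed $(\widehat{Q}_N^{(r,s)},\{x_1,\dots,x_N,y_1,\dots,y_N\})$, mutate periodically at $1,2,\dots,N,1,2,\dots$ and let $\widehat{x_n}$ ($n\ge N+1$) be the resulting cluster variables. Then for every $n\ge N+1$, the Laurent expansion of $\widehat{x_n}$ is $$\widehat{x_n}=cm(G_n^{(r,s,N)})\sum_{M} x(M)\,y(M),$$ where the sum runs over all perfect matchings $M$ of the graph $G_n^{(r,s,N)}$.
   Context: Quiver mutation at a vertex $k$: for every path $i\to k\to j$ add an arrow $i\to j$, reverse all arrows incident to $k$, then delete 2-cycles. Seed mutation at $k$ replaces the variable $X_k$ by $\big(\prod_{i\to k}X_i+\prod_{k\to j}X_j\big)/X_k$ (products over arrows with multiplicity, including arrows to/from frozen vertices) and mutates the quiver at $k$. Gale–Robinson quiver $Q_N^{(r,s)}$ on vertices $1,\dots,N$: (1) arrows $i\to i+r$ for $1\le i\le N-r$ and $j\to N-r+j$ for $1\le j\le r$; (2) arrows $s+i\to i$ for $1\le i\le N-s$ and $N-s+j\to j$ for $1\le j\le s$; (3) arrows $r+i\to s+i$ for $1\le i\le N-r-s$ and $r+j\to N-s+j$ for $1\le j\le s-r$; (4) erase all 2-cycles created. The quiver with principal coefficients $\widehat{Q}_N^{(r,s)}$ has in addition frozen vertices $N+1,\dots,2N$ (never mutated), with one arrow $N+i\to i$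 for each $i$; the variable at vertex $i$ is $x_i$ and at vertex $N+i$ is $y_i$. Periodic mutation: the $k$-th mutation ($k=1,2,\dots$) is at vertex $((k-1)\bmod N)+1$, and $\widehat{x_{N+k}}$ is the new variable produced by the $k$-th mutation. Brane tiling: for $(A,B)\in\mathbb{Z}^2$ let $\lambda(A,B)\in\{1,\dots,N\}$ be the residue of $1+Ar+Bs$ mod $N$. Let $\widetilde Q$ be the infinite quiver with vertex set $\mathbb{Z}^2$, vertex $(A,B)$ labeled $\lambda(A,B)$, an arrow between $(A,B)$ and $(A+1,B)$ oriented from the smaller label to the larger, an arrow between $(A,B)$ and $(A,B+1)$ oriented from the larger label to the smaller, and, in each unit square whose lower-left, upper-left, upper-right, lower-right corners have labels $i,i+s,i+r+s,i+r$ (mod $N$, $i\in\{1,\dots,N\}$), a diagonal arrow from the corner labeled $i+r$ to the corner labeled $i+s$ if $i+r+s\le N$, a diagonal arrow from the corner labeled $i+r+s-N$ to the corner labeled $i$ if $i+r\le N<i+s$, and no diagonal otherwise. The brane tiling $\mathcal T$ is the planar dual of $\widetilde Q$; its faces correspond to vertices of $\widetilde Q$ and carry the same labels. Faces labeled $i$ with $1\le i\le r$ or $N-r+1\le i\le N$ are quadrilaterals, the others hexagons, and $\mathcal T$ is drawn as a subgraph of the square grid in which each quadrilateral face is a unit cell and each hexagonal face is a horizontal $1\times 2$ rectangle (two horizontally adjacent cells with the vertical edge between them removed; its top and bottom each consist of two unit edges). Faces thus lie in horizontal rows of height one. Strips: for $n>N$ let $\bar n\in\{1,\dots,r\}$ with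 $n\equiv N+\bar n\pmod r$; $H_n$ is a set of faces of one row of $\mathcal T$ occupying $2\lfloor (n-N-1)/r\rfloor+1$ consecutive cells whose leftmost cell is a square face labeled $\bar n$ (it is a union of complete faces). $H_n=\emptyset$ for $n\le N$. Pinecone $G_n^{(r,s,N)}$ ($n\ge N+1$): take $H_n$ as central row; in the successive rows above place $H_{n-(N-s)},H_{n-2(N-s)},\dots$ and in the successive rows below place $H_{n-s},H_{n-2s},\dots$, until the strips are empty, glued as faces of $\mathcal T$ in consecutive rows in the unique way such that each strip lies in the interior of the horizontal extent of the adjacent strip closer to the center. $G_n^{(r,s,N)}$ is the subgraph of $\mathcal T$ formed by all edges and vertices bounding these faces. Weights: for an edge $e$ of $\mathcal T$ separating faces labeled $i$ and $j$, $x(e)=1/(x_ix_j)$, and $x(M)=\prod_{e\in M}x(e)$. Covering monomial of a nonempty subgraph $G$ of $\mathcal T$: for each face $F$ of $G$ with label $i$, $m(F)=x_i^{(\#\text{edges of }F)/2-1}$; for each face $F$ of $\mathcal T$ not a face of $G$ but having at least one edge in $G$, with label $i$, $m(F)=x_i^{\lceil e_F/2\rceil}$ where $e_F$ is the number of edges of $F$ lying in $G$; $cm(G)=\prod m(F)$ over both kinds of faces. Heights: let $M_-$ be the minimal perfect matching of $G$, i.e. the unique perfect matching of $G$ all of whose edges are horizontal; for a perfect matching $M$, $y(M)=\prod_F y_{i(F)}^{c(F)}$ over faces $F$ of $G$, where $i(F)$ is the label of $F$ and $c(F)$ is the number of cycles of the symmetric difference $M\oplus M_-$ enclosing $F$.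 *)

theory Defs
  imports
    "HOL-Analysis.Analysis"
    "HOL-Library.Poly_Mapping"
    "HOL-Computational_Algebra.Fraction_Field"
begin

section \<open>Quivers and seeds\<close>

text \<open>\<open>Q i j\<close> is the number of arrows from \<open>i\<close> to \<open>j\<close>.\<close>

type_synonym quiver = "nat \<Rightarrow> nat \<Rightarrow> nat"

definition erase_2cycles :: "quiver \<Rightarrow> quiver" where
  "erase_2cycles Q i j = Q i j - Q j i"

definition add_paths :: "nat \<Rightarrow> quiver \<Rightarrow> quiver" where
  "add_paths k Q i j = Q i j + Q i k * Q k j"

definition reverse_at :: "nat \<Rightarrow> quiver \<Rightarrow> quiver" where
  "reverse_at k Q i j = (if i = k \<or> j = k then Q j i else Q i j)"

definition mutate_quiver :: "nat \<Rightarrow> quiver \<Rightarrow> quiver" where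
  "mutate_quiver k Q = erase_2cycles (reverse_at k (add_paths k Q))"

definition mutate_seed ::
    "nat set \<Rightarrow> nat \<Rightarrow> quiver \<times> (nat \<Rightarrow> 'a::field) \<Rightarrow> quiver \<times> (nat \<Rightarrow> 'a)" where
  "mutate_seed V k = (\<lambda>(Q, X).
     (mutate_quiver k Q,
      X(k := ((\<Prod>i\<in>V. X i ^ Q i k) + (\<Prod>j\<in>V. X j ^ Q k j)) / X k)))"

definition gr_arrows :: "nat \<Rightarrow> nat \<Rightarrow> nat \<Rightarrow> quiver" where
  "gr_arrows r s N a b =
     of_bool (\<exists>i\<in>{1..N - r}. a = i \<and> b = i + r)
   + of_bool (\<exists>j\<in>{1..r}. a = j \<and> b = N - r + j)
   + of_bool (\<exists>i\<in>{1..N - s}. a = s + i \<and> b = i)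
   + of_bool (\<exists>j\<in>{1..s}. a = N - s + j \<and> b = j)
   + of_bool (\<exists>i\<in>{1..N - r - s}. a = r + i \<and> b = s + i)
   + of_bool (\<exists>j\<in>{1..s - r}. a = r + j \<and> b = N - s + j)"

definition gr_quiver :: "nat \<Rightarrow> nat \<Rightarrow> nat \<Rightarrow> quiver" where
  "gr_quiver r s N = erase_2cycles (gr_arrows r s N)"

definition gr_quiver_principal :: "nat \<Rightarrow> nat \<Rightarrow> nat \<Rightarrow> quiver" where
  "gr_quiver_principal r s N a b =
     gr_quiver r s N a b + of_bool (\<exists>i\<in>{1..N}. a = N + i \<and> b = i)"

text \<open>
  Rational functions over \<open>\<rat>\<close> in indeterminates indexed by \<open>nat\<close>.
  The indeterminate of index \<open>i \<in> {1..N}\<close> is \<open>x\<^sub>i\<close>, the one of index \<open>N + i\<close> is \<open>y\<^sub>i\<close>.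
\<close>

type_synonym ratfun = "((nat \<Rightarrow>\<^sub>0 nat) \<Rightarrow>\<^sub>0 rat) fract"

definition indet :: "nat \<Rightarrow> ratfun" where
  "indet i = Fract (Poly_Mapping.single (Poly_Mapping.single i 1) 1) 1"

abbreviation xvar :: "nat \<Rightarrow> ratfun" where
  "xvar i \<equiv> indet i"

abbreviation yvar :: "nat \<Rightarrow> nat \<Rightarrow> ratfun" where
  "yvar N i \<equiv> indet (N + i)"

primrec gr_seed :: "nat \<Rightarrow> nat \<Rightarrow> nat \<Rightarrow> nat \<Rightarrow> quiver \<times> (nat \<Rightarrow> ratfun)" where
  "gr_seed r s N 0 = (gr_quiver_principal r s N, indet)"
| "gr_seed r s N (Suc k) = mutate_seed {1..2 * N} (k mod N + 1) (gr_seed r s N k)"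

text \<open>Meaningful for \<open>n > N\<close>: the variable created by the \<open>(n - N)\<close>-th mutation.\<close>

definition xhat :: "nat \<Rightarrow> nat \<Rightarrow> nat \<Rightarrow> nat \<Rightarrow> ratfun" where
  "xhat r s N n = snd (gr_seed r s N (n - N)) ((n - N - 1) mod N + 1)"


section \<open>The brane tiling\<close>

text \<open>
  A face of the tiling is named by the vertex \<open>(A, B)\<close> of the infinite quiver it is dual to.
  Points of the square grid are pairs of integers, edges are two-element sets of points,
  and a cell is named by its lower left corner.
\<close>

type_synonym face = "int \<times> int"
type_synonym point = "int \<times> int"
type_synonym edge = "point set"

definition label :: "nat \<Rightarrow> nat \<Rightarrow> nat \<Rightarrow> face \<Rightarrow> nat" where
  "label r s N = (\<lambda>(A, B). nat ((A * int r + B * int s) mod int N) + 1)"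

inductive qtilde_arrow :: "nat \<Rightarrow> nat \<Rightarrow> nat \<Rightarrow> face \<Rightarrow> face \<Rightarrow> bool" for r s N where
  "label r s N (A, B) < label r s N (A + 1, B) \<Longrightarrow> qtilde_arrow r s N (A, B) (A + 1, B)"
| "label r s N (A + 1, B) < label r s N (A, B) \<Longrightarrow> qtilde_arrow r s N (A + 1, B) (A, B)"
| "label r s N (A, B + 1) < label r s N (A, B) \<Longrightarrow> qtilde_arrow r s N (A, B) (A, B + 1)"
| "label r s N (A, B) < label r s N (A, B + 1) \<Longrightarrow> qtilde_arrow r s N (A, B + 1) (A, B)"
| "label r s N (A, B) + r + s \<le> N \<Longrightarrow> qtilde_arrow r s N (A + 1, B) (A, B + 1)"
| "label r s N (A, B) + r \<le> N \<Longrightarrow> N < label r s N (A, B) + s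
     \<Longrightarrow> qtilde_arrow r s N (A + 1, B + 1) (A, B)"

definition width :: "nat \<Rightarrow> nat \<Rightarrow> nat \<Rightarrow> face \<Rightarrow> int" where
  "width r s N F = (if label r s N F \<le> r \<or> N - r + 1 \<le> label r s N F then 1 else 2)"

text \<open>
  Face \<open>(A, B)\<close> is drawn as the rectangle \<open>[X, X + width] \<times> [B, B + 1]\<close>, where the function \<open>X\<close>
  gives the abscissa of the left side. All edges have length one, so that a rectangle of
  width two is a hexagon.
\<close>

definition face_edges :: "nat \<Rightarrow> nat \<Rightarrow> nat \<Rightarrow> (face \<Rightarrow> int) \<Rightarrow> face \<Rightarrow> edge set" where
  "face_edges r s N X F =
     {{(x, y), (x + 1, y)} | x y. x \<in> {X F..<X F + width r s N F} \<and> y \<in> {snd F, snd F + 1}}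
   \<union> {{(x, snd F), (x, snd F + 1)} | x. x \<in> {X F, X F + width r s N F}}"

definition face_cells :: "nat \<Rightarrow> nat \<Rightarrow> nat \<Rightarrow> (face \<Rightarrow> int) \<Rightarrow> face \<Rightarrow> point set" where
  "face_cells r s N X F = {X F..<X F + width r s N F} \<times> {snd F}"

text \<open>
  \<open>X\<close> draws the planar dual of the infinite quiver on the square grid: the faces tile the rows,
  and the edges separating two distinct faces correspond one-to-one to the arrows
  between these faces (there is never more than one). This determines \<open>X\<close> up to a
  horizontal translation.
\<close>

definition brane_tiling :: "nat \<Rightarrow> nat \<Rightarrow> nat \<Rightarrow> (face \<Rightarrow> int) \<Rightarrow> bool" where
  "brane_tiling r s N X \<longleftrightarrow>
     (\<forall>A B. X (A + 1, B) = X (A, B) + width r s N (A, B)) \<and>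
     (\<forall>F F'. F \<noteq> F' \<longrightarrow>
        card (face_edges r s N X F \<inter> face_edges r s N X F') =
        of_bool (qtilde_arrow r s N F F' \<or> qtilde_arrow r s N F' F))"


section \<open>Strips and pinecones\<close>

text \<open>The number in \<open>{1..r}\<close> congruent to \<open>m - N\<close> modulo \<open>r\<close>.\<close>

definition strip_label :: "nat \<Rightarrow> nat \<Rightarrow> int \<Rightarrow> nat" where
  "strip_label r N m = nat ((m - int N - 1) mod int r) + 1"

definition is_strip ::
    "nat \<Rightarrow> nat \<Rightarrow> nat \<Rightarrow> (face \<Rightarrow> int) \<Rightarrow> int \<Rightarrow> int \<Rightarrow> face set \<Rightarrow> bool" where
  "is_strip r s N X m B H \<longleftrightarrow>
     (if m \<le> int N then H = {}
      else \<exists>A. label r s N (A, B) = strip_label r N m \<and> (A, B) \<in> H \<and>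
        (\<Union>F\<in>H. face_cells r s N X F) =
        {X (A, B)..<X (A, B) + (2 * ((m - int N - 1) div int r) + 1)} \<times> {B})"

text \<open>The columns of cells met by a strip.\<close>

definition columns :: "nat \<Rightarrow> nat \<Rightarrow> nat \<Rightarrow> (face \<Rightarrow> int) \<Rightarrow> face set \<Rightarrow> int set" where
  "columns r s N X H = fst ` (\<Union>F\<in>H. face_cells r s N X F)"

definition lies_inside ::
    "nat \<Rightarrow> nat \<Rightarrow> nat \<Rightarrow> (face \<Rightarrow> int) \<Rightarrow> face set \<Rightarrow> face set \<Rightarrow> bool" where
  "lies_inside r s N X H H' \<longleftrightarrow>
     Min (columns r s N X H') < Min (columns r s N X H) \<and>
     Max (columns r s N X H) < Max (columns r s N X H')"

text \<open>Index of the strip placed \<open>k\<close> rows above the central one (below it, if \<open>k < 0\<close>).\<close>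

definition row_index :: "nat \<Rightarrow> nat \<Rightarrow> nat \<Rightarrow> int \<Rightarrow> int" where
  "row_index s N n k = (if k \<ge> 0 then int n - k * (int N - int s) else int n - (- k) * int s)"

text \<open>\<open>P\<close> is the set of faces of a copy of the pinecone, with central row \<open>B\<close>.\<close>

definition is_pinecone ::
    "nat \<Rightarrow> nat \<Rightarrow> nat \<Rightarrow> (face \<Rightarrow> int) \<Rightarrow> nat \<Rightarrow> face set \<Rightarrow> bool" where
  "is_pinecone r s N X n P \<longleftrightarrow>
     (\<exists>B H. (\<forall>k. is_strip r s N X (row_index s N n k) (B + k) (H k)) \<and>
            (\<forall>k>0. H k \<noteq> {} \<longrightarrow> lies_inside r s N X (H k) (H (k - 1))) \<and>
            (\<forall>k<0. H k \<noteq> {} \<longrightarrow> lies_inside r s N X (H k) (H (k + 1))) \<and>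
            P = (\<Union>k. H k))"

definition graph_edges :: "nat \<Rightarrow> nat \<Rightarrow> nat \<Rightarrow> (face \<Rightarrow> int) \<Rightarrow> face set \<Rightarrow> edge set" where
  "graph_edges r s N X P = (\<Union>F\<in>P. face_edges r s N X F)"


section \<open>Perfect matchings, weights and heights\<close>

text \<open>A graph without isolated vertices, given by its set of edges.\<close>

definition perfect_matching :: "'v set set \<Rightarrow> 'v set set \<Rightarrow> bool" where
  "perfect_matching E M \<longleftrightarrow> M \<subseteq> E \<and> (\<forall>v\<in>\<Union>E. \<exists>!e. e \<in> M \<and> v \<in> e)"

definition horizontal :: "edge \<Rightarrow> bool" where
  "horizontal e \<longleftrightarrow> (\<exists>x y. e = {(x, y), (x + 1, y)})"

definition minimal_matching :: "edge set \<Rightarrow> edge set" where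
  "minimal_matching E = (THE M. perfect_matching E M \<and> (\<forall>e\<in>M. horizontal e))"

text \<open>The product ranges over the two faces separated by \<open>e\<close>.\<close>

definition edge_weight :: "nat \<Rightarrow> nat \<Rightarrow> nat \<Rightarrow> (face \<Rightarrow> int) \<Rightarrow> edge \<Rightarrow> ratfun" where
  "edge_weight r s N X e =
     1 / (\<Prod>F\<in>{F. e \<in> face_edges r s N X F}. xvar (label r s N F))"

definition x_weight :: "nat \<Rightarrow> nat \<Rightarrow> nat \<Rightarrow> (face \<Rightarrow> int) \<Rightarrow> edge set \<Rightarrow> ratfun" where
  "x_weight r s N X M = (\<Prod>e\<in>M. edge_weight r s N X e)"

definition covering_monomial ::
    "nat \<Rightarrow> nat \<Rightarrow> nat \<Rightarrow> (face \<Rightarrow> int) \<Rightarrow> face set \<Rightarrow> ratfun" where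
  "covering_monomial r s N X P =
     (\<Prod>F\<in>P. xvar (label r s N F) ^ (card (face_edges r s N X F) div 2 - 1)) *
     (\<Prod>F\<in>{F. F \<notin> P \<and> face_edges r s N X F \<inter> graph_edges r s N X P \<noteq> {}}.
        xvar (label r s N F) ^
          nat \<lceil>real (card (face_edges r s N X F \<inter> graph_edges r s N X P)) / 2\<rceil>)"

definition graph_cycles :: "'v set set \<Rightarrow> 'v set set set" where
  "graph_cycles E =
     {C. C \<subseteq> E \<and>
         (\<exists>vs. distinct vs \<and> 3 \<le> length vs \<and>
               C = {{vs ! i, vs ! (Suc i mod length vs)} | i. i < length vs})}"

text \<open>The subset of the plane covered by a set of edges.\<close>

definition plane_curve :: "edge set \<Rightarrow> (real \<times> real) set" where
  "plane_curve C = (\<Union>e\<in>C. convex hull ((\<lambda>(a, b). (real_of_int a, real_of_int b)) ` e))"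

definition face_region ::
    "nat \<Rightarrow> nat \<Rightarrow> nat \<Rightarrow> (face \<Rightarrow> int) \<Rightarrow> face \<Rightarrow> (real \<times> real) set" where
  "face_region r s N X F =
     {real_of_int (X F)<..<real_of_int (X F + width r s N F)} \<times>
     {real_of_int (snd F)<..<real_of_int (snd F + 1)}"

definition height ::
    "nat \<Rightarrow> nat \<Rightarrow> nat \<Rightarrow> (face \<Rightarrow> int) \<Rightarrow> face set \<Rightarrow> edge set \<Rightarrow> face \<Rightarrow> nat" where
  "height r s N X P M F =
     card {C \<in> graph_cycles (sym_diff M (minimal_matching (graph_edges r s N X P))).
             face_region r s N X F \<subseteq> inside (plane_curve C)}"

definition y_weight ::
    "nat \<Rightarrow> nat \<Rightarrow> nat \<Rightarrow> (face \<Rightarrow> int) \<Rightarrow> face set \<Rightarrow> edge set \<Rightarrow> ratfun" where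
  "y_weight r s N X P M = (\<Prod>F\<in>P. yvar N (label r s N F) ^ height r s N X P M F)"


section \<open>Existence of the tiling and of the pinecones\<close>

text \<open>A closed form for the abscissa of the left side of a face in one such drawing.\<close>

definition std_abscissa :: "nat \<Rightarrow> nat \<Rightarrow> nat \<Rightarrow> face \<Rightarrow> int" where
  "std_abscissa r s N = (\<lambda>(A, B). 2 * A + B
     - (A * int r + B * int s) div int N - ((A - 1) * int r + B * int s) div int N)"

lemma div_add_small:
  fixes m t n :: int
  assumes "0 \<le> t" "t \<le> n" "0 < n"
  shows "(m + t) div n = m div n + of_bool (n \<le> m mod n + t)"
proof -
  have 1: "m = m div n * n + m mod n" by simp
  have 2: "0 \<le> m mod n" "m mod n < n" using assms by auto
  have "(m + t) div n = m div n + (m mod n + t) div n"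
    using assms div_mult_self1[of n "m mod n + t" "m div n"] by (simp add: add.assoc[symmetric] ac_simps)
  moreover have "(m mod n + t) div n = of_bool (n \<le> m mod n + t)"
  proof (cases "n \<le> m mod n + t")
    case True
    have "(m mod n + t) div n = 1"
      by (rule int_div_pos_eq[where r = "m mod n + t - n"]) (use True assms 2 in auto)
    then show ?thesis using True by simp
  next
    case False
    then show ?thesis using assms 2 by (simp add: div_pos_pos_trivial)
  qed
  ultimately show ?thesis by simp
qed

lemma div_sub_small:
  fixes m t n :: int
  assumes "0 \<le> t" "t \<le> n" "0 < n"
  shows "(m - t) div n = m div n - of_bool (m mod n < t)"
proof -
  have "(m - t) div n = (m - n + (n - t)) div n" by simp
  also have "\<dots> = (m - n) div n + of_bool (n \<le> (m - n) mod n + (n - t))"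
    using assms by (intro div_add_small) auto
  also have "(m - n) div n = m div n - 1"
    using assms div_add_self2[of n "m - n"] by simp
  also have "(m - n) mod n = m mod n" by simp
  finally show ?thesis by auto
qed

lemma label_eq: "0 < N \<Longrightarrow>
    int (label r s N (A, B)) = (A * int r + B * int s) mod int N + 1"
  by (simp add: label_def)

lemma label_bounds: "0 < N \<Longrightarrow> 1 \<le> label r s N F \<and> label r s N F \<le> N"
proof -
  assume N: "0 < N"
  obtain A B where F: "F = (A, B)" by fastforce
  have "(A * int r + B * int s) mod int N < int N" using N by simp
  then have "int (label r s N (A, B)) \<le> int N" unfolding label_eq[OF N] by simp
  moreover have "1 \<le> label r s N F" unfolding F by (simp add: label_def)
  ultimately show ?thesis unfolding F by linarith
qed

context
  fixes r s N :: nat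
  assumes r: "0 < r" "r < s" "2 * s \<le> N"
begin

lemma Npos: "0 < N" using r by simp

lemma label_step:
  "int (label r s N (A + 1, B)) =
     int (label r s N (A, B)) + int r - int N * of_bool (N < label r s N (A, B) + r)"
  "int (label r s N (A, B + 1)) =
     int (label r s N (A, B)) + int s - int N * of_bool (N < label r s N (A, B) + s)"
proof -
  have *: "(m + int t) mod int N = m mod int N + int t - int N * of_bool (int N \<le> m mod int N + int t)"
    if "t \<le> N" for m :: int and t
  proof -
    have "(m + int t) mod int N = m + int t - (m + int t) div int N * int N"
      by (simp only: minus_div_mult_eq_mod)
    also have "\<dots> = (m - m div int N * int N) + int t
        - int N * of_bool (int N \<le> m mod int N + int t)"
      using div_add_small[of "int t" "int N" m] that Npos by (simp add: algebra_simps)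
    finally show ?thesis by (simp only: minus_div_mult_eq_mod)
  qed
  have "(A + 1) * int r + B * int s = (A * int r + B * int s) + int r"
    "A * int r + (B + 1) * int s = (A * int r + B * int s) + int s"
    by (auto simp: algebra_simps)
  note e = this
  show "int (label r s N (A + 1, B)) =
     int (label r s N (A, B)) + int r - int N * of_bool (N < label r s N (A, B) + r)"
    unfolding label_eq[OF Npos] e using *[of r "A * int r + B * int s"] r label_eq[OF Npos, of r s A B]
    by (auto simp: of_bool_def)
  show "int (label r s N (A, B + 1)) =
     int (label r s N (A, B)) + int s - int N * of_bool (N < label r s N (A, B) + s)"
    unfolding label_eq[OF Npos] e using *[of s "A * int r + B * int s"] r label_eq[OF Npos, of r s A B]
    by (auto simp: of_bool_def)
qed

lemma width_eq: "width r s N F = 2 - of_bool (label r s N F \<le> r) - of_bool (N < label r s N F + r)"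
  using r label_bounds[OF Npos, of r s F] by (auto simp: width_def)

lemma std_abscissa_right:
  "std_abscissa r s N (A + 1, B) = std_abscissa r s N (A, B) + width r s N (A, B)"
proof -
  define m where "m = A * int r + B * int s"
  have e: "(A + 1) * int r + B * int s = m + int r" "(A - 1) * int r + B * int s = m - int r"
    "A * int r + B * int s = m"
    by (auto simp: m_def algebra_simps)
  have L: "int (label r s N (A, B)) = m mod int N + 1" using label_eq[OF Npos] m_def by simp
  have "(m + int r) div int N = m div int N + of_bool (int N \<le> m mod int N + int r)"
    "(m - int r) div int N = m div int N - of_bool (m mod int N < int r)"
    by (rule div_add_small div_sub_small; use r in simp)+
  then show ?thesis unfolding std_abscissa_def width_eq using L by (auto simp: e)
qed

lemma std_abscissa_up:
  "std_abscissa r s N (A + 1, B + 1) = std_abscissa r s N (A + 1, B) +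
     of_bool (label r s N (A, B) + r + s \<le> N) -
     of_bool (label r s N (A, B) + r \<le> N \<and> N < label r s N (A, B) + s)"
proof -
  define m where "m = A * int r + B * int s"
  have e: "(A + 1) * int r + (B + 1) * int s = m + int (r + s)" "A * int r + (B + 1) * int s = m + int s"
    "(A + 1) * int r + B * int s = m + int r"
    "A * int r + B * int s = m"
    by (auto simp: m_def algebra_simps)
  have L: "int (label r s N (A, B)) = m mod int N + 1" using label_eq[OF Npos] m_def by simp
  have "(m + int r) div int N = m div int N + of_bool (int N \<le> m mod int N + int r)"
    "(m + int s) div int N = m div int N + of_bool (int N \<le> m mod int N + int s)"
    "(m + int (r + s)) div int N = m div int N + of_bool (int N \<le> m mod int N + int (r + s))"
    by (rule div_add_small; use r in simp)+
  then show ?thesis unfolding std_abscissa_def using L r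
    by (auto simp: e simp del: of_nat_add)
qed

end

definition hedge :: "point \<Rightarrow> edge" where "hedge = (\<lambda>(x, y). {(x, y), (x + 1, y)})"
definition vedge :: "point \<Rightarrow> edge" where "vedge = (\<lambda>(x, y). {(x, y), (x, y + 1)})"

lemma inj_hedge: "inj hedge" and inj_vedge: "inj vedge" and hv: "hedge p \<noteq> vedge q"
  by (auto simp: inj_def hedge_def vedge_def doubleton_eq_iff split: prod.splits)

lemma face_edges_eq:
  "face_edges r s N X F =
     hedge ` ({X F..<X F + width r s N F} \<times> {snd F, snd F + 1}) \<union>
     vedge ` ({X F, X F + width r s N F} \<times> {snd F})"
proof -
  have "{{(x, y), (x + 1, y)} | x y. x \<in> S \<and> y \<in> T} = hedge ` (S \<times> T)" for S T
    unfolding hedge_def by (auto simp: image_iff Bex_def)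
  moreover have "{{(x, y), (x, y + 1)} | x. x \<in> S} = vedge ` (S \<times> {y})" for S y
    unfolding vedge_def by (auto simp: image_iff Bex_def)
  ultimately show ?thesis unfolding face_edges_def by (simp only:)
qed

lemma hedge_vedge_Int:
  "(hedge ` S \<union> vedge ` T) \<inter> (hedge ` S' \<union> vedge ` T') = hedge ` (S \<inter> S') \<union> vedge ` (T \<inter> T')"
proof -
  have "hedge ` S \<inter> vedge ` T' = {}" "vedge ` T \<inter> hedge ` S' = {}"
    using hv by (auto dest: sym)
  then show ?thesis
    unfolding image_Int[OF inj_hedge] image_Int[OF inj_vedge] Int_Un_distrib Int_Un_distrib2
    by simp
qed

lemma card_common:
  fixes X r s N F F'
  defines "I \<equiv> {X F..<X F + width r s N F} \<inter> {X F'..<X F' + width r s N F'}"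
  defines "J \<equiv> {X F, X F + width r s N F} \<inter> {X F', X F' + width r s N F'}"
  shows "card (face_edges r s N X F \<inter> face_edges r s N X F') =
     card I * card ({snd F, snd F + 1} \<inter> {snd F', snd F' + 1}) + card J * of_bool (snd F = snd F')"
proof -
  have "face_edges r s N X F \<inter> face_edges r s N X F' =
     hedge ` (I \<times> ({snd F, snd F + 1} \<inter> {snd F', snd F' + 1})) \<union> vedge ` (J \<times> ({snd F} \<inter> {snd F'}))"
    (is "_ = ?H \<union> ?V")
    unfolding face_edges_eq hedge_vedge_Int Times_Int_Times I_def J_def ..
  moreover have "?H \<inter> ?V = {}" using hv by blast
  moreover have "finite I" "finite J" by (auto simp: I_def J_def)
  ultimately have "card (face_edges r s N X F \<inter> face_edges r s N X F') = card ?H + card ?V"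
    by (simp add: card_Un_disjoint)
  moreover have "card ?H = card I * card ({snd F, snd F + 1} \<inter> {snd F', snd F' + 1})"
    by (subst card_image) (auto intro: inj_on_subset[OF inj_hedge] simp: card_cartesian_product)
  moreover have "card ?V = card J * of_bool (snd F = snd F')"
    by (subst card_image) (auto intro: inj_on_subset[OF inj_vedge] simp: card_cartesian_product)
  ultimately show ?thesis by simp
qed


context
  fixes r s N :: nat
  assumes r: "0 < r" "r < s" "2 * s \<le> N"
begin

lemma qtilde_arrow_iff:
  "qtilde_arrow r s N (A, B) (C, D) \<longleftrightarrow>
     B = D \<and> (C = A + 1 \<or> A = C + 1) \<and> label r s N (A, B) < label r s N (C, D) \<or>
     A = C \<and> (D = B + 1 \<or> B = D + 1) \<and> label r s N (C, D) < label r s N (A, B) \<or>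
     D = B + 1 \<and> A = C + 1 \<and> label r s N (C, B) + r + s \<le> N \<or>
     B = D + 1 \<and> A = C + 1 \<and> label r s N (C, D) + r \<le> N \<and> N < label r s N (C, D) + s"
  (is "?l \<longleftrightarrow> ?r")
proof
  assume ?l then show ?r by cases auto
next
  assume ?r then show ?l by (elim disjE conjE) (auto intro: qtilde_arrow.intros)
qed

lemma adj_iff:
  "qtilde_arrow r s N (A, B) (C, D) \<or> qtilde_arrow r s N (C, D) (A, B) \<longleftrightarrow>
     B = D \<and> (C = A + 1 \<or> A = C + 1) \<or>
     D = B + 1 \<and> (C = A \<or> A = C + 1 \<and> label r s N (C, B) + r + s \<le> N
        \<or> C = A + 1 \<and> label r s N (A, B) + r \<le> N \<and> N < label r s N (A, B) + s) \<or>
     B = D + 1 \<and> (A = C \<or> C = A + 1 \<and> label r s N (A, D) + r + s \<le> N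
        \<or> A = C + 1 \<and> label r s N (C, D) + r \<le> N \<and> N < label r s N (C, D) + s)"
proof -
  have 1: "label r s N (A + 1, B) \<noteq> label r s N (A, B)" for A B
    using label_step(1)[OF r, of A B] r by (cases "N < label r s N (A, B) + r") auto
  have 2: "label r s N (A, B + 1) \<noteq> label r s N (A, B)" for A B
    using label_step(2)[OF r, of A B] r by (cases "N < label r s N (A, B) + s") auto
  have 3: "label r s N (A, B) \<noteq> label r s N (C, D)" if "B = D \<and> (C = A + 1 \<or> A = C + 1)"
    using 1[of A B] 1[of C D] that by auto
  have 4: "label r s N (A, B) \<noteq> label r s N (C, D)" if "A = C \<and> (D = B + 1 \<or> B = D + 1)"
    using 2[of A B] 2[of C D] that by auto
  consider "B = D" | "D = B + 1" | "B = D + 1" | "B \<noteq> D" "D \<noteq> B + 1" "B \<noteq> D + 1" by blast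
  then show ?thesis
  proof cases
    case 1
    then show ?thesis unfolding qtilde_arrow_iff using 3 by (simp add: neq_iff disj_commute) blast
  next
    case 2
    then show ?thesis unfolding qtilde_arrow_iff using 4 by (simp add: neq_iff disj_commute) blast
  next
    case 3
    then show ?thesis unfolding qtilde_arrow_iff using 4 by (simp add: neq_iff disj_commute) blast
  next
    case 4
    then show ?thesis unfolding qtilde_arrow_iff by simp
  qed
qed

lemma width_bounds: "1 \<le> width r s N F" "width r s N F \<le> 2"
  by (auto simp: width_def)

lemma abscissa_mono:
  assumes X: "\<And>A. X (A + 1, B) = X (A, B) + width r s N (A, B)" and "A \<le> C"
  shows "X (A, B) + (C - A) \<le> X (C, B)"
  using \<open>A \<le> C\<close>
proof (induction C rule: int_ge_induct)
  case (step i)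
  then show ?case using X[of i] width_bounds(1)[of "(i, B)"] by simp
qed simp

private abbreviation "X0 \<equiv> std_abscissa r s N"

lemma same_row:
  assumes "A < C"
  shows "card (face_edges r s N X0 (A, B) \<inter> face_edges r s N X0 (C, B)) = of_bool (C = A + 1)"
proof -
  let ?w = "width r s N"
  note R = std_abscissa_right[OF r]
  have 1: "X0 (A, B) + ?w (A, B) + (C - A - 1) \<le> X0 (C, B)"
    using abscissa_mono[of X0 B "A + 1" C] assms R[of _ B] by auto
  have I: "{X0 (A, B)..<X0 (A, B) + ?w (A, B)} \<inter> {X0 (C, B)..<X0 (C, B) + ?w (C, B)} = {}"
    using 1 assms by auto
  have J: "{X0 (A, B), X0 (A, B) + ?w (A, B)} \<inter> {X0 (C, B), X0 (C, B) + ?w (C, B)} =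
      (if C = A + 1 then {X0 (C, B)} else {})"
    using 1 assms R[of A B] width_bounds(1)[of "(A, B)"] width_bounds(1)[of "(C, B)"] by auto
  show ?thesis unfolding card_common I J by simp
qed

lemma next_row:
  "card (face_edges r s N X0 (A, B) \<inter> face_edges r s N X0 (C, B + 1)) =
    of_bool (C = A \<or> A = C + 1 \<and> label r s N (C, B) + r + s \<le> N
        \<or> C = A + 1 \<and> label r s N (A, B) + r \<le> N \<and> N < label r s N (A, B) + s)"
proof -
  let ?w = "width r s N"
  define d where "d A = (of_bool (label r s N (A, B) + r + s \<le> N) -
     of_bool (label r s N (A, B) + r \<le> N \<and> N < label r s N (A, B) + s) :: int)" for A
  note R = std_abscissa_right[OF r]
  have U: "X0 (A + 1, B + 1) = X0 (A + 1, B) + d A" for A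
    using std_abscissa_up[OF r] by (simp add: d_def)
  have U': "X0 (A, B + 1) = X0 (A, B) + d (A - 1)" for A
    using U[of "A - 1"] by simp
  have dd: "-1 \<le> d A" "d A \<le> 1" for A by (auto simp: d_def)
  have Y: "{B, B + 1} \<inter> {B + 1, B + 1 + 1} = {B + 1}" by auto
  have card_I: "card (face_edges r s N X0 (A, B) \<inter> face_edges r s N X0 (C, B + 1)) =
      nat (min (X0 (A + 1, B)) (X0 (C + 1, B + 1)) - max (X0 (A, B)) (X0 (C, B + 1)))"
    unfolding card_common by (simp add: Y R Int_atLeastLessThan)
  consider "C = A" | "C = A + 1" | "A = C + 1" | "A + 2 \<le> C" | "C + 2 \<le> A" by linarith
  then show ?thesis
  proof cases
    case 1
    have L: "int (label r s N (A, B)) = int (label r s N (A - 1, B)) + int r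
        - int N * of_bool (N < label r s N (A - 1, B) + r)"
      using label_step(1)[OF r, of "A - 1" B] by simp
    have b: "1 \<le> label r s N (A - 1, B)" "label r s N (A - 1, B) \<le> N"
       "1 \<le> label r s N (A, B)" "label r s N (A, B) \<le> N"
      using label_bounds[OF Npos[OF r]] by auto
    have "?w (A, B) + min 0 (d A) - max 0 (d (A - 1)) = 1"
    proof (cases "N < label r s N (A - 1, B) + r")
      case True
      then show ?thesis using L b r unfolding width_eq[OF r] d_def by auto
    next
      case False
      then show ?thesis using L b r unfolding width_eq[OF r] d_def by auto
    qed
    moreover have "X0 (A + 1, B) = X0 (A, B) + ?w (A, B)" "X0 (A + 1, B + 1) = X0 (A + 1, B) + d A"
       "X0 (A, B + 1) = X0 (A, B) + d (A - 1)" by (rule R U U')+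
    ultimately have "min (X0 (A + 1, B)) (X0 (A + 1, B + 1)) - max (X0 (A, B)) (X0 (A, B + 1)) = 1"
      by linarith
    then show ?thesis unfolding card_I unfolding 1 by simp
  next
    case 2
    have "X0 (A + 1, B) = X0 (A, B) + ?w (A, B)" "X0 (A + 1, B + 1) = X0 (A + 1, B) + d A"
      "X0 (A + 1 + 1, B + 1) = X0 (A + 1, B + 1) + ?w (A + 1, B + 1)" by (rule R U)+
    then have "min (X0 (A + 1, B)) (X0 (A + 1 + 1, B + 1)) - max (X0 (A, B)) (X0 (A + 1, B + 1)) = - d A
        \<or> d A \<ge> 0 \<and> min (X0 (A + 1, B)) (X0 (A + 1 + 1, B + 1)) - max (X0 (A, B)) (X0 (A + 1, B + 1)) \<le> 0"
      using width_bounds[of "(A, B)"] width_bounds[of "(A + 1, B + 1)"] dd[of A] by linarith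
    then have "card (face_edges r s N X0 (A, B) \<inter> face_edges r s N X0 (C, B + 1)) = nat (- d A)"
      unfolding card_I unfolding 2 by linarith
    then show ?thesis unfolding 2 using r by (auto simp: d_def)
  next
    case 3
    have "X0 (C + 1 + 1, B) = X0 (C + 1, B) + ?w (C + 1, B)" "X0 (C + 1, B + 1) = X0 (C + 1, B) + d C"
      "X0 (C + 1, B + 1) = X0 (C, B + 1) + ?w (C, B + 1)" by (rule R U)+
    then have "min (X0 (C + 1 + 1, B)) (X0 (C + 1, B + 1)) - max (X0 (C + 1, B)) (X0 (C, B + 1)) = d C
        \<or> d C \<le> 0 \<and> min (X0 (C + 1 + 1, B)) (X0 (C + 1, B + 1)) - max (X0 (C + 1, B)) (X0 (C, B + 1)) \<le> 0"
      using width_bounds[of "(C, B + 1)"] width_bounds[of "(C + 1, B)"] dd[of C] by linarith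
    then have "card (face_edges r s N X0 (A, B) \<inter> face_edges r s N X0 (C, B + 1)) = nat (d C)"
      unfolding card_I unfolding 3 by linarith
    then show ?thesis unfolding 3 using r by (auto simp: d_def)
  next
    case 4
    have "X0 (A + 1, B) \<le> X0 (C, B + 1)"
      using abscissa_mono[of X0 "B + 1" "A + 2" C] 4 R[of _ "B + 1"] U[of "A + 1"] R[of "A + 1" B]
        dd[of "A + 1"] width_bounds[of "(A + 1, B)"] by (auto simp: algebra_simps)
    then show ?thesis unfolding card_I using 4 by auto
  next
    case 5
    have "X0 (C + 1, B + 1) \<le> X0 (A, B)"
      using abscissa_mono[of X0 B "C + 2" A] 5 R[of _ B] U[of C] R[of "C + 1" B]
        dd[of C] width_bounds[of "(C + 1, B)"] by (auto simp: algebra_simps)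
    then show ?thesis unfolding card_I using 5 by auto
  qed
qed

lemma far_row:
  assumes "B + 1 < D"
  shows "card (face_edges r s N X0 (A, B) \<inter> face_edges r s N X0 (C, D)) = 0"
proof -
  have Y: "{B, B + 1} \<inter> {D, D + 1} = {}" using assms by auto
  show ?thesis unfolding card_common using assms by (simp add: Y)
qed

lemma brane_tiling_std: "brane_tiling r s N X0"
proof -
  have *: "card (face_edges r s N X0 (A, B) \<inter> face_edges r s N X0 (C, D)) =
      of_bool (qtilde_arrow r s N (A, B) (C, D) \<or> qtilde_arrow r s N (C, D) (A, B))"
    if BD: "B < D \<or> B = D \<and> A < C" for A B C D
  proof -
    consider "B = D" "A < C" | "D = B + 1" | "B + 1 < D" using BD by fastforce
    then show ?thesis
    proof cases
      case 1 then show ?thesis unfolding adj_iff using same_row[of A C B] by auto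
    next
      case 2 then show ?thesis unfolding adj_iff using next_row[of A B C] by auto
    next
      case 3 then show ?thesis unfolding adj_iff using far_row[of B D A C] by auto
    qed
  qed
  have "card (face_edges r s N X0 F \<inter> face_edges r s N X0 F') =
        of_bool (qtilde_arrow r s N F F' \<or> qtilde_arrow r s N F' F)" if neq: "F \<noteq> F'" for F F'
  proof -
    obtain A B C D where F: "F = (A, B)" "F' = (C, D)" by fastforce
    consider "B < D \<or> B = D \<and> A < C" | "D < B \<or> D = B \<and> C < A" using neq F by fastforce
    then show ?thesis
      by cases (use *[of B D A C] *[of D B C A] F in \<open>simp_all add: Int_commute disj_commute\<close>)
  qed
  then show ?thesis unfolding brane_tiling_def using std_abscissa_right[OF r] by blast
qed

lemma strip_end:
  assumes "label r s N (A, B) \<le> r"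
  shows "\<exists>j. X0 (A + int j, B) = X0 (A, B) + 2 * int q + 1 \<and> r < label r s N (A + int j, B)"
proof (induction q)
  note R = std_abscissa_right[OF r] and L = label_step(1)[OF r]
  case 0
  show ?case
    by (rule exI[of _ 1]) (use assms r R[of A B] L[of A B] label_bounds[OF Npos[OF r], of r s "(A, B)"]
        in \<open>auto simp: width_def\<close>)
next
  note R = std_abscissa_right[OF r] and L = label_step(1)[OF r]
  case (Suc q)
  then obtain j where j: "X0 (A + int j, B) = X0 (A, B) + 2 * int q + 1"
    "r < label r s N (A + int j, B)" by blast
  define a where "a = A + int j"
  have b: "label r s N (a, B) \<le> N" using label_bounds[OF Npos[OF r], of r s "(a, B)"] by simp
  show ?case
  proof (cases "label r s N (a, B) + r \<le> N")
    case True
    have e: "A + int (j + 1) = a + 1" by (simp add: a_def)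
    show ?thesis
      by (rule exI[of _ "j + 1"], unfold e)
        (use True j[folded a_def] R[of a B] L[of a B] r in \<open>auto simp: width_def\<close>)
  next
    case False
    have "label r s N (a + 1, B) \<le> r" "int (label r s N (a + 1, B)) = int (label r s N (a, B)) + int r - int N"
      using False L[of a B] b by auto
    note l = this
    have e: "A + int (j + 2) = a + 1 + 1" by (simp add: a_def)
    show ?thesis
      by (rule exI[of _ "j + 2"], unfold e)
        (use l False j[folded a_def] R[of a B] R[of "a + 1" B] L[of "a + 1" B] r
          in \<open>auto simp: width_def\<close>)
  qed
qed

lemma cells_row:
  "(\<Union>F\<in>{A..<A + int j} \<times> {B}. face_cells r s N X0 F) = {X0 (A, B)..<X0 (A + int j, B)} \<times> {B}"
proof (induction j)
  case (Suc j)
  have "{A..<A + int (Suc j)} = insert (A + int j) {A..<A + int j}" by auto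
  then have "(\<Union>F\<in>{A..<A + int (Suc j)} \<times> {B}. face_cells r s N X0 F) =
      face_cells r s N X0 (A + int j, B) \<union> {X0 (A, B)..<X0 (A + int j, B)} \<times> {B}"
    using Suc by auto
  moreover have "X0 (A, B) \<le> X0 (A + int j, B)"
    using abscissa_mono[of X0 B A "A + int j"] std_abscissa_right[OF r, of _ B] by auto
  moreover have "X0 (A + int (Suc j), B) = X0 (A + int j, B) + width r s N (A + int j, B)"
    using std_abscissa_right[OF r, of "A + int j" B] by (simp add: algebra_simps)
  moreover have "1 \<le> width r s N (A + int j, B)" by (rule width_bounds)
  ultimately show ?case by (auto simp: face_cells_def)
qed simp

lemma is_pinecone_std:
  assumes g: "gcd r (gcd s N) = 1" and n: "N < n"
  shows "\<exists>P. is_pinecone r s N X0 n P"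
proof -
  define m where "m k = row_index s N n k - int N - 1" for k
  define q where "q k = m k div int r" for k
  define t where "t k = m k mod int r" for k
  have mqt: "m k = q k * int r + t k" for k by (simp add: q_def t_def)
  have t: "0 \<le> t k" "t k < int r" for k using r by (auto simp: t_def)
  obtain u v where uv: "u * int s + v * int N = gcd (int s) (int N)" using bezout_int by blast
  obtain u' v' where uv': "u' * int r + v' * gcd (int s) (int N) = gcd (int r) (gcd (int s) (int N))"
    using bezout_int by blast
  have "gcd (int r) (gcd (int s) (int N)) = 1" using g by (metis gcd_int_int_eq of_nat_1)
  then have uv'': "u' * int r + v' * (u * int s + v * int N) = 1" using uv uv' by simp
  define C where "C = m 0 * u'"
  define B where "B = m 0 * (v' * u)"
  define e where "e = m 0 * (v' * v)"
  have CB: "C * int r + B * int s + e * int N = m 0"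
    using arg_cong[OF uv'', of "\<lambda>z. m 0 * z"] by (simp add: C_def B_def e_def algebra_simps)
  define A where "A k = C - q k" for k
  have mk: "m k = m 0 + k * int s - max k 0 * int N" for k
    by (auto simp: m_def row_index_def algebra_simps max_def)
  have AB: "A k * int r + (B + k) * int s = t k + (max k 0 - e) * int N" for k
    using CB mk[of k] mqt[of k] unfolding A_def by (simp add: algebra_simps)
  have lab: "label r s N (A k, B + k) = strip_label r N (row_index s N n k)" for k
  proof -
    have "(t k + (max k 0 - e) * int N) mod int N = t k"
      using t[of k] r by simp
    then show ?thesis unfolding label_def strip_label_def prod.case AB
      by (simp add: t_def m_def algebra_simps)
  qed
  have lab_le: "label r s N (A k, B + k) \<le> r" for k
    unfolding lab strip_label_def using t[of k] r unfolding t_def m_def by linarith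
  define c where "c = 2 * C + B + 2 * e + 1"
  have X: "X0 (A k, B + k) = c - 2 * q k - \<bar>k\<bar>" for k
  proof -
    have "(A k - 1) * int r + (B + k) * int s = t k + int N - int r + (max k 0 - e - 1) * int N"
      using AB[of k] by (simp add: algebra_simps)
    moreover have "(t k + int N - int r + (max k 0 - e - 1) * int N) div int N = max k 0 - e - 1"
      using t[of k] r by (simp add: div_pos_pos_trivial)
    moreover have "(t k + (max k 0 - e) * int N) div int N = max k 0 - e"
      using t[of k] r by (simp add: div_pos_pos_trivial)
    ultimately show ?thesis unfolding std_abscissa_def prod.case AB
      by (auto simp: A_def c_def)
  qed
  have q_nonneg: "0 \<le> q k" if "\<not> row_index s N n k \<le> int N" for k
    using that r by (auto simp: q_def m_def pos_imp_zdiv_nonneg_iff)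
  have "\<exists>j. X0 (A k + int j, B + k) = X0 (A k, B + k) + 2 * q k + 1"
    if "\<not> row_index s N n k \<le> int N" for k
    using strip_end[OF lab_le[of k], of "nat (q k)"] q_nonneg[OF that] by auto
  then obtain j where j: "X0 (A k + int (j k), B + k) = X0 (A k, B + k) + 2 * q k + 1"
    if "\<not> row_index s N n k \<le> int N" for k by metis
  define H where "H k = (if row_index s N n k \<le> int N then {} else {A k..<A k + int (j k)} \<times> {B + k})" for k
  have cells: "(\<Union>F\<in>H k. face_cells r s N X0 F) =
      {X0 (A k, B + k)..<X0 (A k, B + k) + (2 * q k + 1)} \<times> {B + k}"
    if "\<not> row_index s N n k \<le> int N" for k
    using that cells_row[of "A k" "j k" "B + k"] j[OF that] by (simp add: H_def add.assoc)
  have inH: "(A k, B + k) \<in> H k" if "\<not> row_index s N n k \<le> int N" for k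
    using that j[OF that] q_nonneg[OF that] by (cases "j k") (auto simp: H_def)
  have strip: "is_strip r s N X0 (row_index s N n k) (B + k) (H k)" for k
    unfolding is_strip_def using lab[of k] inH[of k] cells[of k]
    by (auto simp: H_def[of k] q_def m_def)
  have cols: "columns r s N X0 (H k) = {c - 2 * q k - \<bar>k\<bar>..c - \<bar>k\<bar>}"
    if "\<not> row_index s N n k \<le> int N" for k
    unfolding columns_def cells[OF that] unfolding X by auto
  have MM: "Min (columns r s N X0 (H k)) = c - 2 * q k - \<bar>k\<bar>"
    "Max (columns r s N X0 (H k)) = c - \<bar>k\<bar>"
    if "\<not> row_index s N n k \<le> int N" for k
    using q_nonneg[OF that] by (auto simp: cols[OF that] intro!: Min_eqI Max_eqI)
  have nest: "lies_inside r s N X0 (H k) (H l)"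
    if "H k \<noteq> {}" "\<bar>k\<bar> = \<bar>l\<bar> + 1" "m k + int r \<le> m l" for k l
  proof -
    have k: "\<not> row_index s N n k \<le> int N" using that by (auto simp: H_def split: if_splits)
    then have l: "\<not> row_index s N n l \<le> int N" using that r by (auto simp: m_def)
    have "(m k + int r) div int r \<le> q l" unfolding q_def using that(3) r by (intro zdiv_mono1) auto
    then have "q k + 1 \<le> q l" using r by (simp add: q_def)
    then show ?thesis unfolding lies_inside_def using MM[OF k] MM[OF l] that(2) by auto
  qed
  have "lies_inside r s N X0 (H k) (H (k - 1))" if "k > 0" "H k \<noteq> {}" for k
    by (rule nest) (use that r in \<open>auto simp: mk[of k] mk[of "k - 1"] algebra_simps\<close>)
  moreover have "lies_inside r s N X0 (H k) (H (k + 1))" if "k < 0" "H k \<noteq> {}" for k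
    by (rule nest) (use that r mk[of k] mk[of "k + 1"] in \<open>auto simp: algebra_simps\<close>)
  ultimately show ?thesis unfolding is_pinecone_def using strip by blast
qed

end

end

theory Submission
  imports Defs
begin

text \<open>
  A perfect matching \<open>M\<close> of the pinecone is encoded by its height function on the faces:
  \<open>M \<oplus> M\<^sub>-\<close> is a disjoint union of cycles that all turn the same way when \<open>M\<close> is oriented against
  \<open>M\<^sub>-\<close>, so the number of cycles around a face is a potential whose jumps across the edges record
  \<open>M\<close>. In coordinates relative to the central row, the potentials are exactly the integer functions
  supported on the pinecone whose differences between neighbouring faces obey bounds that depend
  only on the labels. Hence the sum over matchings is a monomial times a polynomial in the products
  of \<open>y\<^sub>i\<close> with the exchange monomial of the vertex \<open>i\<close>.

  Mutating the initial seed at vertex 1 is an urban renewal at all faces with label 1: summing out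
  the heights of these faces turns the polynomial for \<open>n\<close> into the one for \<open>n - 1\<close> with mutated
  arguments. Iterating until the pinecone degenerates yields the bilinear recurrence with
  coefficients that the cluster variables satisfy. The leading monomials solve the corresponding
  two-term recurrence, and counting the edges of \<open>M\<^sub>-\<close> around each face shows that they equal
  the covering monomial times the weight of \<open>M\<^sub>-\<close>.
\<close>


section \<open>Urban renewal for height functions\<close>

text \<open>The recurrence is proved without superimposing matchings of different pinecones. Since
  renewal replaces the arguments \<open>y\<close> by \<open>mut y\<close>, the recurrence must be
  proved for arbitrary arguments and only then specialised to y times a neighbour monomial. Each
  mutation divides by y and by 1 + y; therefore the arguments range over a set that is closed under
  sums, products and quotients and avoids 0, later the subtraction-free rational functions. Two
  definitions resist direct use. Heights refer to the topological \<open>inside\<close> of a curve: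
  here the matchings supply an integer function on the cells that jumps by one exactly across a
  cycle, and this takes the place of the Jordan curve theorem. The drawing \<open>X\<close> and the
  pinecone \<open>P\<close> are arbitrary solutions of local conditions, so both must be shown to be
  rigid before explicit coordinates are available.\<close>

lemma prod_sum_PiE:
  fixes f :: "'a \<Rightarrow> 'b \<Rightarrow> 'c::comm_semiring_1"
  assumes "finite I" "\<And>i. i \<in> I \<Longrightarrow> finite (J i)"
  shows "(\<Prod>i\<in>I. \<Sum>j\<in>J i. f i j) = (\<Sum>g\<in>PiE I J. \<Prod>i\<in>I. f i (g i))"
  using assms
proof (induction I rule: finite_induct)
  case (insert a I)
  have inj: "inj_on (\<lambda>(y, g). g(a := y)) (J a \<times> PiE I J)"
    using insert(2) by (auto simp: inj_on_def PiE_def extensional_def fun_eq_iff)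
  have "(\<Sum>g\<in>PiE (insert a I) J. \<Prod>i\<in>insert a I. f i (g i)) =
      (\<Sum>(y, g)\<in>J a \<times> PiE I J. f a y * (\<Prod>i\<in>I. f i (g i)))"
    unfolding PiE_insert_eq using insert(1,2)
    by (subst sum.reindex[OF inj])
      (auto intro!: sum.cong arg_cong2[where f = "(*)"] prod.cong)
  also have "\<dots> = (\<Sum>y\<in>J a. f a y) * (\<Sum>g\<in>PiE I J. \<Prod>i\<in>I. f i (g i))"
    by (simp add: sum.cartesian_product[symmetric] sum_product)
  finally show ?case using insert by simp
qed simp

text \<open>The ranges \<open>L g c\<close> depend on \<open>h\<close> only off \<open>Z\<close>, so
  the values on \<open>Z\<close> can be summed independently of each other. Masking by 0 on
  \<open>Z\<close> picks a canonical representative of each fibre.\<close>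

lemma sum_over_fibres:
  fixes w :: "'a \<Rightarrow> int \<Rightarrow> 'b::comm_semiring_1"
  assumes fin: "finite P" "finite B" "\<And>g c. g \<in> B \<Longrightarrow> c \<in> Z \<Longrightarrow> finite (L g c)" and ZP: "Z \<subseteq> P"
    and B0: "\<And>g c. g \<in> B \<Longrightarrow> c \<in> Z \<Longrightarrow> g c = 0"
  shows "(\<Sum>h | (\<lambda>F. if F \<in> Z then 0 else h F) \<in> B \<and>
              (\<forall>c\<in>Z. h c \<in> L (\<lambda>F. if F \<in> Z then 0 else h F) c). \<Prod>F\<in>P. w F (h F)) =
    (\<Sum>g\<in>B. (\<Prod>F\<in>P - Z. w F (g F)) * (\<Prod>c\<in>Z. \<Sum>t\<in>L g c. w c t))"
proof -
  define glue where "glue = (\<lambda>(g, f) F. if F \<in> Z then f F else g F :: int)"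
  have finZ: "finite Z" using ZP fin(1) by (rule finite_subset)
  have red: "(\<lambda>F. if F \<in> Z then 0 else glue (g, f) F) = g" if "g \<in> B" for g f
    using B0[OF that] by (auto simp: glue_def)
  have inj: "inj_on glue (Sigma B (\<lambda>g. PiE Z (L g)))"
  proof (rule inj_onI, clarify)
    fix g f g' f' assume A: "g \<in> B" "f \<in> PiE Z (L g)" "g' \<in> B" "f' \<in> PiE Z (L g')"
      "glue (g, f) = glue (g', f')"
    have g: "g = g'" using red[OF A(1), of f] red[OF A(3), of f'] unfolding A(5) by (rule trans[OF sym])
    have "f c = f' c" for c
      using fun_cong[OF A(5), of c] A(2,4) by (cases "c \<in> Z") (auto simp: glue_def PiE_def extensional_def)
    then show "g = g' \<and> f = f'" using g by auto
  qed
  have img: "{h. (\<lambda>F. if F \<in> Z then 0 else h F) \<in> B \<and>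
              (\<forall>c\<in>Z. h c \<in> L (\<lambda>F. if F \<in> Z then 0 else h F) c)} = glue ` Sigma B (\<lambda>g. PiE Z (L g))"
    (is "?C = _")
  proof (intro set_eqI iffI)
    fix h assume h: "h \<in> ?C"
    let ?g = "\<lambda>F. if F \<in> Z then 0 else h F"
    have "h = glue (?g, restrict h Z)" by (auto simp: glue_def)
    moreover have "(?g, restrict h Z) \<in> Sigma B (\<lambda>g. PiE Z (L g))" using h by auto
    ultimately show "h \<in> glue ` Sigma B (\<lambda>g. PiE Z (L g))" by (rule image_eqI)
  next
    fix h assume "h \<in> glue ` Sigma B (\<lambda>g. PiE Z (L g))"
    then obtain g f where A: "g \<in> B" "f \<in> PiE Z (L g)" "h = glue (g, f)" by auto
    have "(\<lambda>F. if F \<in> Z then 0 else h F) = g" unfolding A(3) by (rule red[OF A(1)])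
    moreover have "\<forall>c\<in>Z. h c \<in> L g c" using A(2) unfolding A(3) by (auto simp: glue_def)
    ultimately show "h \<in> ?C" using A(1) by simp
  qed
  have "(\<Sum>h\<in>?C. \<Prod>F\<in>P. w F (h F)) =
     (\<Sum>(g, f)\<in>Sigma B (\<lambda>g. PiE Z (L g)). \<Prod>F\<in>P. w F (glue (g, f) F))"
    unfolding img by (subst sum.reindex[OF inj]) (simp add: case_prod_beta)
  also have "\<dots> = (\<Sum>g\<in>B. \<Sum>f\<in>PiE Z (L g). \<Prod>F\<in>P. w F (glue (g, f) F))"
    using fin finZ by (subst sum.Sigma) (auto intro!: finite_PiE)
  also have "\<dots> = (\<Sum>g\<in>B. \<Sum>f\<in>PiE Z (L g). (\<Prod>F\<in>P - Z. w F (g F)) * (\<Prod>c\<in>Z. w c (f c)))"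
  proof (intro sum.cong refl)
    fix g f
    have "(\<Prod>F\<in>P. w F (glue (g, f) F)) =
       (\<Prod>F\<in>P - Z. w F (glue (g, f) F)) * (\<Prod>F\<in>Z. w F (glue (g, f) F))"
      by (rule prod.subset_diff[OF ZP fin(1)])
    also have "\<dots> = (\<Prod>F\<in>P - Z. w F (g F)) * (\<Prod>c\<in>Z. w c (f c))"
      by (intro arg_cong2[where f = "(*)"] prod.cong) (auto simp: glue_def)
    finally show "(\<Prod>F\<in>P. w F (glue (g, f) F)) = \<dots>" .
  qed
  also have "\<dots> = (\<Sum>g\<in>B. (\<Prod>F\<in>P - Z. w F (g F)) * (\<Prod>c\<in>Z. \<Sum>t\<in>L g c. w c t))"
    using finZ fin(3) by (intro sum.cong refl) (simp add: sum_distrib_left prod_sum_PiE)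
  finally show ?thesis .
qed

text \<open>The hypotheses leave six cases. At most one of the two intervals has two elements, and
  then its sum has the factor 1 + y. The exponent 1 + u + d - p - q is 1, -1 or 0 according to
  whether that is the left interval, the right one or neither.\<close>

lemma urban_renewal_local:
  fixes y :: "'a::field" and p q u d :: int
  assumes y: "y \<noteq> 0" "1 + y \<noteq> 0"
    and "u \<in> {p - 1, p}" "u \<in> {q - 1, q}" "d \<in> {p - 1, p}" "d \<in> {q - 1, q}"
  shows "(\<Sum>t\<in>{max p q..min u d + 1}. y powi t) =
    y powi (p + q) * (1 + y) powi (1 + u + d - p - q) * (\<Sum>t\<in>{max u d..min p q}. (1 / y) powi t)"
proof -
  have two: "{a..a + 1} = {a, a + 1}" "{a - 1..a} = {a - 1, a}" for a :: int by auto
  have inv: "(1 / y) powi t = y powi (- t)" for t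
    by (simp add: power_int_minus power_int_divide_distrib field_simps)
  have e1: "y powi (p + p) * y powi (- p) = y powi p"
    using y by (simp add: power_int_add[symmetric])
  have e2: "y powi (p + p) * y powi (1 - p) = y powi (p + 1)"
    using y by (simp add: power_int_add[symmetric])
  have e3: "(1 + y) powi - 1 = inverse (1 + y)" by (simp add: power_int_minus)
  consider "p = q" "u = p" "d = p" | "p = q" "u = p - 1" "d = p" | "p = q" "u = p" "d = p - 1"
    | "p = q" "u = p - 1" "d = p - 1" | "q = p + 1" "u = p" "d = p" | "p = q + 1" "u = q" "d = q"
    using assms(3-6) by auto
  then show ?thesis
  proof cases
    case 1
    have "y powi p + y powi (p + 1) = y powi (p + p) * (1 + y) * y powi (- p)"
      using y e1 by (simp add: power_int_add algebra_simps)
    then show ?thesis using two(1)[of q] 1 by (simp add: inv add.commute)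
  next
    case 2
    then show ?thesis using y e1 by (simp add: inv)
  next
    case 3
    then show ?thesis using y e1 by (simp add: inv)
  next
    case 4
    have "y powi (p + p) * (1 + y) powi - 1 * (y powi (1 - p) + y powi - p) =
        (y powi (p + 1) + y powi p) * inverse (1 + y)"
      unfolding e3 using e1 e2 by (simp add: algebra_simps)
    also have "\<dots> = y powi p * ((1 + y) * inverse (1 + y))"
      using y by (simp add: power_int_add algebra_simps)
    also have "\<dots> = y powi p" using y by simp
    finally show ?thesis unfolding 4 using two(2)[of q] 4(1) by (simp add: inv)
  next
    case 5
    then show ?thesis using y by (simp add: inv power_int_add[symmetric])
  next
    case 6
    then show ?thesis using y by (simp add: inv power_int_add[symmetric])
  qed
qed

section \<open>Admissible heights in coordinates relative to the central row\<close>

locale gale_robinson =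
  fixes r s N :: int
  assumes r_pos: "0 < r" and r_less: "r < s" and s_le: "2 * s \<le> N"
begin

lemma N_pos: "0 < N" using r_pos r_less s_le by linarith

text \<open>Labels are counted from 0 here. The origin is a face of the central row whose label is the
  vertex at which the \<open>n\<close>-th variable is produced.\<close>

definition lab :: "int \<Rightarrow> int \<times> int \<Rightarrow> int" where
  "lab n = (\<lambda>(i, k). (n - 1 + i * r + k * s) mod N)"

text \<open>A weighted distance from the origin: a step outward to the right, left, up or down costs
  N - r, r, N - s or s, in each case minus the change of the label modulo N. Hence
  \<open>n - 1 - dst F\<close> lifts the label of F to an integer, see
  \<open>dst_mod\<close>.\<close>

definition dst :: "int \<times> int \<Rightarrow> int" where
  "dst = (\<lambda>(i, k). max (- i * r) (i * (N - r)) + max (k * (N - s)) (- k * s))"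

text \<open>The indices of the strips drop by N - s or s per row, and in a row the strip contains
  the faces i for which - i r and i (N - r) are at most what the index has left above N + 1.
  Together this is one sublevel set of \<open>dst\<close>.\<close>

definition pine :: "int \<Rightarrow> (int \<times> int) set" where
  "pine n = {F. dst F \<le> n - N - 1}"

text \<open>Relates the rows k and k + 1. A height may only drop, by at most 1, on moving one row
  away from the centre, and k is the nearer row exactly if k is nonnegative.\<close>

definition step01 :: "int \<Rightarrow> int \<Rightarrow> int \<Rightarrow> bool" where
  "step01 k a b \<longleftrightarrow> (if 0 \<le> k then 0 \<le> a - b \<and> a - b \<le> 1 else 0 \<le> b - a \<and> b - a \<le> 1)"

text \<open>One conjunct for each dual arrow in the unit square with lower left corner (i, k): its
  bottom side, its left side and the diagonal, if there is one. Labels are counted from 0, hence the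
  strict inequalities.\<close>

definition conf_at :: "int \<Rightarrow> (int \<times> int \<Rightarrow> int) \<Rightarrow> int \<Rightarrow> int \<Rightarrow> bool" where
  "conf_at l h i k \<longleftrightarrow>
     (if l + r < N then 0 \<le> h (i, k) - h (i + 1, k) \<and> h (i, k) - h (i + 1, k) \<le> 1
      else 0 \<le> h (i + 1, k) - h (i, k) \<and> h (i + 1, k) - h (i, k) \<le> 1) \<and>
     step01 k (h (i, k)) (h (i, k + 1)) \<and>
     (l + r + s < N \<longrightarrow> step01 k (h (i + 1, k)) (h (i, k + 1))) \<and>
     (l + r < N \<and> N \<le> l + s \<longrightarrow> step01 k (h (i, k)) (h (i + 1, k + 1)))"

definition conf :: "int \<Rightarrow> (int \<times> int \<Rightarrow> int) set" where
  "conf n = {h. (\<forall>F. 0 \<le> h F) \<and> (\<forall>F. F \<notin> pine n \<longrightarrow> h F = 0) \<and>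
               (\<forall>i k. conf_at (lab n (i, k)) h i k)}"

text \<open>By \<open>xhat_eq_fpoly\<close> this is the F-polynomial of the n-th cluster
  variable.\<close>

definition fpoly :: "int \<Rightarrow> (int \<Rightarrow> 'a::field) \<Rightarrow> 'a" where
  "fpoly n y = (\<Sum>h\<in>conf n. \<Prod>F\<in>pine n. y (lab n F) powi h F)"

text \<open>Coefficient mutation at the vertex 0 followed by renumbering l + 1 as l and 0 as N - 1.
  The labels r and N - r are distinct, but s and N - s coincide if N = 2 s, and then the factor 1 +
  y 0 has to occur twice.\<close>

definition mut :: "(int \<Rightarrow> 'a::field) \<Rightarrow> int \<Rightarrow> 'a" where
  "mut y l = (if l = N - 1 then 1 / y 0
     else y (l + 1) * (if l + 1 = r \<or> l + 1 = N - r then y 0 / (1 + y 0) else 1)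
       * ((if l + 1 = s then 1 + y 0 else 1) * (if l + 1 = N - s then 1 + y 0 else 1)))"

lemma lab_bounds: "0 \<le> lab n F" "lab n F < N"
  using N_pos by (auto simp: lab_def split: prod.split)

lemma mod_add_small:
  fixes m t :: int assumes "0 \<le> t" "t \<le> N"
  shows "(m + t) mod N = (if m mod N + t < N then m mod N + t else m mod N + t - N)"
proof -
  have "(m + t) mod N = m + t - (m + t) div N * N" by (simp add: minus_div_mult_eq_mod)
  also have "\<dots> = m - m div N * N + t - (if m mod N + t < N then 0 else N)"
    using div_add_small[OF assms N_pos, of m] by (simp add: algebra_simps)
  finally show ?thesis by (simp add: minus_div_mult_eq_mod)
qed

lemma lab_right: "lab n (i + 1, k) = (if lab n (i, k) + r < N then lab n (i, k) + r else lab n (i, k) + r - N)"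
proof -
  have "n - 1 + (i + 1) * r + k * s = (n - 1 + i * r + k * s) + r" by (simp add: algebra_simps)
  then show ?thesis unfolding lab_def prod.case using mod_add_small[of r "n - 1 + i * r + k * s"] r_pos r_less s_le
    by (simp only:)
qed

lemma lab_up: "lab n (i, k + 1) = (if lab n (i, k) + s < N then lab n (i, k) + s else lab n (i, k) + s - N)"
proof -
  have "n - 1 + i * r + (k + 1) * s = (n - 1 + i * r + k * s) + s" by (simp add: algebra_simps)
  then show ?thesis unfolding lab_def prod.case using mod_add_small[of s "n - 1 + i * r + k * s"] r_pos r_less s_le
    by (simp only:)
qed

lemma lab_Suc: "lab n F = (if lab (n - 1) F + 1 < N then lab (n - 1) F + 1 else 0)"
proof -
  obtain i k where F: "F = (i, k)" by fastforce
  define m where "m = n - 1 - 1 + i * r + k * s"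
  have e: "n - 1 + i * r + k * s = m + 1" "n - 1 - 1 + i * r + k * s = m" by (simp_all add: m_def)
  define q where "q = m mod N"
  have "0 \<le> q" "q < N" using N_pos by (auto simp: q_def)
  then show ?thesis unfolding lab_def F prod.case e using mod_add_small[of 1 m] N_pos
    unfolding q_def[symmetric] by auto
qed

lemma lab_pred: "lab (n - 1) F = (if lab n F = 0 then N - 1 else lab n F - 1)"
  using lab_Suc[of n F] lab_bounds[of "n - 1" F] by auto

lemma dst_nonneg: "0 \<le> max (- i * r) (i * (N - r))" "0 \<le> max (k * (N - s)) (- k * s)"
  using r_pos r_less s_le by (auto simp: le_max_iff_disj zero_le_mult_iff mult_le_0_iff)

lemma dst_step:
  "dst (i + 1, k) = dst (i, k) + (if 0 \<le> i then N - r else - r)"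
  "dst (i, k + 1) = dst (i, k) + (if 0 \<le> k then N - s else - s)"
proof -
  have *: "max (- (i + 1) * t) ((i + 1) * (N - t)) =
      max (- i * t) (i * (N - t)) + (if 0 \<le> i then N - t else - t)" if "0 < t" "t < N" for i t
  proof (cases "0 \<le> i")
    case True
    then have "- i * t \<le> i * (N - t)" "- (i + 1) * t \<le> (i + 1) * (N - t)"
      using that by (smt (verit) mult_minus_left mult_nonneg_nonneg)+
    then show ?thesis using True by (simp add: algebra_simps)
  next
    case False
    then have "i * (N - t) \<le> - i * t" "(i + 1) * (N - t) \<le> - (i + 1) * t"
      using that N_pos mult_nonneg_nonneg[of "- i" "N"] mult_nonneg_nonneg[of "- i - 1" "N"]
      by (auto simp: algebra_simps)
    then show ?thesis using False by (simp add: algebra_simps)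
  qed
  show "dst (i + 1, k) = dst (i, k) + (if 0 \<le> i then N - r else - r)"
    unfolding dst_def prod.case by (subst *) (use r_pos r_less s_le in auto)
  show "dst (i, k + 1) = dst (i, k) + (if 0 \<le> k then N - s else - s)"
    unfolding dst_def prod.case max.commute[of "_ * (N - s)"] by (subst *) (use r_pos r_less s_le in auto)
qed

lemma dst_mod: "(n - 1 - dst F) mod N = lab n F"
proof -
  obtain i k where F: "F = (i, k)" by fastforce
  have "max (- i * r) (i * (N - r)) = - i * r \<or> max (- i * r) (i * (N - r)) = - i * r + i * N"
    by (auto simp: max_def algebra_simps)
  moreover have "max (k * (N - s)) (- k * s) = - k * s \<or> max (k * (N - s)) (- k * s) = - k * s + k * N"
    by (auto simp: max_def algebra_simps)
  ultimately obtain a b where "max (- i * r) (i * (N - r)) = - i * r + a * N"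
     "max (k * (N - s)) (- k * s) = - k * s + b * N"
    by (metis add.right_neutral mult_zero_left)
  then have "n - 1 - dst F = n - 1 + i * r + k * s + (- a - b) * N"
    by (simp add: F dst_def algebra_simps)
  then show ?thesis by (simp only: F lab_def prod.case mod_mult_self1)
qed

text \<open>By \<open>dst_mod\<close>, n - 1 - dst G is a multiple of N. The bound on dst G makes it
  positive, so it is at least N.\<close>

lemma pine_closed:
  assumes "F \<in> pine n" "lab n G = 0" "dst G < dst F + N"
  shows "G \<in> pine n"
proof -
  have "N dvd n - 1 - dst G" using dst_mod[of n G] assms(2) by auto
  then obtain z where z: "n - 1 - dst G = N * z" by auto
  have "N * z > 0" using z assms by (auto simp: pine_def)
  then have "z \<ge> 1" using N_pos by (simp add: zero_less_mult_iff)
  then have "N * z \<ge> N" using N_pos by simp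
  then show ?thesis using z by (auto simp: pine_def)
qed

lemma finite_pine: "finite (pine n)"
proof -
  have "F \<in> {-\<bar>n\<bar>..\<bar>n\<bar>} \<times> {-\<bar>n\<bar>..\<bar>n\<bar>}" if FF: "F \<in> pine n" for F
  proof -
    obtain i k where F: "F = (i, k)" by fastforce
    have a: "\<bar>i\<bar> \<le> max (- i * t) (i * (N - t))" if "0 < t" "t < N" for i t
    proof (cases "0 \<le> i")
      case True
      then have "i * 1 \<le> i * (N - t)" using that by (intro mult_left_mono) auto
      then have "\<bar>i\<bar> \<le> i * (N - t)" using True by linarith
      then show ?thesis by (rule order_trans[OF _ max.cobounded2])
    next
      case False
      then have "- i * 1 \<le> - i * t" using that by (intro mult_left_mono) auto
      then have "\<bar>i\<bar> \<le> - i * t" using False by linarith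
      then show ?thesis by (rule order_trans[OF _ max.cobounded1])
    qed
    have "\<bar>i\<bar> \<le> max (- i * r) (i * (N - r))" "\<bar>k\<bar> \<le> max (- k * s) (k * (N - s))"
      using a r_pos r_less s_le by auto
    then have "\<bar>i\<bar> + \<bar>k\<bar> \<le> n - N - 1" using FF by (simp add: pine_def F dst_def max.commute)
    then show ?thesis using N_pos by (auto simp: F)
  qed
  then show ?thesis by (meson finite_SigmaI finite_atLeastAtMost_int finite_subset subsetI)
qed

text \<open>In a column the height loses at most 1 per row on the way outwards and is 0 once the row
  number reaches the absolute value of n.\<close>

lemma conf_bounded:
  assumes h: "h \<in> conf n"
  shows "h F \<le> 2 * \<bar>n\<bar>"
proof -
  have h0: "h F = 0" if "F \<notin> pine n" for F using h that unfolding conf_def by blast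
  have S: "step01 k (h (i, k)) (h (i, k + 1))" for i k using h by (auto simp: conf_def conf_at_def)
  have out: "(i, k) \<notin> pine n" if "\<bar>n\<bar> \<le> \<bar>k\<bar>" for i k
  proof -
    have "\<bar>k\<bar> \<le> max (k * (N - s)) (- k * s)"
    proof (cases "0 \<le> k")
      case True
      have "k * 1 \<le> k * (N - s)" using True r_pos r_less s_le by (intro mult_left_mono) auto
      then have "\<bar>k\<bar> \<le> k * (N - s)" using True by linarith
      then show ?thesis by (rule order_trans[OF _ max.cobounded1])
    next
      case False
      have "- k * 1 \<le> - k * s" using False r_pos r_less by (intro mult_left_mono) auto
      then have "\<bar>k\<bar> \<le> - k * s" using False by linarith
      then show ?thesis by (rule order_trans[OF _ max.cobounded2])
    qed
    then show ?thesis using dst_nonneg(1)[of i] that N_pos by (auto simp: pine_def dst_def)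
  qed
  have up: "h (i, k) \<le> int m" if "0 \<le> k" "\<bar>n\<bar> \<le> k + int m" for i k m
    using that
  proof (induction m arbitrary: k)
    case 0 then show ?case using h0[OF out[of k i]] by simp
  next
    case (Suc m)
    have "h (i, k + 1) \<le> int m" by (rule Suc.IH) (use Suc.prems in auto)
    then show ?case using S[of k i] Suc.prems by (simp add: step01_def)
  qed
  have dn: "h (i, k) \<le> int m" if "k \<le> 0" "\<bar>n\<bar> \<le> - k + int m" for i k m
    using that
  proof (induction m arbitrary: k)
    case 0 then show ?case using h0[OF out[of k i]] by simp
  next
    case (Suc m)
    have "h (i, k - 1) \<le> int m" by (rule Suc.IH) (use Suc.prems in auto)
    then show ?case using S[of "k - 1" i] Suc.prems by (simp add: step01_def)
  qed
  obtain i k where F: "F = (i, k)" by fastforce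
  show ?thesis using up[of k "nat \<bar>n\<bar>" i] dn[of k "nat \<bar>n\<bar>" i] F by (cases "0 \<le> k") auto
qed

lemma finite_conf: "finite (conf n)"
proof -
  have "conf n \<subseteq> {h. \<forall>F. (F \<in> pine n \<longrightarrow> h F \<in> {0..2 * \<bar>n\<bar>}) \<and> (F \<notin> pine n \<longrightarrow> h F = 0)}"
    using conf_bounded by (auto simp: conf_def)
  with finite_set_of_finite_funs[OF finite_pine[of n] finite_atLeastAtMost_int[of 0 "2 * \<bar>n\<bar>"], of 0]
  show ?thesis
    by (rule rev_finite_subset)
qed

section \<open>Constraints around the faces with label 0\<close>

lemma lab_zero_nbrs:
  assumes "lab n (i, k) = 0"
  shows "lab n (i - 1, k) = N - r" "lab n (i + 1, k) = r" "lab n (i, k + 1) = s" "lab n (i, k - 1) = N - s"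
    "lab n (i - 1, k - 1) = N - r - s" "lab n (i - 1, k + 1) = s - r"
    "lab n (i + 1, k - 1) = N - s + r" "lab n (i + 1, k + 1) = r + s"
proof -
  note R = lab_right[of n] and U = lab_up[of n] and b = lab_bounds[of n] and p = r_pos r_less s_le
  show 1: "lab n (i - 1, k) = N - r" using R[of "i - 1" k] b[of "(i - 1, k)"] assms p by (auto split: if_splits)
  show 2: "lab n (i + 1, k) = r" using R[of i k] assms p by auto
  show 3: "lab n (i, k + 1) = s" using U[of i k] assms p by auto
  show 4: "lab n (i, k - 1) = N - s" using U[of i "k - 1"] b[of "(i, k - 1)"] assms p by (auto split: if_splits)
  show "lab n (i - 1, k - 1) = N - r - s"
    using R[of "i - 1" "k - 1"] b[of "(i - 1, k - 1)"] 4 p by (auto split: if_splits)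
  show "lab n (i - 1, k + 1) = s - r" using U[of "i - 1" k] 1 p by auto
  show "lab n (i + 1, k - 1) = N - s + r" using R[of i "k - 1"] 4 p by auto
  show "lab n (i + 1, k + 1) = r + s" using U[of "i + 1" k] 2 p by auto
qed

text \<open>These constraints are unaffected by the shift of all labels by one.\<close>

definition conf_off :: "int \<Rightarrow> (int \<times> int \<Rightarrow> int) \<Rightarrow> int \<Rightarrow> int \<Rightarrow> bool" where
  "conf_off n h i k \<longleftrightarrow> (let l = lab n (i, k) in
     (l \<noteq> 0 \<and> l + r < N \<longrightarrow> 0 \<le> h (i, k) - h (i + 1, k) \<and> h (i, k) - h (i + 1, k) \<le> 1) \<and>
     (l \<noteq> 0 \<and> N < l + r \<longrightarrow> 0 \<le> h (i + 1, k) - h (i, k) \<and> h (i + 1, k) - h (i, k) \<le> 1) \<and>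
     (l \<noteq> 0 \<and> l + s \<noteq> N \<longrightarrow> step01 k (h (i, k)) (h (i, k + 1))) \<and>
     (l \<noteq> 0 \<and> l + r + s < N \<longrightarrow> step01 k (h (i + 1, k)) (h (i, k + 1))) \<and>
     (l + r < N \<and> N < l + s \<longrightarrow> step01 k (h (i, k)) (h (i + 1, k + 1))))"

text \<open>Normalised so that the vertical constraint always allows exactly the heights v and v + 1
  at (i, k), for v either of \<open>up_val\<close> and \<open>down_val\<close>: a neighbour farther
  from the centre enters unchanged, a nearer one lowered by 1.\<close>

definition up_val :: "(int \<times> int \<Rightarrow> int) \<Rightarrow> int \<Rightarrow> int \<Rightarrow> int" where
  "up_val h i k = h (i, k + 1) - of_bool (k < 0)"

definition down_val :: "(int \<times> int \<Rightarrow> int) \<Rightarrow> int \<Rightarrow> int \<Rightarrow> int" where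
  "down_val h i k = h (i, k - 1) - of_bool (0 < k)"

text \<open>What remains as a constraint on the four neighbours when the height of the face between
  them is forgotten. It makes both \<open>locA\<close> and \<open>locB\<close> nonempty.\<close>

definition crossing :: "(int \<times> int \<Rightarrow> int) \<Rightarrow> int \<Rightarrow> int \<Rightarrow> bool" where
  "crossing h i k \<longleftrightarrow> (\<forall>t\<in>{up_val h i k, down_val h i k}. \<forall>a\<in>{h (i - 1, k), h (i + 1, k)}. t \<in> {a - 1, a})"

text \<open>The range of the height at a face with label 0. In the labels for n - 1 the same face
  has label N - 1, which reverses the horizontal inequalities and leads to
  \<open>locB\<close>.\<close>

definition locA :: "(int \<times> int \<Rightarrow> int) \<Rightarrow> int \<Rightarrow> int \<Rightarrow> int set" where
  "locA h i k = {max (h (i - 1, k)) (h (i + 1, k))..min (up_val h i k) (down_val h i k) + 1}"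

definition locB :: "(int \<times> int \<Rightarrow> int) \<Rightarrow> int \<Rightarrow> int \<Rightarrow> int set" where
  "locB h i k = {max (up_val h i k) (down_val h i k)..min (h (i - 1, k)) (h (i + 1, k))}"

text \<open>Two of the four instances of \<open>crossing\<close> are diagonal constraints: those
  with the right neighbour here, those with the left neighbour in \<open>conf_iff_locB\<close>. The
  other two follow from the sides of the unit square between the two neighbours.\<close>

lemma conf_iff_locA:
  "(\<forall>i k. conf_at (lab n (i, k)) h i k) \<longleftrightarrow>
   (\<forall>i k. conf_off n h i k) \<and> (\<forall>i k. lab n (i, k) = 0 \<longrightarrow> crossing h i k \<and> h (i, k) \<in> locA h i k)"
  (is "?l \<longleftrightarrow> ?r")
proof
  assume c: ?l
  show ?r
  proof (intro conjI allI impI)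
    fix i k show "conf_off n h i k"
      using c[rule_format, of i k] by (auto simp: conf_off_def conf_at_def Let_def)
  next
    fix i k assume z: "lab n (i, k) = 0"
    note nb = lab_zero_nbrs[OF z] and p = r_pos r_less s_le
    have c0: "conf_at 0 h i k" using c[rule_format, of i k] z by simp
    have c1: "conf_at (N - r) h (i - 1) k" using c[rule_format, of "i - 1" k] nb by simp
    have c2: "conf_at (N - s) h i (k - 1)" using c[rule_format, of i "k - 1"] nb by simp
    have c3: "conf_at (N - r - s) h (i - 1) (k - 1)" using c[rule_format, of "i - 1" "k - 1"] nb by simp
    have c4: "conf_at (s - r) h (i - 1) (k + 1)" using c[rule_format, of "i - 1" "k + 1"] nb by simp
    consider "k = 0" | "0 < k" | "k < 0" by linarith
    note cas = this
    show "crossing h i k"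
      using c0 c1 c2 c3 c4 p unfolding crossing_def up_val_def down_val_def conf_at_def step01_def
      by (cases rule: cas) auto
    show "h (i, k) \<in> locA h i k"
      using c0 c1 c2 p unfolding locA_def up_val_def down_val_def conf_at_def step01_def
      by (cases rule: cas) auto
  qed
next
  assume c: ?r
  note p = r_pos r_less s_le
  have off: "conf_off n h i k" for i k using c by blast
  have z: "crossing h i k" "h (i, k) \<in> locA h i k" if "lab n (i, k) = 0" for i k using c that by blast+
  show ?l
  proof (intro allI)
    fix i k
    define l where "l = lab n (i, k)"
    have b: "0 \<le> l" "l < N" using lab_bounds[of n "(i, k)"] by (auto simp: l_def)
    have H: "if l + r < N then 0 \<le> h (i, k) - h (i + 1, k) \<and> h (i, k) - h (i + 1, k) \<le> 1
      else 0 \<le> h (i + 1, k) - h (i, k) \<and> h (i + 1, k) - h (i, k) \<le> 1"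
    proof -
      consider "l = 0" | "l + r = N" | "l \<noteq> 0" "l + r \<noteq> N" by blast
      then show ?thesis
      proof cases
        case 1
        then show ?thesis using z[of i k] p by (auto simp: locA_def crossing_def l_def)
      next
        case 2
        then have "lab n (i + 1, k) = 0" using lab_right[of n i k] by (simp add: l_def)
        then show ?thesis using z[of "i + 1" k] 2 by (auto simp: locA_def crossing_def)
      next
        case 3
        then show ?thesis using off[of i k] by (auto simp: conf_off_def Let_def l_def)
      qed
    qed
    have V: "step01 k (h (i, k)) (h (i, k + 1))"
    proof -
      consider "l = 0" | "l + s = N" | "l \<noteq> 0" "l + s \<noteq> N" by blast
      then show ?thesis
      proof cases
        case 1
        then show ?thesis using z[of i k]
          by (auto simp: locA_def crossing_def l_def step01_def up_val_def down_val_def)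
      next
        case 2
        then have "lab n (i, k + 1) = 0" using lab_up[of n i k] by (simp add: l_def)
        then show ?thesis using z[of i "k + 1"]
          by (auto simp: locA_def crossing_def step01_def up_val_def down_val_def)
      next
        case 3
        then show ?thesis using off[of i k] by (auto simp: conf_off_def Let_def l_def)
      qed
    qed
    have D1: "step01 k (h (i + 1, k)) (h (i, k + 1))" if "l + r + s < N"
    proof (cases "l = 0")
      case True
      then show ?thesis using z[of i k] by (auto simp: crossing_def l_def step01_def up_val_def)
    next
      case False
      then show ?thesis using off[of i k] that by (auto simp: conf_off_def Let_def l_def)
    qed
    have D2: "step01 k (h (i, k)) (h (i + 1, k + 1))" if "l + r < N" "N \<le> l + s"
    proof (cases "l + s = N")
      case True
      then have "lab n (i, k + 1) = 0" using lab_up[of n i k] by (simp add: l_def)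
      then show ?thesis using z[of i "k + 1"] by (auto simp: crossing_def step01_def down_val_def)
    next
      case False
      then show ?thesis using off[of i k] that by (auto simp: conf_off_def Let_def l_def)
    qed
    show "conf_at (lab n (i, k)) h i k"
      unfolding conf_at_def using H V D1 D2 unfolding l_def by blast
  qed
qed

lemma conf_iff_locB:
  "(\<forall>i k. conf_at (lab (n - 1) (i, k)) h i k) \<longleftrightarrow>
   (\<forall>i k. conf_off n h i k) \<and> (\<forall>i k. lab n (i, k) = 0 \<longrightarrow> crossing h i k \<and> h (i, k) \<in> locB h i k)"
  (is "?l \<longleftrightarrow> ?r")
proof
  assume c: ?l
  show ?r
  proof (intro conjI allI impI)
    fix i k show "conf_off n h i k"
      using c[rule_format, of i k] r_pos r_less s_le
      by (auto simp: conf_off_def conf_at_def Let_def lab_pred split: if_splits)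
  next
    fix i k assume z: "lab n (i, k) = 0"
    note nb = lab_zero_nbrs[OF z] and p = r_pos r_less s_le
    have c0: "conf_at (N - 1) h i k" using c[rule_format, of i k] z by (simp add: lab_pred)
    have c1: "conf_at (N - r - 1) h (i - 1) k" using c[rule_format, of "i - 1" k] nb p by (simp add: lab_pred)
    have c2: "conf_at (N - s - 1) h i (k - 1)" using c[rule_format, of i "k - 1"] nb p by (simp add: lab_pred)
    have c3: "conf_at (N - r - s - 1) h (i - 1) (k - 1)"
      using c[rule_format, of "i - 1" "k - 1"] nb p by (simp add: lab_pred)
    have c4: "conf_at (s - 1) h i (k + 1)" using c[rule_format, of i "k + 1"] nb p by (simp add: lab_pred)
    have c5: "conf_at (r - 1) h (i + 1) k" using c[rule_format, of "i + 1" k] nb p by (simp add: lab_pred)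
    have c6: "conf_at (N - s + r - 1) h (i + 1) (k - 1)"
      using c[rule_format, of "i + 1" "k - 1"] nb p by (simp add: lab_pred)
    consider "k = 0" | "0 < k" | "k < 0" by linarith
    note cas = this
    show "crossing h i k"
      using c0 c1 c2 c3 c4 c5 c6 p unfolding crossing_def up_val_def down_val_def conf_at_def step01_def
      by (cases rule: cas) auto
    show "h (i, k) \<in> locB h i k"
      using c0 c1 c2 p unfolding locB_def up_val_def down_val_def conf_at_def step01_def
      by (cases rule: cas) auto
  qed
next
  assume c: ?r
  note p = r_pos r_less s_le
  have off: "conf_off n h i k" for i k using c by blast
  have z: "crossing h i k" "h (i, k) \<in> locB h i k" if "lab n (i, k) = 0" for i k using c that by blast+
  show ?l
  proof (intro allI)
    fix i k
    define l where "l = lab n (i, k)"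
    define m where "m = lab (n - 1) (i, k)"
    have b: "0 \<le> l" "l < N" using lab_bounds[of n "(i, k)"] by (auto simp: l_def)
    have m: "m = (if l = 0 then N - 1 else l - 1)" by (simp add: m_def l_def lab_pred)
    have H: "if m + r < N then 0 \<le> h (i, k) - h (i + 1, k) \<and> h (i, k) - h (i + 1, k) \<le> 1
      else 0 \<le> h (i + 1, k) - h (i, k) \<and> h (i + 1, k) - h (i, k) \<le> 1"
    proof -
      consider "l = 0" | "l + r = N" | "l \<noteq> 0" "l + r \<noteq> N" by blast
      then show ?thesis
      proof cases
        case 1
        then show ?thesis using z[of i k] p m by (auto simp: locB_def crossing_def l_def)
      next
        case 2
        then have "lab n (i + 1, k) = 0" using lab_right[of n i k] by (simp add: l_def)
        then show ?thesis using z[of "i + 1" k] 2 m p by (auto simp: locB_def crossing_def)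
      next
        case 3
        then show ?thesis using off[of i k] m by (auto simp: conf_off_def Let_def l_def)
      qed
    qed
    have V: "step01 k (h (i, k)) (h (i, k + 1))"
    proof -
      consider "l = 0" | "l + s = N" | "l \<noteq> 0" "l + s \<noteq> N" by blast
      then show ?thesis
      proof cases
        case 1
        then show ?thesis using z[of i k]
          by (auto simp: locB_def crossing_def l_def step01_def up_val_def down_val_def)
      next
        case 2
        then have "lab n (i, k + 1) = 0" using lab_up[of n i k] by (simp add: l_def)
        then show ?thesis using z[of i "k + 1"]
          by (auto simp: locB_def crossing_def step01_def up_val_def down_val_def)
      next
        case 3
        then show ?thesis using off[of i k] by (auto simp: conf_off_def Let_def l_def)
      qed
    qed
    have D1: "step01 k (h (i + 1, k)) (h (i, k + 1))" if "m + r + s < N"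
    proof (cases "l + r + s = N")
      case True
      then have "lab n (i + 1, k + 1) = 0" using lab_up[of n "i + 1" k] lab_right[of n i k] p by (simp add: l_def)
      then show ?thesis using z[of "i + 1" "k + 1"] by (auto simp: crossing_def step01_def down_val_def)
    next
      case False
      then show ?thesis using off[of i k] that m p by (auto simp: conf_off_def Let_def l_def split: if_splits)
    qed
    have D2: "step01 k (h (i, k)) (h (i + 1, k + 1))" if "m + r < N" "N \<le> m + s"
    proof (cases "l + r = N")
      case True
      then have "lab n (i + 1, k) = 0" using lab_right[of n i k] by (simp add: l_def)
      then show ?thesis using z[of "i + 1" k] by (auto simp: crossing_def step01_def up_val_def)
    next
      case False
      then show ?thesis using off[of i k] that m p by (auto simp: conf_off_def Let_def l_def split: if_splits)
    qed
    show "conf_at (lab (n - 1) (i, k)) h i k"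
      unfolding conf_at_def using H V D1 D2 unfolding m_def by blast
  qed
qed

text \<open>The guards in \<open>conf_off\<close> drop each pair of faces of which one has label
  0.\<close>

lemma conf_off_cong:
  assumes "\<And>F. lab n F \<noteq> 0 \<Longrightarrow> g F = h F"
  shows "conf_off n g i k = conf_off n h i k"
proof -
  define l where "l = lab n (i, k)"
  note p = r_pos r_less s_le
  have b: "0 \<le> l" "l < N" using lab_bounds[of n "(i, k)"] by (auto simp: l_def)
  have R: "g (i + 1, k) = h (i + 1, k)" if "l + r \<noteq> N"
    using assms[of "(i + 1, k)"] lab_right[of n i k] that b p by (auto simp: l_def split: if_splits)
  have U: "g (i, k + 1) = h (i, k + 1)" if "l + s \<noteq> N"
    using assms[of "(i, k + 1)"] lab_up[of n i k] that b p by (auto simp: l_def split: if_splits)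
  have D: "g (i + 1, k + 1) = h (i + 1, k + 1)" if "l + r < N" "N < l + s"
    using assms[of "(i + 1, k + 1)"] lab_up[of n "i + 1" k] lab_right[of n i k] that b p
    by (auto simp: l_def split: if_splits)
  have C: "g (i, k) = h (i, k)" if "l \<noteq> 0" using assms[of "(i, k)"] that by (simp add: l_def)
  show ?thesis unfolding conf_off_def Let_def l_def[symmetric]
    using R U D C b p by (cases "l = 0"; cases "l + r = N"; cases "l + s = N") auto
qed

lemma zero_nbrs_cong:
  assumes "\<And>F. lab n F \<noteq> 0 \<Longrightarrow> g F = h F" "lab n (i, k) = 0"
  shows "crossing g i k = crossing h i k" "locA g i k = locA h i k" "locB g i k = locB h i k"
proof -
  note nb = lab_zero_nbrs[OF assms(2)] and p = r_pos r_less s_le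
  have "g (i - 1, k) = h (i - 1, k)" "g (i + 1, k) = h (i + 1, k)" "g (i, k + 1) = h (i, k + 1)"
    "g (i, k - 1) = h (i, k - 1)"
    using nb p by (auto intro!: assms(1))
  then show "crossing g i k = crossing h i k" "locA g i k = locA h i k" "locB g i k = locB h i k"
    by (simp_all add: crossing_def locA_def locB_def up_val_def down_val_def)
qed

text \<open>A step to a neighbour changes \<open>dst\<close> by less than N, so by
  \<open>pine_closed\<close> a face with label 0 belongs to the pinecone as soon as one of its
  neighbours does.\<close>

lemma nbr_outside:
  assumes "lab n (i, k) = 0" "(i, k) \<notin> pine n"
  shows "(i - 1, k) \<notin> pine n" "(i + 1, k) \<notin> pine n" "(i, k + 1) \<notin> pine n" "(i, k - 1) \<notin> pine n"
  using assms pine_closed[of _ n "(i, k)"] dst_step(1)[of i k] dst_step(1)[of "i - 1" k]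
    dst_step(2)[of i k] dst_step(2)[of i "k - 1"] r_pos r_less s_le
  by (smt (verit, ccfv_threshold) add_diff_cancel_right' diff_add_cancel)+

section \<open>Summing out the faces with label 0\<close>

definition zset :: "int \<Rightarrow> (int \<times> int) set" where
  "zset n = {F \<in> pine n. lab n F = 0}"

text \<open>Heights whose values at label 0 have been erased: the common base over which
  \<open>conf n\<close> and \<open>conf (n - 1)\<close> are fibred.\<close>

definition base :: "int \<Rightarrow> (int \<times> int \<Rightarrow> int) set" where
  "base n = {g. (\<forall>F. 0 \<le> g F) \<and> (\<forall>F. F \<notin> pine n \<or> lab n F = 0 \<longrightarrow> g F = 0) \<and>
     (\<forall>i k. conf_off n g i k) \<and> (\<forall>i k. lab n (i, k) = 0 \<longrightarrow> crossing g i k)}"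

lemma pine_mono: "pine (n - 1) \<subseteq> pine n" by (auto simp: pine_def)

text \<open>The ranges are imposed on \<open>zset n\<close> only. A face with label 0 off the
  pinecone has neighbours of height 0, so its range contains 0 anyway. For n - 1 it must also be
  seen that the faces lost on passing from \<open>pine n\<close> to \<open>pine (n - 1)\<close>
  receive height 0.\<close>

lemma conf_fibres:
  "conf n = {h. (\<lambda>F. if F \<in> zset n then 0 else h F) \<in> base n \<and>
     (\<forall>c\<in>zset n. h c \<in> case_prod (locA (\<lambda>F. if F \<in> zset n then 0 else h F)) c)}" (is "_ = ?A")
  "conf (n - 1) = {h. (\<lambda>F. if F \<in> zset n then 0 else h F) \<in> base n \<and>
     (\<forall>c\<in>zset n. h c \<in> case_prod (locB (\<lambda>F. if F \<in> zset n then 0 else h F)) c)}" (is "_ = ?B")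
proof -
  have cong1: "conf_off n (\<lambda>F. if F \<in> zset n then 0 else h F) i k = conf_off n h i k" for h i k
    by (rule conf_off_cong) (simp add: zset_def)
  have cong2: "crossing (\<lambda>F. if F \<in> zset n then 0 else h F) i k = crossing h i k"
    "locA (\<lambda>F. if F \<in> zset n then 0 else h F) i k = locA h i k"
    "locB (\<lambda>F. if F \<in> zset n then 0 else h F) i k = locB h i k" if "lab n (i, k) = 0" for h i k
    by (rule zero_nbrs_cong[OF _ that]; simp add: zset_def)+
  note cong = cong1 cong2
  have baseD: "(\<forall>F. F \<notin> zset n \<longrightarrow> 0 \<le> h F) \<and> (\<forall>F. F \<notin> pine n \<longrightarrow> h F = 0) \<and> (\<forall>i k. conf_off n h i k) \<and>
      (\<forall>i k. lab n (i, k) = 0 \<longrightarrow> crossing h i k)"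
    if "(\<lambda>F. if F \<in> zset n then 0 else h F) \<in> base n" for h
  proof -
    let ?g = "\<lambda>F. if F \<in> zset n then 0 else h F"
    have 1: "\<And>F. 0 \<le> ?g F" "\<And>F. F \<notin> pine n \<Longrightarrow> ?g F = 0" using that unfolding base_def by blast+
    have "0 \<le> h F" if "F \<notin> zset n" for F using 1(1)[of F] that by simp
    moreover have "h F = 0" if "F \<notin> pine n" for F using 1(2)[of F] that by (simp add: zset_def)
    moreover have "\<forall>i k. conf_off n ?g i k" "\<forall>i k. lab n (i, k) = 0 \<longrightarrow> crossing ?g i k"
      using that unfolding base_def by blast+
    then have "\<forall>i k. conf_off n h i k" "\<forall>i k. lab n (i, k) = 0 \<longrightarrow> crossing h i k"
      using cong(1,2) by auto
    ultimately show ?thesis by blast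
  qed
  have baseI: "(\<lambda>F. if F \<in> zset n then 0 else h F) \<in> base n"
    if "\<And>F. 0 \<le> h F" "\<And>F. F \<notin> pine n \<Longrightarrow> h F = 0" "\<And>i k. conf_off n h i k"
      "\<And>i k. lab n (i, k) = 0 \<Longrightarrow> crossing h i k" for h
    using that cong(1,2) unfolding base_def by (auto simp: zset_def)
  show "conf n = ?A"
  proof (intro set_eqI iffI)
    fix h assume h: "h \<in> conf n"
    then have c: "\<forall>i k. conf_at (lab n (i, k)) h i k" by (simp add: conf_def)
    note cc = c[unfolded conf_iff_locA]
    show "h \<in> ?A" using h cc cong(3) baseI[of h] by (auto simp: conf_def zset_def)
  next
    fix h assume h: "h \<in> ?A"
    note b = baseD[of h]
    have bd: "\<And>F. F \<notin> zset n \<Longrightarrow> 0 \<le> h F" "\<And>F. F \<notin> pine n \<Longrightarrow> h F = 0" "\<And>i k. conf_off n h i k"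
      "\<And>i k. lab n (i, k) = 0 \<Longrightarrow> crossing h i k"
      using h b by auto
    have loc: "h (i, k) \<in> locA h i k" if z: "lab n (i, k) = 0" for i k
    proof (cases "(i, k) \<in> pine n")
      case True
      then have "(i, k) \<in> zset n" using z by (simp add: zset_def)
      then show ?thesis using h cong(3)[OF z, of h] by auto
    next
      case False
      then show ?thesis using nbr_outside[OF z False] bd(2)
        by (auto simp: locA_def up_val_def down_val_def)
    qed
    have "0 \<le> h F" for F
    proof (cases "F \<in> zset n")
      case True
      obtain i k where F: "F = (i, k)" by fastforce
      have z: "lab n (i, k) = 0" using True F by (simp add: zset_def)
      have "0 \<le> h (i - 1, k)" using bd(1)[of "(i - 1, k)"] lab_zero_nbrs(1)[OF z] r_pos r_less s_le
        by (simp add: zset_def)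
      then show ?thesis using loc[OF z] by (auto simp: F locA_def)
    qed (use bd in auto)
    then show "h \<in> conf n" using bd loc conf_iff_locA[of n h] by (auto simp: conf_def)
  qed
  show "conf (n - 1) = ?B"
  proof (intro set_eqI iffI)
    fix h assume h: "h \<in> conf (n - 1)"
    then have c: "\<forall>i k. conf_at (lab (n - 1) (i, k)) h i k" by (simp add: conf_def)
    note cc = c[unfolded conf_iff_locB]
    have "h F = 0" if "F \<notin> pine n" for F using h that pine_mono[of n] unfolding conf_def by blast
    then show "h \<in> ?B" using h cc cong(4) baseI[of h] by (auto simp: conf_def zset_def)
  next
    fix h assume h: "h \<in> ?B"
    note b = baseD[of h]
    have bd: "\<And>F. F \<notin> zset n \<Longrightarrow> 0 \<le> h F" "\<And>F. F \<notin> pine n \<Longrightarrow> h F = 0" "\<And>i k. conf_off n h i k"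
      "\<And>i k. lab n (i, k) = 0 \<Longrightarrow> crossing h i k"
      using h b by auto
    have loc: "h (i, k) \<in> locB h i k" if z: "lab n (i, k) = 0" for i k
    proof (cases "(i, k) \<in> pine n")
      case True
      then have "(i, k) \<in> zset n" using z by (simp add: zset_def)
      then show ?thesis using h cong(4)[OF z, of h] by auto
    next
      case False
      then show ?thesis using nbr_outside[OF z False] bd(2)
        by (auto simp: locB_def up_val_def down_val_def)
    qed
    have nonneg: "0 \<le> h F" for F
    proof (cases "F \<in> zset n")
      case True
      obtain i k where F: "F = (i, k)" by fastforce
      have z: "lab n (i, k) = 0" using True F by (simp add: zset_def)
      have "0 \<le> h (i, k + 1)" "0 \<le> h (i, k - 1)"
        using bd(1)[of "(i, k + 1)"] bd(1)[of "(i, k - 1)"] lab_zero_nbrs(3,4)[OF z] r_pos r_less s_le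
        by (simp_all add: zset_def)
      then show ?thesis using loc[OF z] by (cases "0 \<le> k") (auto simp: F locB_def up_val_def down_val_def)
    qed (use bd in auto)
    have "h F = 0" if out: "F \<notin> pine (n - 1)" for F
    proof (cases "F \<in> pine n")
      case True
      obtain i k where F: "F = (i, k)" by fastforce
      \<comment> \<open>The faces lost are those on the boundary of the sublevel set; they all have
        label 0.\<close>
      have d: "n - 1 - dst F = N" using True out by (auto simp: pine_def)
      then have z: "lab n (i, k) = 0" using dst_mod[of n F] F by simp
      \<comment> \<open>The horizontal neighbour on the side away from the origin is outside, and
        its height 0 caps the range \<open>locB\<close>.\<close>
      have "(i - 1, k) \<notin> pine n \<or> (i + 1, k) \<notin> pine n"
        using d F dst_step(1)[of i k] dst_step(1)[of "i - 1" k] r_pos r_less s_le by (auto simp: pine_def)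
      then have "h (i - 1, k) = 0 \<or> h (i + 1, k) = 0" using bd(2) by auto
      then have "h F \<le> 0" using loc[OF z] by (auto simp: F locB_def)
      then show ?thesis using nonneg[of F] by simp
    qed (use bd in auto)
    then show "h \<in> conf (n - 1)" using bd nonneg loc conf_iff_locB[of n h] by (auto simp: conf_def)
  qed
qed

lemma base_crossing:
  assumes "g \<in> base n" "c \<in> zset n"
  shows "crossing g (fst c) (snd c)"
  using assms by (cases c) (auto simp: base_def zset_def)

lemma finite_base: "finite (base n)"
proof -
  have "base n \<subseteq> (\<lambda>h F. if F \<in> zset n then 0 else h F) ` conf (n - 1)"
  proof
    fix g assume g: "g \<in> base n"
    \<comment> \<open>The erased heights are restored by the left end of the range
      \<open>locB\<close>, which is nonempty by \<open>crossing\<close>.\<close>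
    define h where "h F = (if F \<in> zset n then max (up_val g (fst F) (snd F)) (down_val g (fst F) (snd F)) else g F)" for F
    have e: "(\<lambda>F. if F \<in> zset n then 0 else h F) = g" using g by (auto simp: h_def base_def zset_def)
    have "h c \<in> case_prod (locB g) c" if "c \<in> zset n" for c
      using base_crossing[OF g that] that by (cases c) (auto simp: h_def locB_def crossing_def)
    then have "h \<in> conf (n - 1)" unfolding conf_fibres(2) mem_Collect_eq e using g by blast
    then show "g \<in> (\<lambda>h F. if F \<in> zset n then 0 else h F) ` conf (n - 1)"
      using e by (intro image_eqI[of _ _ h]) auto
  qed
  then show ?thesis using finite_conf finite_surj by blast
qed

text \<open>The translation carries label 0 to label l. If a face with label l is in the pinecone,
  then so is the face with label 0 it comes from, by \<open>pine_closed\<close>. A translate that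
  falls outside the pinecone has height 0 and contributes the factor 1.\<close>

lemma prod_zset_shift:
  fixes \<phi> :: "'a::field"
  assumes g: "\<And>F. F \<notin> pine n \<Longrightarrow> g F = 0" and l: "l \<noteq> 0"
    and sh: "\<And>F. lab n (fst F + a, snd F + b) = l \<longleftrightarrow> lab n F = 0"
    and d: "\<And>F. dst F < dst (fst F + a, snd F + b) + N"
  shows "(\<Prod>c\<in>zset n. \<phi> powi g (fst c + a, snd c + b)) =
    (\<Prod>F\<in>pine n - zset n. (if lab n F = l then \<phi> else 1) powi g F)"
proof -
  let ?T = "\<lambda>c. (fst c + a, snd c + b)"
  have inj: "inj_on ?T (zset n)" by (auto simp: inj_on_def)
  have fin: "finite (zset n)" "finite (pine n - zset n)" using finite_pine[of n] by (auto simp: zset_def)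
  have "(\<Prod>c\<in>zset n. \<phi> powi g (?T c)) = (\<Prod>F\<in>?T ` zset n. \<phi> powi g F)"
    by (simp add: prod.reindex[OF inj])
  also have "\<dots> = (\<Prod>F\<in>{F \<in> pine n. lab n F = l}. \<phi> powi g F)"
  proof (rule prod.mono_neutral_right)
    show "{F \<in> pine n. lab n F = l} \<subseteq> ?T ` zset n"
    proof clarify
      fix x y assume F: "(x, y) \<in> pine n" "l = lab n (x, y)"
      have z: "lab n (x - a, y - b) = 0" using sh[of "(x - a, y - b)"] F by simp
      have "(x - a, y - b) \<in> pine n" using pine_closed[OF F(1) z] d[of "(x - a, y - b)"] by simp
      then show "(x, y) \<in> ?T ` zset n" using z by (intro image_eqI[of _ _ "(x - a, y - b)"]) (auto simp: zset_def)
    qed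
    show "\<forall>i\<in>?T ` zset n - {F \<in> pine n. lab n F = l}. \<phi> powi g i = 1"
    proof
      fix F assume F: "F \<in> ?T ` zset n - {F \<in> pine n. lab n F = l}"
      then obtain c where "c \<in> zset n" "F = ?T c" by blast
      then have "lab n F = l" using sh[of c] by (simp add: zset_def)
      then have "F \<notin> pine n" using F by blast
      then show "\<phi> powi g F = 1" using g by simp
    qed
  qed (use fin in auto)
  also have "\<dots> = (\<Prod>F\<in>pine n - zset n. (if lab n F = l then \<phi> else 1) powi g F)"
    by (rule prod.mono_neutral_cong_left) (use fin l in \<open>auto simp: zset_def\<close>)
  finally show ?thesis .
qed

text \<open>In the local identity the exponent 1 + u + d - p - q involves normalised heights. In
  terms of the true heights it has the additional constant 1 minus the two shifts in
  \<open>up_val\<close> and \<open>down_val\<close>, which is 1 if k = 0 and 0 otherwise. So only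
  central faces with label 0 produce a factor of their own.\<close>

definition zcount :: "int \<Rightarrow> nat" where
  "zcount n = card {c \<in> zset n. snd c = 0}"

text \<open>The local identity is applied at each face with label 0. The factors it produces are
  powers whose exponents are the heights of the four neighbours; regrouped by neighbour, they are
  the factors by which \<open>mut\<close> changes the arguments.\<close>

theorem fpoly_mut:
  fixes y :: "int \<Rightarrow> 'a::field"
  assumes y: "y 0 \<noteq> 0" "1 + y 0 \<noteq> 0"
  shows "fpoly n y = (1 + y 0) ^ zcount n * fpoly (n - 1) (mut y)"
proof -
  note p = r_pos r_less s_le
  let ?Z = "zset n"
  define A where "A g = (\<Prod>F\<in>pine n - ?Z. y (lab n F) powi g F) *
      (\<Prod>c\<in>?Z. \<Sum>t\<in>case_prod (locA g) c. y 0 powi t)" for g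
  define B where "B g = (\<Prod>F\<in>pine n - ?Z. mut y (lab n F - 1) powi g F) *
      (\<Prod>c\<in>?Z. \<Sum>t\<in>case_prod (locB g) c. (1 / y 0) powi t)" for g
  have fin: "finite ?Z" using finite_pine[of n] by (auto simp: zset_def)
  have fibA: "finite (case_prod (locA g) c)" and fibB: "finite (case_prod (locB g) c)" for g c
    by (auto simp: locA_def locB_def split: prod.split)
  have Z0: "g c = 0" if "g \<in> base n" "c \<in> ?Z" for g c using that unfolding base_def zset_def by blast
  have ZP: "?Z \<subseteq> pine n" by (auto simp: zset_def)
  have FA: "fpoly n y = (\<Sum>g\<in>base n. A g)"
  proof -
    have "fpoly n y = (\<Sum>g\<in>base n. (\<Prod>F\<in>pine n - ?Z. y (lab n F) powi g F) *
        (\<Prod>c\<in>?Z. \<Sum>t\<in>case_prod (locA g) c. y (lab n c) powi t))"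
      unfolding fpoly_def conf_fibres(1)[of n]
      by (rule sum_over_fibres[where L = "\<lambda>g. case_prod (locA g)"])
        (use fibA finite_pine finite_base ZP Z0 in blast)+
    also have "\<dots> = (\<Sum>g\<in>base n. A g)"
      unfolding A_def by (intro sum.cong refl arg_cong2[where f = "(*)"] prod.cong) (auto simp: zset_def)
    finally show ?thesis .
  qed
  have FB: "fpoly (n - 1) (mut y) = (\<Sum>g\<in>base n. B g)"
  proof -
    have "fpoly (n - 1) (mut y) = (\<Sum>h\<in>conf (n - 1). \<Prod>F\<in>pine n. mut y (lab (n - 1) F) powi h F)"
      unfolding fpoly_def
    proof (intro sum.cong refl prod.mono_neutral_left)
      fix h assume "h \<in> conf (n - 1)"
      then show "\<forall>i\<in>pine n - pine (n - 1). mut y (lab (n - 1) i) powi h i = 1" by (auto simp: conf_def)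
    qed (use finite_pine pine_mono in auto)
    also have "\<dots> = (\<Sum>g\<in>base n. (\<Prod>F\<in>pine n - ?Z. mut y (lab (n - 1) F) powi g F) *
        (\<Prod>c\<in>?Z. \<Sum>t\<in>case_prod (locB g) c. mut y (lab (n - 1) c) powi t))"
      unfolding conf_fibres(2)[of n]
      by (rule sum_over_fibres[where L = "\<lambda>g. case_prod (locB g)"])
        (use fibB finite_pine finite_base ZP Z0 in blast)+
    also have "\<dots> = (\<Sum>g\<in>base n. B g)"
      unfolding B_def
    proof (intro sum.cong refl arg_cong2[where f = "(*)"] prod.cong)
      fix g F assume "F \<in> pine n - ?Z"
      then show "mut y (lab (n - 1) F) powi g F = mut y (lab n F - 1) powi g F" by (auto simp: zset_def lab_pred)
    next
      fix g c t assume "c \<in> ?Z"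
      then have "mut y (lab (n - 1) c) = 1 / y 0" by (simp add: zset_def lab_pred mut_def)
      then show "mut y (lab (n - 1) c) powi t = (1 / y 0) powi t" by simp
    qed
    finally show ?thesis .
  qed
  have "A g = (1 + y 0) ^ zcount n * B g" if g: "g \<in> base n" for g
  proof -
    let ?f = "y 0 / (1 + y 0)"
    have g0: "\<And>F. F \<notin> pine n \<Longrightarrow> g F = 0" using g by (auto simp: base_def)
    define fac where "fac F = (if lab n F = r then ?f else 1) * (if lab n F = N - r then ?f else 1) *
      (if lab n F = s then 1 + y 0 else 1) * (if lab n F = N - s then 1 + y 0 else 1)" for F
    have mutfac: "mut y (lab n F - 1) = y (lab n F) * fac F" if "F \<in> pine n - ?Z" for F
      using lab_bounds[of n F] p by (auto simp: mut_def fac_def)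
    have shR: "lab n (fst F + 1, snd F + 0) = r \<longleftrightarrow> lab n F = 0" for F
      using lab_right[of n "fst F" "snd F"] lab_bounds[of n F] p by (auto split: if_splits)
    have shL: "lab n (fst F + -1, snd F + 0) = N - r \<longleftrightarrow> lab n F = 0" for F
      using lab_right[of n "fst F - 1" "snd F"] lab_bounds[of n F] lab_bounds[of n "(fst F - 1, snd F)"] p
      by (auto split: if_splits)
    have shU: "lab n (fst F + 0, snd F + 1) = s \<longleftrightarrow> lab n F = 0" for F
      using lab_up[of n "fst F" "snd F"] lab_bounds[of n F] p by (auto split: if_splits)
    have shD: "lab n (fst F + 0, snd F + -1) = N - s \<longleftrightarrow> lab n F = 0" for F
      using lab_up[of n "fst F" "snd F - 1"] lab_bounds[of n F] lab_bounds[of n "(fst F, snd F - 1)"] p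
      by (auto split: if_splits)
    have dd: "dst F < dst (fst F + 1, snd F + 0) + N" "dst F < dst (fst F + -1, snd F + 0) + N"
      "dst F < dst (fst F + 0, snd F + 1) + N" "dst F < dst (fst F + 0, snd F + -1) + N" for F
      using dst_step(1)[of "fst F" "snd F"] dst_step(1)[of "fst F - 1" "snd F"]
        dst_step(2)[of "fst F" "snd F"] dst_step(2)[of "fst F" "snd F - 1"] p by (auto split: if_splits)
    have P1: "(\<Prod>c\<in>?Z. ?f powi g (fst c + 1, snd c + 0)) =
        (\<Prod>F\<in>pine n - ?Z. (if lab n F = r then ?f else 1) powi g F)"
      by (rule prod_zset_shift[OF g0 _ shR dd(1)]) (use p in auto)
    have P2: "(\<Prod>c\<in>?Z. ?f powi g (fst c + -1, snd c + 0)) =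
        (\<Prod>F\<in>pine n - ?Z. (if lab n F = N - r then ?f else 1) powi g F)"
      by (rule prod_zset_shift[OF g0 _ shL dd(2)]) (use p in auto)
    have P3: "(\<Prod>c\<in>?Z. (1 + y 0) powi g (fst c + 0, snd c + 1)) =
        (\<Prod>F\<in>pine n - ?Z. (if lab n F = s then 1 + y 0 else 1) powi g F)"
      by (rule prod_zset_shift[OF g0 _ shU dd(3)]) (use p in auto)
    have P4: "(\<Prod>c\<in>?Z. (1 + y 0) powi g (fst c + 0, snd c + -1)) =
        (\<Prod>F\<in>pine n - ?Z. (if lab n F = N - s then 1 + y 0 else 1) powi g F)"
      by (rule prod_zset_shift[OF g0 _ shD dd(4)]) (use p in auto)
    have P5: "(\<Prod>c\<in>?Z. (1 + y 0) powi of_bool (snd c = 0)) = (1 + y 0) ^ zcount n"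
    proof -
      have "(\<Prod>c\<in>?Z. (1 + y 0) powi of_bool (snd c = 0)) = (\<Prod>c\<in>{c \<in> ?Z. snd c = 0}. 1 + y 0)"
        by (rule prod.mono_neutral_cong_right) (use fin in auto)
      then show ?thesis by (simp add: zcount_def)
    qed
    have loc: "(\<Sum>t\<in>case_prod (locA g) c. y 0 powi t) =
        (1 + y 0) powi of_bool (snd c = 0) * ?f powi g (fst c + 1, snd c + 0) * ?f powi g (fst c + -1, snd c + 0) *
        (1 + y 0) powi g (fst c + 0, snd c + 1) * (1 + y 0) powi g (fst c + 0, snd c + -1) *
        (\<Sum>t\<in>case_prod (locB g) c. (1 / y 0) powi t)" if c: "c \<in> ?Z" for c
    proof -
      obtain i k where ik: "c = (i, k)" by fastforce
      have cr: "crossing g i k" using base_crossing[OF g c] ik by simp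
      define a b u d where "a = g (i - 1, k)" "b = g (i + 1, k)" "u = up_val g i k" "d = down_val g i k"
      have S: "(\<Sum>t\<in>locA g i k. y 0 powi t) =
          y 0 powi (a + b) * (1 + y 0) powi (1 + u + d - a - b) * (\<Sum>t\<in>locB g i k. (1 / y 0) powi t)"
        unfolding locA_def locB_def a_b_u_d_def[symmetric]
        by (rule urban_renewal_local) (use cr y in \<open>auto simp: crossing_def a_b_u_d_def\<close>)
      have e: "1 + u + d - a - b = of_bool (k = 0) + g (i, k + 1) + g (i, k - 1) - (a + b)"
        by (auto simp: a_b_u_d_def up_val_def down_val_def)
      have "y 0 powi (a + b) * (1 + y 0) powi (1 + u + d - a - b) =
          (1 + y 0) powi of_bool (k = 0) * ?f powi b * ?f powi a *
          (1 + y 0) powi g (i, k + 1) * (1 + y 0) powi g (i, k - 1)"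
        unfolding e using y by (simp add: power_int_add power_int_diff power_int_divide_distrib mult_ac)
      then show ?thesis using S by (simp add: ik a_b_u_d_def)
    qed
    have "(\<Prod>c\<in>?Z. \<Sum>t\<in>case_prod (locA g) c. y 0 powi t) =
        (\<Prod>c\<in>?Z. (1 + y 0) powi of_bool (snd c = 0) * ?f powi g (fst c + 1, snd c + 0) *
          ?f powi g (fst c + -1, snd c + 0) * (1 + y 0) powi g (fst c + 0, snd c + 1) *
          (1 + y 0) powi g (fst c + 0, snd c + -1) * (\<Sum>t\<in>case_prod (locB g) c. (1 / y 0) powi t))"
      by (rule prod.cong[OF refl loc])
    also have "\<dots> = (1 + y 0) ^ zcount n * (\<Prod>F\<in>pine n - ?Z. fac F powi g F) *
        (\<Prod>c\<in>?Z. \<Sum>t\<in>case_prod (locB g) c. (1 / y 0) powi t)"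
      unfolding prod.distrib P1 P2 P3 P4 P5 fac_def power_int_mult_distrib
      by (simp only: ac_simps)
    finally have "(\<Prod>c\<in>?Z. \<Sum>t\<in>case_prod (locA g) c. y 0 powi t) = \<dots>" .
    moreover have "(\<Prod>F\<in>pine n - ?Z. mut y (lab n F - 1) powi g F) =
        (\<Prod>F\<in>pine n - ?Z. y (lab n F) powi g F) * (\<Prod>F\<in>pine n - ?Z. fac F powi g F)"
      unfolding prod.distrib[symmetric] by (intro prod.cong refl) (simp add: mutfac power_int_mult_distrib)
    ultimately show ?thesis unfolding A_def B_def by (simp only: ac_simps)
  qed
  then show ?thesis unfolding FA FB sum_distrib_left by (intro sum.cong) auto
qed


section \<open>The recurrence for the height polynomials\<close>

definition nu_set :: "int \<Rightarrow> (nat \<times> nat) set" where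
  "nu_set K = {(a, b). int a * r + int b * (N - r) = K}"

definition nu :: "int \<Rightarrow> nat" where
  "nu K = card (nu_set K)"

lemma finite_nu_set: "finite (nu_set K)"
proof -
  have "nu_set K \<subseteq> {..nat K} \<times> {..nat K}"
  proof clarify
    fix a b assume "(a, b) \<in> nu_set K"
    then have e: "int a * r + int b * (N - r) = K" by (simp add: nu_set_def)
    have "int a * 1 \<le> int a * r" "int b * 1 \<le> int b * (N - r)"
      using mult_left_mono[of 1 r "int a"] mult_left_mono[of 1 "N - r" "int b"] r_pos r_less s_le by auto
    then have "int a \<le> K" "int b \<le> K" using e by auto
    then show "a \<in> {..nat K} \<and> b \<in> {..nat K}" by auto
  qed
  then show ?thesis by (rule finite_subset) auto
qed

lemma nu_neg: "K < 0 \<Longrightarrow> nu K = 0"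
proof -
  assume K: "K < 0"
  have "0 \<le> int a * r + int b * (N - r)" for a b using r_pos r_less s_le by simp
  then have "(a, b) \<notin> nu_set K" for a b using K unfolding nu_set_def by (metis (mono_tags, lifting) case_prodD mem_Collect_eq not_le)
  then have "nu_set K = {}" by auto
  then show ?thesis by (simp add: nu_def)
qed

text \<open>Inclusion-exclusion for the pairs with a > 0 and those with b > 0; only the pair (0, 0)
  is in neither set. For the generating function: its product with 1 - t^r - t^(N - r) + t^N is
  1.\<close>

lemma nu_rec: "nu K + nu (K - N) = nu (K - r) + nu (K - N + r) + of_bool (K = 0)"
proof -
  define A where "A = {(a, b) \<in> nu_set K. 0 < a}"
  define B where "B = {(a, b) \<in> nu_set K. 0 < b}"
  have fin: "finite A" "finite B" using finite_nu_set[of K] by (auto simp: A_def B_def intro: rev_finite_subset)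
  have "A = (\<lambda>(a, b). (Suc a, b)) ` nu_set (K - r)"
  proof (intro set_eqI iffI; clarify)
    fix a b assume "(a, b) \<in> A"
    then show "(a, b) \<in> (\<lambda>(a, b). (Suc a, b)) ` nu_set (K - r)"
      by (intro image_eqI[of _ _ "(a - 1, b)"]) (auto simp: A_def nu_set_def of_nat_diff algebra_simps)
  qed (auto simp: A_def nu_set_def algebra_simps)
  then have cA: "card A = nu (K - r)" unfolding nu_def by (simp only:) (subst card_image, auto simp: inj_on_def)
  have "B = (\<lambda>(a, b). (a, Suc b)) ` nu_set (K - N + r)"
  proof (intro set_eqI iffI; clarify)
    fix a b assume "(a, b) \<in> B"
    then show "(a, b) \<in> (\<lambda>(a, b). (a, Suc b)) ` nu_set (K - N + r)"
      by (intro image_eqI[of _ _ "(a, b - 1)"]) (auto simp: B_def nu_set_def of_nat_diff algebra_simps)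
  qed (auto simp: B_def nu_set_def algebra_simps)
  then have cB: "card B = nu (K - N + r)" unfolding nu_def by (simp only:) (subst card_image, auto simp: inj_on_def)
  have "A \<inter> B = (\<lambda>(a, b). (Suc a, Suc b)) ` nu_set (K - N)"
  proof (intro set_eqI iffI; clarify)
    fix a b assume "(a, b) \<in> A" "(a, b) \<in> B"
    then show "(a, b) \<in> (\<lambda>(a, b). (Suc a, Suc b)) ` nu_set (K - N)"
      by (intro image_eqI[of _ _ "(a - 1, b - 1)"]) (auto simp: A_def B_def nu_set_def of_nat_diff algebra_simps)
  qed (auto simp: A_def B_def nu_set_def algebra_simps)
  then have cAB: "card (A \<inter> B) = nu (K - N)" unfolding nu_def by (simp only:) (subst card_image, auto simp: inj_on_def)
  have "nu_set K = (A \<union> B) \<union> (if K = 0 then {(0, 0)} else {})"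
    by (auto simp: A_def B_def nu_set_def)
  moreover have "(A \<union> B) \<inter> (if K = 0 then {(0, 0)} else {}) = {}" by (auto simp: A_def B_def)
  ultimately have "nu K = card (A \<union> B) + of_bool (K = 0)"
    unfolding nu_def using fin by (simp add: card_Un_disjoint split: if_splits)
  then show ?thesis using card_Un_Int[OF fin] cA cB cAB by simp
qed

text \<open>With K = n - N - 1, the central face i has label 0 iff K + i r = b N for some b. Then a
  = b - i satisfies a r + b (N - r) = K, and the two bounds that put the face into the pinecone say
  that a and b are nonnegative.\<close>

lemma zcount_nu: "zcount n = nu (n - N - 1)"
proof -
  define K where "K = n - N - 1"
  define f :: "nat \<times> nat \<Rightarrow> int \<times> int" where "f = (\<lambda>(a, b). (int b - int a, 0))"
  have inj: "inj_on f (nu_set K)"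
  proof (rule inj_onI, clarify)
    fix a b a' b' assume A: "(a, b) \<in> nu_set K" "(a', b') \<in> nu_set K" "f (a, b) = f (a', b')"
    have e: "int b - int a = int b' - int a'" using A(3) by (simp add: f_def)
    have "int b * N - (int b - int a) * r = int b' * N - (int b' - int a') * r"
      using A(1,2) by (simp add: nu_set_def algebra_simps)
    then have "int b = int b'" using e N_pos by simp
    then show "a = a' \<and> b = b'" using e by simp
  qed
  have "{c \<in> zset n. snd c = 0} = f ` nu_set K"
  proof (intro set_eqI iffI)
    fix c assume "c \<in> {c \<in> zset n. snd c = 0}"
    then obtain i k where c: "c = (i, k)" and A: "(i, k) \<in> zset n" and k: "k = 0" by (cases c) auto
    have d: "- i * r \<le> K" "i * (N - r) \<le> K" using A k by (auto simp: zset_def pine_def dst_def K_def)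
    have "N dvd (n - 1 + i * r)" using A k by (auto simp: zset_def lab_def)
    moreover have "K + i * r = (n - 1 + i * r) - N" by (simp add: K_def)
    ultimately have "N dvd K + i * r" by (metis dvd_diff dvd_refl)
    then obtain b where b: "K + i * r = N * b" by auto
    have "0 \<le> N * b" using b d by simp
    then have b0: "0 \<le> b" using N_pos by (simp add: zero_le_mult_iff)
    have "N * i \<le> N * b" using b d by (simp add: algebra_simps)
    then have bi: "i \<le> b" using N_pos by simp
    have "(nat (b - i), nat b) \<in> nu_set K" using b b0 bi by (auto simp: nu_set_def algebra_simps)
    then show "c \<in> f ` nu_set K" using b0 bi k c
      by (intro image_eqI[of _ _ "(nat (b - i), nat b)"]) (auto simp: f_def)
  next
    fix c assume "c \<in> f ` nu_set K"
    then obtain a b where c: "c = f (a, b)" and A: "(a, b) \<in> nu_set K" by auto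
    have e: "int a * r + int b * (N - r) = K" using A by (simp add: nu_set_def)
    have ee: "n - 1 + (int b - int a) * r = (int b + 1) * N" using e by (simp add: K_def algebra_simps)
    have l: "lab n (f (a, b)) = 0" unfolding lab_def f_def using ee by simp
    have "- ((int b - int a) * r) \<le> K" "(int b - int a) * (N - r) \<le> K"
    proof -
      have "K = int b * N - (int b - int a) * r" using e by (simp add: algebra_simps)
      moreover have "0 \<le> int b * N" "0 \<le> int a * N" using N_pos by auto
      ultimately show "- ((int b - int a) * r) \<le> K" "(int b - int a) * (N - r) \<le> K"
        unfolding left_diff_distrib right_diff_distrib by linarith+
    qed
    then have "dst (f (a, b)) \<le> K" unfolding dst_def f_def by simp
    then show "c \<in> {c \<in> zset n. snd c = 0}"
      using l c by (simp add: zset_def pine_def K_def) (simp add: f_def)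
  qed
  then show ?thesis unfolding zcount_def nu_def K_def[symmetric] using card_image[OF inj] by simp
qed

lemma fpoly_trivial:
  assumes "n \<le> N" shows "fpoly n y = 1"
proof -
  have "0 \<le> dst F" for F using dst_nonneg by (auto simp: dst_def split: prod.split)
  then have "F \<notin> pine n" for F using assms by (smt (verit) mem_Collect_eq pine_def)
  then have e: "pine n = {}" by auto
  have "conf n = {\<lambda>_. 0}" unfolding conf_def e by (auto simp: conf_at_def step01_def)
  then show ?thesis by (simp add: fpoly_def e)
qed

text \<open>The monomial of frozen variables in the exchange relation that produces the n-th cluster
  variable, compare \<open>xs_rec\<close>.\<close>

definition ymon :: "int \<Rightarrow> (int \<Rightarrow> 'a::field) \<Rightarrow> 'a" where
  "ymon n y = (\<Prod>l\<in>{0..<N}. y l ^ nu (n - N - 1 - l))"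

text \<open>Away from the defect of \<open>nu_rec\<close> at 0 the powers of y 0 balance. The
  remaining powers of 1 + y 0 are those by which \<open>fpoly_mut\<close> rescales the three
  products in the recurrence.\<close>

lemma ymon_mut:
  fixes y :: "int \<Rightarrow> 'a::field"
  assumes y: "y 0 \<noteq> 0" "1 + y 0 \<noteq> 0" and n: "N + 1 < n"
  defines "k \<equiv> n - N - 1"
  shows "(1 + y 0) ^ (nu (k - r) + nu (k - N + r)) * ymon (n - 1) (mut y) =
    ymon n y * (1 + y 0) ^ (nu (k - s) + nu (k - N + s))"
proof -
  note p = r_pos r_less s_le
  let ?f = "y 0 / (1 + y 0)" and ?I = "{1..<N}"
  define fac where "fac l = (if l = r then ?f else 1) * (if l = N - r then ?f else 1) *
      (if l = s then 1 + y 0 else 1) * (if l = N - s then 1 + y 0 else 1)" for l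
  have mutfac: "mut y (l - 1) = y l * fac l" if "l \<in> ?I" for l using that p by (auto simp: mut_def fac_def)
  have del: "(\<Prod>l\<in>?I. (if l = c then \<phi> else 1) ^ e l) = \<phi> ^ e c" if "c \<in> ?I" for c e and \<phi> :: 'a
  proof -
    have "(\<Prod>l\<in>?I. (if l = c then \<phi> else 1) ^ e l) = (\<Prod>l\<in>?I. if l = c then \<phi> ^ e l else 1)"
      by (intro prod.cong) auto
    then show ?thesis using that by (simp add: prod.delta')
  qed
  have fac: "(\<Prod>l\<in>?I. fac l ^ nu (k - l)) = ?f ^ nu (k - r) * ?f ^ nu (k - (N - r)) *
      (1 + y 0) ^ nu (k - s) * (1 + y 0) ^ nu (k - (N - s))"
  proof -
    have m: "r \<in> ?I" "N - r \<in> ?I" "s \<in> ?I" "N - s \<in> ?I" using p by auto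
    show ?thesis unfolding fac_def power_mult_distrib prod.distrib
      by (simp only: del[OF m(1)] del[OF m(2)] del[OF m(3)] del[OF m(4)])
  qed
  have I: "{0..<N} = insert 0 ?I" using N_pos by auto
  have J: "{0..<N} = insert (N - 1) ((\<lambda>l. l - 1) ` ?I)"
  proof -
    have "x \<in> (\<lambda>l. l - 1) ` ?I" if "0 \<le> x" "x < N - 1" for x
      using that by (intro image_eqI[of _ _ "x + 1"]) auto
    then have J1: "x = N - 1 \<or> x \<in> (\<lambda>l. l - 1) ` ?I" if "0 \<le> x" "x < N" for x
      using that by (cases "x = N - 1") auto
    have "{0..<N} \<subseteq> insert (N - 1) ((\<lambda>l. l - 1) ` ?I)"
    proof
      fix x assume "x \<in> {0..<N}"
      then show "x \<in> insert (N - 1) ((\<lambda>l. l - 1) ` ?I)" using J1[of x] by simp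
    qed
    then show ?thesis using N_pos by (intro equalityI) auto
  qed
  have "ymon (n - 1) (mut y) = mut y (N - 1) ^ nu (n - 1 - N - 1 - (N - 1)) *
      (\<Prod>l\<in>(\<lambda>l. l - 1) ` ?I. mut y l ^ nu (n - 1 - N - 1 - l))"
    unfolding ymon_def J by (subst prod.insert) auto
  also have "\<dots> = (1 / y 0) ^ nu (k - N) * (\<Prod>l\<in>?I. mut y (l - 1) ^ nu (k - l))"
    by (subst prod.reindex) (auto simp: mut_def k_def algebra_simps inj_on_def)
  also have "\<dots> = (1 / y 0) ^ nu (k - N) * ((\<Prod>l\<in>?I. y l ^ nu (k - l)) * (\<Prod>l\<in>?I. fac l ^ nu (k - l)))"
    unfolding prod.distrib[symmetric] by (simp add: mutfac power_mult_distrib)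
  finally have m: "ymon (n - 1) (mut y) = \<dots>" .
  have m': "ymon n y = y 0 ^ nu k * (\<Prod>l\<in>?I. y l ^ nu (k - l))"
    unfolding ymon_def I by (subst prod.insert) (auto simp: k_def)
  have nr: "nu k + nu (k - N) = nu (k - r) + nu (k - N + r)" using nu_rec[of k] n by (simp add: k_def)
  have e: "k - (N - r) = k - N + r" "k - (N - s) = k - N + s" by auto
  have "y 0 ^ nu k * y 0 ^ nu (k - N) = y 0 ^ nu (k - r) * y 0 ^ nu (k - N + r)"
    unfolding power_add[symmetric] nr ..
  then have E: "(1 + y 0) ^ (nu (k - r) + nu (k - N + r)) * ((1 / y 0) ^ nu (k - N) * (?f ^ nu (k - r) * ?f ^ nu (k - N + r))) = y 0 ^ nu k"
    using y by (simp add: power_divide power_add field_simps)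
  define Q where "Q = (\<Prod>l\<in>?I. y l ^ nu (k - l))"
  have "(1 + y 0) ^ (nu (k - r) + nu (k - N + r)) * ymon (n - 1) (mut y) =
      ((1 + y 0) ^ (nu (k - r) + nu (k - N + r)) * ((1 / y 0) ^ nu (k - N) * (?f ^ nu (k - r) * ?f ^ nu (k - N + r)))) *
      (Q * ((1 + y 0) ^ nu (k - s) * (1 + y 0) ^ nu (k - N + s)))"
    unfolding m fac e Q_def[symmetric] by (simp only: mult.assoc mult.left_commute mult.commute)
  also have "\<dots> = ymon n y * (1 + y 0) ^ (nu (k - s) + nu (k - N + s))"
    unfolding E unfolding m' Q_def[symmetric] power_add by (simp only: mult.assoc)
  finally show ?thesis .
qed

text \<open>Induction on n with y arbitrary, since the induction hypothesis is applied to
  \<open>mut y\<close>. Membership in S keeps y 0 and 1 + y 0 different from 0 under repeated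
  mutation.\<close>

theorem fpoly_rec:
  fixes S :: "'a::field set"
  assumes S: "\<And>a b. a \<in> S \<Longrightarrow> b \<in> S \<Longrightarrow> a * b \<in> S" "\<And>a b. a \<in> S \<Longrightarrow> b \<in> S \<Longrightarrow> a + b \<in> S"
     "\<And>a b. a \<in> S \<Longrightarrow> b \<in> S \<Longrightarrow> a / b \<in> S" "1 \<in> S" "0 \<notin> S"
    and "N < n" "\<And>l. y l \<in> S"
  shows "fpoly n y * fpoly (n - N) y =
    fpoly (n - r) y * fpoly (n - N + r) y + ymon n y * (fpoly (n - s) y * fpoly (n - N + s) y)"
proof -
  note p = r_pos r_less s_le
  have "N + 1 \<le> n" using assms by simp
  then have "\<forall>y. (\<forall>l. y l \<in> S) \<longrightarrow> fpoly n y * fpoly (n - N) y =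
    fpoly (n - r) y * fpoly (n - N + r) y + ymon n y * (fpoly (n - s) y * fpoly (n - N + s) y)"
  proof (induction n rule: int_ge_induct)
    case base
    show ?case
    proof (intro allI impI)
      fix y :: "int \<Rightarrow> 'a" assume y: "\<forall>l. y l \<in> S"
      have y0: "y 0 \<noteq> 0" "1 + y 0 \<noteq> 0" using y S by metis+
      have nu0: "nu 0 = 1" using nu_rec[of 0] p by (simp add: nu_neg)
      \<comment> \<open>The pinecone is a single face with label 0 and all others in the recurrence
        are empty, so the recurrence reads 1 + y 0 = 1 + y 0.\<close>
      have "fpoly (N + 1) y = 1 + y 0"
        using fpoly_mut[of y "N + 1", OF y0] by (simp add: zcount_nu nu0 fpoly_trivial)
      moreover have "ymon (N + 1) y = y 0"
      proof -
        have "ymon (N + 1) y = (\<Prod>l\<in>{0..<N}. if l = 0 then y l else 1)"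
          unfolding ymon_def by (intro prod.cong) (auto simp: nu0 nu_neg)
        then show ?thesis using N_pos by (simp add: prod.delta')
      qed
      ultimately show "fpoly (N + 1) y * fpoly (N + 1 - N) y = fpoly (N + 1 - r) y * fpoly (N + 1 - N + r) y +
          ymon (N + 1) y * (fpoly (N + 1 - s) y * fpoly (N + 1 - N + s) y)"
        using p by (simp add: fpoly_trivial)
    qed
  next
    case (step m)
    show ?case
    proof (intro allI impI)
      fix y :: "int \<Rightarrow> 'a" assume y: "\<forall>l. y l \<in> S"
      have y0: "y 0 \<noteq> 0" "1 + y 0 \<noteq> 0" using y S by metis+
      have my: "\<forall>l. mut y l \<in> S" using y S by (auto simp: mut_def)
      define n where "n = m + 1"
      define k where "k = n - N - 1"
      define Y where "Y = 1 + y 0"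
      define f where "f j = fpoly j (mut y)" for j
      have F: "fpoly j y = Y ^ nu (j - N - 1) * f (j - 1)" for j
        using fpoly_mut[of y j, OF y0] by (simp add: Y_def f_def zcount_nu)
      have IH: "f m * f (m - N) = f (m - r) * f (m - N + r) + ymon m (mut y) * (f (m - s) * f (m - N + s))"
        using step.IH my unfolding f_def by blast
      have nr: "nu k + nu (k - N) = nu (k - r) + nu (k - N + r)" using nu_rec[of k] step.hyps by (simp add: k_def n_def)
      have e: "n - N - 1 = k" "n - N - N - 1 = k - N" "n - r - N - 1 = k - r" "n - N + r - N - 1 = k - N + r"
        "n - s - N - 1 = k - s" "n - N + s - N - 1 = k - N + s"
        "n - 1 = m" "n - N - 1 = m - N" "n - r - 1 = m - r" "n - N + r - 1 = m - N + r"
        "n - s - 1 = m - s" "n - N + s - 1 = m - N + s" by (auto simp: k_def n_def)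
      have f2: "fpoly (n - N) y = Y ^ nu (k - N) * f (m - N)" using F[of "n - N"] by (simp add: k_def n_def)
      have f1: "fpoly n y = Y ^ nu k * f m" using F[of n] by (simp add: k_def n_def)
      have f3: "fpoly (n - r) y = Y ^ nu (k - r) * f (m - r)" unfolding F e ..
      have f4: "fpoly (n - N + r) y = Y ^ nu (k - N + r) * f (m - N + r)" unfolding F e ..
      have f5: "fpoly (n - s) y = Y ^ nu (k - s) * f (m - s)" unfolding F e ..
      have f6: "fpoly (n - N + s) y = Y ^ nu (k - N + s) * f (m - N + s)" unfolding F e ..
      have ym: "Y ^ (nu (k - r) + nu (k - N + r)) * ymon m (mut y) = ymon n y * Y ^ (nu (k - s) + nu (k - N + s))"
        using ymon_mut[of y n, OF y0] step.hyps by (simp add: k_def n_def Y_def)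
      have "fpoly n y * fpoly (n - N) y = Y ^ (nu k + nu (k - N)) * (f m * f (m - N))"
        unfolding f1 f2 by (simp add: power_add)
      also have "\<dots> = Y ^ (nu (k - r) + nu (k - N + r)) * (f (m - r) * f (m - N + r)) +
          (Y ^ (nu (k - r) + nu (k - N + r)) * ymon m (mut y)) * (f (m - s) * f (m - N + s))"
        unfolding nr IH by (simp only: distrib_left mult.assoc)
      also have "\<dots> = fpoly (n - r) y * fpoly (n - N + r) y + ymon n y * (fpoly (n - s) y * fpoly (n - N + s) y)"
        unfolding ym f3 f4 f5 f6 by (simp add: power_add)
      finally show "fpoly (m + 1) y * fpoly (m + 1 - N) y = fpoly (m + 1 - r) y * fpoly (m + 1 - N + r) y +
          ymon (m + 1) y * (fpoly (m + 1 - s) y * fpoly (m + 1 - N + s) y)"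
        unfolding n_def .
    qed
  qed
  then show ?thesis using assms(7) by blast
qed

text \<open>The exponents are those of the exchange matrix: the factors are the neighbours
  \<open>i \<plusminus> r\<close>, \<open>i \<plusminus> s\<close> and the diagonal ones of a face with label \<open>i\<close>, counted from 1.\<close>

definition nbr_mon :: "(int \<Rightarrow> 'a::field) \<Rightarrow> int \<Rightarrow> 'a" where
  "nbr_mon x i =
     (if i + r \<le> N then 1 / x (i + r) else x (i + r - N)) *
     (if r < i then x (i - r) else 1 / x (i - r + N)) *
     (if i + s \<le> N then x (i + s) else 1 / x (i + s - N)) *
     (if s < i then 1 / x (i - s) else x (i - s + N)) *
     (if r < i \<and> i + s \<le> N then 1 / x (i + s - r) else 1) *
     (if s < i \<and> i + r \<le> N then x (i - s + r) else 1) *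
     (if r < i \<and> i \<le> s then 1 / x (i + N - r - s) else 1) *
     (if i + r \<le> N \<and> N < i + s then x (i + r + s - N) else 1)"

text \<open>The product \<open>\<beta>\<close> and the quotient \<open>\<gamma>\<close> obey the
  same recurrence. For \<open>\<beta>\<close> it comes from \<open>nu_rec\<close>, whose defect at 0
  inserts the neighbour monomial of n - N once, for each n from N + 1 to 2 N. For
  \<open>\<gamma>\<close> it comes from the recurrence of \<open>\<xi>\<close>, of which
  \<open>\<gamma>\<close> is a quotient of shifts.\<close>

lemma prod_nbr_mon:
  fixes x \<xi> :: "int \<Rightarrow> 'a::field"
  assumes \<xi>: "\<And>j. 1 \<le> j \<Longrightarrow> j \<le> N \<Longrightarrow> \<xi> j = x j" "\<And>j. 1 \<le> j \<Longrightarrow> \<xi> j \<noteq> 0"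
    "\<And>n. N < n \<Longrightarrow> \<xi> n * \<xi> (n - N) = \<xi> (n - r) * \<xi> (n - N + r)"
    and n: "N < n"
  shows "(\<Prod>l\<in>{0..<N}. nbr_mon x (l + 1) ^ nu (n - N - 1 - l)) * (\<xi> (n - r) * \<xi> (n - N + r)) =
    \<xi> (n - s) * \<xi> (n - N + s)"
proof -
  note p = r_pos r_less s_le
  define \<gamma> where "\<gamma> n = \<xi> (n - s) * \<xi> (n - N + s) / (\<xi> (n - r) * \<xi> (n - N + r))" for n
  define \<beta> where "\<beta> n = (\<Prod>l\<in>{0..<N}. nbr_mon x (l + 1) ^ nu (n - N - 1 - l))" for n
  define c where "c n = (if N < n \<and> n \<le> 2 * N then nbr_mon x (n - N) else 1)" for n
  have \<beta>rec: "\<beta> n * \<beta> (n - N) = \<beta> (n - r) * \<beta> (n - N + r) * c n" for n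
  proof -
    have "\<beta> n * \<beta> (n - N) = (\<Prod>l\<in>{0..<N}. nbr_mon x (l + 1) ^ (nu (n - N - 1 - l) + nu (n - N - 1 - l - N)))"
      unfolding \<beta>_def prod.distrib[symmetric] power_add by (simp add: algebra_simps)
    also have "\<dots> = (\<Prod>l\<in>{0..<N}. nbr_mon x (l + 1) ^ nu (n - N - 1 - l - r) *
        nbr_mon x (l + 1) ^ nu (n - N - 1 - l - N + r) * (if l = n - N - 1 then nbr_mon x (l + 1) else 1))"
      unfolding nu_rec power_add by (intro prod.cong refl) auto
    also have "\<dots> = \<beta> (n - r) * \<beta> (n - N + r) * (\<Prod>l\<in>{0..<N}. if l = n - N - 1 then nbr_mon x (l + 1) else 1)"
      unfolding prod.distrib \<beta>_def by (simp add: algebra_simps)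
    also have "(\<Prod>l\<in>{0..<N}. if l = n - N - 1 then nbr_mon x (l + 1) else 1) = c n"
      by (subst prod.delta) (auto simp: c_def)
    finally show ?thesis .
  qed
  have \<beta>1: "\<beta> n = 1" if "n \<le> N" for n unfolding \<beta>_def using that by (intro prod.neutral) (auto simp: nu_neg)
  have nz: "\<xi> j \<noteq> 0" if "1 \<le> j" for j using \<xi>(2) that by blast
  have rec: "\<xi> n = \<xi> (n - r) * \<xi> (n - N + r) / \<xi> (n - N)" if "N < n" for n
    using \<xi>(3)[OF that] nz[of "n - N"] that by (simp add: field_simps)
  \<comment> \<open>Beyond 2 N each of the four indices in \<open>\<gamma>\<close> exceeds N, so
    every factor can be expanded and the recurrence is homogeneous.\<close>
  have big: "\<gamma> n = \<gamma> (n - r) * \<gamma> (n - N + r) / \<gamma> (n - N)" if n: "2 * N < n" for n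
  proof -
    have 1: "\<xi> (n - s) = \<xi> (n - s - r) * \<xi> (n - s - N + r) / \<xi> (n - s - N)"
      "\<xi> (n - N + s) = \<xi> (n - N + s - r) * \<xi> (n - N + s - N + r) / \<xi> (n - N + s - N)"
      "\<xi> (n - r) = \<xi> (n - r - r) * \<xi> (n - r - N + r) / \<xi> (n - r - N)"
      "\<xi> (n - N + r) = \<xi> (n - N + r - r) * \<xi> (n - N + r - N + r) / \<xi> (n - N + r - N)"
      by (rule rec; use n p in simp)+
    have e: "n - r - s = n - s - r" "n - r - N + s = n - N + s - r" "n - r - N + r = n - N"
      "n - N + r - s = n - s - N + r" "n - N + r - N + s = n - N + s - N + r" "n - N + r - r = n - N"
      "n - N - s = n - s - N" "n - N - N + s = n - N + s - N" "n - N - r = n - r - N" "n - N - N + r = n - N + r - N"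
      by auto
    have nn: "\<xi> (n - s - r) \<noteq> 0" "\<xi> (n - s - N + r) \<noteq> 0" "\<xi> (n - s - N) \<noteq> 0" "\<xi> (n - N + s - r) \<noteq> 0"
      "\<xi> (n - N + s - N + r) \<noteq> 0" "\<xi> (n - N + s - N) \<noteq> 0" "\<xi> (n - r - r) \<noteq> 0" "\<xi> (n - N) \<noteq> 0"
      "\<xi> (n - r - N) \<noteq> 0" "\<xi> (n - N + r - N + r) \<noteq> 0" "\<xi> (n - N + r - N) \<noteq> 0"
      by (rule nz; use n p in simp)+
    show ?thesis unfolding \<gamma>_def e 1 e using nn by (simp add: field_simps)
  qed
  \<comment> \<open>Values of \<open>\<gamma>\<close> at indices up to N are replaced by 1, in
    accordance with \<open>\<beta>\<close>. The five ranges of i differ in which neighbours of i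
    wrap around, and so in which factors are initial values.\<close>
  have small: "\<gamma> (N + i) = (if r < i then \<gamma> (N + i - r) else 1) * (if N - r < i then \<gamma> (i + r) else 1) * nbr_mon x i"
    if i: "1 \<le> i" "i \<le> N" for i
  proof -
    have e: "N + i - N + s = i + s" "N + i - N + r = i + r" "N + i - r - N + s = i - r + s" "N + i - r - N + r = i"
      "i + r - r = i" "N + i - r - s = N + i - s - r" "N + i - r - r = N + i - 2 * r" by auto
    consider "i \<le> r" | "r < i" "i \<le> s" | "s < i" "i + s \<le> N" | "N < i + s" "i + r \<le> N" | "N < i + r" by linarith
    then show ?thesis
    proof cases
      case 1
      then show ?thesis unfolding \<gamma>_def nbr_mon_def using p i by (simp add: \<xi>(1) algebra_simps)
    next
      case 2
      have R: "\<xi> (N + i - r) = \<xi> (N + i - 2 * r) * x i / x (i - r)"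
        using rec[of "N + i - r"] 2 p i by (simp add: algebra_simps \<xi>(1))
      have nn: "x i \<noteq> 0" "x (i - r) \<noteq> 0" "\<xi> (N + i - 2 * r) \<noteq> 0" "x (i + r) \<noteq> 0" "x (i + s) \<noteq> 0"
        "x (N + i - s) \<noteq> 0" "x (N + i - s - r) \<noteq> 0" "x (i - r + s) \<noteq> 0"
        using nz[of i] nz[of "i - r"] nz[of "N + i - 2 * r"] nz[of "i + r"] nz[of "i + s"] nz[of "N + i - s"]
          nz[of "N + i - s - r"] nz[of "i - r + s"] 2 p i by (simp_all add: \<xi>(1))
      have m: "nbr_mon x i = 1 / x (i + r) * x (i - r) * x (i + s) * x (N + i - s) * (1 / x (i - r + s)) * (1 / x (N + i - s - r))"
        unfolding nbr_mon_def using 2 p i by (simp add: algebra_simps)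
      have g1: "\<gamma> (N + i) = x (N + i - s) * x (i + s) / (\<xi> (N + i - r) * x (i + r))"
        unfolding \<gamma>_def e using 2 p i by (simp add: \<xi>(1))
      have g2: "\<gamma> (N + i - r) = x (N + i - s - r) * x (i - r + s) / (\<xi> (N + i - 2 * r) * x i)"
        unfolding \<gamma>_def e using 2 p i by (simp add: \<xi>(1))
      have "\<gamma> (N + i) = \<gamma> (N + i - r) * nbr_mon x i"
        unfolding g1 g2 m R using nn by (simp add: field_simps)
      then show ?thesis using 2 p by simp
    next
      case 3
      have R: "\<xi> (N + i - r) = \<xi> (N + i - 2 * r) * x i / x (i - r)"
        using rec[of "N + i - r"] 3 p i by (simp add: algebra_simps \<xi>(1))
      have R2: "\<xi> (N + i - s) = \<xi> (N + i - s - r) * x (i - s + r) / x (i - s)"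
        using rec[of "N + i - s"] 3 p i by (simp add: algebra_simps \<xi>(1))
      have nn: "x i \<noteq> 0" "x (i - r) \<noteq> 0" "\<xi> (N + i - 2 * r) \<noteq> 0" "x (i + r) \<noteq> 0" "x (i + s) \<noteq> 0"
        "x (i - s) \<noteq> 0" "\<xi> (N + i - s - r) \<noteq> 0" "x (i - r + s) \<noteq> 0" "x (i - s + r) \<noteq> 0"
        using nz[of i] nz[of "i - r"] nz[of "N + i - 2 * r"] nz[of "i + r"] nz[of "i + s"] nz[of "i - s"]
          nz[of "N + i - s - r"] nz[of "i - r + s"] nz[of "i - s + r"] 3 p i by (simp_all add: \<xi>(1))
      have m: "nbr_mon x i = 1 / x (i + r) * x (i - r) * x (i + s) * (1 / x (i - s)) * (1 / x (i - r + s)) * x (i - s + r)"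
        unfolding nbr_mon_def using 3 p i by (simp add: algebra_simps)
      have g1: "\<gamma> (N + i) = \<xi> (N + i - s) * x (i + s) / (\<xi> (N + i - r) * x (i + r))"
        unfolding \<gamma>_def e using 3 p i by (simp add: \<xi>(1))
      have g2: "\<gamma> (N + i - r) = \<xi> (N + i - s - r) * x (i - r + s) / (\<xi> (N + i - 2 * r) * x i)"
        unfolding \<gamma>_def e using 3 p i by (simp add: \<xi>(1))
      have "\<gamma> (N + i) = \<gamma> (N + i - r) * nbr_mon x i"
        unfolding g1 g2 m R R2 using nn by (simp add: field_simps)
      then show ?thesis using 3 p by simp
    next
      case 4
      have R: "\<xi> (N + i - r) = \<xi> (N + i - 2 * r) * x i / x (i - r)"
        using rec[of "N + i - r"] 4 p i by (simp add: algebra_simps \<xi>(1))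
      have R2: "\<xi> (N + i - s) = \<xi> (N + i - s - r) * x (i - s + r) / x (i - s)"
        using rec[of "N + i - s"] 4 p i by (simp add: algebra_simps \<xi>(1))
      have R3: "\<xi> (i + s) = \<xi> (i - r + s) * x (i + r + s - N) / x (i + s - N)"
        using rec[of "i + s"] 4 p i by (simp add: algebra_simps \<xi>(1))
      have nn: "x i \<noteq> 0" "x (i - r) \<noteq> 0" "\<xi> (N + i - 2 * r) \<noteq> 0" "x (i + r) \<noteq> 0" "x (i + s - N) \<noteq> 0"
        "x (i - s) \<noteq> 0" "\<xi> (N + i - s - r) \<noteq> 0" "\<xi> (i - r + s) \<noteq> 0" "x (i - s + r) \<noteq> 0" "x (i + r + s - N) \<noteq> 0"
        using nz[of i] nz[of "i - r"] nz[of "N + i - 2 * r"] nz[of "i + r"] nz[of "i + s - N"] nz[of "i - s"]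
          nz[of "N + i - s - r"] nz[of "i - r + s"] nz[of "i - s + r"] nz[of "i + r + s - N"] 4 p i by (simp_all add: \<xi>(1))
      have m: "nbr_mon x i = 1 / x (i + r) * x (i - r) * (1 / x (i + s - N)) * (1 / x (i - s)) * x (i - s + r) * x (i + r + s - N)"
        unfolding nbr_mon_def using 4 p i by (simp add: algebra_simps)
      have g1: "\<gamma> (N + i) = \<xi> (N + i - s) * \<xi> (i + s) / (\<xi> (N + i - r) * x (i + r))"
        unfolding \<gamma>_def e using 4 p i by (simp add: \<xi>(1))
      have g2: "\<gamma> (N + i - r) = \<xi> (N + i - s - r) * \<xi> (i - r + s) / (\<xi> (N + i - 2 * r) * x i)"
        unfolding \<gamma>_def e using 4 p i by (simp add: \<xi>(1))
      have "\<gamma> (N + i) = \<gamma> (N + i - r) * nbr_mon x i"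
        unfolding g1 g2 m R R2 R3 using nn by (simp add: field_simps)
      then show ?thesis using 4 p by simp
    next
      case 5
      have R: "\<xi> (N + i - r) = \<xi> (N + i - 2 * r) * x i / x (i - r)"
        using rec[of "N + i - r"] 5 p i by (simp add: algebra_simps \<xi>(1))
      have R2: "\<xi> (N + i - s) = \<xi> (N + i - s - r) * \<xi> (i - s + r) / x (i - s)"
        using rec[of "N + i - s"] 5 p i by (simp add: algebra_simps \<xi>(1))
      have R3: "\<xi> (i + s) = \<xi> (i - r + s) * \<xi> (i + r + s - N) / x (i + s - N)"
        using rec[of "i + s"] 5 p i by (simp add: algebra_simps \<xi>(1))
      have R4: "\<xi> (i + r) = x i * \<xi> (i + 2 * r - N) / x (i + r - N)"
        using rec[of "i + r"] 5 p i by (simp add: algebra_simps \<xi>(1))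
      have nn: "x i \<noteq> 0" "x (i - r) \<noteq> 0" "\<xi> (N + i - 2 * r) \<noteq> 0" "x (i + r - N) \<noteq> 0" "x (i + s - N) \<noteq> 0"
        "x (i - s) \<noteq> 0" "\<xi> (N + i - s - r) \<noteq> 0" "\<xi> (i - r + s) \<noteq> 0" "\<xi> (i - s + r) \<noteq> 0" "\<xi> (i + r + s - N) \<noteq> 0"
        "\<xi> (i + 2 * r - N) \<noteq> 0"
        using nz[of i] nz[of "i - r"] nz[of "N + i - 2 * r"] nz[of "i + r - N"] nz[of "i + s - N"] nz[of "i - s"]
          nz[of "N + i - s - r"] nz[of "i - r + s"] nz[of "i - s + r"] nz[of "i + r + s - N"]
          nz[of "i + 2 * r - N"] 5 p i by (simp_all add: \<xi>(1))
      have m: "nbr_mon x i = x (i + r - N) * x (i - r) * (1 / x (i + s - N)) * (1 / x (i - s))"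
        unfolding nbr_mon_def using 5 p i by (simp add: algebra_simps)
      have g1: "\<gamma> (N + i) = \<xi> (N + i - s) * \<xi> (i + s) / (\<xi> (N + i - r) * \<xi> (i + r))"
        unfolding \<gamma>_def e by simp
      have g2: "\<gamma> (N + i - r) = \<xi> (N + i - s - r) * \<xi> (i - r + s) / (\<xi> (N + i - 2 * r) * x i)"
        unfolding \<gamma>_def e using 5 p i by (simp add: \<xi>(1))
      have g3: "\<gamma> (i + r) = \<xi> (i - s + r) * \<xi> (i + r + s - N) / (x i * \<xi> (i + 2 * r - N))"
        unfolding \<gamma>_def e using 5 p i by (simp add: \<xi>(1) algebra_simps)
      have "\<gamma> (N + i) = \<gamma> (N + i - r) * \<gamma> (i + r) * nbr_mon x i"
        unfolding g1 g2 g3 m R R2 R3 R4 using nn by (simp add: field_simps)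
      then show ?thesis using 5 p by simp
    qed
  qed
  have \<gamma>nz: "\<gamma> n \<noteq> 0" if "N < n" for n
    using nz[of "n - s"] nz[of "n - N + s"] nz[of "n - r"] nz[of "n - N + r"] that p by (simp add: \<gamma>_def)
  have "\<beta> n = \<gamma> n" if "N < n" for n
    using that
  proof (induction "nat n" arbitrary: n rule: less_induct)
    case less
    have IH: "\<beta> m = \<gamma> m" if "N < m" "m < n" for m
      using less.hyps[of m] that less.prems N_pos by simp
    have b: "\<beta> m = (if N < m then \<gamma> m else 1)" if "m < n" for m using IH[OF _ that] \<beta>1[of m] by auto
    show ?case
    proof (cases "n \<le> 2 * N")
      case True
      define i where "i = n - N"
      have i: "1 \<le> i" "i \<le> N" using True less.prems by (auto simp: i_def)
      have "\<beta> n = \<beta> (n - r) * \<beta> (n - N + r) * c n" using \<beta>rec[of n] \<beta>1[of "n - N"] True by simp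
      then show ?thesis using small[OF i] b[of "n - r"] b[of "n - N + r"] True less.prems p
        by (auto simp: c_def i_def)
    next
      case False
      have "\<beta> n * \<gamma> (n - N) = \<gamma> (n - r) * \<gamma> (n - N + r)"
        using \<beta>rec[of n] False b[of "n - N"] b[of "n - r"] b[of "n - N + r"] p by (auto simp: c_def)
      moreover have "\<gamma> n * \<gamma> (n - N) = \<gamma> (n - r) * \<gamma> (n - N + r)" "\<gamma> (n - N) \<noteq> 0"
        using big[of n] False \<gamma>nz[of "n - N"] by (auto simp: field_simps)
      ultimately show ?thesis by (metis mult_right_cancel)
    qed
  qed
  then show ?thesis using n nz[of "n - r"] nz[of "n - N + r"] p by (simp add: \<beta>_def \<gamma>_def)
qed

text \<open>The arguments are the coefficients with hats: y times the exchange monomial of the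
  vertex. By \<open>prod_nbr_mon\<close>, inserting them into \<open>ymon\<close> exchanges the
  leading monomials of the r-term for those of the s-term.\<close>

theorem cluster_rec:
  fixes S :: "'a::field set"
  assumes S: "\<And>a b. a \<in> S \<Longrightarrow> b \<in> S \<Longrightarrow> a * b \<in> S" "\<And>a b. a \<in> S \<Longrightarrow> b \<in> S \<Longrightarrow> a + b \<in> S"
     "\<And>a b. a \<in> S \<Longrightarrow> b \<in> S \<Longrightarrow> a / b \<in> S" "1 \<in> S" "0 \<notin> S"
    and xy: "\<And>i. x i \<in> S" "\<And>i. y i \<in> S"
    and \<xi>: "\<And>j. 1 \<le> j \<Longrightarrow> j \<le> N \<Longrightarrow> \<xi> j = x j" "\<And>j. 1 \<le> j \<Longrightarrow> \<xi> j \<noteq> 0"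
    "\<And>n. N < n \<Longrightarrow> \<xi> n * \<xi> (n - N) = \<xi> (n - r) * \<xi> (n - N + r)"
    and n: "N < n"
  defines "U \<equiv> \<lambda>n. \<xi> n * fpoly n (\<lambda>l. y l * nbr_mon x (l + 1))"
  shows "U n * U (n - N) = U (n - r) * U (n - N + r) + ymon n y * (U (n - s) * U (n - N + s))"
proof -
  define Y where "Y l = y l * nbr_mon x (l + 1)" for l
  define f where "f n = fpoly n Y" for n
  have "nbr_mon x l \<in> S" for l unfolding nbr_mon_def by (intro S(1)) (auto intro: xy S(3,4))
  then have "Y l \<in> S" for l unfolding Y_def by (intro S(1) xy)
  then have F: "f n * f (n - N) = f (n - r) * f (n - N + r) + ymon n Y * (f (n - s) * f (n - N + s))"
    unfolding f_def by (intro fpoly_rec[of S] S n)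
  have Yy: "ymon n Y = ymon n y * (\<Prod>l\<in>{0..<N}. nbr_mon x (l + 1) ^ nu (n - N - 1 - l))"
    unfolding ymon_def Y_def by (simp add: power_mult_distrib prod.distrib)
  have g: "ymon n Y * (\<xi> (n - r) * \<xi> (n - N + r)) = ymon n y * (\<xi> (n - s) * \<xi> (n - N + s))"
    unfolding Yy mult.assoc by (subst prod_nbr_mon[OF \<xi> n]) auto
  have "U n * U (n - N) = (\<xi> n * \<xi> (n - N)) * (f n * f (n - N))"
    unfolding U_def f_def Y_def by (simp only: ac_simps)
  also have "\<dots> = \<xi> (n - r) * \<xi> (n - N + r) * (f (n - r) * f (n - N + r)) +
      (ymon n Y * (\<xi> (n - r) * \<xi> (n - N + r))) * (f (n - s) * f (n - N + s))"
    unfolding F \<xi>(3)[OF n] by (simp only: distrib_left ac_simps)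
  also have "\<dots> = U (n - r) * U (n - N + r) + ymon n y * (U (n - s) * U (n - N + s))"
    unfolding g unfolding U_def f_def Y_def by (simp only: ac_simps)
  finally show ?thesis .
qed


section \<open>Periodic mutation of the Gale--Robinson quiver\<close>

lemma zero_in_conf: "(\<lambda>_. 0) \<in> conf n"
  by (auto simp: conf_def conf_at_def step01_def)

text \<open>Serves to show that \<open>fpoly\<close> does not vanish, so that the recurrence can be
  divided by it.\<close>

lemma fpoly_closed:
  fixes S :: "'a::field set"
  assumes S: "\<And>a b. a \<in> S \<Longrightarrow> b \<in> S \<Longrightarrow> a * b \<in> S" "\<And>a b. a \<in> S \<Longrightarrow> b \<in> S \<Longrightarrow> a + b \<in> S"
     "\<And>a b. a \<in> S \<Longrightarrow> b \<in> S \<Longrightarrow> a / b \<in> S" "1 \<in> S"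
    and y: "\<And>l. y l \<in> S"
  shows "fpoly n y \<in> S"
proof -
  have pw: "a ^ m \<in> S" if "a \<in> S" for a and m :: nat using that by (induction m) (auto intro: S)
  have pi: "a powi m \<in> S" if "a \<in> S" for a m
    using S(3)[OF S(4) pw[OF that]] pw[OF that] by (auto simp: power_int_def inverse_eq_divide power_divide)
  have pr: "(\<Prod>F\<in>A. f F) \<in> S" if "\<And>F. f F \<in> S" for A and f :: "int \<times> int \<Rightarrow> 'a"
    by (induction A rule: infinite_finite_induct) (auto intro: S that)
  have sm: "(\<Sum>h\<in>A. f h) \<in> S" if "finite A" "A \<noteq> {}" "\<And>h. f h \<in> S" for A and f :: "(int \<times> int \<Rightarrow> int) \<Rightarrow> 'a"
    using that by (induction A rule: finite_ne_induct) (auto intro: S)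
  show ?thesis unfolding fpoly_def
    by (rule sm[OF finite_conf]) (use zero_in_conf in \<open>auto intro!: pr pi y\<close>)
qed

end

section \<open>Subtraction-free rational functions\<close>

definition pos_poly :: "((nat \<Rightarrow>\<^sub>0 nat) \<Rightarrow>\<^sub>0 rat) \<Rightarrow> bool" where
  "pos_poly p \<longleftrightarrow> p \<noteq> 0 \<and> (\<forall>k. 0 \<le> Poly_Mapping.lookup p k)"

text \<open>A concrete instance of the set S in \<open>fpoly_rec\<close> and
  \<open>cluster_rec\<close> that contains all indeterminates.\<close>

definition pos_ratfun :: "ratfun set" where
  "pos_ratfun = {Fract p q | p q. pos_poly p \<and> pos_poly q}"

lemma pos_poly_add: "pos_poly p \<Longrightarrow> pos_poly q \<Longrightarrow> pos_poly (p + q)"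
proof -
  assume A: "pos_poly p" "pos_poly q"
  obtain k where "Poly_Mapping.lookup p k \<noteq> 0" using A(1) unfolding pos_poly_def by (metis poly_mapping_eqI lookup_zero)
  then have "0 < Poly_Mapping.lookup p k" "0 \<le> Poly_Mapping.lookup q k" using A by (auto simp: pos_poly_def less_le)
  then have "Poly_Mapping.lookup (p + q) k > 0" unfolding lookup_add by (rule add_pos_nonneg)
  then have "p + q \<noteq> 0" by (metis less_irrefl lookup_zero)
  then show ?thesis using A unfolding pos_poly_def by (auto simp: lookup_add)
qed

lemma pos_poly_mult: "pos_poly p \<Longrightarrow> pos_poly q \<Longrightarrow> pos_poly (p * q)"
proof -
  assume A: "pos_poly p" "pos_poly q"
  have "0 \<le> Poly_Mapping.lookup (p * q) k" for k
    unfolding lookup_mult Sum_any.expand_set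
    using A by (auto intro!: sum_nonneg mult_nonneg_nonneg simp: pos_poly_def when_def Sum_any.expand_set)
  then show ?thesis using A by (auto simp: pos_poly_def)
qed

lemma pos_ratfun:
  "a \<in> pos_ratfun \<Longrightarrow> b \<in> pos_ratfun \<Longrightarrow> a * b \<in> pos_ratfun"
  "a \<in> pos_ratfun \<Longrightarrow> b \<in> pos_ratfun \<Longrightarrow> a + b \<in> pos_ratfun"
  "a \<in> pos_ratfun \<Longrightarrow> b \<in> pos_ratfun \<Longrightarrow> a / b \<in> pos_ratfun"
  "1 \<in> pos_ratfun" "0 \<notin> pos_ratfun" "indet i \<in> pos_ratfun"
proof -
  have one: "pos_poly 1" by (auto simp: pos_poly_def lookup_one when_def)
  {
    assume "a \<in> pos_ratfun" "b \<in> pos_ratfun"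
    then obtain p q p' q' where A: "a = Fract p q" "b = Fract p' q'" "pos_poly p" "pos_poly q" "pos_poly p'" "pos_poly q'"
      unfolding pos_ratfun_def by blast
    have nz: "q \<noteq> 0" "q' \<noteq> 0" "p' \<noteq> 0" using A by (auto simp: pos_poly_def)
    have "a * b = Fract (p * p') (q * q')" "a + b = Fract (p * q' + p' * q) (q * q')" "a / b = Fract (p * q') (q * p')"
      using nz by (auto simp: A(1,2))
    then show "a * b \<in> pos_ratfun" "a + b \<in> pos_ratfun" "a / b \<in> pos_ratfun"
      unfolding pos_ratfun_def using A(3-6) by (blast intro: pos_poly_mult pos_poly_add)+
  }
  show "1 \<in> pos_ratfun" unfolding pos_ratfun_def One_fract_def using one by blast
  have "Fract p q \<noteq> 0" if "pos_poly p" "pos_poly q" for p q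
    using that by (simp add: pos_poly_def Zero_fract_def eq_fract)
  then show "0 \<notin> pos_ratfun" unfolding pos_ratfun_def by auto
  have "pos_poly (Poly_Mapping.single (Poly_Mapping.single i 1) 1)"
    by (auto simp: pos_poly_def lookup_single when_def) (metis lookup_single_eq lookup_zero zero_neq_one)
  then show "indet i \<in> pos_ratfun" unfolding pos_ratfun_def indet_def using one by blast
qed

section \<open>The quiver as a skew-symmetric matrix\<close>

locale gr_params =
  fixes r s N :: nat
  assumes r0: "0 < r" "r < s" "2 * s \<le> N"

sublocale gr_params \<subseteq> gale_robinson "int r" "int s" "int N"
  using r0 by unfold_locales auto

context gr_params
begin

lemma gr_arrows_eq:
  "gr_arrows r s N a b =
     of_bool (1 \<le> a \<and> b = a + r \<and> b \<le> N) + of_bool (1 \<le> a \<and> a \<le> r \<and> b + r = a + N)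
   + of_bool (1 \<le> b \<and> a = b + s \<and> a \<le> N) + of_bool (1 \<le> b \<and> b \<le> s \<and> a + s = b + N)
   + of_bool (r < a \<and> b + r = a + s \<and> a + s \<le> N) + of_bool (r < a \<and> a \<le> s \<and> b + r + s = a + N)"
proof -
  have "(\<exists>i\<in>{1..N - r}. a = i \<and> b = i + r) \<longleftrightarrow> 1 \<le> a \<and> b = a + r \<and> b \<le> N" using r0 by auto
  moreover have "(\<exists>j\<in>{1..r}. a = j \<and> b = N - r + j) \<longleftrightarrow> 1 \<le> a \<and> a \<le> r \<and> b + r = a + N" using r0 by auto
  moreover have "(\<exists>i\<in>{1..N - s}. a = s + i \<and> b = i) \<longleftrightarrow> 1 \<le> b \<and> a = b + s \<and> a \<le> N" using r0 by auto
  moreover have "(\<exists>j\<in>{1..s}. a = N - s + j \<and> b = j) \<longleftrightarrow> 1 \<le> b \<and> b \<le> s \<and> a + s = b + N" using r0 by auto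
  moreover have "(\<exists>i\<in>{1..N - r - s}. a = r + i \<and> b = s + i) \<longleftrightarrow> r < a \<and> b + r = a + s \<and> a + s \<le> N"
    (is "?l \<longleftrightarrow> ?r")
  proof
    assume ?r then show ?l using r0 by (intro bexI[of _ "a - r"]) auto
  qed (use r0 in auto)
  moreover have "(\<exists>j\<in>{1..s - r}. a = r + j \<and> b = N - s + j) \<longleftrightarrow> r < a \<and> a \<le> s \<and> b + r + s = a + N"
    (is "?l \<longleftrightarrow> ?r")
  proof
    assume ?r then show ?l using r0 by (intro bexI[of _ "a - r"]) auto
  qed (use r0 in auto)
  ultimately show ?thesis unfolding gr_arrows_def by simp
qed

definition bmat :: "nat \<Rightarrow> nat \<Rightarrow> int" where
  "bmat a b = int (gr_arrows r s N a b) - int (gr_arrows r s N b a)"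

lemma gr_quiver_eq: "gr_quiver r s N a b = nat (bmat a b)"
  by (simp add: gr_quiver_def erase_2cycles_def bmat_def nat_diff_distrib')

lemma bmat_skew: "bmat b a = - bmat a b"
  by (simp add: bmat_def)

lemma gr_arrows_one:
  assumes "1 \<le> p" "p \<le> N"
  shows "gr_arrows r s N p 1 = of_bool (p = s + 1) + of_bool (p + s = N + 1)"
    "gr_arrows r s N 1 p = of_bool (p = r + 1) + of_bool (p + r = N + 1)"
proof -
  have c: "(1 \<le> p \<and> 1 = p + r \<and> 1 \<le> N) = False" "(1 \<le> p \<and> p \<le> r \<and> 1 + r = p + N) = False"
    "((1::nat) \<le> 1 \<and> p = 1 + s \<and> p \<le> N) = (p = s + 1)" "((1::nat) \<le> 1 \<and> 1 \<le> s \<and> p + s = 1 + N) = (p + s = N + 1)"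
    "(r < p \<and> 1 + r = p + s \<and> p + s \<le> N) = False" "(r < p \<and> p \<le> s \<and> 1 + r + s = p + N) = False"
    using assms r0 by auto
  show "gr_arrows r s N p 1 = of_bool (p = s + 1) + of_bool (p + s = N + 1)"
    unfolding gr_arrows_eq c by simp
  have c: "((1::nat) \<le> 1 \<and> p = 1 + r \<and> p \<le> N) = (p = r + 1)" "((1::nat) \<le> 1 \<and> 1 \<le> r \<and> p + r = 1 + N) = (p + r = N + 1)"
    "(1 \<le> p \<and> 1 = p + s \<and> 1 \<le> N) = False" "(1 \<le> p \<and> p \<le> s \<and> 1 + s = p + N) = False"
    "(r < 1 \<and> p + r = 1 + s \<and> 1 + s \<le> N) = False" "(r < 1 \<and> 1 \<le> s \<and> p + r + s = 1 + N) = False"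
    using assms r0 by auto
  show "gr_arrows r s N 1 p = of_bool (p = r + 1) + of_bool (p + r = N + 1)"
    unfolding gr_arrows_eq c by simp
qed

lemma bmat_one:
  assumes "1 \<le> p" "p \<le> N"
  shows "bmat p 1 = of_bool (p = s + 1) + of_bool (p + s = N + 1) - of_bool (p = r + 1) - of_bool (p + r = N + 1)"
  unfolding bmat_def gr_arrows_one[OF assms] by simp

lemma bmat_last:
  assumes "1 \<le> q" "q < N"
  shows "bmat N q = bmat (q + 1) 1"
proof -
  have c: "(1 \<le> N \<and> q = N + r \<and> q \<le> N) = False" "(1 \<le> N \<and> N \<le> r \<and> q + r = N + N) = False"
    "(1 \<le> q \<and> N = q + s \<and> N \<le> N) = (q + s = N)" "(1 \<le> q \<and> q \<le> s \<and> N + s = q + N) = (q = s)"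
    "(r < N \<and> q + r = N + s \<and> N + s \<le> N) = False" "(r < N \<and> N \<le> s \<and> q + r + s = N + N) = False"
    using assms r0 by auto
  have 1: "gr_arrows r s N N q = of_bool (q + s = N) + of_bool (q = s)" unfolding gr_arrows_eq c by simp
  have c: "(1 \<le> q \<and> N = q + r \<and> N \<le> N) = (q + r = N)" "(1 \<le> q \<and> q \<le> r \<and> N + r = q + N) = (q = r)"
    "(1 \<le> N \<and> q = N + s \<and> q \<le> N) = False" "(1 \<le> N \<and> N \<le> s \<and> q + s = N + N) = False"
    "(r < q \<and> N + r = q + s \<and> q + s \<le> N) = False" "(r < q \<and> q \<le> s \<and> N + r + s = q + N) = False"
    using assms r0 by auto
  have 2: "gr_arrows r s N q N = of_bool (q + r = N) + of_bool (q = r)" unfolding gr_arrows_eq c by simp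
  show ?thesis using bmat_one[of "q + 1"] assms unfolding bmat_def[of N q] 1 2 by simp
qed

text \<open>Period one of the quiver: the correction terms count the paths through vertex 1, which
  enter from s + 1 and N - s + 1 and leave to r + 1 and N - r + 1. So mutation at 1 only shifts the
  matrix by one.\<close>

lemma bmat_periodic:
  assumes "1 \<le> p" "p < N" "1 \<le> q" "q < N"
  shows "bmat p q = bmat (p + 1) (q + 1) +
    (of_bool (p = s) + of_bool (p + s = N)) * (of_bool (q = r) + of_bool (q + r = N)) -
    (of_bool (p = r) + of_bool (p + r = N)) * (of_bool (q = s) + of_bool (q + s = N))"
proof -
  define d where "d p q = int (gr_arrows r s N (p + 1) (q + 1)) - int (gr_arrows r s N p q)" for p q
  have "d p q = (of_bool (p = r) * of_bool (q = s) - of_bool (p + s = N) * of_bool (q + r = N))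
     + (of_bool (p = r) * of_bool (q + s = N) - of_bool (p = s) * of_bool (q + r = N))"
    if "1 \<le> p" "p < N" "1 \<le> q" "q < N" for p q
  proof -
    have 1: "(of_bool (1 \<le> p + 1 \<and> q + 1 = p + 1 + r \<and> q + 1 \<le> N) :: int) = of_bool (1 \<le> p \<and> q = p + r \<and> q \<le> N)"
      "(of_bool (1 \<le> p + 1 \<and> p + 1 \<le> r \<and> q + 1 + r = p + 1 + N) :: int) = of_bool (1 \<le> p \<and> p \<le> r \<and> q + r = p + N)"
      "(of_bool (1 \<le> q + 1 \<and> p + 1 = q + 1 + s \<and> p + 1 \<le> N) :: int) = of_bool (1 \<le> q \<and> p = q + s \<and> p \<le> N)"
      "(of_bool (1 \<le> q + 1 \<and> q + 1 \<le> s \<and> p + 1 + s = q + 1 + N) :: int) = of_bool (1 \<le> q \<and> q \<le> s \<and> p + s = q + N)"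
      using that by auto
    have 2: "(of_bool (r < p + 1 \<and> q + 1 + r = p + 1 + s \<and> p + 1 + s \<le> N) :: int) =
        of_bool (r < p \<and> q + r = p + s \<and> p + s \<le> N) + (of_bool (p = r) * of_bool (q = s) - of_bool (p + s = N) * of_bool (q + r = N))"
      using that r0 by (auto simp: of_bool_def)
    have 3: "(of_bool (r < p + 1 \<and> p + 1 \<le> s \<and> q + 1 + r + s = p + 1 + N) :: int) =
        of_bool (r < p \<and> p \<le> s \<and> q + r + s = p + N) + (of_bool (p = r) * of_bool (q + s = N) - of_bool (p = s) * of_bool (q + r = N))"
      using that r0 by (auto simp: of_bool_def)
    show ?thesis unfolding d_def gr_arrows_eq of_nat_add of_nat_of_bool 1 2 3 by simp
  qed
  note D = this
  have "bmat (p + 1) (q + 1) = bmat p q + d p q - d q p" by (simp add: bmat_def d_def)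
  then show ?thesis using D[of p q] D[of q p] assms by (simp add: algebra_simps)
qed

text \<open>The vertices form a queue: this is the vertex at position p after t mutations. Position
  1 is mutated next and then goes to position N.\<close>

definition vtx :: "nat \<Rightarrow> nat \<Rightarrow> nat" where
  "vtx t p = (t + p - 1) mod N + 1"

lemma N0: "0 < N" using r0 by simp

lemma vtx_Suc: "1 \<le> p \<Longrightarrow> vtx (Suc t) p = vtx t (p + 1)" "vtx (Suc t) N = vtx t 1" "vtx t 1 = t mod N + 1"
  using N0 by (auto simp: vtx_def)

lemma vtx_bounds: "1 \<le> vtx t p" "vtx t p \<le> N"
  using N0 by (auto simp: vtx_def Suc_le_eq)

lemma vtx_inj: "inj_on (vtx t) {1..N}"
proof (rule inj_onI)
  fix p q assume A: "p \<in> {1..N}" "q \<in> {1..N}" "vtx t p = vtx t q"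
  then have "(t + p - 1) mod N = (t + q - 1) mod N" by (simp add: vtx_def)
  then have "int (t + p - 1) mod int N = int (t + q - 1) mod int N" by (metis of_nat_mod)
  then have "int N dvd (int (t + p - 1) - int (t + q - 1))" by (simp only: mod_eq_dvd_iff)
  then have "int N dvd int p - int q" using A by (simp add: of_nat_diff)
  moreover have "\<bar>int p - int q\<bar> < int N" using A by auto
  ultimately have "int p - int q = 0" using dvd_imp_le_int by (metis abs_of_nat not_le)
  then show "p = q" by simp
qed

lemma vtx_bij: "bij_betw (vtx t) {1..N} {1..N}"
proof -
  have "vtx t ` {1..N} \<subseteq> {1..N}" using vtx_bounds by auto
  then have "vtx t ` {1..N} = {1..N}" using vtx_inj[of t] by (metis card_image card_subset_eq finite_atLeastAtMost)
  then show ?thesis using vtx_inj by (simp add: bij_betw_def)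
qed

definition mult :: "nat \<Rightarrow> nat \<Rightarrow> int" where
  "mult n i = int (nu (int n - int N - int i))"

definition cvec :: "nat \<Rightarrow> nat \<Rightarrow> nat \<Rightarrow> int" where
  "cvec t p i = mult (t + p + N) i - of_bool (r < p) * mult (t + p + N - r) i - of_bool (N < p + r) * mult (t + p + r) i"

text \<open>The defect of \<open>nu_rec\<close> at 0 produces the identity matrix, that is,
  principal coefficients.\<close>

lemma cvec_zero:
  assumes "1 \<le> p" "p \<le> N" "1 \<le> i" "i \<le> N"
  shows "cvec 0 p i = of_bool (p = i)"
proof -
  have "int (nu (int p - int i)) + int (nu (int p - int i - int N)) =
     int (nu (int p - int i - int r)) + int (nu (int p - int i - int N + int r)) + of_bool (p = i)"
    using nu_rec[of "int p - int i"] by (simp flip: of_nat_add)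
  moreover have "nu (int p - int i - int N) = 0" using assms by (intro nu_neg) auto
  moreover have "int (nu (int p - int i - int r)) = of_bool (r < p) * mult (0 + p + N - r) i"
    using assms nu_neg[of "int p - int i - int r"] r0 by (auto simp: mult_def of_nat_diff algebra_simps)
  moreover have "int (nu (int p - int i - int N + int r)) = of_bool (N < p + r) * mult (0 + p + r) i"
    using assms nu_neg[of "int p - int i - int N + int r"] r0 by (auto simp: mult_def algebra_simps)
  ultimately show ?thesis by (simp add: cvec_def mult_def)
qed

lemma cvec_one: "cvec t 1 i = mult (t + 1 + N) i"
  using r0 by (simp add: cvec_def)

lemma cvec_Suc:
  assumes "1 \<le> p" "p < N"
  shows "cvec (Suc t) p i = cvec t (p + 1) i + mult (t + 1 + N) i * (of_bool (p = r) + of_bool (p + r = N))"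
proof -
  have *: "Suc t + p + N = t + (p + 1) + N" "Suc t + p + N - r = t + (p + 1) + N - r" "Suc t + p + r = t + (p + 1) + r" by auto
  have a: "(of_bool (r < p + 1) :: int) = of_bool (r < p) + of_bool (p = r)"
    "(of_bool (N < p + 1 + r) :: int) = of_bool (N < p + r) + of_bool (p + r = N)" by (auto simp: of_bool_def)
  have b: "of_bool (p = r) * mult (t + (p + 1) + N - r) i = of_bool (p = r) * mult (t + 1 + N) i"
    "of_bool (p + r = N) * mult (t + (p + 1) + r) i = of_bool (p + r = N) * mult (t + 1 + N) i"
    using r0 by (auto simp: of_bool_def add_ac)
  have 1: "of_bool (r < p + 1) * mult (t + (p + 1) + N - r) i =
      of_bool (r < p) * mult (t + (p + 1) + N - r) i + of_bool (p = r) * mult (t + 1 + N) i"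
    unfolding a distrib_right b ..
  have 2: "of_bool (N < p + 1 + r) * mult (t + (p + 1) + r) i =
      of_bool (N < p + r) * mult (t + (p + 1) + r) i + of_bool (p + r = N) * mult (t + 1 + N) i"
    unfolding a distrib_right b ..
  show ?thesis unfolding cvec_def * 1 2 by (simp add: algebra_simps)
qed

text \<open>Mutation negates the vector of the mutated vertex, which then has position N; that the
  closed form agrees is \<open>nu_rec\<close> at a positive argument.\<close>

lemma cvec_last:
  assumes "1 \<le> i" "i \<le> N"
  shows "cvec (Suc t) N i = - mult (t + 1 + N) i"
proof -
  define K where "K = int t + 1 + int N - int i"
  have "int (nu K) + int (nu (K - int N)) = int (nu (K - int r)) + int (nu (K - int N + int r))"
    using nu_rec[of K] assms by (simp add: K_def flip: of_nat_add)
  moreover have "mult (Suc t + N + N) i = int (nu K)" "mult (t + 1 + N) i = int (nu (K - int N))"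
    "mult (Suc t + N + N - r) i = int (nu (K - int r))" "mult (Suc t + N + r) i = int (nu (K - int N + int r))"
    using r0 by (auto simp: mult_def K_def of_nat_diff algebra_simps)
  ultimately show ?thesis using r0 by (simp add: cvec_def)
qed

definition xs :: "nat \<Rightarrow> ratfun" where
  "xs n = (if n \<le> N then indet n else xhat r s N n)"

text \<open>Indexing by queue positions makes the mutable part independent of t. Arrows in the two
  directions are the positive and negative parts of one integer, which also records that there are
  no 2-cycles.\<close>

definition seed_inv :: "nat \<Rightarrow> quiver \<times> (nat \<Rightarrow> ratfun) \<Rightarrow> bool" where
  "seed_inv t = (\<lambda>(Q, X).
     (\<forall>p\<in>{1..N}. \<forall>q\<in>{1..N}. Q (vtx t p) (vtx t q) = nat (bmat p q)) \<and>
     (\<forall>p\<in>{1..N}. \<forall>i\<in>{1..N}. Q (N + i) (vtx t p) = nat (cvec t p i) \<and> Q (vtx t p) (N + i) = nat (- cvec t p i)) \<and>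
     (\<forall>p\<in>{1..N}. X (vtx t p) = xs (t + p)) \<and> (\<forall>i\<in>{1..N}. X (N + i) = indet (N + i)))"

text \<open>The truncated subtraction in \<open>erase_2cycles\<close> yields the positive part of
  the usual signed mutation rule.\<close>

lemma mutate_quiver_off:
  assumes "i \<noteq> k" "j \<noteq> k" "Q i j = nat b" "Q j i = nat (- b)"
  shows "mutate_quiver k Q i j = nat (b + int (Q i k) * int (Q k j) - int (Q j k) * int (Q k i))"
proof -
  have "mutate_quiver k Q i j = Q i j + Q i k * Q k j - (Q j i + Q j k * Q k i)"
    using assms by (simp add: mutate_quiver_def erase_2cycles_def reverse_at_def add_paths_def)
  also have "\<dots> = nat (int (Q i j + Q i k * Q k j) - int (Q j i + Q j k * Q k i))"
    by (simp only: nat_minus_as_int)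
  finally show ?thesis using assms(3,4) by (cases "0 \<le> b") (simp_all add: algebra_simps)
qed

lemma mutate_quiver_at:
  assumes "Q k k = 0" "Q i k = nat b" "Q k i = nat (- b)"
  shows "mutate_quiver k Q i k = nat (- b)" "mutate_quiver k Q k i = nat b"
  using assms by (auto simp: mutate_quiver_def erase_2cycles_def reverse_at_def add_paths_def)

lemma exchange_products:
  assumes inv: "seed_inv t (Q, X)"
  defines "k \<equiv> vtx t 1"
  shows "(\<Prod>i\<in>{1..2 * N}. X i ^ Q i k) =
      (\<Prod>i\<in>{1..N}. indet (N + i) ^ nu (int (t + 1) - int i)) * (xs (t + 1 + s) * xs (t + 1 + N - s))"
    "(\<Prod>j\<in>{1..2 * N}. X j ^ Q k j) = xs (t + 1 + r) * xs (t + 1 + N - r)"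
proof -
  have one: "1 \<in> {1..N}" using N0 by simp
  have V: "{1..2 * N} = {1..N} \<union> (\<lambda>i. N + i) ` {1..N}" "{1..N} \<inter> (\<lambda>i. N + i) ` {1..N} = {}" by auto
  have split: "(\<Prod>i\<in>{1..2 * N}. f i) = (\<Prod>p\<in>{1..N}. f (vtx t p)) * (\<Prod>i\<in>{1..N}. f (N + i))" for f :: "nat \<Rightarrow> ratfun"
  proof -
    have "(\<Prod>i\<in>{1..2 * N}. f i) = (\<Prod>i\<in>{1..N}. f i) * (\<Prod>i\<in>(\<lambda>i. N + i) ` {1..N}. f i)"
      unfolding V(1) by (rule prod.union_disjoint) (use V(2) in auto)
    also have "(\<Prod>i\<in>(\<lambda>i. N + i) ` {1..N}. f i) = (\<Prod>i\<in>{1..N}. f (N + i))"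
      by (subst prod.reindex) auto
    finally show ?thesis unfolding prod.reindex_bij_betw[OF vtx_bij[of t], of f] .
  qed
  have del: "(\<Prod>p\<in>{1..N}. xs (t + p) ^ of_bool (p = c)) = xs (t + c)" if "c \<in> {1..N}" for c
  proof -
    have "(\<Prod>p\<in>{1..N}. xs (t + p) ^ of_bool (p = c)) = (\<Prod>p\<in>{1..N}. if p = c then xs (t + p) else 1)"
      by (intro prod.cong) auto
    then show ?thesis using that by (simp add: prod.delta)
  qed
  have fro: "(\<Prod>i\<in>{1..N}. X (N + i) ^ Q (N + i) k) = (\<Prod>i\<in>{1..N}. indet (N + i) ^ nu (int (t + 1) - int i))"
    "(\<Prod>i\<in>{1..N}. X (N + i) ^ Q k (N + i)) = 1"
    using inv one by (auto simp: seed_inv_def k_def cvec_one[simplified] mult_def algebra_simps intro!: prod.cong prod.neutral)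
  have "(\<Prod>p\<in>{1..N}. X (vtx t p) ^ Q (vtx t p) k) =
     (\<Prod>p\<in>{1..N}. xs (t + p) ^ of_bool (p = s + 1) * xs (t + p) ^ of_bool (p = N - s + 1))"
  proof (intro prod.cong refl)
    fix p assume p: "p \<in> {1..N}"
    have "Q (vtx t p) k = nat (bmat p 1)" "X (vtx t p) = xs (t + p)" using inv one p by (auto simp: seed_inv_def k_def)
    \<comment> \<open>If N = 2 s, both indicators hold at the same p and there is a double
      arrow.\<close>
    moreover have "nat (bmat p 1) = of_bool (p = s + 1) + of_bool (p = N - s + 1)"
      using bmat_one[of p] p r0 by (auto simp: of_bool_def)
    ultimately show "X (vtx t p) ^ Q (vtx t p) k = xs (t + p) ^ of_bool (p = s + 1) * xs (t + p) ^ of_bool (p = N - s + 1)"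
      by (simp only: power_add)
  qed
  also have "\<dots> = xs (t + (s + 1)) * xs (t + (N - s + 1))"
    unfolding prod.distrib by (intro arg_cong2[where f = "(*)"] del) (use r0 in auto)
  finally have mo: "(\<Prod>p\<in>{1..N}. X (vtx t p) ^ Q (vtx t p) k) = \<dots>" .
  have "(\<Prod>p\<in>{1..N}. X (vtx t p) ^ Q k (vtx t p)) =
     (\<Prod>p\<in>{1..N}. xs (t + p) ^ of_bool (p = r + 1) * xs (t + p) ^ of_bool (p = N - r + 1))"
  proof (intro prod.cong refl)
    fix p assume p: "p \<in> {1..N}"
    have "Q k (vtx t p) = nat (bmat 1 p)" "X (vtx t p) = xs (t + p)" using inv one p by (auto simp: seed_inv_def k_def)
    moreover have "nat (bmat 1 p) = of_bool (p = r + 1) + of_bool (p = N - r + 1)"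
      unfolding bmat_skew[of 1 p] using bmat_one[of p] p r0 by (auto simp: of_bool_def)
    ultimately show "X (vtx t p) ^ Q k (vtx t p) = xs (t + p) ^ of_bool (p = r + 1) * xs (t + p) ^ of_bool (p = N - r + 1)"
      by (simp only: power_add)
  qed
  also have "\<dots> = xs (t + (r + 1)) * xs (t + (N - r + 1))"
    unfolding prod.distrib by (intro arg_cong2[where f = "(*)"] del) (use r0 in auto)
  finally have mi: "(\<Prod>p\<in>{1..N}. X (vtx t p) ^ Q k (vtx t p)) = \<dots>" .
  have e: "t + 1 + s = t + (s + 1)" "t + 1 + N - s = t + (N - s + 1)" "t + 1 + r = t + (r + 1)" "t + 1 + N - r = t + (N - r + 1)"
    using r0 by auto
  show "(\<Prod>i\<in>{1..2 * N}. X i ^ Q i k) =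
      (\<Prod>i\<in>{1..N}. indet (N + i) ^ nu (int (t + 1) - int i)) * (xs (t + 1 + s) * xs (t + 1 + N - s))"
    unfolding split fro mo e by (rule mult.commute)
  show "(\<Prod>j\<in>{1..2 * N}. X j ^ Q k j) = xs (t + 1 + r) * xs (t + 1 + N - r)"
    unfolding split fro mi e by (rule mult_1_right)
qed

lemma seed_inv_gr_seed: "seed_inv t (gr_seed r s N t)"
proof (induction t)
  case 0
  have v: "vtx 0 p = p" if "p \<in> {1..N}" for p using that by (auto simp: vtx_def)
  have z: "gr_quiver r s N a b = 0" if "a > N \<or> b > N" for a b
  proof -
    have "gr_arrows r s N a b = 0" if "a > N \<or> b > N" for a b
    proof -
      have c: "(1 \<le> a \<and> b = a + r \<and> b \<le> N) = False" "(1 \<le> a \<and> a \<le> r \<and> b + r = a + N) = False"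
        "(1 \<le> b \<and> a = b + s \<and> a \<le> N) = False" "(1 \<le> b \<and> b \<le> s \<and> a + s = b + N) = False"
        "(r < a \<and> b + r = a + s \<and> a + s \<le> N) = False" "(r < a \<and> a \<le> s \<and> b + r + s = a + N) = False"
        using that r0 by auto
      show ?thesis unfolding gr_arrows_eq c by simp
    qed
    then show ?thesis using that unfolding gr_quiver_eq bmat_def by auto
  qed
  show ?case unfolding seed_inv_def gr_seed.simps
    by (auto simp: v gr_quiver_principal_def gr_quiver_eq[symmetric] z xs_def cvec_zero)
next
  case (Suc t)
  obtain Q X where QX: "gr_seed r s N t = (Q, X)" by fastforce
  have inv: "seed_inv t (Q, X)" using Suc QX by simp
  define k where "k = vtx t 1"
  have one: "1 \<in> {1..N}" using N0 by simp
  have k: "k = t mod N + 1" unfolding k_def by (rule vtx_Suc)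
  have kN: "1 \<le> k" "k \<le> N" using vtx_bounds by (auto simp: k_def)
  obtain X' where S: "gr_seed r s N (Suc t) = (mutate_quiver k Q, X')" and X': "\<And>j. j \<noteq> k \<Longrightarrow> X' j = X j"
    by (simp add: QX mutate_seed_def k)
  have Qq: "Q (vtx t p) (vtx t q) = nat (bmat p q)" if "p \<in> {1..N}" "q \<in> {1..N}" for p q
    using inv that by (auto simp: seed_inv_def)
  have Qc: "Q (N + i) (vtx t p) = nat (cvec t p i)" "Q (vtx t p) (N + i) = nat (- cvec t p i)"
    if "p \<in> {1..N}" "i \<in> {1..N}" for p i using inv that by (auto simp: seed_inv_def)
  have ne: "vtx t (p + 1) \<noteq> k" if "1 \<le> p" "p < N" for p
    using inj_onD[OF vtx_inj[of t], of "p + 1" 1] that one by (auto simp: k_def)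
  have bm1: "int (nat (bmat (p + 1) 1)) = of_bool (p = s) + of_bool (p + s = N)"
     "int (nat (bmat 1 (p + 1))) = of_bool (p = r) + of_bool (p + r = N)" if "1 \<le> p" "p < N" for p
    unfolding bmat_skew[of 1 "p + 1"] using bmat_one[of "p + 1"] that r0 by (auto simp: of_bool_def)
  have Qkk: "Q k k = 0" using Qq[OF one one] by (simp add: k_def bmat_def)
  have A: "mutate_quiver k Q (vtx (Suc t) p) (vtx (Suc t) q) = nat (bmat p q)" if pq: "p \<in> {1..N}" "q \<in> {1..N}" for p q
  proof -
    consider "p < N" "q < N" | "p = N" "q < N" | "p < N" "q = N" | "p = N" "q = N" using pq by force
    then show ?thesis
    proof cases
      case 1
      have pq': "p + 1 \<in> {1..N}" "q + 1 \<in> {1..N}" using 1 by auto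
      have pb: "1 \<le> p" "p < N" "1 \<le> q" "q < N" using 1 pq by auto
      have "mutate_quiver k Q (vtx t (p + 1)) (vtx t (q + 1)) = nat (bmat (p + 1) (q + 1) +
          int (Q (vtx t (p + 1)) k) * int (Q k (vtx t (q + 1))) - int (Q (vtx t (q + 1)) k) * int (Q k (vtx t (p + 1))))"
        using ne pq 1 Qq[OF pq'] Qq[OF pq'(2,1)] bmat_skew[of "p + 1" "q + 1"] by (intro mutate_quiver_off) auto
      also have "\<dots> = nat (bmat p q)"
        using bmat_periodic[of p q] pq 1 unfolding k_def Qq[OF pq'(1) one] Qq[OF pq'(2) one] Qq[OF one pq'(1)] Qq[OF one pq'(2)]
          bm1(1)[OF pb(1,2)] bm1(1)[OF pb(3,4)] bm1(2)[OF pb(1,2)] bm1(2)[OF pb(3,4)]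
        by (simp add: mult.commute)
      finally show ?thesis using pq by (simp add: vtx_Suc)
    next
      case 2
      have q': "q + 1 \<in> {1..N}" using 2 by auto
      have "mutate_quiver k Q k (vtx t (q + 1)) = nat (bmat (q + 1) 1)"
        using Qq[OF q' one] Qq[OF one q'] bmat_skew[of "q + 1" 1] by (intro mutate_quiver_at Qkk) (auto simp: k_def)
      then show ?thesis using bmat_last[of q] 2 pq by (simp add: vtx_Suc k_def)
    next
      case 3
      have p': "p + 1 \<in> {1..N}" using 3 by auto
      have "mutate_quiver k Q (vtx t (p + 1)) k = nat (- bmat (p + 1) 1)"
        using Qq[OF p' one] Qq[OF one p'] bmat_skew[of "p + 1" 1] by (intro mutate_quiver_at Qkk) (auto simp: k_def)
      then show ?thesis using bmat_last[of p] bmat_skew[of p N] 3 pq by (simp add: vtx_Suc k_def)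
    next
      case 4
      have "mutate_quiver k Q k k = nat 0" using Qkk by (intro mutate_quiver_at) auto
      then show ?thesis using 4 by (simp add: vtx_Suc k_def bmat_def)
    qed
  qed
  have B: "mutate_quiver k Q (N + i) (vtx (Suc t) p) = nat (cvec (Suc t) p i) \<and>
      mutate_quiver k Q (vtx (Suc t) p) (N + i) = nat (- cvec (Suc t) p i)" if pi: "p \<in> {1..N}" "i \<in> {1..N}" for p i
  proof (cases "p = N")
    case True
    have "mutate_quiver k Q (N + i) k = nat (- cvec t 1 i)" "mutate_quiver k Q k (N + i) = nat (cvec t 1 i)"
      using Qc[OF one pi(2)] by (intro mutate_quiver_at Qkk; simp add: k_def)+
    then show ?thesis using True cvec_last[of i t] cvec_one[of t i] pi by (simp add: vtx_Suc k_def)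
  next
    case False
    have p: "1 \<le> p" "p < N" using pi False by auto
    have p': "p + 1 \<in> {1..N}" using p by auto
    have m0: "0 \<le> mult (t + 1 + N) i" by (simp add: mult_def)
    \<comment> \<open>The vertex to be mutated receives arrows from frozen vertices but sends none
      to them, so only paths from frozen to mutable vertices are created.\<close>
    have q1: "Q (N + i) k = nat (mult (t + 1 + N) i)" "Q k (N + i) = 0"
      using Qc[OF one pi(2)] m0 unfolding k_def cvec_one by auto
    have nk: "N + i \<noteq> k" using kN pi by auto
    have bq: "int (Q k (vtx t (p + 1))) = of_bool (p = r) + of_bool (p + r = N)"
      unfolding k_def Qq[OF one p'] by (rule bm1(2)[OF p])
    have "mutate_quiver k Q (N + i) (vtx t (p + 1)) = nat (cvec t (p + 1) i +
        int (Q (N + i) k) * int (Q k (vtx t (p + 1))) - int (Q (vtx t (p + 1)) k) * int (Q k (N + i)))"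
      using Qc[OF p' pi(2)] by (intro mutate_quiver_off ne p nk) auto
    moreover have "mutate_quiver k Q (vtx t (p + 1)) (N + i) = nat (- cvec t (p + 1) i +
        int (Q (vtx t (p + 1)) k) * int (Q k (N + i)) - int (Q (N + i) k) * int (Q k (vtx t (p + 1))))"
      using Qc[OF p' pi(2)] by (intro mutate_quiver_off ne p nk) auto
    moreover have "cvec (Suc t) p i = cvec t (p + 1) i + int (Q (N + i) k) * int (Q k (vtx t (p + 1)))"
      unfolding cvec_Suc[OF p] bq q1 using m0 by simp
    ultimately show ?thesis using q1(2) p by (simp add: vtx_Suc)
  qed
  have C: "X' (vtx (Suc t) p) = xs (Suc t + p)" if p: "p \<in> {1..N}" for p
  proof (cases "p = N")
    case True
    have "xs (Suc t + N) = snd (gr_seed r s N (Suc t)) (t mod N + 1)" using N0 by (simp add: xs_def xhat_def)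
    then show ?thesis using True unfolding S k[symmetric] by (simp add: vtx_Suc k_def)
  next
    case False
    then have "1 \<le> p" "p < N" using p by auto
    then show ?thesis using X'[OF ne[of p]] inv by (simp add: vtx_Suc seed_inv_def)
  qed
  have D: "X' (N + i) = indet (N + i)" if "i \<in> {1..N}" for i
    using X'[of "N + i"] kN that inv by (auto simp: seed_inv_def)
  show ?case unfolding S seed_inv_def prod.case using A B C D by blast
qed

lemma xs_rec:
  assumes "N < n"
  shows "xs n = (xs (n - r) * xs (n - N + r) +
    (\<Prod>i\<in>{1..N}. indet (N + i) ^ nu (int n - int N - int i)) * (xs (n - s) * xs (n - N + s))) / xs (n - N)"
proof -
  define t where "t = n - N - 1"
  have n: "n = t + 1 + N" using assms by (simp add: t_def)
  obtain Q X where QX: "gr_seed r s N t = (Q, X)" by fastforce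
  have inv: "seed_inv t (Q, X)" using seed_inv_gr_seed[of t] QX by simp
  have k: "vtx t 1 = t mod N + 1" by (rule vtx_Suc)
  have Xk: "X (vtx t 1) = xs (t + 1)" using inv N0 by (auto simp: seed_inv_def)
  have "xs n = snd (gr_seed r s N (Suc t)) (vtx t 1)" unfolding k using N0 by (simp add: xs_def xhat_def n)
  also have "\<dots> = ((\<Prod>i\<in>{1..2 * N}. X i ^ Q i (vtx t 1)) + (\<Prod>j\<in>{1..2 * N}. X j ^ Q (vtx t 1) j)) / X (vtx t 1)"
    unfolding k by (simp add: QX mutate_seed_def)
  also have "\<dots> = (xs (t + 1 + r) * xs (t + 1 + N - r) +
      (\<Prod>i\<in>{1..N}. indet (N + i) ^ nu (int (t + 1) - int i)) * (xs (t + 1 + s) * xs (t + 1 + N - s))) / xs (t + 1)"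
    unfolding exchange_products[OF inv] Xk by (simp only: add.commute)
  finally show ?thesis using r0 by (simp add: n mult.commute add_ac)
qed

text \<open>Both sides solve the exchange recurrence with the same first N values. It determines the
  next value because the divisor is a product of a nonzero leading term and a subtraction-free
  \<open>fpoly\<close>.\<close>

theorem xhat_eq_fpoly:
  fixes \<xi> :: "int \<Rightarrow> ratfun"
  assumes \<xi>: "\<And>j. 1 \<le> j \<Longrightarrow> j \<le> int N \<Longrightarrow> \<xi> j = indet (nat j)" "\<And>j. 1 \<le> j \<Longrightarrow> \<xi> j \<noteq> 0"
    "\<And>n. int N < n \<Longrightarrow> \<xi> n * \<xi> (n - int N) = \<xi> (n - int r) * \<xi> (n - int N + int r)"
    and n: "N < n"
  shows "xhat r s N n = \<xi> (int n) *
    fpoly (int n) (\<lambda>l. indet (N + nat l + 1) * nbr_mon (\<lambda>i. indet (nat i)) (l + 1))"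
proof -
  define x where "x i = indet (nat i)" for i
  define y where "y l = indet (N + nat l + 1)" for l
  define U where "U n = \<xi> n * fpoly n (\<lambda>l. y l * nbr_mon x (l + 1))" for n
  have xy: "x i \<in> pos_ratfun" "y i \<in> pos_ratfun" for i unfolding x_def y_def by (rule pos_ratfun)+
  have \<xi>1: "\<And>j. 1 \<le> j \<Longrightarrow> j \<le> int N \<Longrightarrow> \<xi> j = x j" using \<xi>(1) by (simp add: x_def)
  have rec: "U n * U (n - int N) = U (n - int r) * U (n - int N + int r) + ymon n y * (U (n - int s) * U (n - int N + int s))"
    if "int N < n" for n
    unfolding U_def by (rule cluster_rec[of pos_ratfun]) (use \<xi>1 \<xi>(2,3) xy pos_ratfun that in blast)+
  have "nbr_mon x l \<in> pos_ratfun" for l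
    unfolding nbr_mon_def by (intro pos_ratfun(1)) (auto intro: xy pos_ratfun(3,4))
  then have "fpoly n (\<lambda>l. y l * nbr_mon x (l + 1)) \<in> pos_ratfun" for n
    by (intro fpoly_closed pos_ratfun xy)
  then have fp: "fpoly n (\<lambda>l. y l * nbr_mon x (l + 1)) \<in> pos_ratfun" for n .
  have fnz: "fpoly n (\<lambda>l. y l * nbr_mon x (l + 1)) \<noteq> 0" for n
  proof
    assume z: "fpoly n (\<lambda>l. y l * nbr_mon x (l + 1)) = 0"
    show False using fp[of n] pos_ratfun(5) unfolding z by blast
  qed
  have Unz: "U n \<noteq> 0" if "1 \<le> n" for n unfolding U_def using \<xi>(2)[OF that] fnz by (simp only: mult_eq_0_iff) simp
  have ym: "ymon (int n) y = (\<Prod>i\<in>{1..N}. indet (N + i) ^ nu (int n - int N - int i))" for n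
  proof -
    have bij: "bij_betw (\<lambda>i. int i - 1) {1..N} {0..<int N}"
      by (rule bij_betwI[of _ _ _ "\<lambda>l. nat (l + 1)"]) auto
    show ?thesis unfolding ymon_def prod.reindex_bij_betw[OF bij, symmetric]
      by (intro prod.cong refl) (auto simp: y_def nat_diff_distrib algebra_simps)
  qed
  have "xs n = U (int n)" if "1 \<le> n" for n
    using that
  proof (induction n rule: less_induct)
    case (less n)
    show ?case
    proof (cases "n \<le> N")
      case True
      then show ?thesis using less.prems \<xi>(1)[of "int n"] by (simp add: xs_def U_def fpoly_trivial)
    next
      case False
      then have n: "N < n" by simp
      have IH: "xs m = U (int m)" if "1 \<le> m" "m < n" for m using less.IH that by simp
      have e: "xs (n - r) = U (int n - int r)" "xs (n - N + r) = U (int n - int N + int r)"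
        "xs (n - s) = U (int n - int s)" "xs (n - N + s) = U (int n - int N + int s)" "xs (n - N) = U (int n - int N)"
        using IH[of "n - r"] IH[of "n - N + r"] IH[of "n - s"] IH[of "n - N + s"] IH[of "n - N"] n r0
        by (simp_all add: of_nat_diff algebra_simps)
      have "xs n = U (int n) * U (int n - int N) / U (int n - int N)"
        unfolding xs_rec[OF n] e rec[of "int n", OF n[folded of_nat_less_iff[where 'a = int]]] ym ..
      then show ?thesis using Unz[of "int n - int N"] n by simp
    qed
  qed
  from this[of n] show ?thesis using n unfolding xs_def U_def x_def y_def by (simp only: not_le[symmetric]) simp
qed

end


section \<open>Lattice cycles and the cells they enclose\<close>

lemma cyclic_induct:
  assumes "i0 < (n::nat)" "P i0" "\<And>i. i < n \<Longrightarrow> P i \<Longrightarrow> P (Suc i mod n)" "j < n"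
  shows "P j"
proof -
  have "P ((i0 + m) mod n)" for m
  proof (induction m)
    case 0 then show ?case using assms by simp
  next
    case (Suc m)
    have "(i0 + Suc m) mod n = Suc ((i0 + m) mod n) mod n" by (simp add: mod_Suc_eq)
    then show ?case using assms(3)[OF _ Suc] assms(1) by simp
  qed
  from this[of "j + n - i0"] show ?thesis using assms by simp
qed

definition cyc_edge :: "'v list \<Rightarrow> nat \<Rightarrow> 'v set" where
  "cyc_edge vs i = {vs ! i, vs ! (Suc i mod length vs)}"

lemma graph_cycles_iff:
  "C \<in> graph_cycles E \<longleftrightarrow> C \<subseteq> E \<and> (\<exists>vs. distinct vs \<and> 3 \<le> length vs \<and> C = cyc_edge vs ` {..<length vs})"
  unfolding graph_cycles_def cyc_edge_def by (auto simp: image_def)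

lemma cyc_edges_at:
  assumes vs: "distinct vs" "3 \<le> length vs" "i < length vs"
  shows "{e \<in> cyc_edge vs ` {..<length vs}. vs ! (Suc i mod length vs) \<in> e} = {cyc_edge vs i, cyc_edge vs (Suc i mod length vs)}"
    and "cyc_edge vs i \<noteq> cyc_edge vs (Suc i mod length vs)"
proof -
  let ?n = "length vs"
  have S: "Suc j mod ?n = (if Suc j = ?n then 0 else Suc j)" if "j < ?n" for j using that by auto
  have eqi: "vs ! a = vs ! b \<longleftrightarrow> a = b" if "a < ?n" "b < ?n" for a b
    using nth_eq_iff_index_eq[OF vs(1)] that by simp
  have l: "Suc j mod ?n < ?n" if "j < ?n" for j using that by (intro mod_less_divisor) auto
  have "j = i \<or> j = Suc i mod ?n" if "j < ?n" "vs ! (Suc i mod ?n) \<in> cyc_edge vs j" for j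
    using that vs(3) unfolding cyc_edge_def by (auto simp: eqi l) (auto simp: S split: if_splits)
  then show "{e \<in> cyc_edge vs ` {..<?n}. vs ! (Suc i mod ?n) \<in> e} = {cyc_edge vs i, cyc_edge vs (Suc i mod ?n)}"
    using vs(3) l[OF vs(3)] by (auto simp: cyc_edge_def)
  have "vs ! i \<notin> cyc_edge vs (Suc i mod ?n)"
    unfolding cyc_edge_def using vs l[OF vs(3)] l[OF l[OF vs(3)]] by (auto simp: eqi S split: if_splits)
  then show "cyc_edge vs i \<noteq> cyc_edge vs (Suc i mod ?n)" by (auto simp: cyc_edge_def)
qed

lemma cyc_vertex: "v \<in> \<Union>(cyc_edge vs ` {..<length vs}) \<Longrightarrow> \<exists>i<length vs. v = vs ! (Suc i mod length vs)"
proof -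
  assume "v \<in> \<Union>(cyc_edge vs ` {..<length vs})"
  then obtain j where j: "j < length vs" "v = vs ! j \<or> v = vs ! (Suc j mod length vs)" by (auto simp: cyc_edge_def)
  have "\<exists>i<length vs. j = Suc i mod length vs"
  proof (cases j)
    case 0 then show ?thesis using j by (intro exI[of _ "length vs - 1"]) auto
  next
    case (Suc i) then show ?thesis using j by (intro exI[of _ i]) auto
  qed
  then show ?thesis using j by blast
qed

section \<open>Graphs in which every vertex has degree two\<close>

locale two_regular =
  fixes D :: "'v set set"
  assumes fin: "finite D" and card_edge: "\<And>e. e \<in> D \<Longrightarrow> card e = 2"
    and degree: "\<And>v. v \<in> \<Union>D \<Longrightarrow> card {e \<in> D. v \<in> e} = 2"
begin

text \<open>A cycle has two edges at each of its vertices, and there are no more.\<close>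

lemma cycle_saturated:
  assumes C: "C \<in> graph_cycles D" and v: "v \<in> \<Union>C"
  shows "{e \<in> C. v \<in> e} = {e \<in> D. v \<in> e}"
proof -
  obtain vs where vs: "distinct vs" "3 \<le> length vs" "C = cyc_edge vs ` {..<length vs}" and CD: "C \<subseteq> D"
    using C unfolding graph_cycles_iff by blast
  obtain i where i: "i < length vs" "v = vs ! (Suc i mod length vs)" using cyc_vertex[of v vs] v unfolding vs(3) by blast
  have "card {e \<in> C. v \<in> e} = 2" unfolding vs(3) i(2) cyc_edges_at(1)[OF vs(1,2) i(1)]
    using cyc_edges_at(2)[OF vs(1,2) i(1)] by simp
  moreover have "{e \<in> C. v \<in> e} \<subseteq> {e \<in> D. v \<in> e}" using CD by auto
  moreover have "card {e \<in> D. v \<in> e} = 2" using degree v CD by blast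
  moreover have "finite {e \<in> D. v \<in> e}" using fin by simp
  ultimately show ?thesis using card_subset_eq by metis
qed

text \<open>Two cycles with a common edge must use the same edges at its end and so go on together,
  all the way around.\<close>

lemma cycle_unique:
  assumes "C \<in> graph_cycles D" "C' \<in> graph_cycles D" "e \<in> C" "e \<in> C'"
  shows "C \<subseteq> C'"
proof -
  obtain vs where vs: "distinct vs" "3 \<le> length vs" "C = cyc_edge vs ` {..<length vs}" and CD: "C \<subseteq> D"
    using assms(1) unfolding graph_cycles_iff by blast
  let ?n = "length vs"
  obtain i0 where i0: "i0 < ?n" "cyc_edge vs i0 \<in> C'" using assms vs(3) by auto
  have "cyc_edge vs j \<in> C'" if "j < ?n" for j
    using i0 _ that
  proof (rule cyclic_induct[of i0 ?n "\<lambda>j. cyc_edge vs j \<in> C'"])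
    fix i assume i: "i < ?n" "cyc_edge vs i \<in> C'"
    let ?v = "vs ! (Suc i mod ?n)"
    have "?v \<in> \<Union>C'" using i by (auto simp: cyc_edge_def)
    then have "{e \<in> C'. ?v \<in> e} = {e \<in> D. ?v \<in> e}" by (rule cycle_saturated[OF assms(2)])
    moreover have "cyc_edge vs (Suc i mod ?n) \<in> {e \<in> D. ?v \<in> e}"
    proof -
      have "Suc i mod ?n < ?n" using i by (intro mod_less_divisor) auto
      then have "cyc_edge vs (Suc i mod ?n) \<in> C" unfolding vs(3) by blast
      then show ?thesis using CD by (auto simp: cyc_edge_def)
    qed
    ultimately show "cyc_edge vs (Suc i mod ?n) \<in> C'" by blast
  qed
  then show ?thesis using vs(3) by auto
qed

text \<open>Consider a longest path that starts with e. The second edge at its last vertex leads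
  back to the path by maximality, and to the first vertex because of the degrees. The path closed by
  this edge contains e.\<close>

lemma cycle_exists:
  assumes e: "e \<in> D"
  shows "\<exists>C\<in>graph_cycles D. e \<in> C"
proof -
  obtain u v where uv: "e = {u, v}" "u \<noteq> v" using card_edge[OF e] by (meson card_2_iff)
  define good where "good vs \<longleftrightarrow> distinct vs \<and> 2 \<le> length vs \<and> {vs ! 0, vs ! 1} = e \<and> set vs \<subseteq> \<Union>D \<and>
     (\<forall>i. Suc i < length vs \<longrightarrow> {vs ! i, vs ! Suc i} \<in> D)" for vs
  have finV: "finite (\<Union>D)" using fin card_edge by (metis card.infinite finite_Union zero_neq_numeral)
  have finG: "finite {vs. good vs}"
    by (rule finite_subset[OF _ finite_subset_distinct[OF finV]]) (auto simp: good_def)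
  have "good [u, v]" using uv e by (auto simp: good_def less_Suc_eq)
  moreover have "\<forall>vs. good vs \<longrightarrow> length vs \<le> Max (length ` {vs. good vs})" using finG by auto
  ultimately obtain vs where vs: "good vs" and mx: "\<And>ws. good ws \<Longrightarrow> length ws \<le> length vs"
    using ex_has_greatest_nat[of good "[u, v]" length "Suc (Max (length ` {vs. good vs}))"]
    unfolding less_Suc_eq_le by blast
  define m where "m = length vs - 1"
  have m: "1 \<le> m" "length vs = Suc m" using vs by (auto simp: good_def m_def)
  have dist: "distinct vs" and edges: "\<And>i. i < m \<Longrightarrow> {vs ! i, vs ! Suc i} \<in> D" using vs m by (auto simp: good_def)
  have eqi: "vs ! a = vs ! b \<longleftrightarrow> a = b" if "a \<le> m" "b \<le> m" for a b
    using nth_eq_iff_index_eq[OF dist] that m by simp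
  define w where "w = vs ! m"
  have pw: "{vs ! (m - 1), w} \<in> D" using edges[of "m - 1"] m by (simp add: w_def)
  then have "card {e \<in> D. w \<in> e} = 2" by (intro degree) auto
  then obtain a b where ab: "{e \<in> D. w \<in> e} = {a, b}" "a \<noteq> b" unfolding card_2_iff by blast
  obtain e' where "e' \<in> {a, b}" and e'3: "e' \<noteq> {vs ! (m - 1), w}" using ab(2) by blast
  then have "e' \<in> {e \<in> D. w \<in> e}" using ab(1) by simp
  with e'3 have e': "e' \<in> D" "w \<in> e'" "e' \<noteq> {vs ! (m - 1), w}" by simp_all
  obtain p q where pq: "e' = {p, q}" "p \<noteq> q" using card_edge[OF e'(1)] unfolding card_2_iff by blast
  obtain z where z: "e' = {w, z}" "z \<noteq> w"
  proof (cases "w = p")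
    case True then show thesis using pq that[of q] by simp
  next
    case False
    then have "w = q" using pq e'(2) by simp
    then show thesis using pq that[of p] by (simp add: insert_commute)
  qed
  have zin: "z \<in> set vs"
  proof (rule ccontr)
    assume "z \<notin> set vs"
    have nn: "(vs @ [z]) ! i = (if i \<le> m then vs ! i else z)" if "i \<le> Suc m" for i
      using that m by (simp add: nth_append)
    have "good (vs @ [z])" unfolding good_def
    proof (intro conjI allI impI)
      show "distinct (vs @ [z])" using dist \<open>z \<notin> set vs\<close> by simp
      show "2 \<le> length (vs @ [z])" using m by simp
      show "{(vs @ [z]) ! 0, (vs @ [z]) ! 1} = e" using vs m by (simp add: nn good_def)
      show "set (vs @ [z]) \<subseteq> \<Union>D" using vs e' z by (auto simp: good_def)
      fix i assume "Suc i < length (vs @ [z])"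
      then show "{(vs @ [z]) ! i, (vs @ [z]) ! Suc i} \<in> D"
        using edges[of i] e'(1) z(1) m by (cases "i = m") (auto simp: nn w_def)
    qed
    then show False using mx by force
  qed
  then obtain j where j: "j \<le> m" "z = vs ! j" using m by (metis in_set_conv_nth less_Suc_eq_le)
  have jm: "j \<noteq> m" using j z by (auto simp: w_def)
  have jm': "j \<noteq> m - 1" using j z e'(3) by (auto simp: insert_commute)
  \<comment> \<open>At an inner vertex of the path the new edge would be the third.\<close>
  have "j = 0"
  proof (rule ccontr)
    assume "j \<noteq> 0"
    then have b: "{vs ! (j - 1), z} \<in> D" "{z, vs ! Suc j} \<in> D" using edges[of "j - 1"] edges[of j] j jm by auto
    have "card {{vs ! (j - 1), z}, {z, vs ! Suc j}, {w, z}} = 3"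
    proof -
      have "vs ! (j - 1) \<noteq> vs ! Suc j" "vs ! (j - 1) \<noteq> w" "vs ! Suc j \<noteq> w"
        using j jm jm' \<open>j \<noteq> 0\<close> m by (auto simp: w_def eqi)
      then have "{vs ! (j - 1), z} \<noteq> {z, vs ! Suc j}" "{vs ! (j - 1), z} \<noteq> {w, z}" "{z, vs ! Suc j} \<noteq> {w, z}"
        by (auto simp: doubleton_eq_iff)
      then show ?thesis by simp
    qed
    moreover have "{{vs ! (j - 1), z}, {z, vs ! Suc j}, {w, z}} \<subseteq> {e \<in> D. z \<in> e}" using b e'(1) z by auto
    moreover have "card {e \<in> D. z \<in> e} = 2" using b by (intro degree) auto
    moreover have "finite {e \<in> D. z \<in> e}" using fin by simp
    ultimately show False
      using card_mono[of "{e \<in> D. z \<in> e}" "{{vs ! (j - 1), z}, {z, vs ! Suc j}, {w, z}}"] by linarith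
  qed
  then have m2: "2 \<le> m" using jm' m by (cases "m = 1") auto
  have "cyc_edge vs i \<in> D" if "i \<le> m" for i
    using edges[of i] e'(1) z(1) j(2) \<open>j = 0\<close> that m by (cases "i = m") (auto simp: cyc_edge_def w_def)
  then have "cyc_edge vs ` {..<length vs} \<in> graph_cycles D"
    unfolding graph_cycles_iff using dist m m2 by auto
  moreover have "e = cyc_edge vs 0" using vs m by (auto simp: good_def cyc_edge_def)
  then have "e \<in> cyc_edge vs ` {..<length vs}" using m by simp
  ultimately show ?thesis by (rule bexI[rotated])
qed

lemma ex1_cycle: "e \<in> D \<Longrightarrow> \<exists>!C. C \<in> graph_cycles D \<and> e \<in> C"
proof -
  assume "e \<in> D"
  then obtain C where C: "C \<in> graph_cycles D" "e \<in> C" using cycle_exists by blast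
  show ?thesis
  proof (rule ex1I[of _ C])
    fix C' assume C': "C' \<in> graph_cycles D \<and> e \<in> C'"
    show "C' = C" using cycle_unique[of C' C e] cycle_unique[of C C' e] C C' by blast
  qed (use C in blast)
qed

end

section \<open>Lattice curves in the plane\<close>

lemma hedge_eq [simp]: "hedge p = hedge q \<longleftrightarrow> p = q" and vedge_eq [simp]: "vedge p = vedge q \<longleftrightarrow> p = q"
  and hv_neq [simp]: "hedge p \<noteq> vedge q" "vedge q \<noteq> hedge p"
  using inj_hedge inj_vedge hv[of p q] by (auto dest: injD)

lemma plane_curve_iff:
  assumes "C \<subseteq> range hedge \<union> range vedge"
  shows "(a, b) \<in> plane_curve C \<longleftrightarrow>
    (\<exists>x y. hedge (x, y) \<in> C \<and> b = real_of_int y \<and> real_of_int x \<le> a \<and> a \<le> real_of_int x + 1) \<or>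
    (\<exists>x y. vedge (x, y) \<in> C \<and> a = real_of_int x \<and> real_of_int y \<le> b \<and> b \<le> real_of_int y + 1)"
proof -
  let ?e = "\<lambda>(a, b). (real_of_int a, real_of_int b)"
  have seg: "p \<in> closed_segment (c :: real) d \<longleftrightarrow> c \<le> p \<and> p \<le> d" if "c \<le> d" for p c d
    using that by (auto simp: closed_segment_eq_real_ivl)
  have H: "(a, b) \<in> convex hull (?e ` hedge (x, y)) \<longleftrightarrow> b = real_of_int y \<and> real_of_int x \<le> a \<and> a \<le> real_of_int x + 1" for x y
  proof -
    have "convex hull (?e ` hedge (x, y)) = closed_segment (real_of_int x, real_of_int y) (real_of_int x + 1, real_of_int y)"
      by (simp add: hedge_def segment_convex_hull)
    also have "\<dots> = closed_segment (real_of_int x) (real_of_int x + 1) \<times> {real_of_int y}"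
      by (auto simp: closed_segment_def algebra_simps image_iff)
    finally show ?thesis by (auto simp: seg)
  qed
  have V: "(a, b) \<in> convex hull (?e ` vedge (x, y)) \<longleftrightarrow> a = real_of_int x \<and> real_of_int y \<le> b \<and> b \<le> real_of_int y + 1" for x y
  proof -
    have "convex hull (?e ` vedge (x, y)) = closed_segment (real_of_int x, real_of_int y) (real_of_int x, real_of_int y + 1)"
      by (simp add: vedge_def segment_convex_hull)
    also have "\<dots> = {real_of_int x} \<times> closed_segment (real_of_int y) (real_of_int y + 1)"
      by (auto simp: closed_segment_def algebra_simps image_iff)
    finally show ?thesis by (auto simp: seg)
  qed
  have "(a, b) \<in> plane_curve C \<longleftrightarrow> (\<exists>e\<in>C. (a, b) \<in> convex hull (?e ` e))" by (simp add: plane_curve_def)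
  also have "\<dots> \<longleftrightarrow> (\<exists>x y. hedge (x, y) \<in> C \<and> (a, b) \<in> convex hull (?e ` hedge (x, y))) \<or>
      (\<exists>x y. vedge (x, y) \<in> C \<and> (a, b) \<in> convex hull (?e ` vedge (x, y)))"
    using assms by (fastforce simp: image_iff)
  finally show ?thesis unfolding H V .
qed

text \<open>A nonnegative function \<open>H\<close> on the cells that jumps by one exactly across the edges of a cycle
  is the indicator function of its inside. Cells not separated by the cycle lie in one component of
  the complement; following the cycle once around shows that one side of each edge is joined to
  infinity.\<close>

locale lattice_cycle =
  fixes C :: "edge set" and vs :: "point list" and H :: "int \<times> int \<Rightarrow> int"
  assumes vs: "distinct vs" "3 \<le> length vs" "C = cyc_edge vs ` {..<length vs}"
    and lattice: "C \<subseteq> range hedge \<union> range vedge"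
    and nonneg: "\<And>c. 0 \<le> H c" and fin_supp: "finite {c. H c \<noteq> 0}"
    and Hv: "\<And>x y. \<bar>H (x, y) - H (x - 1, y)\<bar> = of_bool (vedge (x, y) \<in> C)"
    and Hh: "\<And>x y. \<bar>H (x, y) - H (x, y - 1)\<bar> = of_bool (hedge (x, y) \<in> C)"
begin

abbreviation "S \<equiv> plane_curve C"

definition cell :: "int \<times> int \<Rightarrow> (real \<times> real) set" where
  "cell = (\<lambda>(x, y). {real_of_int x..real_of_int x + 1} \<times> {real_of_int y..real_of_int y + 1})"

definition ctr :: "int \<times> int \<Rightarrow> real \<times> real" where
  "ctr = (\<lambda>(x, y). (real_of_int x + 1 / 2, real_of_int y + 1 / 2))"

definition reach :: "int \<times> int \<Rightarrow> bool" where
  "reach c \<longleftrightarrow> \<not> bounded (connected_component_set (- S) (ctr c))"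

lemmas curve = plane_curve_iff[OF lattice]

lemma half_not_int: "real_of_int y + 1 / 2 \<noteq> real_of_int z"
proof
  assume "real_of_int y + 1 / 2 = real_of_int z"
  then have "real_of_int (2 * y + 1) = real_of_int (2 * z)" by simp
  then have "2 * y + 1 = 2 * z" by (rule of_int_eq_iff[THEN iffD1])
  then show False by presburger
qed

lemma row_off_curve:
  assumes "\<And>x'. a \<le> real_of_int x' \<Longrightarrow> real_of_int x' \<le> b \<Longrightarrow> vedge (x', y) \<notin> C" and "a \<le> t" "t \<le> b"
  shows "(t, real_of_int y + 1 / 2) \<notin> S"
proof
  assume "(t, real_of_int y + 1 / 2) \<in> S"
  then obtain x' y' where A: "vedge (x', y') \<in> C" "t = real_of_int x'" "real_of_int y' \<le> real_of_int y + 1 / 2"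
    "real_of_int y + 1 / 2 \<le> real_of_int y' + 1"
    unfolding curve using half_not_int by metis
  have y: "y' = y" using A(3,4) by linarith
  have "vedge (x', y) \<in> C" using A(1) unfolding y .
  then show False using assms(1)[of x'] assms(2,3) A(2) by simp
qed

lemma column_off_curve:
  assumes "\<And>y'. a \<le> real_of_int y' \<Longrightarrow> real_of_int y' \<le> b \<Longrightarrow> hedge (x, y') \<notin> C" and "a \<le> t" "t \<le> b"
  shows "(real_of_int x + 1 / 2, t) \<notin> S"
proof
  assume "(real_of_int x + 1 / 2, t) \<in> S"
  then obtain x' y' where A: "hedge (x', y') \<in> C" "t = real_of_int y'" "real_of_int x' \<le> real_of_int x + 1 / 2"
    "real_of_int x + 1 / 2 \<le> real_of_int x' + 1"
    unfolding curve using half_not_int by metis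
  have x: "x' = x" using A(3,4) by linarith
  have "hedge (x, y') \<in> C" using A(1) unfolding x .
  then show False using assms(1)[of y'] assms(2,3) A(2) by simp
qed

lemma component_eq:
  assumes "connected T" "T \<subseteq> - S" "p \<in> T" "q \<in> T"
  shows "connected_component_set (- S) p = connected_component_set (- S) q"
proof (rule connected_component_eq[symmetric])
  show "q \<in> connected_component_set (- S) p"
    unfolding mem_Collect_eq connected_component_def using assms by blast
qed

lemma reach_right:
  assumes "vedge (x + 1, y) \<notin> C"
  shows "reach (x, y) = reach (x + 1, y)"
proof -
  let ?T = "{real_of_int x + 1 / 2..real_of_int x + 3 / 2} \<times> {real_of_int y + 1 / 2}"
  have "connected ?T" by (intro convex_connected convex_Times) auto
  moreover have "?T \<subseteq> - S"
  proof clarify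
    fix t assume t: "t \<in> {real_of_int x + 1 / 2..real_of_int x + 3 / 2}" "(t, real_of_int y + 1 / 2) \<in> S"
    have "vedge (x', y) \<notin> C" if "real_of_int x + 1 / 2 \<le> real_of_int x'" "real_of_int x' \<le> real_of_int x + 3 / 2" for x'
    proof -
      have "x' = x + 1" using that by linarith
      then show ?thesis using assms by simp
    qed
    then show False using row_off_curve[of "real_of_int x + 1 / 2" "real_of_int x + 3 / 2" y t] t by auto
  qed
  ultimately have "connected_component_set (- S) (ctr (x, y)) = connected_component_set (- S) (ctr (x + 1, y))"
    by (rule component_eq) (auto simp: ctr_def)
  then show ?thesis by (simp add: reach_def)
qed

lemma reach_up:
  assumes "hedge (x, y + 1) \<notin> C"
  shows "reach (x, y) = reach (x, y + 1)"
proof -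
  let ?T = "{real_of_int x + 1 / 2} \<times> {real_of_int y + 1 / 2..real_of_int y + 3 / 2}"
  have "connected ?T" by (intro convex_connected convex_Times) auto
  moreover have "?T \<subseteq> - S"
  proof clarify
    fix t assume t: "t \<in> {real_of_int y + 1 / 2..real_of_int y + 3 / 2}" "(real_of_int x + 1 / 2, t) \<in> S"
    have "hedge (x, y') \<notin> C" if "real_of_int y + 1 / 2 \<le> real_of_int y'" "real_of_int y' \<le> real_of_int y + 3 / 2" for y'
    proof -
      have "y' = y + 1" using that by linarith
      then show ?thesis using assms by simp
    qed
    then show False using column_off_curve[of "real_of_int y + 1 / 2" "real_of_int y + 3 / 2" x t] t by auto
  qed
  ultimately have "connected_component_set (- S) (ctr (x, y)) = connected_component_set (- S) (ctr (x, y + 1))"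
    by (rule component_eq) (auto simp: ctr_def)
  then show ?thesis by (simp add: reach_def)
qed

lemma reach_row:
  assumes "\<And>x'. x < x' \<Longrightarrow> vedge (x', y) \<notin> C"
  shows "reach (x, y)"
proof -
  let ?T = "{real_of_int x + 1 / 2..} \<times> {real_of_int y + 1 / 2}"
  have "connected ?T" by (intro convex_connected convex_Times) auto
  moreover have "?T \<subseteq> - S"
  proof clarify
    fix t assume t: "real_of_int x + 1 / 2 \<le> t" "(t, real_of_int y + 1 / 2) \<in> S"
    have "vedge (x', y) \<notin> C" if "real_of_int x + 1 / 2 \<le> real_of_int x'" for x'
      using assms[of x'] that by linarith
    then show False using row_off_curve[of "real_of_int x + 1 / 2" t y t] t by auto
  qed
  ultimately have "?T \<subseteq> connected_component_set (- S) (ctr (x, y))"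
    by (intro connected_component_maximal) (auto simp: ctr_def)
  moreover have "\<not> bounded ?T"
  proof
    assume "bounded ?T"
    then have "bounded (fst ` ?T)" by (rule bounded_fst)
    moreover have "fst ` ?T = {real_of_int x + 1 / 2..}" by (auto simp: image_iff)
    ultimately obtain B where "\<forall>t\<ge>real_of_int x + 1 / 2. \<bar>t\<bar> \<le> B" unfolding bounded_iff by auto
    from this[rule_format, of "max (real_of_int x + 1 / 2) (B + 1)"] show False by linarith
  qed
  ultimately show ?thesis unfolding reach_def by (metis bounded_subset)
qed

section \<open>Following the cycle once around\<close>

definition cell_edges :: "int \<times> int \<Rightarrow> edge set" where
  "cell_edges = (\<lambda>(x, y). {hedge (x, y), hedge (x, y + 1), vedge (x, y), vedge (x + 1, y)})"

definition side_reach :: "edge \<Rightarrow> bool" where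
  "side_reach e \<longleftrightarrow> (\<exists>c. reach c \<and> e \<in> cell_edges c)"

lemma side_reach_iff:
  "side_reach (hedge (x, y)) \<longleftrightarrow> reach (x, y) \<or> reach (x, y - 1)"
  "side_reach (vedge (x, y)) \<longleftrightarrow> reach (x, y) \<or> reach (x - 1, y)"
proof -
  have "hedge (x, y) \<in> cell_edges c \<longleftrightarrow> c = (x, y) \<or> c = (x, y - 1)"
    "vedge (x, y) \<in> cell_edges c \<longleftrightarrow> c = (x, y) \<or> c = (x - 1, y)" for c
    by (cases c; auto simp: cell_edges_def)+
  then show "side_reach (hedge (x, y)) \<longleftrightarrow> reach (x, y) \<or> reach (x, y - 1)"
    "side_reach (vedge (x, y)) \<longleftrightarrow> reach (x, y) \<or> reach (x - 1, y)"
    unfolding side_reach_def by auto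
qed

lemma edges_at_point:
  assumes "e \<in> C" "(x, y) \<in> e"
  shows "e \<in> {hedge (x, y), hedge (x - 1, y), vedge (x, y), vedge (x, y - 1)}"
proof -
  consider p q where "e = hedge (p, q)" | p q where "e = vedge (p, q)" using assms lattice by fast
  then show ?thesis
  proof cases
    case 1
    then have "x = p \<and> y = q \<or> x = p + 1 \<and> y = q" using assms(2) by (auto simp: hedge_def)
    then show ?thesis using 1 by auto
  next
    case 2
    then have "x = p \<and> y = q \<or> x = p \<and> y = q + 1" using assms(2) by (auto simp: vedge_def)
    then show ?thesis using 2 by auto
  qed
qed

text \<open>Four segments leave a lattice point and separate the cells ne, nw, sw, se. Only e and f
  lie on the cycle, so the other two glue the four cells into two groups, and each group borders
  both e and f.\<close>

lemma four_sides:
  assumes "distinct [E, W, U, D]" "e \<in> {E, W, U, D}" "f \<in> {E, W, U, D}" "e \<noteq> f"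
    "E = e \<or> E = f \<or> ne = se" "W = e \<or> W = f \<or> nw = sw" "U = e \<or> U = f \<or> ne = nw" "D = e \<or> D = f \<or> se = sw"
    "P E = (ne \<or> se)" "P W = (nw \<or> sw)" "P U = (ne \<or> nw)" "P D = (se \<or> sw)" "P e"
  shows "P f"
proof -
  have d: "E \<noteq> W" "E \<noteq> U" "E \<noteq> D" "W \<noteq> U" "W \<noteq> D" "U \<noteq> D" using assms(1) by auto
  have d': "W \<noteq> E" "U \<noteq> E" "D \<noteq> E" "U \<noteq> W" "D \<noteq> W" "D \<noteq> U" using d by auto
  consider "e = E" | "e = W" | "e = U" | "e = D" using assms(2) by blast
  then show ?thesis
  proof cases
    case 1
    consider "f = W" | "f = U" | "f = D" using assms(3,4) 1 by blast
    then show ?thesis using assms(5-) d d' 1 by cases (simp_all add: disj_commute)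
  next
    case 2
    consider "f = E" | "f = U" | "f = D" using assms(3,4) 2 by blast
    then show ?thesis using assms(5-) d d' 2 by cases (simp_all add: disj_commute)
  next
    case 3
    consider "f = E" | "f = W" | "f = D" using assms(3,4) 3 by blast
    then show ?thesis using assms(5-) d d' 3 by cases (simp_all add: disj_commute)
  next
    case 4
    consider "f = E" | "f = W" | "f = U" using assms(3,4) 4 by blast
    then show ?thesis using assms(5-) d d' 4 by cases (simp_all add: disj_commute)
  qed
qed

lemma side_reach_next:
  assumes i: "i < length vs" and sr: "side_reach (cyc_edge vs i)"
  shows "side_reach (cyc_edge vs (Suc i mod length vs))"
proof -
  let ?e = "cyc_edge vs i" and ?f = "cyc_edge vs (Suc i mod length vs)"
  obtain x y where v: "vs ! (Suc i mod length vs) = (x, y)" by fastforce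
  have at: "{e \<in> C. (x, y) \<in> e} = {?e, ?f}" using cyc_edges_at(1)[OF vs(1,2) i] unfolding vs(3) v .
  have ne: "?e \<noteq> ?f" by (rule cyc_edges_at(2)[OF vs(1,2) i])
  have mem: "(x, y) \<in> hedge (x, y)" "(x, y) \<in> hedge (x - 1, y)" "(x, y) \<in> vedge (x, y)" "(x, y) \<in> vedge (x, y - 1)"
    by (auto simp: hedge_def vedge_def)
  have off: "e \<notin> C" if "(x, y) \<in> e" "e \<noteq> ?e" "e \<noteq> ?f" for e using at that by blast
  have m: "?e \<in> C" "?f \<in> C" "(x, y) \<in> ?e" "(x, y) \<in> ?f" using at by auto
  have ee: "?e \<in> {hedge (x, y), hedge (x - 1, y), vedge (x, y), vedge (x, y - 1)}"
    "?f \<in> {hedge (x, y), hedge (x - 1, y), vedge (x, y), vedge (x, y - 1)}"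
    by (rule edges_at_point[OF m(1,3)], rule edges_at_point[OF m(2,4)])
  have E: "reach (x, y) = reach (x, y - 1)" if "hedge (x, y) \<notin> C" using reach_up[of x "y - 1"] that by simp
  have W: "reach (x - 1, y) = reach (x - 1, y - 1)" if "hedge (x - 1, y) \<notin> C" using reach_up[of "x - 1" "y - 1"] that by simp
  have Nn: "reach (x, y) = reach (x - 1, y)" if "vedge (x, y) \<notin> C" using reach_right[of "x - 1" y] that by simp
  have Sn: "reach (x, y - 1) = reach (x - 1, y - 1)" if "vedge (x, y - 1) \<notin> C" using reach_right[of "x - 1" "y - 1"] that by simp
  have it: "side_reach (hedge (x, y)) = (reach (x, y) \<or> reach (x, y - 1))"
    "side_reach (hedge (x - 1, y)) = (reach (x - 1, y) \<or> reach (x - 1, y - 1))"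
    "side_reach (vedge (x, y)) = (reach (x, y) \<or> reach (x - 1, y))"
    "side_reach (vedge (x, y - 1)) = (reach (x, y - 1) \<or> reach (x - 1, y - 1))"
    by (rule side_reach_iff)+
  have off': "hedge (x, y) = ?e \<or> hedge (x, y) = ?f \<or> reach (x, y) = reach (x, y - 1)"
    "hedge (x - 1, y) = ?e \<or> hedge (x - 1, y) = ?f \<or> reach (x - 1, y) = reach (x - 1, y - 1)"
    "vedge (x, y) = ?e \<or> vedge (x, y) = ?f \<or> reach (x, y) = reach (x - 1, y)"
    "vedge (x, y - 1) = ?e \<or> vedge (x, y - 1) = ?f \<or> reach (x, y - 1) = reach (x - 1, y - 1)"
    using off mem E W Nn Sn by blast+
  have "distinct [hedge (x, y), hedge (x - 1, y), vedge (x, y), vedge (x, y - 1)]" by simp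
  then show ?thesis using ee ne off' it sr by (rule four_sides)
qed

text \<open>Two cells that meet only in a corner are compared by way of the cell (x', y), which
  contains the same point. So there is a jump across a side through the point.\<close>

lemma separated_on_curve:
  assumes "(a, b) \<in> cell c" "(a, b) \<in> cell c'" "H c \<noteq> H c'"
  shows "(a, b) \<in> S"
proof -
  have row: "(a, b) \<in> S" if "(a, b) \<in> cell (x, y)" "(a, b) \<in> cell (x', y)" "H (x, y) \<noteq> H (x', y)" "x < x'" for x x' y
  proof -
    have "real_of_int x' \<le> real_of_int x + 1" using that by (auto simp: cell_def)
    then have x': "x = x' - 1" using that(4) by linarith
    have "vedge (x', y) \<in> C" using Hv[of x' y] that(3) x' by (cases "vedge (x', y) \<in> C") auto
    moreover have "a = real_of_int x'" "real_of_int y \<le> b" "b \<le> real_of_int y + 1" using that x' by (auto simp: cell_def)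
    ultimately show ?thesis unfolding curve by blast
  qed
  have col: "(a, b) \<in> S" if "(a, b) \<in> cell (x, y)" "(a, b) \<in> cell (x, y')" "H (x, y) \<noteq> H (x, y')" "y < y'" for x y y'
  proof -
    have "real_of_int y' \<le> real_of_int y + 1" using that by (auto simp: cell_def)
    then have y': "y = y' - 1" using that(4) by linarith
    have "hedge (x, y') \<in> C" using Hh[of x y'] that(3) y' by (cases "hedge (x, y') \<in> C") auto
    moreover have "b = real_of_int y'" "real_of_int x \<le> a" "a \<le> real_of_int x + 1" using that y' by (auto simp: cell_def)
    ultimately show ?thesis unfolding curve by blast
  qed
  obtain x y x' y' where c: "c = (x, y)" "c' = (x', y')" by fastforce
  have mid: "(a, b) \<in> cell (x', y)" using assms c by (auto simp: cell_def)
  have "H (x, y) \<noteq> H (x', y) \<or> H (x', y) \<noteq> H (x', y')" using assms c by auto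
  then show ?thesis
  proof
    assume A: "H (x, y) \<noteq> H (x', y)"
    then have "x < x' \<or> x' < x" by (metis linorder_neqE)
    then show ?thesis using row[of x y x'] row[of x' y x] A assms c mid by metis
  next
    assume A: "H (x', y) \<noteq> H (x', y')"
    then have "y < y' \<or> y' < y" by (metis linorder_neqE)
    then show ?thesis using col[of x' y y'] col[of x' y' y] A assms c mid by metis
  qed
qed

text \<open>The plane is the union of the compact set \<open>K1\<close> of cells with H nonzero and
  the closed set \<open>K0\<close> of the others. They meet only on the curve, so a connected set
  that avoids the curve and starts in \<open>K1\<close> stays there.\<close>

lemma component_bounded:
  assumes z: "z \<in> cell c" "H c \<noteq> 0" "z \<notin> S"
  shows "bounded (connected_component_set (- S) z)"
proof -
  obtain R where R: "\<And>c. H c \<noteq> 0 \<Longrightarrow> \<bar>fst c\<bar> < R \<and> \<bar>snd c\<bar> < R"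
  proof
    let ?A = "(\<lambda>c. \<bar>fst c\<bar>) ` {c. H c \<noteq> 0} \<union> (\<lambda>c. \<bar>snd c\<bar>) ` {c. H c \<noteq> 0} \<union> {0}"
    have "finite ?A" using fin_supp by auto
    then have "t < Max ?A + 1" if "t \<in> ?A" for t using that Max_ge[of ?A t] by linarith
    then show "\<bar>fst c\<bar> < Max ?A + 1 \<and> \<bar>snd c\<bar> < Max ?A + 1" if "H c \<noteq> 0" for c using that by blast
  qed
  define K1 where "K1 = (\<Union>c\<in>{c. H c \<noteq> 0}. cell c)"
  \<comment> \<open>Four closed half planes replace the infinitely many cells far out, so that
    \<open>K0\<close> is a finite union of closed sets.\<close>
  define big where "big = ({..- real_of_int R} \<union> {real_of_int R + 1..}) \<times> (UNIV :: real set) \<union>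
     (UNIV :: real set) \<times> ({..- real_of_int R} \<union> {real_of_int R + 1..})"
  define K0 where "K0 = big \<union> (\<Union>c\<in>{c \<in> {-R..R} \<times> {-R..R}. H c = 0}. cell c)"
  have ccell: "compact (cell c)" for c by (auto simp: cell_def compact_Times split: prod.split)
  have cK1: "compact K1" unfolding K1_def using fin_supp ccell by (intro compact_UN) auto
  have "closed big" unfolding big_def by (intro closed_Un closed_Times) auto
  moreover have "closed (\<Union>c\<in>{c \<in> {-R..R} \<times> {-R..R}. H c = 0}. cell c)"
    using ccell by (intro closed_UN) (auto intro: compact_imp_closed)
  ultimately have cK0: "closed K0" unfolding K0_def by (rule closed_Un)
  have cover: "w \<in> K0 \<union> K1" for w
  proof -
    obtain a b where w: "w = (a, b)" by fastforce
    have in_cell: "w \<in> cell (\<lfloor>a\<rfloor>, \<lfloor>b\<rfloor>)" unfolding cell_def w by simp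
    consider "H (\<lfloor>a\<rfloor>, \<lfloor>b\<rfloor>) \<noteq> 0" | "H (\<lfloor>a\<rfloor>, \<lfloor>b\<rfloor>) = 0" "(\<lfloor>a\<rfloor>, \<lfloor>b\<rfloor>) \<in> {-R..R} \<times> {-R..R}" | "(\<lfloor>a\<rfloor>, \<lfloor>b\<rfloor>) \<notin> {-R..R} \<times> {-R..R}" by blast
    then show ?thesis
    proof cases
      case 1 then show ?thesis using in_cell by (auto simp: K1_def)
    next
      case 2 then show ?thesis using in_cell by (auto simp: K0_def)
    next
      case 3
      then have "\<lfloor>a\<rfloor> < - R \<or> R < \<lfloor>a\<rfloor> \<or> \<lfloor>b\<rfloor> < - R \<or> R < \<lfloor>b\<rfloor>" by auto
      then have "a \<le> - real_of_int R \<or> real_of_int R + 1 \<le> a \<or> b \<le> - real_of_int R \<or> real_of_int R + 1 \<le> b" by linarith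
      then show ?thesis by (auto simp: K0_def big_def w)
    qed
  qed
  have disj: "K0 \<inter> K1 \<subseteq> S"
  proof
    fix w assume w: "w \<in> K0 \<inter> K1"
    obtain a b where ab: "w = (a, b)" by fastforce
    obtain c where c: "H c \<noteq> 0" "(a, b) \<in> cell c" using w ab by (auto simp: K1_def)
    obtain x y where xy: "c = (x, y)" by fastforce
    have "\<bar>x\<bar> < R" "\<bar>y\<bar> < R" using R[OF c(1)] xy by auto
    moreover have "real_of_int x \<le> a" "a \<le> real_of_int x + 1" "real_of_int y \<le> b" "b \<le> real_of_int y + 1"
      using c(2) xy by (auto simp: cell_def)
    ultimately have "- real_of_int R < a" "a < real_of_int R + 1" "- real_of_int R < b" "b < real_of_int R + 1" by linarith+
    then have "w \<notin> big" by (auto simp: big_def ab)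
    then obtain c' where c': "H c' = 0" "(a, b) \<in> cell c'" using w ab by (auto simp: K0_def)
    show "w \<in> S" unfolding ab using separated_on_curve[OF c(2) c'(2)] c(1) c'(1) by simp
  qed
  let ?T = "connected_component_set (- S) z"
  have zT: "z \<in> ?T" using z(3) by simp
  have TS: "?T \<subseteq> - S" by (rule connected_component_subset)
  have conn: "connected ?T" by simp
  have "?T \<subseteq> K1"
  proof (rule ccontr)
    assume "\<not> ?T \<subseteq> K1"
    then have "K0 \<inter> ?T \<noteq> {}" using cover by blast
    moreover have "K1 \<inter> ?T \<noteq> {}" using zT z(1,2) by (auto simp: K1_def)
    moreover have "K0 \<inter> K1 \<inter> ?T = {}" using disj TS by blast
    moreover have "?T \<subseteq> K0 \<union> K1" using cover by blast
    ultimately show False using conn cK0 compact_imp_closed[OF cK1] unfolding connected_closed by blast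
  qed
  then show ?thesis by (rule bounded_subset[OF compact_imp_bounded[OF cK1]])
qed

lemma ctr_off_curve: "ctr c \<notin> S"
proof -
  obtain x y where c: "c = (x, y)" by fastforce
  show ?thesis unfolding c ctr_def prod.case curve using half_not_int by metis
qed

lemma ctr_cell: "ctr c \<in> cell c" by (auto simp: ctr_def cell_def split: prod.split)

lemma reach_zero: "reach c \<Longrightarrow> H c = 0"
  using component_bounded[OF ctr_cell _ ctr_off_curve, of c] unfolding reach_def by blast

lemma row_zero_far: "\<exists>B. \<forall>x>B. H (x, y) = 0"
proof -
  let ?A = "insert 0 (fst ` {c. H c \<noteq> 0})"
  have "finite ?A" using fin_supp by auto
  have "H (x, y) = 0" if "x > Max ?A" for x
  proof (rule ccontr)
    assume "H (x, y) \<noteq> 0"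
    then have "x \<in> ?A" by force
    then show False using Max_ge[OF \<open>finite ?A\<close>, of x] that by simp
  qed
  then show ?thesis by blast
qed

lemma row_induct:
  assumes "x \<le> x'" "\<And>t. x < t \<Longrightarrow> t \<le> x' \<Longrightarrow> vedge (t, y) \<notin> C"
  shows "reach (x, y) = reach (x', y) \<and> H (x, y) = H (x', y)"
  using assms
proof (induction x' rule: int_ge_induct)
  case (step i)
  have "vedge (i + 1, y) \<notin> C" using step by auto
  then show ?case using step reach_right[of i y] Hv[of "i + 1" y] by simp
qed simp

text \<open>In the row of a cell with H nonzero there is a last edge of the cycle; the ray from its
  right side leads to infinity. From this edge the property is carried around the cycle.\<close>

lemma all_sides_reach: "e \<in> C \<Longrightarrow> side_reach e"
proof -
  assume e: "e \<in> C"
  have "\<exists>c. H c \<noteq> 0"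
  proof (rule ccontr)
    assume "\<not> (\<exists>c. H c \<noteq> 0)"
    then have "vedge (x, y) \<notin> C" "hedge (x, y) \<notin> C" for x y using Hv[of x y] Hh[of x y] by auto
    then show False using e lattice by auto
  qed
  then obtain x0 y0 where c: "H (x0, y0) \<noteq> 0" by fastforce
  obtain B where B: "\<forall>x>B. H (x, y0) = 0" using row_zero_far by blast
  let ?A = "{x. x0 < x \<and> x \<le> max B x0 + 1 \<and> vedge (x, y0) \<in> C}"
  have finA: "finite ?A" by (rule finite_subset[of _ "{x0..max B x0 + 1}"]) auto
  have "?A \<noteq> {}"
  proof
    assume "?A = {}"
    then have "H (x0, y0) = H (max B x0 + 1, y0)" using row_induct[of x0 "max B x0 + 1" y0] by auto
    then show False using B c by simp
  qed
  define x1 where "x1 = Max ?A"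
  have x1: "x1 \<in> ?A" unfolding x1_def using finA \<open>?A \<noteq> {}\<close> by (rule Max_in)
  have "vedge (x', y0) \<notin> C" if "x1 < x'" for x'
  proof
    assume v: "vedge (x', y0) \<in> C"
    have "\<not> x' \<le> max B x0 + 1" using v that x1 Max_ge[OF finA, of x'] unfolding x1_def[symmetric] by auto
    then have "H (x', y0) = 0" "H (x' - 1, y0) = 0" using B by auto
    then show False using Hv[of x' y0] v by simp
  qed
  then have "reach (x1, y0)" by (rule reach_row)
  then have "side_reach (vedge (x1, y0))" by (simp add: side_reach_iff)
  moreover obtain i0 where i0: "i0 < length vs" "cyc_edge vs i0 = vedge (x1, y0)" using x1 vs(3) by auto
  ultimately have s0: "side_reach (cyc_edge vs i0)" by simp
  obtain j where j: "j < length vs" "e = cyc_edge vs j" using e vs(3) by auto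
  show "side_reach e" unfolding j(2) using i0(1) s0 side_reach_next j(1) by (rule cyclic_induct)
qed

text \<open>Going right from c, nothing changes up to the first edge of the cycle. One side of that
  edge is joined to infinity. If it is the far side, then H is 0 there, and the jump by one together
  with nonnegativity gives 1 on the near side.\<close>

lemma reach_or_one: "(reach c \<and> H c = 0) \<or> (\<not> reach c \<and> H c = 1)"
proof -
  obtain x y where c: "c = (x, y)" by fastforce
  show ?thesis
  proof (cases "\<exists>x'>x. vedge (x', y) \<in> C")
    case False
    then have "reach (x, y)" by (intro reach_row) auto
    then show ?thesis using reach_zero c by blast
  next
    case True
    obtain x' where x': "x < x'" "vedge (x', y) \<in> C" "\<And>t. x < t \<Longrightarrow> t \<le> x' - 1 \<Longrightarrow> vedge (t, y) \<notin> C"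
    proof -
      obtain x1 where x1: "x < x1" "vedge (x1, y) \<in> C" using True by blast
      let ?A = "{t. x < t \<and> t \<le> x1 \<and> vedge (t, y) \<in> C}"
      have finA: "finite ?A" by (rule finite_subset[of _ "{x..x1}"]) auto
      have m: "Min ?A \<in> ?A" using finA x1 by (intro Min_in) auto
      have "vedge (t, y) \<notin> C" if "x < t" "t \<le> Min ?A - 1" for t
        using Min_le[OF finA, of t] that m by auto
      then show thesis using that m by blast
    qed
    have eq: "reach (x, y) = reach (x' - 1, y)" "H (x, y) = H (x' - 1, y)"
      using row_induct[of x "x' - 1" y] x' by auto
    have sr: "reach (x', y) \<or> reach (x' - 1, y)" using all_sides_reach[OF x'(2)] by (simp add: side_reach_iff)
    have d: "\<bar>H (x', y) - H (x' - 1, y)\<bar> = 1" using Hv[of x' y] x'(2) by simp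
    show ?thesis
    proof (cases "reach (x' - 1, y)")
      case True
      then show ?thesis using eq reach_zero c by auto
    next
      case False
      then have "H (x', y) = 0" using sr reach_zero by blast
      then show ?thesis using d eq nonneg[of "(x' - 1, y)"] False c by auto
    qed
  qed
qed

theorem inside_cell:
  assumes "z \<in> cell c" "z \<notin> S" "H c = 1"
  shows "z \<in> inside S"
  using component_bounded[of z c] assms by (simp add: inside_def)

theorem ctr_inside: "ctr c \<in> inside S \<Longrightarrow> H c = 1"
  using reach_or_one[of c] unfolding inside_def reach_def by blast

lemma H_01: "H c = 0 \<or> H c = 1" using reach_or_one[of c] by blast

end


section \<open>The shape of the pinecone\<close>

text \<open>An arbitrary drawn pinecone in explicit coordinates: (C, B) is the face at the relative
  origin and c the column of the last cell of the central row. The last cells of the other rows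
  recede by one column per row.\<close>

locale drawn_pinecone = gr_params +
  fixes n :: nat and X :: "face \<Rightarrow> int" and P :: "face set" and C B c :: int
  assumes n: "N < n"
    and label_rel: "\<And>i k. int (label r s N (C + i, B + k)) = lab (int n) (i, k) + 1"
    and X_rel: "\<And>i k. X (C + i, B + k) = c + 2 * i - \<bar>k\<bar> - 1
       - (int n - int N - 1 - max (k * (int N - int s)) (- k * int s) + i * int r) div int N
       - (int n - int N - 1 - max (k * (int N - int s)) (- k * int s) + i * int r - int r) div int N"
    and P_rel: "\<And>i k. (C + i, B + k) \<in> P \<longleftrightarrow> (i, k) \<in> pine (int n)"
    and P_cells: "(\<Union>F\<in>P. face_cells r s N X F) = {(x, y).
       c - \<bar>y - B\<bar> - 2 * ((int n - int N - 1 - max ((y - B) * (int N - int s)) (- (y - B) * int s)) div int r) \<le> x \<and>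
       x \<le> c - \<bar>y - B\<bar>}"
    and bt: "brane_tiling r s N X"

section \<open>Rigidity of the drawing and of the pinecone\<close>

context gr_params
begin

lemma row_face:
  assumes X: "\<And>A. X (A + 1, B) = X (A, B) + width r s N (A, B)"
  shows "\<exists>A. X (A, B) \<le> x \<and> x < X (A + 1, B)"
proof -
  have mono: "X (A, B) + (A' - A) \<le> X (A', B)" if "A \<le> A'" for A A'
    using abscissa_mono[OF r0, of X B A A'] X that by blast
  define A0 where "A0 = min 0 (x - X (0, B))"
  have a0: "X (A0, B) \<le> x" using mono[of A0 0] by (auto simp: A0_def)
  have "x < X (A0 + int j, B) \<Longrightarrow> \<exists>A. X (A, B) \<le> x \<and> x < X (A + 1, B)" for j
  proof (induction j)
    case 0 then show ?case using a0 by simp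
  next
    case (Suc j)
    show ?case
    proof (cases "x < X (A0 + int j, B)")
      case True then show ?thesis by (rule Suc.IH)
    next
      case False
      then show ?thesis using Suc.prems by (intro exI[of _ "A0 + int j"]) (simp add: add.assoc add.commute[of 1])
    qed
  qed
  moreover have "x < X (A0 + int (nat (x - X (A0, B) + 1)), B)"
    using mono[of A0 "A0 + int (nat (x - X (A0, B) + 1))"] a0 by simp
  ultimately show ?thesis by blast
qed

lemma row_face_unique:
  assumes X: "\<And>A. X (A + 1, B) = X (A, B) + width r s N (A, B)"
    and "X (A, B) \<le> x" "x < X (A + 1, B)" "X (A', B) \<le> x" "x < X (A' + 1, B)"
  shows "A = A'"
proof (rule ccontr)
  assume "A \<noteq> A'"
  then have "A + 1 \<le> A' \<or> A' + 1 \<le> A" by linarith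
  then show False
  proof
    assume "A + 1 \<le> A'"
    then show False using abscissa_mono[OF r0, of X B "A + 1" A'] X assms by fastforce
  next
    assume "A' + 1 \<le> A"
    then show False using abscissa_mono[OF r0, of X B "A' + 1" A] X assms by fastforce
  qed
qed

lemma ex_wrap: "\<exists>A. N < label r s N (A, B) + r"
proof (rule ccontr)
  assume *: "\<not> ?thesis"
  have "int (label r s N (int j, B)) = int (label r s N (0, B)) + int j * int r" for j
  proof (induction j)
    case (Suc j)
    have "\<not> N < label r s N (int j, B) + r" using * by blast
    then show ?case using Suc label_step(1)[OF r0, of "int j" B] by (simp add: algebra_simps)
  qed simp
  from this[of N] have "int N * int r < int (label r s N (int N, B))"
    using label_bounds[OF N0, of r s "(0, B)"] by simp
  moreover have "int N * 1 \<le> int N * int r" using r0 by (intro mult_left_mono) auto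
  ultimately show False using label_bounds[OF N0, of r s "(int N, B)"] by simp
qed

text \<open>The widths fix each row up to a shift. At a face with label + r > N the square of the
  quiver to its upper right has no diagonal, so four faces meet in a point. A relative shift of the
  next row would give two faces without a connecting arrow a common edge.\<close>

lemma brane_tiling_unique:
  assumes bt: "brane_tiling r s N X"
  shows "\<exists>\<delta>. \<forall>F. X F = std_abscissa r s N F + \<delta>"
proof -
  let ?w = "width r s N" and ?X0 = "std_abscissa r s N"
  have R: "X (A + 1, B) = X (A, B) + ?w (A, B)" for A B using bt by (simp add: brane_tiling_def)
  note R0 = std_abscissa_right[OF r0]
  define \<delta> where "\<delta> B = X (0, B) - ?X0 (0, B)" for B
  have row: "X (A, B) = ?X0 (A, B) + \<delta> B" for A B
  proof (induction A rule: int_induct[of _ 0])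
    case base show ?case by (simp add: \<delta>_def)
  next
    case (step1 i) then show ?case using R[of i B] R0[of i B] by simp
  next
    case (step2 i) then show ?case using R[of "i - 1" B] R0[of "i - 1" B] by simp
  qed
  have adj: "qtilde_arrow r s N (A, B) (C, B + 1) \<or> qtilde_arrow r s N (C, B + 1) (A, B)"
    if "X (A, B) \<le> x" "x < X (A + 1, B)" "X (C, B + 1) \<le> x" "x < X (C + 1, B + 1)" for A B C x
  proof -
    have Y: "{B, B + 1} \<inter> {B + 1, B + 1 + 1} = {B + 1}" by auto
    have "x \<in> {X (A, B)..<X (A, B) + ?w (A, B)} \<inter> {X (C, B + 1)..<X (C, B + 1) + ?w (C, B + 1)}"
      using that R by auto
    then have "card ({X (A, B)..<X (A, B) + ?w (A, B)} \<inter> {X (C, B + 1)..<X (C, B + 1) + ?w (C, B + 1)}) \<noteq> 0" by auto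
    then have "card (face_edges r s N X (A, B) \<inter> face_edges r s N X (C, B + 1)) \<noteq> 0"
      unfolding card_common by (simp add: Y)
    moreover have "card (face_edges r s N X (A, B) \<inter> face_edges r s N X (C, B + 1)) =
      of_bool (qtilde_arrow r s N (A, B) (C, B + 1) \<or> qtilde_arrow r s N (C, B + 1) (A, B))"
      using bt by (simp add: brane_tiling_def)
    ultimately show ?thesis by (auto split: if_splits)
  qed
  have mono: "X (A, B) + (A' - A) \<le> X (A', B)" if "A \<le> A'" for A A' B
    using abscissa_mono[OF r0, of X B A A'] R that by blast
  have step: "\<delta> (B + 1) = \<delta> B" for B
  proof -
    obtain A where A: "N < label r s N (A, B) + r" using ex_wrap by blast
    have u: "X (A + 1, B + 1) = X (A + 1, B) + (\<delta> (B + 1) - \<delta> B)"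
      using std_abscissa_up[OF r0, of A B] A unfolding row by simp
    show ?thesis
    proof (rule ccontr)
      assume "\<delta> (B + 1) \<noteq> \<delta> B"
      then consider "\<delta> (B + 1) > \<delta> B" | "\<delta> (B + 1) < \<delta> B" by linarith
      then show False
      proof cases
        case 1
        obtain D where D: "X (D, B + 1) \<le> X (A + 1, B)" "X (A + 1, B) < X (D + 1, B + 1)"
          using row_face[of X "B + 1"] R by blast
        have "D \<le> A" using mono[of "A + 1" D "B + 1"] D(1) u 1 by linarith
        moreover have "X (A + 1, B) < X (A + 1 + 1, B)" using R[of "A + 1" B] width_bounds(1)[OF r0, of "(A + 1, B)"] by simp
        \<comment> \<open>The faces (A + 1, B) and (D, B + 1) would lie above one another, but D < A
          is too far, and D = A requires the missing diagonal.\<close>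
        ultimately show False using adj[of "A + 1" B "X (A + 1, B)" D] D A adj_iff[OF r0, of "A + 1" B D "B + 1"] by auto
      next
        case 2
        obtain D where D: "X (D, B) \<le> X (A + 1, B + 1)" "X (A + 1, B + 1) < X (D + 1, B)"
          using row_face[of X B] R by blast
        have "D \<le> A" using mono[of "A + 1" D B] D(1) u 2 by linarith
        moreover have "X (A + 1, B + 1) < X (A + 1 + 1, B + 1)" using R[of "A + 1" "B + 1"] width_bounds(1)[OF r0, of "(A + 1, B + 1)"] by simp
        ultimately show False using adj[of D B "X (A + 1, B + 1)" "A + 1"] D A adj_iff[OF r0, of D B "A + 1" "B + 1"] by auto
      qed
    qed
  qed
  have "\<delta> B = \<delta> 0" for B
  proof (induction B rule: int_induct[of _ 0])
    case (step2 i) then show ?case using step[of "i - 1"] by simp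
  qed (use step in auto)
  then have "X F = ?X0 F + \<delta> 0" for F using row[of "fst F" "snd F"] by simp
  then show ?thesis by blast
qed

text \<open>A strip only prescribes the label of its first face, and this label recurs periodically
  in the row. Nesting in the next strip towards the centre excludes all but one occurrence.\<close>

lemma drawn_pinecone_exists:
  assumes bt: "brane_tiling r s N X" and pc: "is_pinecone r s N X n P" and n: "N < n"
  shows "\<exists>C B c. drawn_pinecone r s N n X P C B c"
proof -
  let ?w = "width r s N"
  have Rt: "X (A + 1, B) = X (A, B) + ?w (A, B)" for A B using bt by (simp add: brane_tiling_def)
  have mono: "X (A, B) + (A' - A) \<le> X (A', B)" if "A \<le> A'" for A A' B
    using abscissa_mono[OF r0, of X B A A'] Rt that by blast
  obtain B H where strip: "\<And>k. is_strip r s N X (row_index s N n k) (B + k) (H k)"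
    and up: "\<And>k. 0 < k \<Longrightarrow> H k \<noteq> {} \<Longrightarrow> lies_inside r s N X (H k) (H (k - 1))"
    and dn: "\<And>k. k < 0 \<Longrightarrow> H k \<noteq> {} \<Longrightarrow> lies_inside r s N X (H k) (H (k + 1))"
    and P: "P = (\<Union>k. H k)"
    using pc unfolding is_pinecone_def by blast
  define m where "m k = int n - int N - 1 - max (k * (int N - int s)) (- k * int s)" for k
  define q where "q k = m k div int r" for k
  define t where "t k = m k mod int r" for k
  have mqt: "m k = q k * int r + t k" for k by (simp add: q_def t_def)
  have t: "0 \<le> t k" "t k < int r" for k using r0 by (auto simp: t_def)
  have mx: "max (k * (int N - int s)) (- k * int s) = - k * int s + max k 0 * int N" for k
  proof (cases "0 \<le> k")
    case True
    then have "- k * int s \<le> k * (int N - int s)" using r0 by (simp add: algebra_simps)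
    then show ?thesis using True by (simp add: algebra_simps)
  next
    case False
    then have "k * (int N - int s) \<le> - k * int s" using r0 mult_nonpos_nonneg[of k "int N"] by (simp add: algebra_simps)
    then show ?thesis using False by simp
  qed
  have m0: "m 0 = int n - int N - 1" by (simp add: m_def)
  have mk: "m k = m 0 + k * int s - max k 0 * int N" for k unfolding m_def mx by simp
  have row: "row_index s N n k = m k + int N + 1" for k
    using mk[of k] m0 by (auto simp: row_index_def algebra_simps max_def)
  have sl: "int (strip_label r N (row_index s N n k)) = t k + 1" for k
    unfolding strip_label_def row using t[of k] by (simp add: t_def)
  have H0: "H k = {}" if "m k < 0" for k using strip[of k] that by (simp add: is_strip_def row)
  have "\<exists>A. \<not> m k < 0 \<longrightarrow> int (label r s N (A, B + k)) = t k + 1 \<and> (A, B + k) \<in> H k \<and>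
      (\<Union>F\<in>H k. face_cells r s N X F) = {X (A, B + k)..<X (A, B + k) + (2 * q k + 1)} \<times> {B + k}" for k
  proof (cases "m k < 0")
    case False
    then obtain A where "label r s N (A, B + k) = strip_label r N (row_index s N n k)" "(A, B + k) \<in> H k"
      "(\<Union>F\<in>H k. face_cells r s N X F) = {X (A, B + k)..<X (A, B + k) + (2 * q k + 1)} \<times> {B + k}"
      using strip[of k] unfolding is_strip_def row q_def by auto
    then show ?thesis using sl[of k] by (intro exI[of _ A]) simp
  qed simp
  then obtain A where A: "\<And>k. \<not> m k < 0 \<Longrightarrow> int (label r s N (A k, B + k)) = t k + 1"
    "\<And>k. \<not> m k < 0 \<Longrightarrow> (A k, B + k) \<in> H k"
    "\<And>k. \<not> m k < 0 \<Longrightarrow> (\<Union>F\<in>H k. face_cells r s N X F) = {X (A k, B + k)..<X (A k, B + k) + (2 * q k + 1)} \<times> {B + k}"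
    by metis
  have q_nonneg: "0 \<le> q k" if "\<not> m k < 0" for k using that r0 by (simp add: q_def pos_imp_zdiv_nonneg_iff)
  have m00: "\<not> m 0 < 0" using n m0 by simp
  define C where "C = A 0 + q 0"
  have "(A 0 * int r + B * int s) mod int N = t 0" using A(1)[OF m00] label_eq[OF N0, of r s "A 0" B] by simp
  then obtain e0 where "A 0 * int r + B * int s = t 0 + int N * e0"
    by (metis add.commute mult_div_mod_eq)
  then have e0: "C * int r + B * int s = m 0 + e0 * int N" unfolding C_def using mqt[of 0] by (simp add: algebra_simps)
  have v: "(C + i) * int r + (B + k) * int s = (m k + i * int r) + (max k 0 + e0) * int N" for i k
    using e0 mk[of k] by (simp add: algebra_simps)
  have label_w: "int (label r s N (C + i, B + k)) = (m k + i * int r) mod int N + 1" for i k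
    unfolding label_eq[OF N0] v by simp
  obtain \<delta> where \<delta>: "\<And>F. X F = std_abscissa r s N F + \<delta>" using brane_tiling_unique[OF bt] by blast
  \<comment> \<open>Chosen so that the strip in row k, in its expected place, has its last cell in
    column c - |k|.\<close>
  define c where "c = 2 * C + B - 2 * e0 + 1 + \<delta>"
  have Xr: "X (C + i, B + k) = c + 2 * i - \<bar>k\<bar> - 1 - (m k + i * int r) div int N - (m k + i * int r - int r) div int N" for i k
  proof -
    have 1: "((C + i) * int r + (B + k) * int s) div int N = (m k + i * int r) div int N + (max k 0 + e0)"
      unfolding v using N0 by simp
    have "(C + i - 1) * int r + (B + k) * int s = (m k + i * int r - int r) + (max k 0 + e0) * int N"
      using v[of i k] by (simp add: algebra_simps)
    then have 2: "((C + i - 1) * int r + (B + k) * int s) div int N = (m k + i * int r - int r) div int N + (max k 0 + e0)"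
      using N0 by simp
    show ?thesis unfolding \<delta> std_abscissa_def prod.case 1 2 by (auto simp: c_def max_def)
  qed
  have Xt: "X (C + i, B + k) = c + 2 * i - \<bar>k\<bar> - 2 * z" if "m k + i * int r = t k + int N * z" for i k z
  proof -
    have "(t k + int N * z) div int N = z" using t[of k] r0 by simp
    moreover have E: "t k + int N * z - int r = (t k + int N - int r) + int N * (z - 1)" by (simp add: algebra_simps)
    have "(t k + int N - int r) div int N = 0" using t[of k] r0 by (intro div_pos_pos_trivial) auto
    then have "(t k + int N * z - int r) div int N = z - 1" unfolding E using N0 by (subst div_mult_self2) auto
    ultimately show ?thesis unfolding Xr that by simp
  qed
  have Xleft: "X (C - q k, B + k) = c - 2 * q k - \<bar>k\<bar>" for k
    using Xt[of k "- q k" 0] mqt[of k] by simp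
  have cols: "columns r s N X (H k) = {X (A k, B + k)..X (A k, B + k) + 2 * q k}" if "\<not> m k < 0" for k
    unfolding columns_def A(3)[OF that] by auto
  have MM: "Min (columns r s N X (H k)) = X (A k, B + k)" "Max (columns r s N X (H k)) = X (A k, B + k) + 2 * q k"
    if "\<not> m k < 0" for k
    using q_nonneg[OF that] by (auto simp: cols[OF that] intro!: Min_eqI Max_eqI)
  \<comment> \<open>Strip k can miss its expected place only by j faces with j r = z N, that is, by
    2 (j - z) columns where (j - z) r = z (N - r). Nesting forces j - z <= 0 and (j - z) r >= 1 - (N
    - s) > - (N - r), hence z = 0.\<close>
  have indstep: "X (A k, B + k) = c - 2 * q k - \<bar>k\<bar>"
    if k: "\<not> m k < 0" and inside: "lies_inside r s N X (H k) (H l)" and kl: "\<bar>k\<bar> = \<bar>l\<bar> + 1"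
      and IH: "X (A l, B + l) = c - 2 * q l - \<bar>l\<bar>" and ml: "m k \<le> m l" "m l - m k \<le> int N - int s" for k l
  proof -
    have l: "\<not> m l < 0" using k ml by simp
    define i where "i = A k - C"
    define j where "j = i + q k"
    have "(m k + i * int r) mod int N = t k" using label_w[of i k] A(1)[OF k] by (simp add: i_def)
    then obtain z where z: "m k + i * int r = t k + int N * z" by (metis add.commute mult_div_mod_eq)
    then have jz: "j * int r = int N * z" using mqt[of k] by (simp add: j_def algebra_simps)
    have Xk: "X (A k, B + k) = c - 2 * q k - \<bar>k\<bar> + 2 * (j - z)"
      using Xt[OF z] by (simp add: i_def j_def algebra_simps)
    have i1: "X (A l, B + l) < X (A k, B + k)" "X (A k, B + k) + 2 * q k < X (A l, B + l) + 2 * q l"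
      using inside MM[OF k] MM[OF l] by (auto simp: lies_inside_def)
    have "2 * (j - z) < 1" using i1(2) unfolding Xk IH kl by linarith
    then have jz0: "j - z \<le> 0" by presburger
    have "2 * (q k - q l) + 1 < 2 * (j - z)" using i1(1) unfolding Xk IH kl by (simp add: algebra_simps)
    then have jz1: "1 + q k - q l \<le> j - z" by presburger
    have zz: "(j - z) * int r = z * (int N - int r)" using jz by (simp add: algebra_simps)
    have "(1 + q k - q l) * int r \<le> (j - z) * int r" using jz1 r0 by (intro mult_right_mono) auto
    then have lower: "1 - (int N - int s) \<le> z * (int N - int r)"
      using zz mqt[of k] mqt[of l] t[of k] t[of l] ml by (simp add: algebra_simps)
    have "z = 0"
    proof (rule ccontr)
      assume "z \<noteq> 0"
      then consider "1 \<le> z" | "z \<le> - 1" by linarith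
      then show False
      proof cases
        case 1
        then have "0 < z * (int N - int r)" using r0 by simp
        moreover have "(j - z) * int r \<le> 0" using jz0 by (simp add: mult_nonpos_nonneg)
        ultimately show False using zz by simp
      next
        case 2
        then have "z * (int N - int r) \<le> - 1 * (int N - int r)" using r0 by (intro mult_right_mono) auto
        from order_trans[OF lower this] show False using r0 by simp
      qed
    qed
    then have "j = 0" using jz r0 by simp
    then show ?thesis using Xk \<open>z = 0\<close> by simp
  qed
  have XA: "X (A k, B + k) = c - 2 * q k - \<bar>k\<bar>" if "\<not> m k < 0" for k
  proof -
    have zero: "X (A 0, B + 0) = c - 2 * q 0 - \<bar>0\<bar>" using Xleft[of 0] by (simp add: C_def)
    have mstep: "m (int j) - m (int j + 1) = int N - int s" "m (- int j) - m (- int j - 1) = int s" for j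
      unfolding mk[of "int j"] mk[of "int j + 1"] mk[of "- int j"] mk[of "- int j - 1"] by (simp_all add: algebra_simps)
    have "\<not> m (int j) < 0 \<Longrightarrow> X (A (int j), B + int j) = c - 2 * q (int j) - \<bar>int j\<bar>" for j
    proof (induction j)
      case 0 then show ?case using zero by simp
    next
      case (Suc j)
      have m': "m (int j + 1) \<le> m (int j)" "m (int j) - m (int j + 1) \<le> int N - int s" using mstep(1)[of j] r0 by auto
      have e: "int (Suc j) = int j + 1" by simp
      have k: "\<not> m (int j + 1) < 0" using Suc.prems unfolding e .
      have "X (A (int j + 1), B + (int j + 1)) = c - 2 * q (int j + 1) - \<bar>int j + 1\<bar>"
        by (rule indstep[OF k _ _ Suc.IH m']) (use up[of "int j + 1"] A(2)[OF k] k m' in auto)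
      then show ?case unfolding e .
    qed
    moreover have "\<not> m (- int j) < 0 \<Longrightarrow> X (A (- int j), B + (- int j)) = c - 2 * q (- int j) - \<bar>- int j\<bar>" for j
    proof (induction j)
      case 0 then show ?case using zero by simp
    next
      case (Suc j)
      have m': "m (- int j - 1) \<le> m (- int j)" "m (- int j) - m (- int j - 1) \<le> int N - int s" using mstep(2)[of j] r0 by auto
      have e: "- int (Suc j) = - int j - 1" by simp
      have k: "\<not> m (- int j - 1) < 0" using Suc.prems unfolding e .
      have "X (A (- int j - 1), B + (- int j - 1)) = c - 2 * q (- int j - 1) - \<bar>- int j - 1\<bar>"
        by (rule indstep[OF k _ _ Suc.IH m']) (use dn[of "- int j - 1"] A(2)[OF k] k m' in auto)
      then show ?case unfolding e .
    qed
    ultimately show ?thesis using that by (cases k rule: int_cases2) simp_all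
  qed
  have cellsH: "(\<Union>F\<in>H k. face_cells r s N X F) = {c - 2 * q k - \<bar>k\<bar>..c - \<bar>k\<bar>} \<times> {B + k}" for k
  proof (cases "m k < 0")
    case True
    then have "q k < 0" unfolding q_def using r0 by (intro div_neg_pos_less0) auto
    then show ?thesis using H0[OF True] by auto
  next
    case False
    show ?thesis unfolding A(3)[OF False] XA[OF False] by auto
  qed
  have Pc: "(\<Union>F\<in>P. face_cells r s N X F) = {(x, y). c - \<bar>y - B\<bar> - 2 * (m (y - B) div int r) \<le> x \<and> x \<le> c - \<bar>y - B\<bar>}"
  proof -
    have "(\<Union>F\<in>P. face_cells r s N X F) = (\<Union>k. {c - 2 * q k - \<bar>k\<bar>..c - \<bar>k\<bar>} \<times> {B + k})"
      unfolding P cellsH[symmetric] by blast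
    also have "\<dots> = {(x, y). c - 2 * q (y - B) - \<bar>y - B\<bar> \<le> x \<and> x \<le> c - \<bar>y - B\<bar>}"
    proof (intro set_eqI iffI; clarify)
      fix x y assume "c - 2 * q (y - B) - \<bar>y - B\<bar> \<le> x" "x \<le> c - \<bar>y - B\<bar>"
      then show "(x, y) \<in> (\<Union>k. {c - 2 * q k - \<bar>k\<bar>..c - \<bar>k\<bar>} \<times> {B + k})"
        by (intro UN_I[of "y - B"]) auto
    qed auto
    finally show ?thesis by (auto simp: q_def)
  qed
  have HF: "F \<in> H k \<longleftrightarrow> snd F = B + k \<and> c - 2 * q k - \<bar>k\<bar> \<le> X F \<and> X F \<le> c - \<bar>k\<bar>" if k: "\<not> m k < 0" for F k
  proof -
    note cells = cellsH[of k]
    have wp: "1 \<le> ?w F" for F by (rule width_bounds(1)[OF r0])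
    show ?thesis
    proof
      assume "F \<in> H k"
      moreover have "(X F, snd F) \<in> face_cells r s N X F" using wp[of F] by (simp add: face_cells_def)
      ultimately have "(X F, snd F) \<in> {c - 2 * q k - \<bar>k\<bar>..c - \<bar>k\<bar>} \<times> {B + k}" using cells by blast
      then show "snd F = B + k \<and> c - 2 * q k - \<bar>k\<bar> \<le> X F \<and> X F \<le> c - \<bar>k\<bar>" by auto
    next
      assume F: "snd F = B + k \<and> c - 2 * q k - \<bar>k\<bar> \<le> X F \<and> X F \<le> c - \<bar>k\<bar>"
      then have "(X F, B + k) \<in> (\<Union>F\<in>H k. face_cells r s N X F)" unfolding cells by auto
      then obtain G where G: "G \<in> H k" "X G \<le> X F" "X F < X G + ?w G" "snd G = B + k" by (auto simp: face_cells_def)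
      obtain a b where ab: "F = (a, B + k)" "G = (b, B + k)" using F G(4) by (metis prod.collapse)
      have "a = b"
        by (rule row_face_unique[of X "B + k" a "X F"]) (use Rt G ab wp[of F] in auto)
      then show "F \<in> H k" using G ab by simp
    qed
  qed
  have Prel: "(C + i, B + k) \<in> P \<longleftrightarrow> (i, k) \<in> pine (int n)" for i k
  proof -
    have "(C + i, B + k) \<in> P \<longleftrightarrow> (C + i, B + k) \<in> H k"
    proof
      assume "(C + i, B + k) \<in> P"
      then obtain k' where k': "(C + i, B + k) \<in> H k'" using P by blast
      then have "\<not> m k' < 0" using H0 by blast
      then show "(C + i, B + k) \<in> H k" using HF[of k'] k' by auto
    qed (use P in blast)
    also have "\<dots> \<longleftrightarrow> - i * int r \<le> m k \<and> i * (int N - int r) \<le> m k"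
    proof (cases "m k < 0")
      case True
      have "0 \<le> max (- i * int r) (i * (int N - int r))" by (rule dst_nonneg)
      then show ?thesis using H0[OF True] True by auto
    next
      case False
      have lo: "c - 2 * q k - \<bar>k\<bar> \<le> X (C + i, B + k) \<longleftrightarrow> - i * int r \<le> m k"
      proof -
        have "- i * int r \<le> m k \<longleftrightarrow> - i \<le> q k"
        proof
          assume "- i * int r \<le> m k"
          then have "(- i * int r) div int r \<le> q k" unfolding q_def using r0 by (intro zdiv_mono1) auto
          moreover have "(- i * int r) div int r = - i" using r0 by (intro nonzero_mult_div_cancel_right) auto
          ultimately show "- i \<le> q k" by simp
        next
          assume "- i \<le> q k"
          then have "- i * int r \<le> q k * int r" using r0 by (intro mult_right_mono) auto
          then show "- i * int r \<le> m k" using mqt[of k] t[of k] by linarith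
        qed
        moreover have "c - 2 * q k - \<bar>k\<bar> \<le> X (C + i, B + k) \<longleftrightarrow> - i \<le> q k"
          using Xleft[of k] mono[of "C - q k" "C + i" "B + k"] mono[of "C + i" "C - q k" "B + k"] by linarith
        ultimately show ?thesis by simp
      qed
      have hi: "X (C + i, B + k) \<le> c - \<bar>k\<bar> \<longleftrightarrow> i * (int N - int r) \<le> m k"
      proof -
        define w where "w = m k + i * int r"
        have Xw: "X (C + i, B + k) = c + 2 * i - \<bar>k\<bar> - 1 - w div int N - (w - int r) div int N" unfolding w_def by (rule Xr)
        have d: "(w - int r) div int N = w div int N - of_bool (w mod int N < int r)"
          using r0 by (intro div_sub_small) auto
        have "i * (int N - int r) \<le> m k \<longleftrightarrow> i * int N \<le> w" by (auto simp: w_def algebra_simps)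
        also have "\<dots> \<longleftrightarrow> i \<le> w div int N"
        proof
          assume "i * int N \<le> w"
          then show "i \<le> w div int N" using N0 zdiv_mono1[of "i * int N" w "int N"] by simp
        next
          assume "i \<le> w div int N"
          then have "i * int N \<le> w div int N * int N" by (intro mult_right_mono) auto
          moreover have "w div int N * int N + w mod int N = w" "0 \<le> w mod int N" using N0 by auto
          ultimately show "i * int N \<le> w" by linarith
        qed
        finally show ?thesis unfolding Xw d by (auto split: if_splits)
      qed
      show ?thesis unfolding HF[OF False] using lo hi by simp
    qed
    also have "\<dots> \<longleftrightarrow> (i, k) \<in> pine (int n)"
      by (simp add: pine_def dst_def m_def algebra_simps) linarith
    finally show ?thesis .
  qed
  have "int (label r s N (C + i, B + k)) = lab (int n) (i, k) + 1" for i k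
  proof -
    have "int n - 1 + i * int r + k * int s = m k + i * int r + (1 + max k 0) * int N"
      using mk[of k] by (simp add: m0 algebra_simps)
    then show ?thesis unfolding label_w lab_def prod.case by (simp only: mod_mult_self1)
  qed
  then have "drawn_pinecone r s N n X P C B c"
    using n Prel Xr[unfolded m_def] Pc[unfolded m_def] bt by unfold_locales
  then show ?thesis by blast
qed

end

section \<open>Cells, faces and the minimal matching\<close>

context drawn_pinecone
begin

definition mm :: "int \<Rightarrow> int" where
  "mm k = int n - int N - 1 - max (k * (int N - int s)) (- k * int s)"

definition qq :: "int \<Rightarrow> int" where "qq k = mm k div int r"

abbreviation w :: "face \<Rightarrow> int" where "w \<equiv> width r s N"
abbreviation fe :: "face \<Rightarrow> edge set" where "fe \<equiv> face_edges r s N X"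
abbreviation G :: "edge set" where "G \<equiv> graph_edges r s N X P"
abbreviation lb :: "face \<Rightarrow> nat" where "lb \<equiv> label r s N"

lemma X_right: "X (A + 1, b) = X (A, b) + w (A, b)"
  using bt by (simp add: brane_tiling_def)

lemma X_up: "X (A + 1, b + 1) = X (A + 1, b) + of_bool (lb (A, b) + r + s \<le> N)
     - of_bool (lb (A, b) + r \<le> N \<and> N < lb (A, b) + s)"
proof -
  obtain \<delta> where "\<And>F. X F = std_abscissa r s N F + \<delta>" using brane_tiling_unique[OF bt] by blast
  then show ?thesis using std_abscissa_up[OF r0, of A b] by simp
qed

lemma w_bounds: "1 \<le> w F" "w F \<le> 2"
  using width_bounds[OF r0] by auto

text \<open>The face covering the cell (x, y). Arguing with cells treats quadrilaterals and hexagons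
  alike.\<close>

definition fa :: "int \<Rightarrow> int \<Rightarrow> face" where
  "fa x y = (THE A. X (A, y) \<le> x \<and> x < X (A + 1, y), y)"

lemma fa_ex1: "\<exists>!A. X (A, y) \<le> x \<and> x < X (A + 1, y)"
proof -
  obtain A where A: "X (A, y) \<le> x \<and> x < X (A + 1, y)" using row_face[of X y x] X_right by blast
  show ?thesis
  proof (rule ex1I[of _ A])
    show "X (A, y) \<le> x \<and> x < X (A + 1, y)" by (rule A)
    fix A' assume "X (A', y) \<le> x \<and> x < X (A' + 1, y)"
    then show "A' = A" using row_face_unique[of X y A' x A] X_right A by blast
  qed
qed

lemma snd_fa [simp]: "snd (fa x y) = y" by (simp add: fa_def)

lemma fa_bounds: "X (fa x y) \<le> x" "x < X (fa x y) + w (fa x y)"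
proof -
  define A where "A = (THE A. X (A, y) \<le> x \<and> x < X (A + 1, y))"
  have "X (A, y) \<le> x \<and> x < X (A + 1, y)" unfolding A_def by (rule theI'[OF fa_ex1])
  then show "X (fa x y) \<le> x" "x < X (fa x y) + w (fa x y)" unfolding fa_def A_def[symmetric] by (auto simp: X_right)
qed

lemma fa_eq_iff: "F = fa x y \<longleftrightarrow> snd F = y \<and> X F \<le> x \<and> x < X F + w F"
proof
  assume "F = fa x y" then show "snd F = y \<and> X F \<le> x \<and> x < X F + w F" using fa_bounds by auto
next
  assume F: "snd F = y \<and> X F \<le> x \<and> x < X F + w F"
  obtain A where A: "F = (A, y)" using F by (metis prod.collapse)
  have "(THE A. X (A, y) \<le> x \<and> x < X (A + 1, y)) = A"
    by (rule the1_equality[OF fa_ex1]) (use F A X_right in auto)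
  then show "F = fa x y" by (simp add: fa_def A)
qed

lemma fa_X [simp]: "fa (X F) (snd F) = F"
  using fa_eq_iff[of F "X F" "snd F"] w_bounds(1)[of F] by auto

lemma hedge_face_iff: "hedge (x, y) \<in> fe F \<longleftrightarrow> F = fa x y \<or> F = fa x (y - 1)"
proof -
  have "hedge (x, y) \<in> fe F \<longleftrightarrow> (x, y) \<in> {X F..<X F + w F} \<times> {snd F, snd F + 1}"
    unfolding face_edges_eq by (auto simp: image_iff)
  then show ?thesis unfolding fa_eq_iff by auto
qed

text \<open>Holds at the vertical unit segments that are edges of the tiling and fails at those
  inside a hexagon.\<close>

definition bd :: "int \<Rightarrow> int \<Rightarrow> bool" where "bd x y \<longleftrightarrow> X (fa x y) = x"

lemma bd_left: assumes "bd x y" shows "fa (x - 1) y = (fst (fa x y) - 1, y)" "X (fa (x - 1) y) + w (fa (x - 1) y) = x"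
proof -
  define A where "A = fst (fa x y)"
  have F: "fa x y = (A, y)" unfolding A_def by (metis prod.collapse snd_fa)
  have "X (A, y) = x" using assms F by (simp add: bd_def)
  then have x: "X (A - 1, y) + w (A - 1, y) = x" using X_right[of "A - 1" y] by simp
  then have "(A - 1, y) = fa (x - 1) y" unfolding fa_eq_iff using w_bounds(1)[of "(A - 1, y)"] by simp
  then show "fa (x - 1) y = (fst (fa x y) - 1, y)" "X (fa (x - 1) y) + w (fa (x - 1) y) = x" using x by (auto simp: F)
qed

lemma not_bd: "\<not> bd x y \<Longrightarrow> fa (x - 1) y = fa x y"
  using fa_bounds[of x y] by (subst eq_commute) (auto simp: fa_eq_iff bd_def)

lemma vedge_face_iff: "vedge (x, y) \<in> fe F \<longleftrightarrow> bd x y \<and> (F = fa x y \<or> F = fa (x - 1) y)"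
proof -
  have "vedge (x, y) \<in> fe F \<longleftrightarrow> (x, y) \<in> {X F, X F + w F} \<times> {snd F}"
    unfolding face_edges_eq by (auto simp: image_iff)
  also have "\<dots> \<longleftrightarrow> bd x y \<and> (F = fa x y \<or> F = fa (x - 1) y)"
  proof
    assume A: "(x, y) \<in> {X F, X F + w F} \<times> {snd F}"
    then consider "x = X F" "y = snd F" | "x = X F + w F" "y = snd F" by auto
    then show "bd x y \<and> (F = fa x y \<or> F = fa (x - 1) y)"
    proof cases
      case 1 then show ?thesis by (simp add: bd_def)
    next
      case 2
      have "X (fst F + 1, snd F) = x" using X_right[of "fst F" "snd F"] 2 by simp
      moreover have "fa (X (fst F + 1, snd F)) (snd F) = (fst F + 1, snd F)" using fa_X[of "(fst F + 1, snd F)"] by simp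
      ultimately have "bd x y" unfolding bd_def 2(2) by simp
      moreover have "F = fa (x - 1) y" unfolding fa_eq_iff using 2 w_bounds(1)[of F] by simp
      ultimately show ?thesis by blast
    qed
  next
    assume A: "bd x y \<and> (F = fa x y \<or> F = fa (x - 1) y)"
    then show "(x, y) \<in> {X F, X F + w F} \<times> {snd F}" using bd_left[of x y] by (auto simp: bd_def)
  qed
  finally show ?thesis .
qed

definition inP :: "int \<Rightarrow> int \<Rightarrow> bool" where "inP x y \<longleftrightarrow> fa x y \<in> P"

lemma inP_iff: "inP x y \<longleftrightarrow> c - \<bar>y - B\<bar> - 2 * qq (y - B) \<le> x \<and> x \<le> c - \<bar>y - B\<bar>"
proof -
  have "inP x y \<longleftrightarrow> (x, y) \<in> (\<Union>F\<in>P. face_cells r s N X F)"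
  proof
    assume "inP x y"
    then show "(x, y) \<in> (\<Union>F\<in>P. face_cells r s N X F)"
      unfolding inP_def using fa_bounds[of x y] by (intro UN_I[of "fa x y"]) (auto simp: face_cells_def)
  next
    assume "(x, y) \<in> (\<Union>F\<in>P. face_cells r s N X F)"
    then obtain F where F: "F \<in> P" "snd F = y" "X F \<le> x" "x < X F + w F" by (auto simp: face_cells_def)
    then have "F = fa x y" by (simp add: fa_eq_iff)
    then show "inP x y" using F by (simp add: inP_def)
  qed
  then show ?thesis unfolding P_cells by (simp add: qq_def mm_def)
qed

lemma hedge_G: "hedge (x, y) \<in> G \<longleftrightarrow> inP x y \<or> inP x (y - 1)"
  unfolding graph_edges_def inP_def using hedge_face_iff by auto

lemma vedge_G: "vedge (x, y) \<in> G \<longleftrightarrow> bd x y \<and> (inP x y \<or> inP (x - 1) y)"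
  unfolding graph_edges_def inP_def using vedge_face_iff by auto

lemma G_lattice: "G \<subseteq> range hedge \<union> range vedge"
  unfolding graph_edges_def face_edges_eq by auto

lemma finite_P: "finite P"
proof -
  have "P \<subseteq> (\<lambda>(i, k). (C + i, B + k)) ` pine (int n)"
  proof clarify
    fix a b assume "(a, b) \<in> P"
    then have "(a - C, b - B) \<in> pine (int n)" using P_rel[of "a - C" "b - B"] by simp
    then show "(a, b) \<in> (\<lambda>(i, k). (C + i, B + k)) ` pine (int n)" by (intro image_eqI[of _ _ "(a - C, b - B)"]) auto
  qed
  then show ?thesis using finite_pine finite_surj by blast
qed

lemma finite_fe: "finite (fe F)" unfolding face_edges_eq by auto

lemma finite_G: "finite G" unfolding graph_edges_def using finite_P finite_fe by auto

lemma qq_step: "0 \<le> k \<Longrightarrow> qq (k + 1) + 1 \<le> qq k" "k \<le> 0 \<Longrightarrow> qq (k - 1) + 1 \<le> qq k"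
proof -
  have N2: "int r \<le> int N - int s" "int r \<le> int s" using r0 by auto
  have mx: "0 \<le> k \<Longrightarrow> max (k * (int N - int s)) (- k * int s) = k * (int N - int s)"
     "k \<le> 0 \<Longrightarrow> max (k * (int N - int s)) (- k * int s) = - k * int s" for k
  proof -
    assume "0 \<le> k"
    then have "- k * int s \<le> 0" "0 \<le> k * (int N - int s)" using r0 by (auto simp: mult_nonneg_nonneg)
    then show "max (k * (int N - int s)) (- k * int s) = k * (int N - int s)" by linarith
  next
    assume "k \<le> 0"
    then have "0 \<le> - k * int s" "k * (int N - int s) \<le> 0" using r0 by (auto simp: mult_nonpos_nonneg)
    then show "max (k * (int N - int s)) (- k * int s) = - k * int s" by linarith
  qed
  have *: "qq k' + 1 \<le> qq k" if "mm k' + int r \<le> mm k" for k k'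
  proof -
    have "(mm k' + int r) div int r \<le> qq k" unfolding qq_def using that r0 by (intro zdiv_mono1) auto
    then show ?thesis using r0 by (simp add: qq_def)
  qed
  show "0 \<le> k \<Longrightarrow> qq (k + 1) + 1 \<le> qq k"
    by (rule *) (use N2 mx(1)[of k] mx(1)[of "k + 1"] in \<open>simp add: mm_def algebra_simps\<close>)
  show "k \<le> 0 \<Longrightarrow> qq (k - 1) + 1 \<le> qq k"
    by (rule *) (use N2 mx(2)[of k] mx(2)[of "k - 1"] in \<open>simp add: mm_def algebra_simps\<close>)
qed

text \<open>The cell below or above a horizontal edge that is nearer to the central row.\<close>

definition near :: "int \<Rightarrow> int" where "near y = (if B < y then y - 1 else y)"
definition far :: "int \<Rightarrow> int" where "far y = (if B < y then y else y - 1)"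

lemma near_far_cases:
  "near y = y \<and> far y = y - 1 \<and> y \<le> B \<or> near y = y - 1 \<and> far y = y \<and> B < y"
  by (auto simp: near_def far_def)

lemma far_eq: "\<bar>far y - B\<bar> = \<bar>near y - B\<bar> + 1" "qq (far y - B) + 1 \<le> qq (near y - B)"
proof -
  show "\<bar>far y - B\<bar> = \<bar>near y - B\<bar> + 1" by (auto simp: near_def far_def)
  show "qq (far y - B) + 1 \<le> qq (near y - B)"
    using qq_step(1)[of "y - 1 - B"] qq_step(2)[of "y - B"] by (auto simp: near_def far_def algebra_simps)
qed

lemma inP_far: "inP x (far y) \<Longrightarrow> inP x (near y)"
  unfolding inP_iff using far_eq[of y] by auto

lemma hedge_G_near: "hedge (x, y) \<in> G \<longleftrightarrow> inP x (near y)"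
  unfolding hedge_G using inP_far[of x y] near_far_cases[of y] by auto

text \<open>The parity of the distance from the last cell of the strip nearer to the line y. This
  strip has an odd number 2 q + 1 of cells, so its edges at even distance match its 2 q + 2 vertices
  on the line.\<close>

definition par :: "int \<Rightarrow> int \<Rightarrow> bool" where
  "par x y \<longleftrightarrow> even (x - c + \<bar>near y - B\<bar>)"

text \<open>Signs that turn a divergence-free function on edges into a gradient. They are reflected
  in the central row through \<open>near\<close>, so that heights grow towards the centre on both
  sides.\<close>

definition psg :: "int \<Rightarrow> int \<Rightarrow> int" where "psg x y = (if par x y then 1 else - 1)"
definition vsg :: "int \<Rightarrow> int \<Rightarrow> int" where "vsg x y = (if even (x - c + \<bar>y - B\<bar>) then 1 else - 1)"

lemma vsg_near_far: "vsg x (near y) = psg x y" "vsg x (far y) = - psg x y"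
  by (auto simp: vsg_def psg_def par_def far_eq(1))

lemma psg_prev: "psg (x - 1) y = - psg x y"
  by (auto simp: psg_def par_def)

lemma psg_sq: "psg x y * psg x y = 1" "vsg x y * vsg x y = 1" by (auto simp: psg_def vsg_def)

definition Mmin :: "edge set" where "Mmin = {hedge (x, y) | x y. par x y \<and> hedge (x, y) \<in> G}"

lemma hedge_Mmin: "hedge (x, y) \<in> Mmin \<longleftrightarrow> par x y \<and> hedge (x, y) \<in> G"
  unfolding Mmin_def by auto

lemma vedge_Mmin: "vedge p \<notin> Mmin"
  unfolding Mmin_def by auto

definition edges_at :: "point \<Rightarrow> edge set" where
  "edges_at = (\<lambda>(x, y). {hedge (x, y), hedge (x - 1, y), vedge (x, y), vedge (x, y - 1)})"

lemma edges_at_iff: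
  assumes "e \<in> range hedge \<union> range vedge"
  shows "(x, y) \<in> e \<longleftrightarrow> e \<in> edges_at (x, y)"
proof -
  consider a b where "e = hedge (a, b)" | a b where "e = vedge (a, b)" using assms by fast
  then show ?thesis
  proof cases
    case 1
    have "(x, y) \<in> e \<longleftrightarrow> (a, b) = (x, y) \<or> (a, b) = (x - 1, y)" using 1 by (auto simp: hedge_def)
    then show ?thesis unfolding 1 edges_at_def by auto
  next
    case 2
    have "(x, y) \<in> e \<longleftrightarrow> (a, b) = (x, y) \<or> (a, b) = (x, y - 1)" using 2 by (auto simp: vedge_def)
    then show ?thesis unfolding 2 edges_at_def by auto
  qed
qed

lemma sum_edges_at:
  fixes f :: "edge \<Rightarrow> int"
  shows "(\<Sum>e\<in>edges_at (x, y). f e) = f (hedge (x, y)) + f (hedge (x - 1, y)) + f (vedge (x, y)) + f (vedge (x, y - 1))"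
  by (simp add: edges_at_def)

text \<open>This linear form of the condition makes the difference of two matchings divergence
  free.\<close>

lemma perfect_matching_iff:
  assumes "M \<subseteq> G"
  shows "perfect_matching G M \<longleftrightarrow>
    (\<forall>p. (\<Sum>e\<in>edges_at p. of_bool (e \<in> M)) = (of_bool (p \<in> \<Union>G) :: int))"
proof -
  have lat: "M \<subseteq> range hedge \<union> range vedge" using assms G_lattice by blast
  have at: "{e. e \<in> M \<and> p \<in> e} = edges_at p \<inter> M" for p
    using edges_at_iff[of _ "fst p" "snd p"] lat by auto
  have fin: "finite (edges_at p)" for p by (auto simp: edges_at_def split: prod.split)
  have sm: "(\<Sum>e\<in>edges_at p. of_bool (e \<in> M)) = int (card {e. e \<in> M \<and> p \<in> e})" for p
    unfolding at using fin[of p] by (simp add: sum.If_cases of_bool_def Int_commute)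
  have e1: "(\<exists>!e. e \<in> M \<and> p \<in> e) \<longleftrightarrow> card {e. e \<in> M \<and> p \<in> e} = 1" for p
  proof
    assume "\<exists>!e. e \<in> M \<and> p \<in> e"
    then obtain e where "e \<in> M \<and> p \<in> e" "\<And>e'. e' \<in> M \<and> p \<in> e' \<Longrightarrow> e' = e" by (elim ex1E) blast
    then have "{e. e \<in> M \<and> p \<in> e} = {e}" by blast
    then show "card {e. e \<in> M \<and> p \<in> e} = 1" by simp
  next
    assume "card {e. e \<in> M \<and> p \<in> e} = 1"
    then obtain e where "{e. e \<in> M \<and> p \<in> e} = {e}" by (rule card_1_singletonE)
    then show "\<exists>!e. e \<in> M \<and> p \<in> e" by (intro ex1I[of _ e]) blast+
  qed
  have e0: "card {e. e \<in> M \<and> p \<in> e} = 0" if "p \<notin> \<Union>G" for p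
  proof -
    have "{e. e \<in> M \<and> p \<in> e} = {}" using assms that by blast
    then show ?thesis by (simp only: card.empty)
  qed
  show ?thesis unfolding perfect_matching_def sm
  proof (intro iffI allI)
    fix p assume A: "M \<subseteq> G \<and> (\<forall>v\<in>\<Union>G. \<exists>!e. e \<in> M \<and> v \<in> e)"
    show "int (card {e. e \<in> M \<and> p \<in> e}) = of_bool (p \<in> \<Union>G)"
    proof (cases "p \<in> \<Union>G")
      case True
      then have "card {e. e \<in> M \<and> p \<in> e} = 1" using A e1[of p] by blast
      then show ?thesis using True by (simp only: of_nat_1 of_bool_eq(2) if_True)
    next
      case False
      then show ?thesis using e0[OF False] by (simp only: of_nat_0 of_bool_eq(1))
    qed
  next
    assume A: "\<forall>p. int (card {e. e \<in> M \<and> p \<in> e}) = of_bool (p \<in> \<Union>G)"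
    have "\<exists>!e. e \<in> M \<and> v \<in> e" if "v \<in> \<Union>G" for v
      unfolding e1 using A[rule_format, of v] that by (simp only: of_bool_eq(2) of_nat_eq_1_iff)
    then show "M \<subseteq> G \<and> (\<forall>v\<in>\<Union>G. \<exists>!e. e \<in> M \<and> v \<in> e)" using assms by blast
  qed
qed

lemma point_G: "(x, y) \<in> \<Union>G \<longleftrightarrow> inP x (near y) \<or> inP (x - 1) (near y)"
proof -
  have "(x, y) \<in> \<Union>G \<longleftrightarrow> (\<exists>e\<in>edges_at (x, y). e \<in> G)"
  proof -
    have "e \<in> G \<Longrightarrow> (x, y) \<in> e \<longleftrightarrow> e \<in> edges_at (x, y)" for e using edges_at_iff[of e x y] G_lattice by blast
    then show ?thesis by blast
  qed
  also have "\<dots> \<longleftrightarrow> hedge (x, y) \<in> G \<or> hedge (x - 1, y) \<in> G \<or> vedge (x, y) \<in> G \<or> vedge (x, y - 1) \<in> G"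
    by (auto simp: edges_at_def)
  also have "\<dots> \<longleftrightarrow> inP x (near y) \<or> inP (x - 1) (near y)"
    unfolding hedge_G_near vedge_G using inP_far[of x y] inP_far[of "x - 1" y] near_far_cases[of y] by auto
  finally show ?thesis .
qed

lemma inP_par: "inP x (near y) \<or> inP (x - 1) (near y) \<Longrightarrow> if par x y then inP x (near y) else inP (x - 1) (near y)"
proof -
  assume A: "inP x (near y) \<or> inP (x - 1) (near y)"
  define a where "a = \<bar>near y - B\<bar>"
  define q where "q = qq (near y - B)"
  have i: "inP x (near y) \<longleftrightarrow> c - a - 2 * q \<le> x \<and> x \<le> c - a" for x by (simp add: inP_iff a_def q_def)
  have p: "par x y \<longleftrightarrow> even (x - c + a)" by (simp add: par_def a_def)
  show ?thesis
  proof (cases "even (x - c + a)")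
    case True
    then obtain z where "x - c + a = 2 * z" by (rule evenE)
    then show ?thesis using A True unfolding i p by simp presburger
  next
    case False
    then obtain z where "x - c + a = 2 * z + 1" by (rule oddE)
    then show ?thesis using A False unfolding i p by simp presburger
  qed
qed

lemma perfect_matching_Mmin: "perfect_matching G Mmin"
proof -
  have sub: "Mmin \<subseteq> G" by (auto simp: Mmin_def)
  have "(\<Sum>e\<in>edges_at (x, y). of_bool (e \<in> Mmin)) = (of_bool ((x, y) \<in> \<Union>G) :: int)" for x y
  proof -
    have pp: "par (x - 1) y \<longleftrightarrow> \<not> par x y" by (auto simp: par_def)
    show ?thesis unfolding sum_edges_at hedge_Mmin point_G hedge_G_near pp
      using vedge_Mmin inP_par[of x y] by (auto split: if_splits)
  qed
  then show ?thesis unfolding perfect_matching_iff[OF sub] by auto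
qed


section \<open>Matchings as potentials\<close>

text \<open>A function on the edges that is divergence free and supported on \<open>G\<close> is the gradient of
  the function \<open>pot\<close> on the cells; the signs alternate so that all jumps away from the central
  row go in the same direction.\<close>

definition flow :: "(edge \<Rightarrow> int) \<Rightarrow> bool" where
  "flow d \<longleftrightarrow> (\<forall>e. e \<notin> G \<longrightarrow> d e = 0) \<and> (\<forall>p. (\<Sum>e\<in>edges_at p. d e) = 0)"

definition x_min :: int where "x_min = Min (insert 0 (fst ` \<Union>G))"

definition pot :: "(edge \<Rightarrow> int) \<Rightarrow> int \<Rightarrow> int \<Rightarrow> int" where
  "pot d x y = - (\<Sum>x'\<in>{x_min..x}. vsg x' y * d (vedge (x', y)))"

lemma x_min_le:
  assumes "e \<in> G" "(x, y) \<in> e" shows "x_min \<le> x"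
proof -
  have "finite e" if "e \<in> G" for e using that G_lattice by (auto simp: hedge_def vedge_def)
  then have "finite (\<Union>G)" using finite_G by auto
  moreover have "x \<in> fst ` \<Union>G" using assms by force
  ultimately show ?thesis unfolding x_min_def by (intro Min_le) auto
qed

lemma hedge_x_min: "hedge (x, y) \<in> G \<Longrightarrow> x_min \<le> x" and vedge_x_min: "vedge (x, y) \<in> G \<Longrightarrow> x_min \<le> x"
  using x_min_le[of "hedge (x, y)" x y] x_min_le[of "vedge (x, y)" x y] by (auto simp: hedge_def vedge_def)

lemma pot_step:
  assumes "flow d" shows "pot d x y = pot d (x - 1) y - vsg x y * d (vedge (x, y))"
proof (cases "x_min \<le> x")
  case True
  then have "{x_min..x} = insert x {x_min..x - 1}" by auto
  then show ?thesis by (simp add: pot_def)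
next
  case False
  then have "vedge (x, y) \<notin> G" using vedge_x_min by blast
  then show ?thesis using assms False by (simp add: pot_def flow_def)
qed

lemma pot_far_left: "x < x_min \<Longrightarrow> pot d x y = 0" by (simp add: pot_def)

text \<open>The defect \<open>E\<close> vanishes left of the graph and does not change from x - 1 to
  x, because the divergence at (x, y) is 0. So the potential, built from vertical edges alone,
  accounts for horizontal edges as well.\<close>

lemma pot_near_far:
  assumes d: "flow d" shows "pot d x (near y) - pot d x (far y) = psg x y * d (hedge (x, y))"
proof -
  define E where "E x = pot d x (near y) - pot d x (far y) - psg x y * d (hedge (x, y))" for x
  have "E x = E (x - 1)" for x
  proof -
    have "(\<Sum>e\<in>edges_at (x, y). d e) = 0" using d by (simp add: flow_def)
    then have s: "d (hedge (x, y)) + d (hedge (x - 1, y)) + d (vedge (x, near y)) + d (vedge (x, far y)) = 0"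
      unfolding sum_edges_at using near_far_cases[of y] by auto
    have "E x - E (x - 1) = - psg x y * (d (hedge (x, y)) + d (hedge (x - 1, y)) + d (vedge (x, near y)) + d (vedge (x, far y)))"
      unfolding E_def using pot_step[OF d, of x "near y"] pot_step[OF d, of x "far y"]
      by (simp add: vsg_near_far psg_prev algebra_simps)
    then show ?thesis unfolding s by simp
  qed
  then have st: "E (x + 1) = E x" for x by (metis add_diff_cancel_right')
  have "E x = 0"
  proof (cases "x < x_min")
    case True
    then have "hedge (x, y) \<notin> G" using hedge_x_min by force
    then show ?thesis using True d by (simp add: E_def pot_far_left flow_def)
  next
    case False
    have "hedge (x_min - 1, y) \<notin> G" using hedge_x_min by force
    then have base: "E (x_min - 1) = 0" using d by (simp add: E_def pot_far_left flow_def)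
    have "x_min - 1 \<le> x" using False by simp
    then show ?thesis by (induction x rule: int_ge_induct) (use base st in auto)
  qed
  then show ?thesis by (simp add: E_def)
qed

lemma row_empty: "\<exists>K. \<forall>y. K \<le> \<bar>y - B\<bar> \<longrightarrow> (\<forall>x. \<not> inP x y)"
proof -
  have up: "qq (int j) \<le> qq 0 - int j" for j
  proof (induction j)
    case (Suc j) then show ?case using qq_step(1)[of "int j"] by (simp add: add.commute)
  qed simp
  have dn: "qq (- int j) \<le> qq 0 - int j" for j
  proof (induction j)
    case (Suc j)
    have e: "- int (Suc j) = - int j - 1" by simp
    show ?case unfolding e using Suc qq_step(2)[of "- int j"] by simp
  qed simp
  have "qq k \<le> qq 0 - \<bar>k\<bar>" for k by (cases k rule: int_cases2) (use up dn in auto)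
  then have "\<not> inP x y" if "qq 0 + 1 \<le> \<bar>y - B\<bar>" for x y
    unfolding inP_iff using that by (smt (verit))
  then show ?thesis by blast
qed

lemma pot_empty_row:
  assumes "flow d" "\<And>x. \<not> inP x y" shows "pot d x y = 0"
proof -
  have "d (vedge (x, y)) = 0" for x using assms by (simp add: flow_def vedge_G)
  then show ?thesis by (simp add: pot_def)
qed

text \<open>Each row is \<open>near y'\<close> for a line y' whose \<open>far y'\<close> is the next
  row outwards, and rows far out meet no strip.\<close>

lemma far_induct [case_names far step]:
  assumes "\<And>y. (\<And>x. \<not> inP x y) \<Longrightarrow> Q y" and "\<And>y. Q (far y) \<Longrightarrow> Q (near y)"
  shows "Q y"
proof -
  obtain K where K: "\<And>y x. K \<le> \<bar>y - B\<bar> \<Longrightarrow> \<not> inP x y" using row_empty by blast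
  have "K \<le> \<bar>y - B\<bar> + int j \<Longrightarrow> Q y" for j y
  proof (induction j arbitrary: y)
    case 0 then show ?case using assms(1) K by simp
  next
    case (Suc j)
    define y' where "y' = (if B \<le> y then y + 1 else y)"
    have y': "near y' = y" "\<bar>far y' - B\<bar> = \<bar>y - B\<bar> + 1" using far_eq(1)[of y'] by (auto simp: y'_def near_def)
    have "Q (far y')" using Suc.IH[of "far y'"] Suc.prems y'(2) by simp
    then show ?case using assms(2)[of y'] y'(1) by simp
  qed
  from this[of y "nat (K - \<bar>y - B\<bar>)"] show ?thesis by simp
qed

text \<open>To the left of the strip no edge has contributed yet. To its right the column can be
  followed outwards to an empty row without crossing an edge of the graph, since strips farther out
  end farther to the left.\<close>

lemma pot_outside:
  assumes d: "flow d" and "\<not> inP x y" shows "pot d x y = 0"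
proof -
  consider "x < c - \<bar>y - B\<bar> - 2 * qq (y - B)" | "c - \<bar>y - B\<bar> < x" using assms(2) unfolding inP_iff by linarith
  then show ?thesis
  proof cases
    case 1
    have "d (vedge (x', y)) = 0" if "x' \<le> x" for x'
    proof -
      have "vedge (x', y) \<notin> G" unfolding vedge_G inP_iff using that 1 by auto
      then show ?thesis using d by (simp add: flow_def)
    qed
    then show ?thesis by (simp add: pot_def)
  next
    case 2
    have "c - \<bar>y - B\<bar> < x \<longrightarrow> pot d x y = 0"
    proof (induction y rule: far_induct)
      case (far y) then show ?case using pot_empty_row[OF d] by blast
    next
      case (step y)
      show ?case
      proof
        assume x: "c - \<bar>near y - B\<bar> < x"
        then have "hedge (x, y) \<notin> G" unfolding hedge_G_near inP_iff by simp
        then have "d (hedge (x, y)) = 0" using d by (simp add: flow_def)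
        then have "pot d x (near y) = pot d x (far y)" using pot_near_far[OF d, of x y] by simp
        then show "pot d x (near y) = 0" using step x far_eq(1)[of y] by simp
      qed
    qed
    then show ?thesis using 2 by blast
  qed
qed

lemma pot_nonneg:
  assumes d: "flow d" and pos: "\<And>x y. 0 \<le> psg x y * d (hedge (x, y))"
  shows "0 \<le> pot d x y"
proof (induction y rule: far_induct)
  case (far y) then show ?case using pot_empty_row[OF d] by simp
next
  case (step y) then show ?case using pot_near_far[OF d, of x y] pos[of x y] by linarith
qed

text \<open>Taken as \<open>Mmin\<close> minus M: multiplied by \<open>psg\<close> it is then 0 or 1
  on horizontal edges, which makes the potential nonnegative.\<close>

definition mdiff :: "edge set \<Rightarrow> edge \<Rightarrow> int" where
  "mdiff M e = of_bool (e \<in> Mmin) - of_bool (e \<in> M)"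

lemma Mmin_G: "Mmin \<subseteq> G" by (auto simp: Mmin_def)

lemma mdiff_flow:
  assumes "perfect_matching G M" shows "flow (mdiff M)"
proof -
  have MG: "M \<subseteq> G" using assms by (simp add: perfect_matching_def)
  have "(\<Sum>e\<in>edges_at p. mdiff M e) = 0" for p
    unfolding mdiff_def sum_subtractf
      spec[OF assms[unfolded perfect_matching_iff[OF MG]], of p]
      spec[OF perfect_matching_Mmin[unfolded perfect_matching_iff[OF Mmin_G]], of p] by simp
  then show ?thesis unfolding flow_def mdiff_def using MG Mmin_G by auto
qed

lemma mdiff_hedge:
  assumes "M \<subseteq> G" shows "psg x y * mdiff M (hedge (x, y)) \<in> {0, 1}"
  using assms Mmin_G by (auto simp: mdiff_def psg_def hedge_Mmin)

lemma mdiff_vedge: "mdiff M (vedge p) = - of_bool (vedge p \<in> M)"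
  using vedge_Mmin by (simp add: mdiff_def)

text \<open>A matching without vertical edges has potential 0, so it agrees with \<open>Mmin\<close>
  on horizontal edges too.\<close>

lemma minimal_matching_eq: "minimal_matching G = Mmin"
  unfolding minimal_matching_def
proof (rule the_equality)
  show "perfect_matching G Mmin \<and> (\<forall>e\<in>Mmin. horizontal e)"
    using perfect_matching_Mmin by (auto simp: Mmin_def horizontal_def hedge_def)
  fix M assume M: "perfect_matching G M \<and> (\<forall>e\<in>M. horizontal e)"
  have MG: "M \<subseteq> G" using M by (simp add: perfect_matching_def)
  have nv: "vedge p \<notin> M" for p
  proof
    assume "vedge p \<in> M"
    then obtain x y where "vedge p = hedge (x, y)" using M by (auto simp: horizontal_def hedge_def)
    then show False by simp
  qed
  have fl: "flow (mdiff M)" using mdiff_flow M by blast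
  have "pot (mdiff M) x y = 0" for x y by (simp add: pot_def mdiff_vedge nv)
  then have "psg x y * mdiff M (hedge (x, y)) = 0" for x y using pot_near_far[OF fl, of x y] by simp
  then have h: "mdiff M (hedge (x, y)) = 0" for x y by (metis mult_eq_0_iff psg_sq(1) zero_neq_one)
  have v: "mdiff M (vedge p) = 0" for p using nv by (simp add: mdiff_vedge)
  have "e \<in> M \<longleftrightarrow> e \<in> Mmin" for e
  proof (cases "e \<in> G")
    case True
    then consider a b where "e = hedge (a, b)" | p where "e = vedge p" using G_lattice by fast
    then have "mdiff M e = 0" by cases (use h v in auto)
    then show ?thesis by (auto simp: mdiff_def split: if_splits)
  qed (use MG Mmin_G in auto)
  then show "M = Mmin" by blast
qed

lemma pot_sum:
  assumes "finite I" shows "pot (\<lambda>e. \<Sum>i\<in>I. f i e) x y = (\<Sum>i\<in>I. pot (f i) x y)"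
  unfolding pot_def sum_distrib_left sum_negf by (subst sum.swap) simp

lemma pot_const_on_face:
  assumes d: "flow d" shows "pot d x y = pot d (X (fa x y)) y"
proof -
  have "pot d x y = pot d (x - 1) y" if "\<not> bd x y"
  proof -
    have "vedge (x, y) \<notin> G" using that by (simp add: vedge_G)
    then show ?thesis using pot_step[OF d, of x y] d by (simp add: flow_def)
  qed
  note 1 = this
  consider "x = X (fa x y)" | "x = X (fa x y) + 1" using fa_bounds[of x y] w_bounds(2)[of "fa x y"] by linarith
  then show ?thesis
  proof cases
    case 2
    then have "\<not> bd x y" by (simp add: bd_def)
    from 1[OF this] show ?thesis using 2 by (metis add_diff_cancel_right')
  qed simp
qed

lemma edges_at_G: "e \<in> G \<Longrightarrow> p \<in> e \<longleftrightarrow> e \<in> edges_at p"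
  using edges_at_iff[of e "fst p" "snd p"] G_lattice unfolding prod.collapse by blast

text \<open>The symmetric difference is 2-regular and so a disjoint union of cycles; restricting
  \<open>mdiff M\<close> to each of them gives flows again. The potential of each such flow is the
  indicator function of the inside of its cycle, and these potentials add up to that of M.\<close>

lemma height_eq:
  assumes M: "perfect_matching G M" and F: "F \<in> P"
  shows "int (height r s N X P M F) = pot (mdiff M) (X F) (snd F)"
proof -
  define D where "D = sym_diff M Mmin"
  have MG: "M \<subseteq> G" using M by (simp add: perfect_matching_def)
  have DG: "D \<subseteq> G" using MG Mmin_G by (auto simp: D_def)
  have fl: "flow (mdiff M)" by (rule mdiff_flow[OF M])
  have dD: "mdiff M e = 0 \<longleftrightarrow> e \<notin> D" "\<bar>mdiff M e\<bar> = of_bool (e \<in> D)" for e by (auto simp: mdiff_def D_def)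
  have u1: "\<And>v. v \<in> \<Union>G \<Longrightarrow> \<exists>!e. e \<in> M \<and> v \<in> e" and u2: "\<And>v. v \<in> \<Union>G \<Longrightarrow> \<exists>!e. e \<in> Mmin \<and> v \<in> e"
    using M perfect_matching_Mmin unfolding perfect_matching_def by blast+
  interpret two_regular D
  proof
    show "finite D" using DG finite_G finite_subset by blast
    show "card e = 2" if "e \<in> D" for e
      using that DG G_lattice by (auto simp: hedge_def vedge_def)
    show "card {e \<in> D. v \<in> e} = 2" if v: "v \<in> \<Union>D" for v
    proof -
      have vG: "v \<in> \<Union>G" using v DG by blast
      obtain a where a: "a \<in> M" "v \<in> a" "\<And>e. e \<in> M \<Longrightarrow> v \<in> e \<Longrightarrow> e = a" using u1[OF vG] by (elim ex1E) blast
      obtain b where b: "b \<in> Mmin" "v \<in> b" "\<And>e. e \<in> Mmin \<Longrightarrow> v \<in> e \<Longrightarrow> e = b" using u2[OF vG] by (elim ex1E) blast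
      have ab: "a \<noteq> b"
      proof
        assume eq: "a = b"
        obtain e where e: "e \<in> D" "v \<in> e" using v by blast
        then show False using a b eq unfolding D_def by blast
      qed
      have "{e \<in> D. v \<in> e} = {a, b}" unfolding D_def using a b ab by blast
      then show ?thesis using ab by simp
    qed
  qed
  define Cs where "Cs = graph_cycles D"
  have "Cs \<subseteq> Pow D" unfolding Cs_def graph_cycles_def by blast
  then have finCs: "finite Cs" using fin by (meson finite_Pow_iff finite_subset)
  define dC where "dC Cy e = of_bool (e \<in> Cy) * mdiff M e" for Cy :: "edge set" and e
  have CyD: "Cy \<subseteq> D" if "Cy \<in> Cs" for Cy using that by (simp add: Cs_def graph_cycles_iff)
  have flC: "flow (dC Cy)" if Cy: "Cy \<in> Cs" for Cy
  proof -
    have "(\<Sum>e\<in>edges_at p. dC Cy e) = 0" for p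
    proof (cases "p \<in> \<Union>Cy")
      case True
      have sat: "{e \<in> Cy. p \<in> e} = {e \<in> D. p \<in> e}" using cycle_saturated[OF _ True] Cy by (simp add: Cs_def)
      have "dC Cy e = mdiff M e" if "e \<in> edges_at p" for e
      proof (cases "e \<in> D")
        case True
        then have "p \<in> e" using edges_at_G[of e p] that DG by blast
        then have "e \<in> Cy" using sat True by blast
        then show ?thesis by (simp add: dC_def)
      next
        case False then show ?thesis using dD(1)[of e] by (simp add: dC_def)
      qed
      then have "(\<Sum>e\<in>edges_at p. dC Cy e) = (\<Sum>e\<in>edges_at p. mdiff M e)" by (intro sum.cong) auto
      then show ?thesis using fl unfolding flow_def by metis
    next
      case False
      have "dC Cy e = 0" if "e \<in> edges_at p" for e
      proof -
        have "e \<notin> Cy"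
        proof
          assume e: "e \<in> Cy"
          then have "p \<in> e" using edges_at_G[of e p] that CyD[OF Cy] DG by blast
          then show False using e False by blast
        qed
        then show ?thesis by (simp add: dC_def)
      qed
      then show ?thesis by simp
    qed
    moreover have "dC Cy e = 0" if "e \<notin> G" for e using CyD[OF Cy] DG that by (auto simp: dC_def)
    ultimately show ?thesis unfolding flow_def by blast
  qed
  have decomp: "mdiff M e = (\<Sum>Cy\<in>Cs. dC Cy e)" for e
  proof (cases "e \<in> D")
    case True
    obtain Cy where Cy: "Cy \<in> Cs" "e \<in> Cy" "\<And>C'. C' \<in> Cs \<Longrightarrow> e \<in> C' \<Longrightarrow> C' = Cy"
      using ex1_cycle[OF True] unfolding Cs_def by (elim ex1E) blast
    have "(\<Sum>Cy\<in>Cs. dC Cy e) = (\<Sum>C'\<in>Cs. if C' = Cy then mdiff M e else 0)"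
    proof (rule sum.cong[OF refl])
      fix C' assume C': "C' \<in> Cs"
      show "dC C' e = (if C' = Cy then mdiff M e else 0)"
      proof (cases "C' = Cy")
        case True then show ?thesis using Cy(2) by (simp add: dC_def)
      next
        case False
        then have "e \<notin> C'" using Cy(3)[OF C'] by blast
        then show ?thesis using False by (simp add: dC_def)
      qed
    qed
    also have "\<dots> = mdiff M e" unfolding sum.delta[OF finCs] using Cy(1) by simp
    finally show ?thesis by simp
  next
    case False
    then have "dC Cy e = 0" for Cy using dD(1)[of e] by (simp add: dC_def)
    then show ?thesis using dD(1)[of e] False by simp
  qed
  have potM: "pot (mdiff M) x y = (\<Sum>Cy\<in>Cs. pot (dC Cy) x y)" for x y
    using pot_sum[OF finCs, of dC x y] decomp by (simp add: pot_def)
  have cyc: "(face_region r s N X F \<subseteq> inside (plane_curve Cy) \<longleftrightarrow> pot (dC Cy) (X F) (snd F) = 1) \<and>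
      (pot (dC Cy) (X F) (snd F) = 0 \<or> pot (dC Cy) (X F) (snd F) = 1)" if Cy: "Cy \<in> Cs" for Cy
  proof -
    obtain vs where vs: "distinct vs" "3 \<le> length vs" "Cy = cyc_edge vs ` {..<length vs}"
      using Cy unfolding Cs_def graph_cycles_iff by blast
    define H where "H = (\<lambda>(x, y). pot (dC Cy) x y)"
    have absd: "\<bar>dC Cy e\<bar> = of_bool (e \<in> Cy)" for e
    proof (cases "e \<in> Cy")
      case True then show ?thesis using CyD[OF Cy] dD(2)[of e] by (auto simp: dC_def)
    qed (simp add: dC_def)
    have latC: "Cy \<subseteq> range hedge \<union> range vedge" using CyD[OF Cy] DG G_lattice by blast
    interpret L: lattice_cycle Cy vs H
    proof
      show "distinct vs" "3 \<le> length vs" "Cy = cyc_edge vs ` {..<length vs}" by (rule vs)+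
      show "Cy \<subseteq> range hedge \<union> range vedge" by (rule latC)
      \<comment> \<open>The restricted flow inherits its signs from \<open>mdiff M\<close>; hence no
        cycle has potential -1 inside.\<close>
      show "0 \<le> H cl" for cl
      proof -
        have "0 \<le> psg x y * dC Cy (hedge (x, y))" for x y
          using mdiff_hedge[OF MG, of x y] by (auto simp: dC_def)
        then show ?thesis unfolding H_def using pot_nonneg[OF flC[OF Cy]] by (simp split: prod.split)
      qed
      show "finite {cl. H cl \<noteq> 0}"
      proof -
        have "{cl. H cl \<noteq> 0} \<subseteq> (\<Union>F\<in>P. face_cells r s N X F)"
        proof
          fix cl assume cl: "cl \<in> {cl. H cl \<noteq> 0}"
          obtain x y where xy: "cl = (x, y)" by fastforce
          have "inP x y" using pot_outside[OF flC[OF Cy], of x y] cl xy by (auto simp: H_def)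
          then show "cl \<in> (\<Union>F\<in>P. face_cells r s N X F)"
            unfolding inP_def xy using fa_bounds[of x y] by (intro UN_I[of "fa x y"]) (auto simp: face_cells_def)
        qed
        moreover have "finite (\<Union>F\<in>P. face_cells r s N X F)" using finite_P by (auto simp: face_cells_def)
        ultimately show ?thesis by (rule finite_subset)
      qed
      show "\<bar>H (x, y) - H (x - 1, y)\<bar> = of_bool (vedge (x, y) \<in> Cy)" for x y
      proof -
        have "H (x, y) - H (x - 1, y) = - (vsg x y * dC Cy (vedge (x, y)))"
          unfolding H_def using pot_step[OF flC[OF Cy], of x y] by simp
        then show ?thesis using absd[of "vedge (x, y)"] by (auto simp: vsg_def abs_mult)
      qed
      show "\<bar>H (x, y) - H (x, y - 1)\<bar> = of_bool (hedge (x, y) \<in> Cy)" for x y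
      proof -
        have "\<bar>H (x, y) - H (x, y - 1)\<bar> = \<bar>psg x y * dC Cy (hedge (x, y))\<bar>"
          using pot_near_far[OF flC[OF Cy], of x y] near_far_cases[of y] unfolding H_def prod.case
          by (metis abs_minus_commute)
        then show ?thesis using absd[of "hedge (x, y)"] by (auto simp: psg_def abs_mult)
      qed
    qed
    have "face_region r s N X F \<subseteq> inside (plane_curve Cy)" if H1: "H (X F, snd F) = 1"
    proof
      fix z assume z: "z \<in> face_region r s N X F"
      obtain a b where ab: "z = (a, b)" by fastforce
      have a: "real_of_int (X F) < a" "a < real_of_int (X F + w F)" and b: "real_of_int (snd F) < b" "b < real_of_int (snd F) + 1"
        using z by (auto simp: face_region_def ab)
      define x where "x = \<lfloor>a\<rfloor>"
      have x: "X F \<le> x" "x < X F + w F" using a unfolding x_def by (auto simp: le_floor_iff floor_less_iff)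
      have zc: "z \<in> L.cell (x, snd F)" using b unfolding L.cell_def ab x_def by simp
      have fx: "fa x (snd F) = F" using fa_eq_iff[of F x "snd F"] x by auto
      have Hx: "H (x, snd F) = 1"
        using pot_const_on_face[OF flC[OF Cy], of x "snd F"] H1 unfolding H_def fx by simp
      have "z \<notin> plane_curve Cy"
      proof
        assume "z \<in> plane_curve Cy"
        then consider x' y' where "hedge (x', y') \<in> Cy" "b = real_of_int y'"
          | x' y' where "vedge (x', y') \<in> Cy" "a = real_of_int x'" "real_of_int y' \<le> b" "b \<le> real_of_int y' + 1"
          unfolding ab L.curve by blast
        then show False
        proof cases
          case 1
          then have "real_of_int (snd F) < real_of_int y'" "real_of_int y' < real_of_int (snd F + 1)" using b by simp_all
          then show False unfolding of_int_less_iff by linarith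
        next
          case 2
          have "real_of_int (snd F) < real_of_int (y' + 1)" "real_of_int y' < real_of_int (snd F + 1)" using 2 b by simp_all
          then have y': "y' = snd F" unfolding of_int_less_iff by linarith
          have x': "x' = x" using 2(2) by (simp add: x_def)
          have "vedge (x, snd F) \<in> G" using 2(1) CyD[OF Cy] DG unfolding x' y' by blast
          then have "X F = x" unfolding vedge_G bd_def fx by blast
          then show False using a(1) 2(2) x' by simp
        qed
      qed
      then show "z \<in> inside (plane_curve Cy)" using L.inside_cell[OF zc _ Hx] by blast
    qed
    moreover have "H (X F, snd F) = 1" if "face_region r s N X F \<subseteq> inside (plane_curve Cy)"
    proof -
      \<comment> \<open>For the converse one point suffices: the centre of the first cell of the
        face.\<close>
      have "L.ctr (X F, snd F) \<in> face_region r s N X F"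
        using w_bounds(1)[of F] by (simp add: L.ctr_def face_region_def)
      then show ?thesis using that L.ctr_inside by blast
    qed
    moreover have "H (X F, snd F) = 0 \<or> H (X F, snd F) = 1" by (rule L.H_01)
    ultimately show ?thesis unfolding H_def by auto
  qed
  have "height r s N X P M F = card {Cy \<in> Cs. face_region r s N X F \<subseteq> inside (plane_curve Cy)}"
    unfolding height_def minimal_matching_eq Cs_def D_def ..
  also have "\<dots> = card {Cy \<in> Cs. pot (dC Cy) (X F) (snd F) = 1}" using cyc by (intro arg_cong[where f = card]) auto
  also have "int \<dots> = (\<Sum>Cy\<in>Cs. of_bool (pot (dC Cy) (X F) (snd F) = 1))"
    using finCs by (simp add: sum.If_cases of_bool_def Int_def)
  also have "\<dots> = (\<Sum>Cy\<in>Cs. pot (dC Cy) (X F) (snd F))" using cyc by (intro sum.cong) auto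
  also have "\<dots> = pot (mdiff M) (X F) (snd F)" by (rule potM[symmetric])
  finally show ?thesis .
qed


section \<open>Matchings and admissible heights\<close>

definition rel :: "face \<Rightarrow> int \<times> int" where "rel F = (fst F - C, snd F - B)"

lemma lb_rel: "int (lb F) = lab (int n) (rel F) + 1"
  using label_rel[of "fst F - C" "snd F - B"] by (simp add: rel_def)

lemma P_iff: "F \<in> P \<longleftrightarrow> rel F \<in> pine (int n)"
  using P_rel[of "fst F - C" "snd F - B"] by (simp add: rel_def)

lemma lb_bounds: "1 \<le> lb F" "lb F \<le> N"
  using label_bounds[OF N0] by auto

lemma inP_X: "inP (X F) (snd F) \<longleftrightarrow> F \<in> P" by (simp add: inP_def)

lemma lb_right: "lb (A + 1, b) = (if N < lb (A, b) + r then lb (A, b) + r - N else lb (A, b) + r)"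
  using label_step(1)[OF r0, of A b] lb_bounds(1)[of "(A + 1, b)"] by auto

lemma lb_up: "lb (A, b + 1) = (if N < lb (A, b) + s then lb (A, b) + s - N else lb (A, b) + s)"
  using label_step(2)[OF r0, of A b] lb_bounds(1)[of "(A, b + 1)"] by auto

lemma small_right: "lb (A + 1, b) \<le> r \<longleftrightarrow> N < lb (A, b) + r"
  using lb_right[of A b] lb_bounds[of "(A, b)"] by auto

lemma mm_mod: "(mm k + i * int r) mod int N = lab (int n) (i, k)"
proof -
  have "max (k * (int N - int s)) (- k * int s) = - k * int s \<or> max (k * (int N - int s)) (- k * int s) = - k * int s + k * int N"
    by (auto simp: max_def algebra_simps)
  then obtain a where "max (k * (int N - int s)) (- k * int s) = - k * int s + a * int N"
    by (metis add.right_neutral mult_zero_left)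
  then have "mm k + i * int r = int n - 1 + i * int r + k * int s + (- a - 1) * int N"
    by (simp add: mm_def algebra_simps)
  then show ?thesis by (simp only: lab_def prod.case mod_mult_self1)
qed

lemma X_parity: "X F = c - \<bar>snd F - B\<bar> - 1 + of_bool (lb F \<le> r) + 2 * (fst F - C - (mm (snd F - B) + (fst F - C) * int r) div int N)"
proof -
  define i k where "i = fst F - C" "k = snd F - B"
  define ww where "ww = mm k + i * int r"
  have "ww mod int N = lab (int n) (i, k)" unfolding ww_def by (rule mm_mod)
  then have l: "int (lb F) = ww mod int N + 1" using lb_rel[of F] by (simp add: rel_def i_k_def)
  have d: "(ww - int r) div int N = ww div int N - of_bool (ww mod int N < int r)"
    using r0 by (intro div_sub_small) auto
  have "X F = c + 2 * i - \<bar>k\<bar> - 1 - ww div int N - (ww - int r) div int N"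
    using X_rel[of i k] by (simp add: i_k_def ww_def mm_def)
  moreover have "(of_bool (ww mod int N < int r) :: int) = of_bool (lb F \<le> r)" using l by auto
  ultimately show ?thesis unfolding d i_k_def[symmetric] ww_def[symmetric] by simp
qed

text \<open>In a row the parity of the left side changes only after a quadrilateral, and
  quadrilaterals come in pairs, just before and just after a wrap of the labels. This ties the
  signs, defined by position, to the labels.\<close>

lemma small_iff: "lb F \<le> r \<longleftrightarrow> even (X F - c + \<bar>snd F - B\<bar>)"
proof -
  have "X F - c + \<bar>snd F - B\<bar> = of_bool (lb F \<le> r) - 1 + 2 * (fst F - C - (mm (snd F - B) + (fst F - C) * int r) div int N)"
    using X_parity[of F] by linarith
  then show ?thesis by (cases "lb F \<le> r") simp_all
qed

lemma vsg_bd: "bd x y \<Longrightarrow> vsg x y = (if lb (fa x y) \<le> r then 1 else - 1)"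
  unfolding vsg_def small_iff bd_def by simp

lemma hedge_adj:
  assumes "fa x y = (A, y)" "fa x (y + 1) = (D, y + 1)"
  shows "D = A \<or> A = D + 1 \<and> lb (D, y) + r + s \<le> N \<or> D = A + 1 \<and> lb (A, y) + r \<le> N \<and> N < lb (A, y) + s"
proof -
  have "hedge (x, y + 1) \<in> fe (A, y) \<inter> fe (D, y + 1)" using assms by (simp add: hedge_face_iff)
  then have "card (fe (A, y) \<inter> fe (D, y + 1)) \<noteq> 0" using finite_fe by auto
  moreover have "(A, y) \<noteq> (D, y + 1)" by simp
  then have "card (fe (A, y) \<inter> fe (D, y + 1)) =
      of_bool (qtilde_arrow r s N (A, y) (D, y + 1) \<or> qtilde_arrow r s N (D, y + 1) (A, y))"
    using bt unfolding brane_tiling_def by blast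
  ultimately have "qtilde_arrow r s N (A, y) (D, y + 1) \<or> qtilde_arrow r s N (D, y + 1) (A, y)"
    by (metis of_bool_eq(1))
  then show ?thesis unfolding adj_iff[OF r0] by auto
qed

lemma adj_hedge:
  assumes "D = A \<or> A = D + 1 \<and> lb (D, y) + r + s \<le> N \<or> D = A + 1 \<and> lb (A, y) + r \<le> N \<and> N < lb (A, y) + s"
  shows "\<exists>x. fa x y = (A, y) \<and> fa x (y + 1) = (D, y + 1)"
proof -
  have "qtilde_arrow r s N (A, y) (D, y + 1) \<or> qtilde_arrow r s N (D, y + 1) (A, y)"
    unfolding adj_iff[OF r0] using assms by auto
  then have "card (fe (A, y) \<inter> fe (D, y + 1)) = 1" using bt unfolding brane_tiling_def by auto
  then obtain e where e: "e \<in> fe (A, y)" "e \<in> fe (D, y + 1)" by (metis IntE card_1_singletonE insertI1)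
  then consider a b where "e = hedge (a, b)" | a b where "e = vedge (a, b)" unfolding face_edges_eq by fast
  then show ?thesis
  proof cases
    case 1
    have 2: "(A, y) = fa a b \<or> (A, y) = fa a (b - 1)" "(D, y + 1) = fa a b \<or> (D, y + 1) = fa a (b - 1)"
      using e by (simp_all add: 1 hedge_face_iff)
    have s: "y = b \<or> y = b - 1" "y + 1 = b \<or> y + 1 = b - 1" using 2 by (metis snd_conv snd_fa)+
    then have b: "b = y + 1" by presburger
    have "(A, y) \<noteq> fa a b" "(D, y + 1) \<noteq> fa a (b - 1)" using b by (metis snd_conv snd_fa add_cancel_right_right zero_neq_one, metis snd_conv snd_fa add_diff_cancel_right' add_cancel_right_right zero_neq_one)
    then have "(A, y) = fa a y" "(D, y + 1) = fa a (y + 1)" using 2 b by auto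
    then show ?thesis by metis
  next
    case 2
    have "(A, y) = fa a b \<or> (A, y) = fa (a - 1) b" "(D, y + 1) = fa a b \<or> (D, y + 1) = fa (a - 1) b"
      using e by (simp_all add: 2 vedge_face_iff)
    then have "y = b" "y + 1 = b" by (metis snd_conv snd_fa)+
    then show ?thesis by simp
  qed
qed

definition hgt :: "edge set \<Rightarrow> int \<times> int \<Rightarrow> int" where
  "hgt M = (\<lambda>(i, k). pot (mdiff M) (X (C + i, B + k)) (B + k))"

lemma hgt_rel: "hgt M (rel F) = pot (mdiff M) (X F) (snd F)"
  by (simp add: hgt_def rel_def)

lemma hgt_fa: "perfect_matching G M \<Longrightarrow> pot (mdiff M) x y = hgt M (rel (fa x y))"
  unfolding hgt_rel using pot_const_on_face[OF mdiff_flow, of M x y] by simp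

text \<open>Each constraint belongs to one edge of the tiling, across which the potential jumps by 0
  or 1 in the direction given by the sign of the edge. For the diagonal constraints the edge is
  found by \<open>adj_hedge\<close>.\<close>

lemma hgt_conf:
  assumes M: "perfect_matching G M"
  shows "hgt M \<in> conf (int n)"
proof -
  have MG: "M \<subseteq> G" using M by (simp add: perfect_matching_def)
  note fl = mdiff_flow[OF M]
  have nn: "0 \<le> hgt M F" for F
  proof -
    have "0 \<le> psg x y * mdiff M (hedge (x, y))" for x y using mdiff_hedge[OF MG, of x y] by auto
    then show ?thesis unfolding hgt_def using pot_nonneg[OF fl] by (simp split: prod.split)
  qed
  have zero: "hgt M F = 0" if "F \<notin> pine (int n)" for F
  proof -
    obtain i k where F: "F = (i, k)" by fastforce
    have "\<not> inP (X (C + i, B + k)) (B + k)" using inP_X[of "(C + i, B + k)"] P_rel[of i k] that F by simp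
    then show ?thesis using pot_outside[OF fl] by (simp add: F hgt_def)
  qed
  have at: "conf_at (lab (int n) (i, k)) (hgt M) i k" for i k
  proof -
    define A y where "A = C + i" "y = B + k"
    have rels: "rel (A, y) = (i, k)" "rel (A + 1, y) = (i + 1, k)" "rel (A, y + 1) = (i, k + 1)" "rel (A + 1, y + 1) = (i + 1, k + 1)"
      by (auto simp: rel_def A_y_def)
    have l: "int (lb (A, y)) = lab (int n) (i, k) + 1" using lb_rel[of "(A, y)"] rels by simp
    define x where "x = X (A + 1, y)"
    have fx: "fa x y = (A + 1, y)" using fa_X[of "(A + 1, y)"] by (simp add: x_def)
    have bx: "bd x y" unfolding bd_def fx by (simp add: x_def)
    have fx': "fa (x - 1) y = (A, y)" using bd_left(1)[OF bx] fx by simp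
    have "pot (mdiff M) x y - pot (mdiff M) (x - 1) y = vsg x y * of_bool (vedge (x, y) \<in> M)"
      using pot_step[OF fl, of x y] by (simp add: mdiff_vedge)
    then have H: "hgt M (i + 1, k) - hgt M (i, k) = vsg x y * of_bool (vedge (x, y) \<in> M)"
      unfolding hgt_fa[OF M] fx fx' rels .
    have vs: "vsg x y = (if N < lb (A, y) + r then 1 else - 1)" using vsg_bd[OF bx] small_right[of A y] fx by simp
    have st: "step01 k (hgt M (rel (a, y))) (hgt M (rel (d, y + 1)))"
      if ad: "d = a \<or> a = d + 1 \<and> lb (d, y) + r + s \<le> N \<or> d = a + 1 \<and> lb (a, y) + r \<le> N \<and> N < lb (a, y) + s" for a d
    proof -
      obtain x where x: "fa x y = (a, y)" "fa x (y + 1) = (d, y + 1)" using adj_hedge[OF ad] by blast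
      have "pot (mdiff M) x (near (y + 1)) - pot (mdiff M) x (far (y + 1)) \<in> {0, 1}"
        using pot_near_far[OF fl, of x "y + 1"] mdiff_hedge[OF MG, of x "y + 1"] by simp
      then have *: "hgt M (rel (fa x (near (y + 1)))) - hgt M (rel (fa x (far (y + 1)))) \<in> {0, 1}"
        unfolding hgt_fa[OF M] .
      show ?thesis
      proof (cases "0 \<le> k")
        case True
        then have "near (y + 1) = y" "far (y + 1) = y + 1" by (auto simp: near_def far_def A_y_def)
        then show ?thesis using * True by (auto simp: step01_def x)
      next
        case False
        then have "near (y + 1) = y + 1" "far (y + 1) = y" by (auto simp: near_def far_def A_y_def)
        then show ?thesis using * False by (auto simp: step01_def x)
      qed
    qed
    have hor: "if lab (int n) (i, k) + int r < int N
        then 0 \<le> hgt M (i, k) - hgt M (i + 1, k) \<and> hgt M (i, k) - hgt M (i + 1, k) \<le> 1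
        else 0 \<le> hgt M (i + 1, k) - hgt M (i, k) \<and> hgt M (i + 1, k) - hgt M (i, k) \<le> 1"
    proof (cases "N < lb (A, y) + r")
      case True
      then have "\<not> lab (int n) (i, k) + int r < int N" using l by linarith
      then show ?thesis using H vs True by (cases "vedge (x, y) \<in> M") auto
    next
      case False
      then have "lab (int n) (i, k) + int r < int N" using l by linarith
      then show ?thesis using H vs False by (cases "vedge (x, y) \<in> M") auto
    qed
    have V: "step01 k (hgt M (i, k)) (hgt M (i, k + 1))" using st[of A A] rels by simp
    have D1: "step01 k (hgt M (i + 1, k)) (hgt M (i, k + 1))" if "lab (int n) (i, k) + int r + int s < int N"
    proof -
      have "lb (A, y) + r + s \<le> N" using that l by linarith
      then show ?thesis using st[of A "A + 1"] rels by simp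
    qed
    have D2: "step01 k (hgt M (i, k)) (hgt M (i + 1, k + 1))"
      if "lab (int n) (i, k) + int r < int N" "int N \<le> lab (int n) (i, k) + int s"
    proof -
      have "lb (A, y) + r \<le> N" "N < lb (A, y) + s" using that l by linarith+
      then show ?thesis using st[of "A + 1" A] rels by simp
    qed
    show ?thesis unfolding conf_at_def using hor V D1 D2 by blast
  qed
  show ?thesis unfolding conf_def using nn zero at by blast
qed

lemma hgt_inj:
  assumes M: "perfect_matching G M" "perfect_matching G M'" and e: "hgt M = hgt M'"
  shows "M = M'"
proof -
  have p: "pot (mdiff M) x y = pot (mdiff M') x y" for x y using hgt_fa[OF M(1)] hgt_fa[OF M(2)] e by simp
  have h: "mdiff M (hedge (x, y)) = mdiff M' (hedge (x, y))" for x y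
  proof -
    have "psg x y * mdiff M (hedge (x, y)) = psg x y * mdiff M' (hedge (x, y))"
      unfolding pot_near_far[OF mdiff_flow[OF M(1)], symmetric] pot_near_far[OF mdiff_flow[OF M(2)], symmetric] p ..
    then show ?thesis by (auto simp: psg_def split: if_splits)
  qed
  have v: "mdiff M (vedge (x, y)) = mdiff M' (vedge (x, y))" for x y
  proof -
    have "vsg x y * mdiff M (vedge (x, y)) = vsg x y * mdiff M' (vedge (x, y))"
      using pot_step[OF mdiff_flow[OF M(1)], of x y] pot_step[OF mdiff_flow[OF M(2)], of x y] unfolding p by linarith
    then show ?thesis by (auto simp: vsg_def split: if_splits)
  qed
  have "e \<in> M \<longleftrightarrow> e \<in> M'" for e
  proof (cases "e \<in> G")
    case True
    then consider a b where "e = hedge (a, b)" | a b where "e = vedge (a, b)" using G_lattice by fast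
    then have "mdiff M e = mdiff M' e" by cases (use h v in auto)
    then show ?thesis by (auto simp: mdiff_def split: if_splits)
  next
    case False
    then show ?thesis using M unfolding perfect_matching_def by blast
  qed
  then show ?thesis by blast
qed

text \<open>The signed jumps of h form a divergence-free function d. The bounds on the jumps say
  that the indicator of \<open>Mmin\<close> minus d only takes the values 0 and 1, so it is the
  indicator of a perfect matching.\<close>

lemma hgt_surj:
  assumes h: "h \<in> conf (int n)"
  shows "\<exists>M. perfect_matching G M \<and> hgt M = h"
proof -
  define hc where "hc x y = h (rel (fa x y))" for x y
  have h0: "hc x y = 0" if "\<not> inP x y" for x y
  proof -
    have "rel (fa x y) \<notin> pine (int n)" using that P_iff by (simp add: inP_def)
    then show ?thesis using h unfolding hc_def conf_def by blast
  qed
  have at: "conf_at (lab (int n) (i, k)) h i k" for i k using h by (simp add: conf_def)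
  have diffh: "hc x (near y) - hc x (far y) \<in> {0, 1}" for x y
  proof -
    define y' where "y' = y - 1"
    have y: "y = y' + 1" by (simp add: y'_def)
    define A where "A = fst (fa x y')"
    define D where "D = fst (fa x (y' + 1))"
    have A: "fa x y' = (A, y')" and D: "fa x (y' + 1) = (D, y' + 1)" unfolding A_def D_def by (metis prod.collapse snd_fa)+
    define k where "k = y' - B"
    have "step01 k (hc x y') (hc x (y' + 1))"
      using hedge_adj[OF A D]
    proof (elim disjE conjE)
      assume "D = A"
      then show ?thesis using at[of "A - C" k] unfolding conf_at_def hc_def A D rel_def k_def by (simp add: algebra_simps)
    next
      assume E: "A = D + 1" "lb (D, y') + r + s \<le> N"
      then have "lab (int n) (D - C, k) + int r + int s < int N" using lb_rel[of "(D, y')"] by (simp add: rel_def k_def)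
      then show ?thesis using at[of "D - C" k] E(1) unfolding conf_at_def hc_def A D rel_def k_def by (simp add: algebra_simps)
    next
      assume E: "D = A + 1" "lb (A, y') + r \<le> N" "N < lb (A, y') + s"
      then have "lab (int n) (A - C, k) + int r < int N" "int N \<le> lab (int n) (A - C, k) + int s"
        using lb_rel[of "(A, y')"] by (simp_all add: rel_def k_def)
      then show ?thesis using at[of "A - C" k] E(1) unfolding conf_at_def hc_def A D rel_def k_def by (simp add: algebra_simps)
    qed
    then show ?thesis unfolding y near_def far_def step01_def k_def by (auto split: if_splits)
  qed
  have diffv: "vsg x y * (hc x y - hc (x - 1) y) \<in> {0, 1}" for x y
  proof (cases "bd x y")
    case False then show ?thesis using not_bd[OF False] by (simp add: hc_def)
  next
    case True
    define A where "A = fst (fa x y) - 1"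
    have F: "fa x y = (A + 1, y)" unfolding A_def by (simp add: prod_eq_iff)
    have F': "fa (x - 1) y = (A, y)" using bd_left(1)[OF True] F by simp
    have l: "int (lb (A, y)) = lab (int n) (A - C, y - B) + 1" using lb_rel[of "(A, y)"] by (simp add: rel_def)
    have hh: "hc x y = h (A - C + 1, y - B)" "hc (x - 1) y = h (A - C, y - B)" unfolding hc_def F F' rel_def by (simp_all add: algebra_simps)
    have vs: "vsg x y = (if N < lb (A, y) + r then 1 else - 1)" using vsg_bd[OF True] small_right[of A y] F by simp
    show ?thesis
    proof (cases "N < lb (A, y) + r")
      case True
      then have "\<not> lab (int n) (A - C, y - B) + int r < int N" using l by linarith
      then show ?thesis using at[of "A - C" "y - B"] True unfolding vs hh conf_at_def by auto
    next
      case False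
      then have "lab (int n) (A - C, y - B) + int r < int N" using l by linarith
      then show ?thesis using at[of "A - C" "y - B"] False unfolding vs hh conf_at_def by auto
    qed
  qed
  define d where "d e = (if e \<in> range hedge then (case inv hedge e of (x, y) \<Rightarrow> psg x y * (hc x (near y) - hc x (far y)))
     else if e \<in> range vedge then (case inv vedge e of (x, y) \<Rightarrow> - (vsg x y * (hc x y - hc (x - 1) y))) else 0)" for e
  have dh: "d (hedge (x, y)) = psg x y * (hc x (near y) - hc x (far y))" for x y
    by (simp add: d_def inv_f_f[OF inj_hedge])
  have dv: "d (vedge (x, y)) = - (vsg x y * (hc x y - hc (x - 1) y))" for x y
  proof -
    have "vedge (x, y) \<notin> range hedge" by auto
    then show ?thesis by (simp add: d_def inv_f_f[OF inj_vedge])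
  qed
  have dout: "d e = 0" if "e \<notin> G" for e
  proof -
    consider a b where "e = hedge (a, b)" | a b where "e = vedge (a, b)" | "e \<notin> range hedge" "e \<notin> range vedge" by fast
    then show ?thesis
    proof cases
      case 1
      have "\<not> inP a (near b)" "\<not> inP a (far b)" using that inP_far[of a b] unfolding 1 hedge_G_near by blast+
      then show ?thesis unfolding 1 dh by (simp add: h0)
    next
      case 2
      show ?thesis
      proof (cases "bd a b")
        case True
        then have "\<not> inP a b" "\<not> inP (a - 1) b" using that unfolding 2 vedge_G by blast+
        then show ?thesis unfolding 2 dv by (simp add: h0)
      next
        case False
        then show ?thesis unfolding 2 dv hc_def by (simp add: not_bd)
      qed
    next
      case 3 then show ?thesis by (simp add: d_def)
    qed
  qed
  have div0: "(\<Sum>e\<in>edges_at p. d e) = 0" for p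
  proof -
    obtain x y where p: "p = (x, y)" by fastforce
    have e: "d (vedge (x, y)) + d (vedge (x, y - 1)) = d (vedge (x, near y)) + d (vedge (x, far y))"
      using near_far_cases[of y] by auto
    have "(\<Sum>e\<in>edges_at p. d e) = d (hedge (x, y)) + d (hedge (x - 1, y)) + (d (vedge (x, near y)) + d (vedge (x, far y)))"
      unfolding p sum_edges_at e[symmetric] by simp
    also have "\<dots> = 0" unfolding dh dv vsg_near_far psg_prev by (simp add: algebra_simps)
    finally show ?thesis .
  qed
  have fl: "flow d" unfolding flow_def using dout div0 by blast
  define M where "M = {e \<in> G. of_bool (e \<in> Mmin) - d e = 1}"
  have MG: "M \<subseteq> G" by (auto simp: M_def)
  have occ: "of_bool (e \<in> M) = of_bool (e \<in> Mmin) - d e" for e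
  proof (cases "e \<in> G")
    case False
    then show ?thesis using dout[OF False] Mmin_G MG by auto
  next
    case True
    then consider a b where "e = hedge (a, b)" | a b where "e = vedge (a, b)" using G_lattice by fast
    then have "of_bool (e \<in> Mmin) - d e \<in> {0, 1}"
    proof cases
      case 1
      then show ?thesis using diffh[of a b] True unfolding 1 dh hedge_Mmin psg_def by auto
    next
      case 2
      then show ?thesis using diffv[of a b] vedge_Mmin unfolding 2 dv by auto
    qed
    then show ?thesis using True by (auto simp: M_def)
  qed
  have PM: "perfect_matching G M"
    unfolding perfect_matching_iff[OF MG] occ sum_subtractf div0
    using perfect_matching_Mmin[unfolded perfect_matching_iff[OF Mmin_G]] by simp
  have "mdiff M = d" by (rule ext) (simp add: mdiff_def occ)
  have pd: "pot d x y = hc x y" for x y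
  proof -
    have st: "pot d x y - pot d (x - 1) y = hc x y - hc (x - 1) y" for x
    proof -
      have "vsg x y * (vsg x y * (hc x y - hc (x - 1) y)) = hc x y - hc (x - 1) y"
        unfolding mult.assoc[symmetric] psg_sq by simp
      then show ?thesis using pot_step[OF fl, of x y] by (simp add: dv)
    qed
    have lo: "pot d x y = hc x y" if "x < x_min" for x
    proof -
      have "\<not> inP x y"
      proof
        assume "inP x y"
        then have "hedge (x, y) \<in> G" by (simp add: hedge_G)
        then show False using hedge_x_min that by fastforce
      qed
      then show ?thesis using pot_far_left[OF that] h0 by simp
    qed
    show ?thesis
    proof (cases "x < x_min")
      case False
      then have "x_min - 1 \<le> x" by simp
      then show ?thesis
      proof (induction x rule: int_ge_induct)
        case (step i) then show ?case using st[of "i + 1"] by simp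
      qed (use lo in simp)
    qed (use lo in simp)
  qed
  have "hgt M (i, k) = h (i, k)" for i k
  proof -
    have "fa (X (C + i, B + k)) (B + k) = (C + i, B + k)" using fa_X[of "(C + i, B + k)"] by simp
    then show ?thesis unfolding hgt_def prod.case \<open>mdiff M = d\<close> pd hc_def by (simp add: rel_def)
  qed
  then have "hgt M = h" by auto
  then show ?thesis using PM by blast
qed

lemma hgt_bij: "bij_betw hgt {M. perfect_matching G M} (conf (int n))"
proof -
  have "hgt ` {M. perfect_matching G M} = conf (int n)"
    using hgt_conf hgt_surj by (auto simp: image_iff)
  then show ?thesis unfolding bij_betw_def inj_on_def using hgt_inj by blast
qed


section \<open>Weights of matchings\<close>

abbreviation xF :: "face \<Rightarrow> ratfun" where "xF F \<equiv> indet (lb F)"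
abbreviation ew :: "edge \<Rightarrow> ratfun" where "ew \<equiv> edge_weight r s N X"

lemma indet_nz: "indet i \<noteq> 0"
  using pos_ratfun(5) pos_ratfun(6)[of i] by metis

lemma ew_hedge: "ew (hedge (x, y)) = 1 / (xF (fa x y) * xF (fa x (y - 1)))"
proof -
  have "fa x y \<noteq> fa x (y - 1)" by (metis diff_zero diff_left_imp_eq snd_fa zero_neq_one)
  then have "(\<Prod>F\<in>{fa x y, fa x (y - 1)}. xF F) = xF (fa x y) * xF (fa x (y - 1))" by simp
  moreover have "{F. hedge (x, y) \<in> fe F} = {fa x y, fa x (y - 1)}" by (auto simp: hedge_face_iff)
  ultimately show ?thesis by (simp add: edge_weight_def)
qed

lemma ew_vedge: assumes "bd x y" shows "ew (vedge (x, y)) = 1 / (xF (fa x y) * xF (fa (x - 1) y))"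
proof -
  have "fa x y \<noteq> fa (x - 1) y" using bd_left(1)[OF assms] by (metis diff_zero diff_left_imp_eq fst_conv zero_neq_one)
  then have "(\<Prod>F\<in>{fa x y, fa (x - 1) y}. xF F) = xF (fa x y) * xF (fa (x - 1) y)" by simp
  moreover have "{F. vedge (x, y) \<in> fe F} = {fa x y, fa (x - 1) y}" using assms by (auto simp: vedge_face_iff)
  ultimately show ?thesis by (simp add: edge_weight_def)
qed

lemma ew_nz: "e \<in> G \<Longrightarrow> ew e \<noteq> 0"
proof -
  assume e: "e \<in> G"
  then consider a b where "e = hedge (a, b)" | a b where "e = vedge (a, b)" using G_lattice by fast
  then show ?thesis
  proof cases
    case 1 then show ?thesis using ew_hedge indet_nz by simp
  next
    case 2
    then have "bd a b" using e by (simp add: vedge_G)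
    then show ?thesis using 2 ew_vedge indet_nz by simp
  qed
qed

lemma bd_X: "bd (X F) (snd F)" "bd (X F + w F) (snd F)"
  "fa (X F + w F) (snd F) = (fst F + 1, snd F)" "fa (X F - 1) (snd F) = (fst F - 1, snd F)"
proof -
  show 1: "bd (X F) (snd F)" by (simp add: bd_def)
  show "fa (X F - 1) (snd F) = (fst F - 1, snd F)" using bd_left(1)[OF 1] by simp
  have e: "X (fst F + 1, snd F) = X F + w F" using X_right[of "fst F" "snd F"] by simp
  show 2: "fa (X F + w F) (snd F) = (fst F + 1, snd F)" using fa_X[of "(fst F + 1, snd F)"] by (simp add: e)
  show "bd (X F + w F) (snd F)" unfolding bd_def 2 e ..
qed

definition sg :: "face \<Rightarrow> int \<Rightarrow> int" where "sg F x = (if even (x - c + \<bar>snd F - B\<bar>) then 1 else - 1)"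

text \<open>Raising the height of \<open>F\<close> by one multiplies the weight of a matching by the product of
  \<open>ew e powi orient F e\<close> over the edges of \<open>F\<close>.\<close>

definition orient :: "face \<Rightarrow> edge \<Rightarrow> int" where
  "orient F e = (if e \<in> range hedge then - sg F (fst (inv hedge e))
     else if fst (inv vedge e) = X F then sg F (X F) else - sg F (fst (inv vedge e)))"

lemma orient_hedge: "orient F (hedge (x, y)) = - sg F x"
  by (simp add: orient_def inv_f_f[OF inj_hedge])

lemma orient_vedge: "orient F (vedge (x, y)) = (if x = X F then sg F x else - sg F x)"
proof -
  have "vedge (x, y) \<notin> range hedge" by auto
  then show ?thesis by (simp add: orient_def inv_f_f[OF inj_vedge])
qed

lemma sg_psg: "sg (fa x (near y)) x' = psg x' y" "sg (fa x (far y)) x' = - psg x' y"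
  using far_eq(1)[of y] by (auto simp: sg_def psg_def par_def)

text \<open>The jump of the potential across e, written as a sum over the faces at e. A face outside
  the pinecone may be left out because its height is 0.\<close>

lemma mdiff_orient:
  assumes M: "perfect_matching G M" and e: "e \<in> G"
  shows "- mdiff M e = (\<Sum>F\<in>{F \<in> P. e \<in> fe F}. orient F e * hgt M (rel F))"
proof -
  note fl = mdiff_flow[OF M]
  have zero: "hgt M (rel F) = 0" if "F \<notin> P" for F
    using hgt_conf[OF M] that P_iff unfolding conf_def by blast
  have ext: "(\<Sum>F\<in>{F \<in> P. e \<in> fe F}. orient F e * hgt M (rel F)) = (\<Sum>F\<in>{F. e \<in> fe F}. orient F e * hgt M (rel F))"
    if "finite {F. e \<in> fe F}"
    by (rule sum.mono_neutral_left) (use that zero in auto)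
  consider a b where "e = hedge (a, b)" | a b where "e = vedge (a, b)" using e G_lattice by fast
  then show ?thesis
  proof cases
    case 1
    have ne: "fa a (near b) \<noteq> fa a (far b)" proof -
      have "snd (fa a (near b)) \<noteq> snd (fa a (far b))" using near_far_cases[of b] by auto
      then show ?thesis by metis
    qed
    have S: "{F. e \<in> fe F} = {fa a (near b), fa a (far b)}" unfolding 1 using near_far_cases[of b] by (auto simp: hedge_face_iff)
    have "psg a b * mdiff M e = hgt M (rel (fa a (near b))) - hgt M (rel (fa a (far b)))"
      using pot_near_far[OF fl, of a b] unfolding 1 hgt_fa[OF M] by simp
    then have "psg a b * (psg a b * mdiff M e) = psg a b * (hgt M (rel (fa a (near b))) - hgt M (rel (fa a (far b))))" by simp
    then have "mdiff M e = psg a b * (hgt M (rel (fa a (near b))) - hgt M (rel (fa a (far b))))"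
      unfolding mult.assoc[symmetric] psg_sq by simp
    moreover have "(\<Sum>F\<in>{F \<in> P. e \<in> fe F}. orient F e * hgt M (rel F)) =
       - psg a b * hgt M (rel (fa a (near b))) + psg a b * hgt M (rel (fa a (far b)))"
      unfolding ext[unfolded S, simplified] using ne ext unfolding S by (simp add: 1 orient_hedge sg_psg)
    ultimately show ?thesis by (simp add: algebra_simps)
  next
    case 2
    have bd: "bd a b" using e unfolding 2 vedge_G by blast
    have X1: "X (fa a b) = a" using bd by (simp add: bd_def)
    have X2: "X (fa (a - 1) b) \<noteq> a" using fa_bounds(1)[of "a - 1" b] by linarith
    have ne: "fa a b \<noteq> fa (a - 1) b" using X1 X2 by metis
    have S: "{F. e \<in> fe F} = {fa a b, fa (a - 1) b}" unfolding 2 using bd by (auto simp: vedge_face_iff)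
    have sgs: "sg (fa a b) a = vsg a b" "sg (fa (a - 1) b) a = vsg a b" by (auto simp: sg_def vsg_def)
    have "vsg a b * mdiff M e = hgt M (rel (fa (a - 1) b)) - hgt M (rel (fa a b))"
      using pot_step[OF fl, of a b] unfolding 2 hgt_fa[OF M] by simp
    then have "vsg a b * (vsg a b * mdiff M e) = vsg a b * (hgt M (rel (fa (a - 1) b)) - hgt M (rel (fa a b)))" by simp
    then have "mdiff M e = vsg a b * (hgt M (rel (fa (a - 1) b)) - hgt M (rel (fa a b)))"
      unfolding mult.assoc[symmetric] psg_sq by simp
    moreover have "(\<Sum>F\<in>{F \<in> P. e \<in> fe F}. orient F e * hgt M (rel F)) =
       vsg a b * hgt M (rel (fa a b)) - vsg a b * hgt M (rel (fa (a - 1) b))"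
      using ne ext unfolding S by (simp add: 2 orient_vedge X1 X2 X2[symmetric] sgs)
    ultimately show ?thesis by (simp add: algebra_simps)
  qed
qed

lemma prod_powi: "(\<Prod>i\<in>I. f i) powi k = (\<Prod>i\<in>I. (f i :: ratfun) powi k)"
  by (induction I rule: infinite_finite_induct) (auto simp: power_int_mult_distrib)

lemma powi_sum: "finite I \<Longrightarrow> (a :: ratfun) \<noteq> 0 \<Longrightarrow> a powi (\<Sum>i\<in>I. f i) = (\<Prod>i\<in>I. a powi f i)"
  by (induction I rule: finite_induct) (auto simp: power_int_add)

definition face_mon :: "face \<Rightarrow> ratfun" where "face_mon F = (\<Prod>e\<in>fe F. ew e powi orient F e)"

lemma x_weight_eq:
  assumes M: "perfect_matching G M"
  shows "x_weight r s N X M = x_weight r s N X Mmin * (\<Prod>F\<in>P. face_mon F powi hgt M (rel F))"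
proof -
  have MG: "M \<subseteq> G" using M by (simp add: perfect_matching_def)
  have ind: "x_weight r s N X M' = (\<Prod>e\<in>G. ew e powi of_bool (e \<in> M'))" if "M' \<subseteq> G" for M'
    unfolding x_weight_def by (rule prod.mono_neutral_cong_left) (use that finite_G in auto)
  have feG: "fe F \<subseteq> G" if "F \<in> P" for F using that by (auto simp: graph_edges_def)
  have "x_weight r s N X M = (\<Prod>e\<in>G. ew e powi of_bool (e \<in> Mmin) * ew e powi (- mdiff M e))"
    unfolding ind[OF MG] by (intro prod.cong refl) (simp add: power_int_add[symmetric] ew_nz mdiff_def)
  also have "\<dots> = x_weight r s N X Mmin * (\<Prod>e\<in>G. ew e powi (- mdiff M e))"
    unfolding prod.distrib ind[OF Mmin_G] ..
  also have "(\<Prod>e\<in>G. ew e powi (- mdiff M e)) = (\<Prod>e\<in>G. \<Prod>F\<in>{F \<in> P. e \<in> fe F}. ew e powi (orient F e * hgt M (rel F)))"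
    by (intro prod.cong refl) (simp add: mdiff_orient[OF M] powi_sum finite_P ew_nz)
  also have "\<dots> = (\<Prod>F\<in>P. \<Prod>e\<in>{e \<in> G. e \<in> fe F}. ew e powi (orient F e * hgt M (rel F)))"
    by (rule prod.swap_restrict) (use finite_G finite_P in auto)
  also have "\<dots> = (\<Prod>F\<in>P. face_mon F powi hgt M (rel F))"
  proof (intro prod.cong refl)
    fix F assume "F \<in> P"
    then have "{e \<in> G. e \<in> fe F} = fe F" using feG by blast
    then show "(\<Prod>e\<in>{e \<in> G. e \<in> fe F}. ew e powi (orient F e * hgt M (rel F))) = face_mon F powi hgt M (rel F)"
      unfolding face_mon_def prod_powi by (simp add: power_int_mult)
  qed
  finally show ?thesis .
qed

lemma width_lb: "w F = (if lb F \<le> r \<or> N < lb F + r then 1 else 2)"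
  using width_eq[OF r0, of F] r0 by auto

lemma lb_left: "lb (A - 1, b) = (if lb (A, b) \<le> r then lb (A, b) + N - r else lb (A, b) - r)"
  using lb_right[of "A - 1" b] lb_bounds[of "(A - 1, b)"] r0 by (auto split: if_splits)

lemma lb_down: "lb (A, b - 1) = (if lb (A, b) \<le> s then lb (A, b) + N - s else lb (A, b) - s)"
  using lb_up[of A "b - 1"] lb_bounds[of "(A, b - 1)"] r0 by (auto split: if_splits)

lemma X_next: "X (A, b) < X (A + 1, b)" using X_right[of A b] w_bounds(1)[of "(A, b)"] by simp

lemma fa_I: "X (A, b) \<le> x \<Longrightarrow> x < X (A + 1, b) \<Longrightarrow> fa x b = (A, b)"
  using fa_eq_iff[of "(A, b)" x b] X_right[of A b] by auto

text \<open>The signs alternate around the face, so its own variable cancels. The neighbours that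
  remain depend on whether the face is the quadrilateral after a wrap of the labels, the one before
  it, or a hexagon.\<close>

lemma face_mon_eq: "face_mon F = nbr_mon (\<lambda>i. indet (nat i)) (int (lb F))"
proof -
  obtain A y where F: "F = (A, y)" by fastforce
  define x0 where "x0 = X F"
  define l where "l = lb F"
  have lF: "lb (A, y) = l" by (simp add: l_def F)
  have lbd: "1 \<le> l" "l \<le> N" using lb_bounds[of F] by (auto simp: l_def)
  have XA: "X (A, y) = x0" by (simp add: x0_def F)
  have nz: "\<And>i. indet i \<noteq> 0" by (rule indet_nz)
  have U1: "X (A, y + 1) = x0 + of_bool (lb (A - 1, y) + r + s \<le> N) - of_bool (lb (A - 1, y) + r \<le> N \<and> N < lb (A - 1, y) + s)"
    using X_up[of "A - 1" y] XA by simp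
  have U2: "X (A + 1, y + 1) = x0 + w F + of_bool (l + r + s \<le> N) - of_bool (l + r \<le> N \<and> N < l + s)"
    using X_up[of A y] X_right[of A y] XA lF by (simp add: F)
  have D1: "x0 = X (A, y - 1) + of_bool (lb (A - 1, y - 1) + r + s \<le> N) - of_bool (lb (A - 1, y - 1) + r \<le> N \<and> N < lb (A - 1, y - 1) + s)"
    using X_up[of "A - 1" "y - 1"] XA by simp
  have D2: "x0 + w F = X (A + 1, y - 1) + of_bool (lb (A, y - 1) + r + s \<le> N) - of_bool (lb (A, y - 1) + r \<le> N \<and> N < lb (A, y - 1) + s)"
    using X_up[of A "y - 1"] X_right[of A y] XA by (simp add: F)
  have lL: "lb (A - 1, y) = (if l \<le> r then l + N - r else l - r)" using lb_left[of A y] lF by simp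
  have lR: "lb (A + 1, y) = (if N < l + r then l + r - N else l + r)" using lb_right[of A y] lF by simp
  have lU: "lb (A, y + 1) = (if N < l + s then l + s - N else l + s)" using lb_up[of A y] lF by simp
  have lD: "lb (A, y - 1) = (if l \<le> s then l + N - s else l - s)" using lb_down[of A y] lF by simp
  have lLU: "lb (A - 1, y + 1) = (if lb (A, y + 1) \<le> r then lb (A, y + 1) + N - r else lb (A, y + 1) - r)" by (rule lb_left)
  have lRU: "lb (A + 1, y + 1) = (if N < lb (A, y + 1) + r then lb (A, y + 1) + r - N else lb (A, y + 1) + r)" by (rule lb_right)
  have lLD: "lb (A - 1, y - 1) = (if lb (A, y - 1) \<le> r then lb (A, y - 1) + N - r else lb (A, y - 1) - r)" by (rule lb_left)
  have lRD: "lb (A + 1, y - 1) = (if N < lb (A, y - 1) + r then lb (A, y - 1) + r - N else lb (A, y - 1) + r)" by (rule lb_right)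
  have ewL: "ew (vedge (x0, y)) = 1 / (indet l * indet (lb (A - 1, y)))"
    using ew_vedge[of x0 y] bd_X(1,4)[of F] fa_X[of F] by (simp add: x0_def F l_def)
  have ewR: "ew (vedge (x0 + w F, y)) = 1 / (indet (lb (A + 1, y)) * indet l)"
  proof -
    have "fa (x0 + w F - 1) y = F" using fa_eq_iff[of F "x0 + w F - 1" y] w_bounds(1)[of F] by (simp add: x0_def F)
    then show ?thesis using ew_vedge[of "x0 + w F" y] bd_X(2,3)[of F] by (simp add: x0_def F l_def)
  qed
  have ewT: "ew (hedge (x, y + 1)) = 1 / (xF (fa x (y + 1)) * indet l)" "ew (hedge (x, y)) = 1 / (indet l * xF (fa x (y - 1)))"
    if "x0 \<le> x" "x < x0 + w F" for x
  proof -
    have "fa x y = F" using fa_eq_iff[of F x y] that by (simp add: x0_def F)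
    then show "ew (hedge (x, y + 1)) = 1 / (xF (fa x (y + 1)) * indet l)" "ew (hedge (x, y)) = 1 / (indet l * xF (fa x (y - 1)))"
      using ew_hedge[of x "y + 1"] ew_hedge[of x y] by (simp_all add: l_def)
  qed
  have small: "l \<le> r \<longleftrightarrow> even (x0 - c + \<bar>y - B\<bar>)" using small_iff[of F] by (simp add: l_def x0_def F)
  have sg: "sg F x = (if even (x - c + \<bar>y - B\<bar>) then 1 else - 1)" for x by (simp add: sg_def F)
  have fe: "fe F = hedge ` ({x0..<x0 + w F} \<times> {y, y + 1}) \<union> vedge ` ({x0, x0 + w F} \<times> {y})"
    unfolding face_edges_eq x0_def F by simp
  consider (sm) "l \<le> r" | (lg) "N < l + r" | (hx) "r < l" "l + r \<le> N" by linarith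
  then show ?thesis
  proof cases
    case sm
    have w1: "w F = 1" using width_lb[of F] sm by (simp add: l_def)
    have s0: "sg F x0 = 1" "sg F (x0 + 1) = - 1" using small sm by (auto simp: sg)
    have fT: "fa x0 (y + 1) = (A, y + 1)"
      using U1 X_next[of A "y + 1"] sm lL r0 lbd by (intro fa_I) auto
    have fD: "fa x0 (y - 1) = (A, y - 1)"
      using D1 X_next[of A "y - 1"] sm lLD lD r0 lbd by (intro fa_I) auto
    have "fe F = {hedge (x0, y), hedge (x0, y + 1), vedge (x0, y), vedge (x0 + 1, y)}"
      unfolding fe w1 by auto
    then have "face_mon F = ew (hedge (x0, y)) powi - 1 * ew (hedge (x0, y + 1)) powi - 1 * ew (vedge (x0, y)) * ew (vedge (x0 + 1, y))"
      unfolding face_mon_def using s0 by (simp add: orient_hedge orient_vedge x0_def[symmetric])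
    also have "\<dots> = xF (A, y - 1) * xF (A, y + 1) / (xF (A - 1, y) * xF (A + 1, y))"
    proof -
      have e: "ew (hedge (x0, y + 1)) = 1 / (xF (A, y + 1) * indet l)" "ew (hedge (x0, y)) = 1 / (indet l * xF (A, y - 1))"
        "ew (vedge (x0 + 1, y)) = 1 / (indet (lb (A + 1, y)) * indet l)"
        using ewT[of x0] ewR fT fD w1 by simp_all
      show ?thesis unfolding e ewL using nz by (simp add: power_int_minus field_simps)
    qed
    also have "\<dots> = nbr_mon (\<lambda>i. indet (nat i)) (int l)"
      unfolding nbr_mon_def lL lR lU lD using sm r0 lbd
      by (simp add: nat_add_distrib nat_diff_distrib field_simps flip: of_nat_add)
    finally show ?thesis by (simp add: l_def)
  next
    case lg
    have w1: "w F = 1" using width_lb[of F] lg by (simp add: l_def)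
    have ns: "\<not> l \<le> r" using lg r0 by simp
    have s0: "sg F x0 = - 1" "sg F (x0 + 1) = 1" using small ns by (auto simp: sg)
    have fT: "fa x0 (y + 1) = (A, y + 1)"
      using U1 U2 w1 lg ns lL r0 lbd by (intro fa_I) auto
    have fD: "fa x0 (y - 1) = (A, y - 1)"
      using D2 X_next[of A "y - 1"] w1 lg lD r0 lbd by (intro fa_I) auto
    have "fe F = {hedge (x0, y), hedge (x0, y + 1), vedge (x0, y), vedge (x0 + 1, y)}"
      unfolding fe w1 by auto
    then have "face_mon F = ew (hedge (x0, y)) * ew (hedge (x0, y + 1)) * ew (vedge (x0, y)) powi - 1 * ew (vedge (x0 + 1, y)) powi - 1"
      unfolding face_mon_def using s0 by (simp add: orient_hedge orient_vedge x0_def[symmetric])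
    also have "\<dots> = xF (A - 1, y) * xF (A + 1, y) / (xF (A, y - 1) * xF (A, y + 1))"
    proof -
      have e: "ew (hedge (x0, y + 1)) = 1 / (xF (A, y + 1) * indet l)" "ew (hedge (x0, y)) = 1 / (indet l * xF (A, y - 1))"
        "ew (vedge (x0 + 1, y)) = 1 / (indet (lb (A + 1, y)) * indet l)"
        using ewT[of x0] ewR fT fD w1 by simp_all
      show ?thesis unfolding e ewL using nz by (simp add: power_int_minus field_simps)
    qed
    also have "\<dots> = nbr_mon (\<lambda>i. indet (nat i)) (int l)"
      unfolding nbr_mon_def lL lR lU lD using lg r0 lbd
      by (simp add: nat_add_distrib nat_diff_distrib field_simps flip: of_nat_add)
    finally show ?thesis by (simp add: l_def)
  next
    case hx
    have w2: "w F = 2" using width_lb[of F] hx by (simp add: l_def)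
    have s0: "sg F x0 = - 1" "sg F (x0 + 1) = 1" "sg F (x0 + 2) = - 1" using small hx by (auto simp: sg)
    have i2: "{x0..<x0 + 2} = {x0, x0 + 1}" by auto
    have "fe F = {hedge (x0, y), hedge (x0, y + 1), hedge (x0 + 1, y), hedge (x0 + 1, y + 1), vedge (x0, y), vedge (x0 + 2, y)}"
      unfolding fe w2 i2 by auto
    then have fm: "face_mon F = ew (hedge (x0, y)) * ew (hedge (x0, y + 1)) * ew (hedge (x0 + 1, y)) powi - 1 *
        ew (hedge (x0 + 1, y + 1)) powi - 1 * ew (vedge (x0, y)) powi - 1 * ew (vedge (x0 + 2, y))"
      unfolding face_mon_def using s0 by (simp add: orient_hedge orient_vedge x0_def[symmetric])
    have fm2: "face_mon F = xF (fa (x0 + 1) (y + 1)) * xF (fa (x0 + 1) (y - 1)) * xF (A - 1, y) /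
        (xF (fa x0 (y + 1)) * xF (fa x0 (y - 1)) * xF (A + 1, y))"
    proof -
      have e: "ew (hedge (x0, y + 1)) = 1 / (xF (fa x0 (y + 1)) * indet l)" "ew (hedge (x0, y)) = 1 / (indet l * xF (fa x0 (y - 1)))"
        "ew (hedge (x0 + 1, y + 1)) = 1 / (xF (fa (x0 + 1) (y + 1)) * indet l)"
        "ew (hedge (x0 + 1, y)) = 1 / (indet l * xF (fa (x0 + 1) (y - 1)))"
        "ew (vedge (x0 + 2, y)) = 1 / (indet (lb (A + 1, y)) * indet l)"
        using ewT[of x0] ewT[of "x0 + 1"] ewR w2 by simp_all
      show ?thesis unfolding fm e ewL using nz by (simp add: power_int_minus field_simps)
    qed
    \<comment> \<open>Above a hexagon lie its vertical neighbour and one diagonal neighbour, to the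
      left of it or to the right according to l + s <= N. The same happens below.\<close>
    have T: "xF (fa (x0 + 1) (y + 1)) / xF (fa x0 (y + 1)) =
        (if l + s \<le> N then indet (l + s) / indet (l + s - r) else indet (l + r + s - N) / indet (l + s - N))"
    proof (cases "l + s \<le> N")
      case True
      have X1: "X (A, y + 1) = x0 + 1" using U1 lL hx True by simp
      have "fa (x0 + 1) (y + 1) = (A, y + 1)" using X1 X_next[of A "y + 1"] by (intro fa_I) auto
      moreover have "fa x0 (y + 1) = (A - 1, y + 1)" using X1 X_next[of "A - 1" "y + 1"] by (intro fa_I) auto
      ultimately show ?thesis using True lU lLU r0 by simp
    next
      case False
      have X1: "X (A + 1, y + 1) = x0 + 1" using U2 w2 hx False by simp
      have "fa (x0 + 1) (y + 1) = (A + 1, y + 1)" using X1 X_next[of "A + 1" "y + 1"] by (intro fa_I) auto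
      moreover have "fa x0 (y + 1) = (A, y + 1)" using X1 X_next[of A "y + 1"] by (intro fa_I) auto
      moreover have "lb (A, y + 1) = l + s - N" "lb (A + 1, y + 1) = l + r + s - N" using False lU lRU hx r0 by auto
      ultimately show ?thesis using False by simp
    qed
    have D: "xF (fa (x0 + 1) (y - 1)) / xF (fa x0 (y - 1)) =
        (if s < l then indet (l - s + r) / indet (l - s) else indet (l + N - s) / indet (l + N - r - s))"
    proof (cases "s < l")
      case True
      have X1: "X (A + 1, y - 1) = x0 + 1" using D2 w2 lD hx True by simp
      have "fa (x0 + 1) (y - 1) = (A + 1, y - 1)" using X1 X_next[of "A + 1" "y - 1"] by (intro fa_I) auto
      moreover have "fa x0 (y - 1) = (A, y - 1)" using X1 X_next[of A "y - 1"] by (intro fa_I) auto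
      moreover have "lb (A, y - 1) = l - s" "lb (A + 1, y - 1) = l - s + r" using True lD lRD hx r0 by auto
      ultimately show ?thesis using True by simp
    next
      case False
      have lD': "lb (A, y - 1) = l + N - s" "lb (A - 1, y - 1) = l + N - r - s" using False lD lLD hx r0 by auto
      have "\<not> lb (A - 1, y - 1) + r + s \<le> N" "lb (A - 1, y - 1) + r \<le> N" "N < lb (A - 1, y - 1) + s"
        unfolding lD' using False hx r0 lbd by linarith+
      then have X1: "X (A, y - 1) = x0 + 1" using D1 by simp
      have "fa (x0 + 1) (y - 1) = (A, y - 1)" using X1 X_next[of A "y - 1"] by (intro fa_I) auto
      moreover have "fa x0 (y - 1) = (A - 1, y - 1)" using X1 X_next[of "A - 1" "y - 1"] by (intro fa_I) auto
      ultimately show ?thesis using False lD' by simp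
    qed
    have "face_mon F = (xF (fa (x0 + 1) (y + 1)) / xF (fa x0 (y + 1))) * (xF (fa (x0 + 1) (y - 1)) / xF (fa x0 (y - 1))) *
        (xF (A - 1, y) / xF (A + 1, y))" unfolding fm2 by simp
    also have "\<dots> = nbr_mon (\<lambda>i. indet (nat i)) (int l)"
      unfolding T D lL lR nbr_mon_def using hx r0 lbd
      by (cases "l + s \<le> N"; cases "s < l") (simp_all add: nat_add_distrib nat_diff_distrib field_simps flip: of_nat_add of_nat_diff)
    finally show ?thesis by (simp add: l_def)
  qed
qed

lemma matching_sum:
  "(\<Sum>M | perfect_matching G M. x_weight r s N X M * y_weight r s N X P M) =
    x_weight r s N X Mmin * fpoly (int n) (\<lambda>l. indet (N + nat l + 1) * nbr_mon (\<lambda>i. indet (nat i)) (l + 1))"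
proof -
  define Y where "Y l = indet (N + nat l + 1) * nbr_mon (\<lambda>i. indet (nat i)) (l + 1)" for l
  have bij: "bij_betw rel P (pine (int n))"
    by (rule bij_betwI[of _ _ _ "\<lambda>(i, k). (C + i, B + k)"]) (auto simp: P_iff, auto simp: rel_def)
  have "x_weight r s N X M * y_weight r s N X P M =
      x_weight r s N X Mmin * (\<Prod>F\<in>pine (int n). Y (lab (int n) F) powi hgt M F)"
    if M: "perfect_matching G M" for M
  proof -
    have "x_weight r s N X M * y_weight r s N X P M = x_weight r s N X Mmin *
        (\<Prod>F\<in>P. face_mon F powi hgt M (rel F) * indet (N + lb F) ^ height r s N X P M F)"
      unfolding x_weight_eq[OF M] y_weight_def prod.distrib by simp
    also have "(\<Prod>F\<in>P. face_mon F powi hgt M (rel F) * indet (N + lb F) ^ height r s N X P M F) =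
        (\<Prod>F\<in>P. Y (lab (int n) (rel F)) powi hgt M (rel F))"
    proof (intro prod.cong refl)
      fix F assume F: "F \<in> P"
      have h: "hgt M (rel F) = int (height r s N X P M F)" using height_eq[OF M F] by (simp add: hgt_rel)
      have l: "lab (int n) (rel F) = int (lb F) - 1" using lb_rel[of F] by simp
      have "Y (lab (int n) (rel F)) = indet (N + lb F) * face_mon F"
        unfolding Y_def l face_mon_eq using lb_bounds(1)[of F] by (simp add: nat_diff_distrib)
      then show "face_mon F powi hgt M (rel F) * indet (N + lb F) ^ height r s N X P M F = Y (lab (int n) (rel F)) powi hgt M (rel F)"
        unfolding h by (simp add: power_mult_distrib mult.commute)
    qed
    also have "\<dots> = (\<Prod>F\<in>pine (int n). Y (lab (int n) F) powi hgt M F)"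
      by (rule prod.reindex_bij_betw[OF bij])
    finally show ?thesis .
  qed
  then have "(\<Sum>M | perfect_matching G M. x_weight r s N X M * y_weight r s N X P M) =
      x_weight r s N X Mmin * (\<Sum>M\<in>{M. perfect_matching G M}. \<Prod>F\<in>pine (int n). Y (lab (int n) F) powi hgt M F)"
    unfolding sum_distrib_left by (intro sum.cong) auto
  also have "(\<Sum>M\<in>{M. perfect_matching G M}. \<Prod>F\<in>pine (int n). Y (lab (int n) F) powi hgt M F) = fpoly (int n) Y"
    unfolding fpoly_def by (rule sum.reindex_bij_betw[OF hgt_bij])
  finally show ?thesis unfolding Y_def .
qed

end


section \<open>The covering monomial\<close>

context gr_params
begin

text \<open>The solution of \<open>\<xi>\<^sub>n \<xi>\<^bsub>n-N\<^esub> = \<xi>\<^bsub>n-r\<^esub> \<xi>\<^bsub>n-N+r\<^esub>\<close> with initial values \<open>x\<^sub>1, \<dots>, x\<^sub>N\<close>: the quotient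
  \<open>\<xi>\<^sub>n / \<xi>\<^bsub>n-N+r\<^esub>\<close> is \<open>r\<close>-periodic in \<open>n\<close>.\<close>

definition lead :: "int \<Rightarrow> ratfun" where
  "lead j = (if j \<le> int N then indet (nat j)
     else (let K = j - int N - 1; D = int N - int r in
       indet (nat (K mod D + int r + 1)) *
       (\<Prod>b\<in>{0..K div D}. indet (nat (D + (K - b * int N) mod int r + 1)) / indet (nat ((K - b * int N) mod int r + 1)))))"

lemma lead_nz: "lead j \<noteq> 0"
proof -
  have "indet i \<noteq> 0" for i using pos_ratfun(5) pos_ratfun(6)[of i] by metis
  then show ?thesis by (simp add: lead_def Let_def)
qed

text \<open>Advancing by D = N - r multiplies \<open>lead\<close> by \<open>\<rho>\<close> of K mod
  r. The indices n and n - r have the same residue, so the quotients over n - N + r and over n - N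
  agree.\<close>

lemma lead_rec:
  assumes n: "int N < n"
  shows "lead n * lead (n - int N) = lead (n - int r) * lead (n - int N + int r)"
proof -
  define D where "D = int N - int r"
  define \<rho> where "\<rho> t = indet (nat (D + t + 1)) / indet (nat (t + 1))" for t
  have Dp: "0 < D" "int r < D" using r0 by (auto simp: D_def)
  have L: "lead (K + int N + 1) = indet (nat (K mod D + int r + 1)) * (\<Prod>b\<in>{0..K div D}. \<rho> ((K - b * int N) mod int r))"
    if "0 \<le> K" for K using that by (simp add: lead_def Let_def D_def \<rho>_def)
  have neg: "lead (K + int N + 1) = indet (nat (K + int N + 1))" if "K < 0" for K using that by (simp add: lead_def)
  have step: "lead (K + int N + 1) = \<rho> (K mod int r) * lead (K - D + int N + 1)" if K: "0 \<le> K" for K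
  proof (cases "D \<le> K")
    case True
    have m: "(K - D) mod D = K mod D" by simp
    have d: "(K - D) div D = K div D - 1" using Dp(1) div_add_self2[of D "K - D"] by simp
    have "K div D \<ge> 1" using True Dp(1) by (simp add: pos_imp_zdiv_pos_iff int_one_le_iff_zero_less)
    then have I: "{0..K div D} = insert 0 ((\<lambda>b. b + 1) ` {0..K div D - 1})"
    proof (intro equalityI subsetI)
      fix b assume "b \<in> {0..K div D}"
      then show "b \<in> insert 0 ((\<lambda>b. b + 1) ` {0..K div D - 1})" by (cases "b = 0") (auto intro!: image_eqI[of _ _ "b - 1"])
    qed auto
    have sh: "(K - (b + 1) * int N) mod int r = (K - D - b * int N) mod int r" for b
    proof -
      have E: "K - D - b * int N = K - (b + 1) * int N + int r" by (simp add: D_def algebra_simps)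
      show ?thesis unfolding E mod_add_self2 ..
    qed
    have "(\<Prod>b\<in>(\<lambda>b. b + 1) ` {0..K div D - 1}. \<rho> ((K - b * int N) mod int r)) =
        (\<Prod>b\<in>{0..K div D - 1}. \<rho> ((K - D - b * int N) mod int r))"
      by (rule prod.reindex_cong[of "\<lambda>b. b + 1"]) (auto simp: inj_on_def sh)
    then have "(\<Prod>b\<in>{0..K div D}. \<rho> ((K - b * int N) mod int r)) =
        \<rho> (K mod int r) * (\<Prod>b\<in>{0..K div D - 1}. \<rho> ((K - D - b * int N) mod int r))"
      unfolding I by (subst prod.insert) auto
    then show ?thesis using L[OF K] L[of "K - D"] True unfolding m d by simp
  next
    case False
    then have "K div D = 0" "K mod D = K" using K by auto
    then show ?thesis using L[OF K] neg[of "K - D"] False by (simp add: D_def algebra_simps)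
  qed
  define K where "K = n - int N - 1"
  have K: "0 \<le> K" using n by (simp add: K_def)
  have e: "n = K + int N + 1" "n - int N + int r = K - D + int N + 1" "n - int r = (K - int r) + int N + 1"
     "n - int N = (K - int N) + int N + 1" by (auto simp: K_def D_def)
  have main: "\<rho> (K mod int r) * lead ((K - int N) + int N + 1) = lead ((K - int r) + int N + 1)"
  proof (cases "int r \<le> K")
    case True
    have "lead ((K - int r) + int N + 1) = \<rho> ((K - int r) mod int r) * lead ((K - int r) - D + int N + 1)"
      using True by (intro step) simp
    moreover have "(K - int r) - D = K - int N" by (simp add: D_def)
    ultimately show ?thesis by simp
  next
    case False
    then have "K mod int r = K" using K by simp
    moreover have "indet i \<noteq> 0" for i using pos_ratfun(5) pos_ratfun(6)[of i] by metis
    ultimately show ?thesis using neg[of "K - int N"] neg[of "K - int r"] False r0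
      by (simp add: \<rho>_def D_def algebra_simps)
  qed
  have "lead n = \<rho> (K mod int r) * lead (n - int N + int r)" unfolding e(2) unfolding e(1) by (rule step[OF K])
  then have "lead n * lead (n - int N) = (\<rho> (K mod int r) * lead ((K - int N) + int N + 1)) * lead (n - int N + int r)"
    using e(4) by simp
  then show ?thesis unfolding main e(3)[symmetric] .
qed

end

context drawn_pinecone
begin

section \<open>Counting edges around a face\<close>

lemma card_fe_Int:
  "int (card (fe F \<inter> T)) = (\<Sum>x\<in>{X F..<X F + w F}. of_bool (hedge (x, snd F) \<in> T) + of_bool (hedge (x, snd F + 1) \<in> T))
     + of_bool (vedge (X F, snd F) \<in> T) + of_bool (vedge (X F + w F, snd F) \<in> T)"
proof -
  let ?I = "{X F..<X F + w F}" and ?y = "snd F"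
  have "int (card (fe F \<inter> T)) = (\<Sum>e\<in>fe F. of_bool (e \<in> T))"
    using finite_fe[of F] by (simp add: of_bool_def sum.If_cases)
  also have "\<dots> = (\<Sum>e\<in>hedge ` (?I \<times> {?y, ?y + 1}). of_bool (e \<in> T)) + (\<Sum>e\<in>vedge ` ({X F, X F + w F} \<times> {?y}). of_bool (e \<in> T))"
    unfolding face_edges_eq by (rule sum.union_disjoint) auto
  also have "(\<Sum>e\<in>hedge ` (?I \<times> {?y, ?y + 1}). of_bool (e \<in> T)) = (\<Sum>p\<in>?I \<times> {?y, ?y + 1}. (of_bool (hedge p \<in> T) :: int))"
    by (subst sum.reindex) (auto simp: inj_on_def)
  also have "\<dots> = (\<Sum>x\<in>?I. \<Sum>y\<in>{?y, ?y + 1}. of_bool (hedge (x, y) \<in> T))"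
    unfolding sum.cartesian_product by (intro sum.cong refl) auto
  also have "\<dots> = (\<Sum>x\<in>?I. of_bool (hedge (x, ?y) \<in> T) + of_bool (hedge (x, ?y + 1) \<in> T))"
    by (intro sum.cong refl, subst sum.insert) auto
  also have "(\<Sum>e\<in>vedge ` ({X F, X F + w F} \<times> {?y}). of_bool (e \<in> T)) = (\<Sum>p\<in>{X F, X F + w F} \<times> {?y}. (of_bool (vedge p \<in> T) :: int))"
    by (subst sum.reindex) (auto simp: inj_on_def)
  also have "\<dots> = (\<Sum>x\<in>{X F, X F + w F}. \<Sum>y\<in>{?y}. of_bool (vedge (x, y) \<in> T))"
    unfolding sum.cartesian_product by (intro sum.cong refl) auto
  also have "\<dots> = of_bool (vedge (X F, ?y) \<in> T) + of_bool (vedge (X F + w F, ?y) \<in> T)" using w_bounds(1)[of F] by simp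
  finally show ?thesis by (simp add: add.assoc)
qed

lemma cells_inP: "X F \<le> x \<Longrightarrow> x < X F + w F \<Longrightarrow> inP x (snd F) \<longleftrightarrow> F \<in> P"
  using fa_eq_iff[of F x "snd F"] by (auto simp: inP_def)

definition inner :: "int \<Rightarrow> int" where "inner y = (if B < y then y - 1 else y + 1)"

lemma inner_facts:
  assumes "y \<noteq> B"
  shows "near y = y \<and> near (y + 1) = inner y \<or> near y = inner y \<and> near (y + 1) = y"
    "\<bar>inner y - B\<bar> = \<bar>y - B\<bar> - 1" "qq (y - B) + 1 \<le> qq (inner y - B)"
    "inP x y \<Longrightarrow> inP x (inner y)" "mm (inner y - B) \<le> mm (y - B) + (int N - int s)"
proof -
  define y' where "y' = (if B < y then y else y + 1)"
  have nf: "far y' = y" "near y' = inner y" using assms by (auto simp: y'_def inner_def near_def far_def)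
  show "near y = y \<and> near (y + 1) = inner y \<or> near y = inner y \<and> near (y + 1) = y"
    using assms by (auto simp: inner_def near_def)
  show "\<bar>inner y - B\<bar> = \<bar>y - B\<bar> - 1" using far_eq(1)[of y'] nf by simp
  show "qq (y - B) + 1 \<le> qq (inner y - B)" using far_eq(2)[of y'] nf by simp
  show "inP x y \<Longrightarrow> inP x (inner y)" using inP_far[of x y'] nf by simp
  have "max (k * (int N - int s)) (- k * int s) = (if 0 \<le> k then k * (int N - int s) else - k * int s)" for k
  proof (cases "0 \<le> k")
    case True
    then have "- k * int s \<le> 0" "0 \<le> k * (int N - int s)" using r0 by (auto simp: mult_nonneg_nonneg)
    then show ?thesis using True by (simp only: if_True)
  next
    case False
    then have "0 \<le> - k * int s" "k * (int N - int s) \<le> 0" using r0 by (auto simp: mult_nonpos_nonneg)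
    then show ?thesis using False by (simp only: if_False)
  qed
  then show "mm (inner y - B) \<le> mm (y - B) + (int N - int s)"
    using assms r0 unfolding mm_def inner_def by (auto simp: algebra_simps)
qed

text \<open>Labels up to r occur once per wrap. Beyond the left end of the strip in the row of F,
  the next such face is about 2 (N - r) / r columns away, whereas the strip towards the centre
  overhangs by only about 2 (N - s) / r, and r < s. On the right it overhangs by one column, of the
  wrong parity.\<close>

lemma small_outside:
  assumes small: "lb F \<le> r" and out: "F \<notin> P" and y: "snd F \<noteq> B"
  shows "\<not> inP (X F) (inner (snd F))"
proof
  assume inn: "inP (X F) (inner (snd F))"
  define k where "k = snd F - B"
  define i where "i = fst F - C"
  define ww where "ww = mm k + i * int r"
  define z where "z = ww div int N"
  define q' where "q' = qq (inner (snd F) - B)"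
  define a where "a = \<bar>k\<bar>"
  have XF: "X F = c - a + 2 * (i - z)" using X_parity[of F] small by (simp add: k_def i_def ww_def z_def a_def)
  have I: "c - a + 1 - 2 * q' \<le> X F" "X F \<le> c - a + 1"
    using inn inner_facts(2)[OF y] unfolding inP_iff by (auto simp: k_def a_def q'_def)
  have "2 * (i - z) \<le> 1" "1 - 2 * q' \<le> 2 * (i - z)" using I unfolding XF by linarith+
  then have iz: "i \<le> z" "1 - q' \<le> i - z" by presburger+
  have wN: "ww = z * int N + ww mod int N" "0 \<le> ww mod int N" using N0 by (auto simp: z_def)
  have lw: "ww mod int N < int r"
    using small lb_rel[of F] mm_mod[of k i] by (simp add: rel_def i_def k_def ww_def)
  have "rel F \<notin> pine (int n)" using out P_iff by simp
  then have "\<not> (max (- i * int r) (i * (int N - int r)) \<le> mm k)"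
    by (simp add: pine_def dst_def rel_def i_def k_def mm_def algebra_simps)
  then have "ww < 0 \<or> ww < i * int N" by (auto simp: ww_def algebra_simps)
  moreover have "i * int N \<le> z * int N" using iz(1) by (intro mult_right_mono) auto
  ultimately have "ww < 0" using wN by linarith
  then have "z < 0" unfolding z_def using N0 by (intro div_neg_pos_less0) auto
  then have z1: "z \<le> - 1" by simp
  have "int r * q' \<le> mm (inner (snd F) - B)"
  proof -
    have "q' * int r + mm (inner (snd F) - B) mod int r = mm (inner (snd F) - B)" by (simp add: q'_def qq_def)
    moreover have "0 \<le> mm (inner (snd F) - B) mod int r" using r0 by simp
    ultimately show ?thesis by (simp add: mult.commute)
  qed
  also have "\<dots> \<le> mm k + (int N - int s)" using inner_facts(5)[OF y] by (simp add: k_def)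
  finally have 1: "int r * q' \<le> mm k + (int N - int s)" .
  have "int r * (1 - i + z) \<le> int r * q'" using iz(2) by (intro mult_left_mono) auto
  then have "int r + int r * z \<le> ww + (int N - int s)" using 1 unfolding ww_def by (simp add: algebra_simps)
  then have "int r + int r * z \<le> z * int N + int r - 1 + (int N - int s)" using wN lw by linarith
  then have 2: "1 + int s - int N \<le> (int N - int r) * z" by (simp add: algebra_simps)
  have "(int N - int r) * z \<le> (int N - int r) * (- 1)" using z1 r0 by (intro mult_left_mono) auto
  with 2 have "1 + int s - int N \<le> (int N - int r) * (- 1)" by (rule order_trans)
  then show False using r0 by simp
qed

definition adj :: "face set" where "adj = {F. F \<notin> P \<and> fe F \<inter> G \<noteq> {}}"

definition mu :: "face \<Rightarrow> nat" where "mu F = card (fe F \<inter> Mmin)"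

lemma card_fe: "card (fe F) div 2 - 1 = nat (w F)"
proof -
  have "int (card (fe F \<inter> UNIV)) = 2 * w F + 2" unfolding card_fe_Int using w_bounds(1)[of F] by simp
  then show ?thesis using w_bounds(1)[of F] by simp
qed

lemma par_own: "near y' = y \<Longrightarrow> par x y' \<longleftrightarrow> even (x - c + \<bar>y - B\<bar>)"
  by (simp add: par_def)

lemma mu_sum: "int (mu F) = (\<Sum>x\<in>{X F..<X F + w F}. of_bool (par x (snd F) \<and> inP x (near (snd F)))
    + of_bool (par x (snd F + 1) \<and> inP x (near (snd F + 1))))"
  unfolding mu_def card_fe_Int using vedge_Mmin by (simp add: hedge_Mmin hedge_G_near)

lemma par_inner: "y \<noteq> B \<Longrightarrow> near y' = inner y \<Longrightarrow> par x y' \<longleftrightarrow> odd (x - c + \<bar>y - B\<bar>)"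
  unfolding par_def using inner_facts(2)[of y] by simp

lemma mu_off_center:
  assumes "snd F \<noteq> B"
  shows "int (mu F) = (\<Sum>x\<in>{X F..<X F + w F}. of_bool (even (x - c + \<bar>snd F - B\<bar>) \<and> F \<in> P)
    + of_bool (odd (x - c + \<bar>snd F - B\<bar>) \<and> inP x (inner (snd F))))"
  unfolding mu_sum
proof (intro sum.cong refl)
  fix x assume "x \<in> {X F..<X F + w F}"
  then have i: "inP x (snd F) \<longleftrightarrow> F \<in> P" using cells_inP[of F x] by auto
  show "(of_bool (par x (snd F) \<and> inP x (near (snd F))) + of_bool (par x (snd F + 1) \<and> inP x (near (snd F + 1))) :: int) =
      of_bool (even (x - c + \<bar>snd F - B\<bar>) \<and> F \<in> P) + of_bool (odd (x - c + \<bar>snd F - B\<bar>) \<and> inP x (inner (snd F)))"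
    using inner_facts(1)[OF assms]
  proof
    assume a: "near (snd F) = snd F \<and> near (snd F + 1) = inner (snd F)"
    show ?thesis using par_own[of "snd F" "snd F" x] par_inner[OF assms, of "snd F + 1" x] a i by simp
  next
    assume a: "near (snd F) = inner (snd F) \<and> near (snd F + 1) = snd F"
    show ?thesis using par_own[of "snd F + 1" "snd F" x] par_inner[OF assms, of "snd F" x] a i by simp
  qed
qed

lemma mu_center:
  assumes "snd F = B"
  shows "int (mu F) = (\<Sum>x\<in>{X F..<X F + w F}. 2 * of_bool (even (x - c) \<and> F \<in> P))"
  unfolding mu_sum
proof (intro sum.cong refl)
  fix x assume "x \<in> {X F..<X F + w F}"
  then have i: "inP x (snd F) \<longleftrightarrow> F \<in> P" using cells_inP[of F x] by auto
  have "near (snd F) = snd F" "near (snd F + 1) = snd F" using assms by (auto simp: near_def)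
  then show "(of_bool (par x (snd F) \<and> inP x (near (snd F))) + of_bool (par x (snd F + 1) \<and> inP x (near (snd F + 1))) :: int) =
      2 * of_bool (even (x - c) \<and> F \<in> P)" using i par_own[of "snd F" "snd F" x] par_own[of "snd F + 1" "snd F" x] assms by simp
qed

lemma interval_w: "{X F..<X F + w F} = (if w F = 1 then {X F} else {X F, X F + 1})"
  using w_bounds[of F] by auto

text \<open>Off the central row each column of the face has one edge in \<open>Mmin\<close>, on the
  outer or the inner side according to parity. In the central row both sides have the same parity:
  even columns have two such edges and odd ones none, which balances in a hexagon but not in a
  quadrilateral.\<close>

lemma exponent_inside:
  assumes F: "F \<in> P"
  shows "w F - int (mu F) = (if snd F = B \<and> lb F \<le> r then - 1 else if snd F = B \<and> N < lb F + r then 1 else 0)"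
proof (cases "snd F = B")
  case False
  have "inP x (inner (snd F))" if "X F \<le> x" "x < X F + w F" for x
    using inner_facts(4)[OF False] cells_inP[OF that] F by blast
  then have "int (mu F) = (\<Sum>x\<in>{X F..<X F + w F}. 1)"
    unfolding mu_off_center[OF False] using F by (intro sum.cong) (auto simp: of_bool_def)
  then show ?thesis using False w_bounds(1)[of F] by simp
next
  case True
  have ev: "lb F \<le> r \<longleftrightarrow> even (X F - c)" using small_iff[of F] True by simp
  have wl: "w F = (if lb F \<le> r \<or> N < lb F + r then 1 else 2)" by (rule width_lb)
  have nb: "\<not> (lb F \<le> r \<and> N < lb F + r)" using r0 by auto
  show ?thesis unfolding mu_center[OF True] interval_w using True F ev wl nb by auto
qed

lemma edges_count:
  assumes F: "F \<notin> P"
  shows "int (card (fe F \<inter> G)) = (\<Sum>x\<in>{X F..<X F + w F}. of_bool (snd F \<noteq> B \<and> inP x (inner (snd F))))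
     + of_bool (inP (X F - 1) (snd F)) + of_bool (inP (X F + w F) (snd F))"
proof -
  have "vedge (X F, snd F) \<in> G \<longleftrightarrow> inP (X F - 1) (snd F)"
    using bd_X(1)[of F] F by (simp add: vedge_G inP_X)
  moreover have "vedge (X F + w F, snd F) \<in> G \<longleftrightarrow> inP (X F + w F) (snd F)"
    using bd_X(2)[of F] F cells_inP[of F "X F + w F - 1"] w_bounds(1)[of F] by (simp add: vedge_G)
  moreover have "(of_bool (hedge (x, snd F) \<in> G) + of_bool (hedge (x, snd F + 1) \<in> G) :: int) = of_bool (snd F \<noteq> B \<and> inP x (inner (snd F)))"
    if "x \<in> {X F..<X F + w F}" for x
  proof -
    have i: "\<not> inP x (snd F)" using cells_inP[of F x] that F by auto
    show ?thesis
    proof (cases "snd F = B")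
      case True
      then have "near (snd F) = snd F" "near (snd F + 1) = snd F" by (auto simp: near_def)
      then show ?thesis using i True by (simp add: hedge_G_near)
    next
      case False
      then show ?thesis using inner_facts(1)[OF False] i by (auto simp: hedge_G_near)
    qed
  qed
  ultimately show ?thesis unfolding card_fe_Int by simp
qed

text \<open>A face outside meets the graph on its side towards the centre and at an end of the strip
  in its own row. Parity and \<open>small_outside\<close> restrict the possible positions, so few
  common edges occur and the exponent in the covering monomial is always 1.\<close>

lemma exponent_outside:
  assumes F: "F \<in> adj"
  shows "card (fe F \<inter> G) \<in> {1, 2}" "int (mu F) = of_bool (snd F \<noteq> B)"
proof -
  have out: "F \<notin> P" and ne: "card (fe F \<inter> G) \<noteq> 0" using F finite_fe[of F] by (auto simp: adj_def)
  define x0 where "x0 = X F"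
  define e where "e = int (card (fe F \<inter> G))"
  have e1: "1 \<le> e" using ne by (simp add: e_def)
  define hi where "hi = c - \<bar>snd F - B\<bar>"
  define q where "q = qq (snd F - B)"
  have own: "inP x (snd F) \<longleftrightarrow> hi - 2 * q \<le> x \<and> x \<le> hi" for x by (simp add: inP_iff hi_def q_def)
  have ev: "even (x - c + \<bar>snd F - B\<bar>) \<longleftrightarrow> even (x - hi)" for x by (auto simp: hi_def)
  have not_own: "\<not> (hi - 2 * q \<le> x \<and> x \<le> hi)" if "x0 \<le> x" "x < x0 + w F" for x
    using cells_inP[of F x] that out own[of x] by (simp add: x0_def)
  have "(e = 1 \<or> e = 2) \<and> int (mu F) = of_bool (snd F \<noteq> B)"
  proof (cases "snd F = B")
    case True
    have "e = of_bool (inP (X F - 1) (snd F)) + of_bool (inP (X F + w F) (snd F))"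
      unfolding e_def edges_count[OF out] using True by simp
    moreover have "int (mu F) = 0" unfolding mu_center[OF True] using out by simp
    ultimately show ?thesis using True e1 by (auto simp: of_bool_def split: if_splits)
  next
    case False
    define q' where "q' = qq (inner (snd F) - B)"
    have qq': "q + 1 \<le> q'" using inner_facts(3)[OF False] by (simp add: q_def q'_def)
    have inn: "inP x (inner (snd F)) \<longleftrightarrow> hi + 1 - 2 * q' \<le> x \<and> x \<le> hi + 1" for x
      using inner_facts(2)[OF False] by (auto simp: inP_iff hi_def q'_def)
    have ee: "e = (\<Sum>x\<in>{X F..<X F + w F}. of_bool (hi + 1 - 2 * q' \<le> x \<and> x \<le> hi + 1))
      + of_bool (hi - 2 * q \<le> x0 - 1 \<and> x0 - 1 \<le> hi) + of_bool (hi - 2 * q \<le> x0 + w F \<and> x0 + w F \<le> hi)"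
      unfolding e_def edges_count[OF out] own inn using False by (simp add: x0_def)
    have mm: "int (mu F) = (\<Sum>x\<in>{X F..<X F + w F}. of_bool (odd (x - hi) \<and> hi + 1 - 2 * q' \<le> x \<and> x \<le> hi + 1))"
      unfolding mu_off_center[OF False] ev inn using out by simp
    have sm: "lb F \<le> r \<longleftrightarrow> even (x0 - hi)" using small_iff[of F] ev[of x0] by (simp add: x0_def)
    have star: "\<not> (hi + 1 - 2 * q' \<le> x0 \<and> x0 \<le> hi + 1)" if "even (x0 - hi)"
      using small_outside[OF _ out False] sm that inn by (simp add: x0_def)
    \<comment> \<open>A face that ends where the strip of its row begins is followed by a face
      starting in an even column, so it is the quadrilateral just before a wrap.\<close>
    have right: "w F = 1" if "x0 + w F = hi - 2 * q"
    proof -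
      have "lb (fst F + 1, snd F) \<le> r"
      proof -
        have "X (fst F + 1, snd F) = hi - 2 * q" using X_right[of "fst F" "snd F"] that by (simp add: x0_def)
        then show ?thesis unfolding small_iff using ev[of "hi - 2 * q"] by simp
      qed
      then have "N < lb F + r" using small_right[of "fst F" "snd F"] by simp
      then show ?thesis by (simp add: width_lb)
    qed
    show ?thesis
    proof (cases "w F = 1")
      case True
      have no: "\<not> (hi - 2 * q \<le> x0 \<and> x0 \<le> hi)" using not_own[of x0] True by simp
      have E: "e = of_bool (hi + 1 - 2 * q' \<le> x0 \<and> x0 \<le> hi + 1) + of_bool (hi - 2 * q \<le> x0 - 1 \<and> x0 - 1 \<le> hi)
         + of_bool (hi - 2 * q \<le> x0 + 1 \<and> x0 + 1 \<le> hi)" unfolding ee interval_w using True by (simp add: x0_def)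
      have Mu: "int (mu F) = of_bool (odd (x0 - hi) \<and> hi + 1 - 2 * q' \<le> x0 \<and> x0 \<le> hi + 1)"
        unfolding mm interval_w using True by (simp add: x0_def)
      consider (L) "hi - 2 * q \<le> x0 - 1 \<and> x0 - 1 \<le> hi" | (R) "hi - 2 * q \<le> x0 + 1 \<and> x0 + 1 \<le> hi"
        | (N) "\<not> (hi - 2 * q \<le> x0 - 1 \<and> x0 - 1 \<le> hi)" "\<not> (hi - 2 * q \<le> x0 + 1 \<and> x0 + 1 \<le> hi)" by blast
      then show ?thesis
      proof cases
        case L
        then have "x0 = hi + 1" using no by linarith
        then show ?thesis using L qq' False unfolding E Mu by auto
      next
        case R
        then have "x0 = hi - 2 * q - 1" using no by linarith
        then show ?thesis using R qq' False unfolding E Mu by auto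
      next
        case N
        then have "hi + 1 - 2 * q' \<le> x0 \<and> x0 \<le> hi + 1" using e1 unfolding E by (auto simp: of_bool_def split: if_splits)
        then show ?thesis using N star False unfolding E Mu by auto
      qed
    next
      case wF: False
      then have w2: "w F = 2" using w_bounds[of F] by auto
      have no: "\<not> (hi - 2 * q \<le> x0 \<and> x0 \<le> hi)" "\<not> (hi - 2 * q \<le> x0 + 1 \<and> x0 + 1 \<le> hi)"
        using not_own[of x0] not_own[of "x0 + 1"] w2 by simp_all
      have od: "odd (x0 - hi)" using sm width_lb[of F] w2 by (auto split: if_splits)
      have nR: "\<not> (hi - 2 * q \<le> x0 + 2 \<and> x0 + 2 \<le> hi)"
      proof
        assume A: "hi - 2 * q \<le> x0 + 2 \<and> x0 + 2 \<le> hi"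
        then have "x0 + 2 = hi - 2 * q" using no(2) by linarith
        then show False using right w2 by simp
      qed
      have E: "e = of_bool (hi + 1 - 2 * q' \<le> x0 \<and> x0 \<le> hi + 1) + of_bool (hi + 1 - 2 * q' \<le> x0 + 1 \<and> x0 + 1 \<le> hi + 1)
         + of_bool (hi - 2 * q \<le> x0 - 1 \<and> x0 - 1 \<le> hi)" unfolding ee interval_w using w2 nR by (simp add: x0_def)
      have Mu: "int (mu F) = of_bool (hi + 1 - 2 * q' \<le> x0 \<and> x0 \<le> hi + 1)"
        unfolding mm interval_w using w2 od by (simp add: x0_def)
      obtain z where z: "x0 = hi + 2 * z + 1" using od by (metis add.assoc diff_add_cancel add.commute oddE)
      have "(e = 1 \<or> e = 2) \<and> (hi + 1 - 2 * q' \<le> x0 \<and> x0 \<le> hi + 1)"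
      proof (cases "0 \<le> z")
        case True
        then have "\<not> x0 + 1 \<le> hi + 1" using z by linarith
        then have e2: "e = of_bool (hi + 1 - 2 * q' \<le> x0 \<and> x0 \<le> hi + 1) + of_bool (hi - 2 * q \<le> x0 - 1 \<and> x0 - 1 \<le> hi)"
          unfolding E by simp
        then have d: "hi + 1 - 2 * q' \<le> x0 \<and> x0 \<le> hi + 1 \<or> hi - 2 * q \<le> x0 - 1 \<and> x0 - 1 \<le> hi"
          using e1 by (auto simp: of_bool_def split: if_splits)
        then have "hi + 1 - 2 * q' \<le> x0 \<and> x0 \<le> hi + 1" using qq' by linarith
        then show ?thesis using e2 by auto
      next
        case z0: False
        then have b: "2 * z + 2 < - 2 * q" using no(2) z by linarith
        \<comment> \<open>The inner strip begins in a column of the same parity as x0, so it covers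
          both cells of the hexagon or neither.\<close>
        have "(hi + 1 - 2 * q' \<le> x0 \<and> x0 \<le> hi + 1) \<longleftrightarrow> - q' \<le> z"
          "(hi + 1 - 2 * q' \<le> x0 + 1 \<and> x0 + 1 \<le> hi + 1) \<longleftrightarrow> - q' \<le> z"
          "\<not> (hi - 2 * q \<le> x0 - 1 \<and> x0 - 1 \<le> hi)"
          using z z0 b by presburger+
        then show ?thesis using e1 unfolding E by (auto simp: of_bool_def split: if_splits)
      qed
      then show ?thesis using False Mu by simp
    qed
  qed
  then show "card (fe F \<inter> G) \<in> {1, 2}" "int (mu F) = of_bool (snd F \<noteq> B)" by (auto simp: e_def)
qed

lemma finite_faces_of_edge: "e \<in> G \<Longrightarrow> finite {F. e \<in> fe F}"
proof -
  assume "e \<in> G"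
  then have "e \<in> range hedge \<union> range vedge" using G_lattice by (rule rev_subsetD)
  then obtain x y where "e = hedge (x, y) \<or> e = vedge (x, y)" by (metis Un_iff imageE surj_pair)
  then show ?thesis
  proof
    assume 1: "e = hedge (x, y)" show ?thesis by (rule finite_subset[of _ "{fa x y, fa x (y - 1)}"]) (auto simp: 1 hedge_face_iff)
  next
    assume 2: "e = vedge (x, y)" show ?thesis by (rule finite_subset[of _ "{fa x y, fa (x - 1) y}"]) (auto simp: 2 vedge_face_iff)
  qed
qed

lemma finite_adj: "finite adj"
proof (rule finite_subset)
  show "adj \<subseteq> (\<Union>e\<in>G. {F. e \<in> fe F})" by (auto simp: adj_def)
  show "finite (\<Union>e\<in>G. {F. e \<in> fe F})" using finite_G finite_faces_of_edge by blast
qed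

lemma x_weight_Mmin: "x_weight r s N X Mmin = (\<Prod>F\<in>P \<union> adj. (1 / xF F) ^ mu F)"
proof -
  let ?S = "P \<union> adj"
  have "x_weight r s N X Mmin = (\<Prod>e\<in>Mmin. \<Prod>F\<in>{F \<in> ?S. e \<in> fe F}. 1 / xF F)"
    unfolding x_weight_def
  proof (intro prod.cong refl)
    fix e assume "e \<in> Mmin"
    then have "e \<in> G" using Mmin_G by blast
    then have "{F \<in> ?S. e \<in> fe F} = {F. e \<in> fe F}" by (auto simp: adj_def)
    then show "ew e = (\<Prod>F\<in>{F \<in> ?S. e \<in> fe F}. 1 / xF F)"
      unfolding edge_weight_def prod_dividef by simp
  qed
  also have "\<dots> = (\<Prod>F\<in>?S. \<Prod>e\<in>{e \<in> Mmin. e \<in> fe F}. 1 / xF F)"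
    by (rule prod.swap_restrict) (use finite_P finite_adj finite_subset[OF Mmin_G finite_G] in auto)
  also have "\<dots> = (\<Prod>F\<in>?S. (1 / xF F) ^ mu F)"
    by (intro prod.cong refl) (simp add: mu_def Int_def conj_commute)
  finally show ?thesis .
qed

lemma covering_weight:
  "covering_monomial r s N X P * x_weight r s N X Mmin =
    (\<Prod>F\<in>{F \<in> P. snd F = B \<and> lb F \<le> r}. 1 / xF F) * (\<Prod>F\<in>{F \<in> P. snd F = B \<and> N < lb F + r}. xF F) *
    (\<Prod>F\<in>{F \<in> adj. snd F = B}. xF F)"
proof -
  have "covering_monomial r s N X P = (\<Prod>F\<in>P. xF F ^ nat (w F)) * (\<Prod>F\<in>adj. xF F)"
  proof -
    have "nat \<lceil>real (card (fe F \<inter> G)) / 2\<rceil> = 1" if "F \<in> adj" for F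
    proof -
      have "\<lceil>1 / 2 :: real\<rceil> = 1" by (simp add: ceiling_eq_iff)
      then show ?thesis using exponent_outside(1)[OF that] by auto
    qed
    then have "(\<Prod>F\<in>adj. xF F ^ nat \<lceil>real (card (fe F \<inter> G)) / 2\<rceil>) = (\<Prod>F\<in>adj. xF F)"
      by (intro prod.cong) auto
    then show ?thesis unfolding covering_monomial_def card_fe adj_def by simp
  qed
  then have "covering_monomial r s N X P * x_weight r s N X Mmin =
      (\<Prod>F\<in>P. xF F ^ nat (w F) * (1 / xF F) ^ mu F) * (\<Prod>F\<in>adj. xF F * (1 / xF F) ^ mu F)"
    unfolding x_weight_Mmin using finite_P finite_adj
    by (subst prod.union_disjoint) (auto simp: prod.distrib adj_def)
  also have "(\<Prod>F\<in>adj. xF F * (1 / xF F) ^ mu F) = (\<Prod>F\<in>adj. if snd F = B then xF F else 1)"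
  proof (intro prod.cong refl)
    fix F assume "F \<in> adj"
    then have "mu F = of_bool (snd F \<noteq> B)" using exponent_outside(2)[of F] by (simp add: of_bool_def split: if_splits)
    then show "xF F * (1 / xF F) ^ mu F = (if snd F = B then xF F else 1)" by (simp add: indet_nz)
  qed
  also have "\<dots> = (\<Prod>F\<in>{F \<in> adj. snd F = B}. xF F)" using finite_adj by (simp add: prod.inter_filter)
  also have "(\<Prod>F\<in>P. xF F ^ nat (w F) * (1 / xF F) ^ mu F) =
      (\<Prod>F\<in>P. (if snd F = B \<and> lb F \<le> r then 1 / xF F else 1) * (if snd F = B \<and> N < lb F + r then xF F else 1))"
  proof (intro prod.cong refl)
    fix F assume F: "F \<in> P"
    have "xF F ^ nat (w F) * (1 / xF F) ^ mu F = xF F powi (w F - int (mu F))"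
    proof -
      have "xF F powi (int (nat (w F)) - int (mu F)) = xF F ^ nat (w F) / xF F ^ mu F"
        unfolding power_int_diff[OF disjI1[OF indet_nz]] power_int_of_nat ..
      then show ?thesis using w_bounds(1)[of F] by (simp add: power_one_over)
    qed
    also have "\<dots> = (if snd F = B \<and> lb F \<le> r then 1 / xF F else 1) * (if snd F = B \<and> N < lb F + r then xF F else 1)"
      unfolding exponent_inside[OF F] using r0 by (auto simp: power_int_minus field_simps)
    finally show "xF F ^ nat (w F) * (1 / xF F) ^ mu F = \<dots>" .
  qed
  also have "\<dots> = (\<Prod>F\<in>{F \<in> P. snd F = B \<and> lb F \<le> r}. 1 / xF F) * (\<Prod>F\<in>{F \<in> P. snd F = B \<and> N < lb F + r}. xF F)"
    using finite_P by (simp add: prod.distrib prod.inter_filter)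
  finally show ?thesis .
qed

lemma fa_side: "fa (X F - 1) (snd F) = (fst F - 1, snd F)" "fa (X F + w F) (snd F) = (fst F + 1, snd F)"
proof -
  show "fa (X F - 1) (snd F) = (fst F - 1, snd F)" using bd_left(1)[OF bd_X(1)[of F]] by simp
  show "fa (X F + w F) (snd F) = (fst F + 1, snd F)"
    using X_right[of "fst F" "snd F"] fa_X[of "(fst F + 1, snd F)"] by simp
qed

lemma adj_center:
  assumes "snd F = B"
  shows "F \<in> adj \<longleftrightarrow> F \<notin> P \<and> ((fst F - 1, B) \<in> P \<or> (fst F + 1, B) \<in> P)"
proof (cases "F \<in> P")
  case False
  have "fe F \<inter> G \<noteq> {} \<longleftrightarrow> int (card (fe F \<inter> G)) \<noteq> 0" using finite_fe[of F] by simp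
  also have "\<dots> \<longleftrightarrow> (fst F - 1, B) \<in> P \<or> (fst F + 1, B) \<in> P"
    unfolding edges_count[OF False] inP_def fa_side using assms by (auto simp: of_bool_def)
  finally show ?thesis using False by (simp add: adj_def)
qed (simp add: adj_def)

text \<open>The strip starts with a label up to r. The outside face to the left of it completes the
  quotients f (i - 1) / f i taken over all faces that follow a wrap, and the outside face to the
  right of the strip gives the first factor of \<open>lead\<close>.\<close>

lemma covering_weight_eq_lead: "covering_monomial r s N X P * x_weight r s N X Mmin = lead (int n)"
proof -
  define K where "K = int n - int N - 1"
  define D where "D = int N - int r"
  define q where "q = K div int r"
  define \<beta> where "\<beta> = K div D"
  define \<sigma> where "\<sigma> i \<longleftrightarrow> lb (C + i, B) \<le> r" for i
  define f where "f i = xF (C + i, B)" for i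
  have K: "0 \<le> K" using n by (simp add: K_def)
  have D: "0 < D" "int r < D" using r0 by (auto simp: D_def)
  have q0: "0 \<le> q" "0 \<le> \<beta>" using K D r0 by (auto simp: q_def \<beta>_def pos_imp_zdiv_nonneg_iff)
  have Kq: "K = q * int r + K mod int r" "0 \<le> K mod int r" "K mod int r < int r" using r0 by (auto simp: q_def)
  have Kb: "K = \<beta> * D + K mod D" "0 \<le> K mod D" "K mod D < D" using D by (auto simp: \<beta>_def)
  have dv: "i * d \<le> K \<longleftrightarrow> i \<le> K div d" if d: "0 < d" for i d
  proof
    assume "i * d \<le> K"
    then have "(i * d) div d \<le> K div d" using d by (intro zdiv_mono1) auto
    then show "i \<le> K div d" using d by simp
  next
    assume "i \<le> K div d"
    then have "i * d \<le> (K div d) * d" using d by (intro mult_right_mono) auto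
    moreover have "K = (K div d) * d + K mod d" "0 \<le> K mod d" using d by auto
    ultimately show "i * d \<le> K" by linarith
  qed
  have inP: "(C + i, B) \<in> P \<longleftrightarrow> - q \<le> i \<and> i \<le> \<beta>" for i
  proof -
    have "(C + i, B) \<in> P \<longleftrightarrow> - i * int r \<le> K \<and> i * D \<le> K"
      using P_rel[of i 0] by (simp add: pine_def dst_def K_def D_def)
    also have "- i * int r \<le> K \<longleftrightarrow> - q \<le> i"
      using dv[of "int r" "- i"] r0 unfolding q_def by linarith
    also have "i * D \<le> K \<longleftrightarrow> i \<le> \<beta>" unfolding \<beta>_def by (rule dv[OF D(1)])
    finally show ?thesis .
  qed
  have lbi: "int (lb (C + i, B)) = (K + i * int r) mod int N + 1" for i
    using label_rel[of i 0] mm_mod[of 0 i] by (simp add: mm_def K_def)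
  have \<sigma>_iff: "\<sigma> i \<longleftrightarrow> (K + i * int r) mod int N < int r" for i
    using lbi[of i] unfolding \<sigma>_def by linarith
  have large: "N < lb (C + i, B) + r \<longleftrightarrow> \<sigma> (i + 1)" for i
    using small_right[of "C + i" B] by (simp add: \<sigma>_def add.assoc)
  have euclid: "(t + m * d) div d = m" "(t + m * d) mod d = t" if "0 \<le> t" "t < d" for t m d :: int
  proof -
    have "d \<noteq> 0" "t div d = 0" "t mod d = t" using that by auto
    then show "(t + m * d) div d = m" "(t + m * d) mod d = t" by simp_all
  qed
  have ends: "\<sigma> (- q)" "\<not> \<sigma> (\<beta> + 1)" "f (\<beta> + 1) = indet (nat (K mod D + int r + 1))"
  proof -
    have E0: "K + (- q) * int r = K mod int r" using Kq(1) by simp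
    have "K mod int r mod int N = K mod int r" using Kq(2,3) r0 by (intro mod_pos_pos_trivial; linarith)
    then show "\<sigma> (- q)" unfolding \<sigma>_iff E0 using Kq(3) by simp
    have E: "K + (\<beta> + 1) * int r = K mod D + int r + \<beta> * int N" using Kb(1) by (simp add: D_def algebra_simps)
    have m: "(K + (\<beta> + 1) * int r) mod int N = K mod D + int r"
      unfolding E mod_mult_self1 using Kb(2,3) D_def by (intro mod_pos_pos_trivial; linarith)
    show "\<not> \<sigma> (\<beta> + 1)" unfolding \<sigma>_iff m using Kb by simp
    have "int (lb (C + (\<beta> + 1), B)) = K mod D + int r + 1" using lbi[of "\<beta> + 1"] m by simp
    then show "f (\<beta> + 1) = indet (nat (K mod D + int r + 1))" unfolding f_def by (metis nat_int)
  qed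
  have row: "(\<Prod>F\<in>{F \<in> S. snd F = B \<and> Q F}. g F) = (\<Prod>i\<in>{i. (C + i, B) \<in> S \<and> Q (C + i, B)}. g (C + i, B))"
    for S :: "face set" and Q :: "face \<Rightarrow> bool" and g :: "face \<Rightarrow> ratfun"
    by (rule prod.reindex_bij_witness[of _ "\<lambda>i. (C + i, B)" "\<lambda>F. fst F - C"]) auto
  have s1: "(\<Prod>F\<in>{F \<in> P. snd F = B \<and> lb F \<le> r}. 1 / xF F) = (\<Prod>i\<in>{i \<in> {- q..\<beta>}. \<sigma> i}. 1 / f i)"
    unfolding row by (simp add: inP \<sigma>_def f_def)
  have s2: "(\<Prod>F\<in>{F \<in> P. snd F = B \<and> N < lb F + r}. xF F) = (\<Prod>i\<in>{i \<in> {- q + 1..\<beta>}. \<sigma> i}. f (i - 1))"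
  proof -
    have "(\<Prod>F\<in>{F \<in> P. snd F = B \<and> N < lb F + r}. xF F) = (\<Prod>i\<in>{i. (- q \<le> i \<and> i \<le> \<beta>) \<and> \<sigma> (i + 1)}. f i)"
      unfolding row by (simp add: inP large f_def)
    also have "\<dots> = (\<Prod>i\<in>{i \<in> {- q + 1..\<beta>}. \<sigma> i}. f (i - 1))"
    proof (rule prod.reindex_bij_witness[of _ "\<lambda>i. i - 1" "\<lambda>i. i + 1"])
      fix i assume "i \<in> {i. (- q \<le> i \<and> i \<le> \<beta>) \<and> \<sigma> (i + 1)}"
      then show "i + 1 \<in> {i \<in> {- q + 1..\<beta>}. \<sigma> i}" using ends(2) by (cases "i = \<beta>") auto
    qed auto
    finally show ?thesis .
  qed
  have s3: "(\<Prod>F\<in>{F \<in> adj. snd F = B}. xF F) = f (- q - 1) * f (\<beta> + 1)"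
  proof -
    have "(C + i, B) \<in> adj \<longleftrightarrow> i = - q - 1 \<or> i = \<beta> + 1" for i
      using inP[of i] inP[of "i - 1"] inP[of "i + 1"] q0 unfolding adj_center[of "(C + i, B)", simplified]
      by (auto simp: algebra_simps)
    then have "{i. (C + i, B) \<in> adj} = {- q - 1, \<beta> + 1}" by auto
    then show ?thesis using row[of xF adj "\<lambda>_. True"] q0 by (simp add: f_def)
  qed
  have ins: "{i \<in> {- q..\<beta>}. \<sigma> i} = insert (- q) {i \<in> {- q + 1..\<beta>}. \<sigma> i}" using ends(1) q0 by auto
  have s4: "(\<Prod>i\<in>{i \<in> {- q..\<beta>}. \<sigma> i}. f (i - 1)) = f (- q - 1) * (\<Prod>i\<in>{i \<in> {- q + 1..\<beta>}. \<sigma> i}. f (i - 1))"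
  proof -
    have "finite {i \<in> {- q + 1..\<beta>}. \<sigma> i}" by (rule finite_subset[of _ "{- q + 1..\<beta>}"]) auto
    then show ?thesis unfolding ins by (subst prod.insert) auto
  qed
  have "covering_monomial r s N X P * x_weight r s N X Mmin =
      f (\<beta> + 1) * ((\<Prod>i\<in>{i \<in> {- q..\<beta>}. \<sigma> i}. 1 / f i) * (\<Prod>i\<in>{i \<in> {- q..\<beta>}. \<sigma> i}. f (i - 1)))"
    unfolding covering_weight s1 s2 s3 s4 by (simp only: mult_ac)
  also have "\<dots> = f (\<beta> + 1) * (\<Prod>i\<in>{i \<in> {- q..\<beta>}. \<sigma> i}. f (i - 1) / f i)"
    unfolding prod.distrib[symmetric] by simp
  also have "(\<Prod>i\<in>{i \<in> {- q..\<beta>}. \<sigma> i}. f (i - 1) / f i) =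
      (\<Prod>b\<in>{0..\<beta>}. indet (nat (D + (K - b * int N) mod int r + 1)) / indet (nat ((K - b * int N) mod int r + 1)))"
  \<comment> \<open>The face i is indexed by its number b of wraps: K + i r = b N + t with 0 <= t <
    r. Division of K - b N by r recovers i and t.\<close>
  proof (rule prod.reindex_bij_witness[of _ "\<lambda>b. - ((K - b * int N) div int r)" "\<lambda>i. (K + i * int r) div int N"])
    fix i assume "i \<in> {i \<in> {- q..\<beta>}. \<sigma> i}"
    then have i: "- q \<le> i" "i \<le> \<beta>" "\<sigma> i" by auto
    define b t where "b = (K + i * int r) div int N" and "t = (K + i * int r) mod int N"
    have bt: "K + i * int r = b * int N + t" by (simp add: b_def t_def)
    have t: "0 \<le> t" "t < int r" using i(3) N0 by (auto simp: \<sigma>_iff t_def)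
    have Kb': "K - b * int N = t + (- i) * int r" using bt by (simp add: algebra_simps)
    have dm: "(K - b * int N) div int r = - i" "(K - b * int N) mod int r = t"
      unfolding Kb' using t by (rule euclid)+
    show "- ((K - (K + i * int r) div int N * int N) div int r) = i" using dm(1) by (simp add: b_def)
    have "- q * int r \<le> i * int r" using i(1) by (intro mult_right_mono) auto
    then have "0 \<le> K + i * int r" using Kq by linarith
    then have "0 \<le> b" using N0 by (simp add: b_def pos_imp_zdiv_nonneg_iff)
    moreover have "b \<le> \<beta>"
    proof -
      have "i * int r \<le> \<beta> * int r" using i(2) by (intro mult_right_mono) auto
      then have "K + i * int r \<le> \<beta> * int N + K mod D" using Kb(1) by (simp add: D_def algebra_simps)
      then have "b \<le> (K mod D + \<beta> * int N) div int N" unfolding b_def using N0 by (intro zdiv_mono1) auto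
      also have "\<dots> = \<beta>"
      proof -
        have "K mod D div int N = 0" using Kb(2,3) D_def by (intro div_pos_pos_trivial; linarith)
        then show ?thesis using N0 by simp
      qed
      finally show ?thesis .
    qed
    ultimately show "(K + i * int r) div int N \<in> {0..\<beta>}" by (simp add: b_def)
    have l: "int (lb (C + i, B)) = t + 1" using lbi[of i] by (simp add: t_def)
    have "lb (C + i - 1, B) = lb (C + i, B) + N - r" using lb_left[of "C + i" B] i(3) by (simp add: \<sigma>_def)
    then have l': "int (lb (C + (i - 1), B)) = D + t + 1" using l r0 by (simp add: D_def algebra_simps)
    have "f i = indet (nat (t + 1))" "f (i - 1) = indet (nat (D + t + 1))" unfolding f_def l[symmetric] l'[symmetric] by simp_all
    then show "indet (nat (D + (K - (K + i * int r) div int N * int N) mod int r + 1)) /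
        indet (nat ((K - (K + i * int r) div int N * int N) mod int r + 1)) = f (i - 1) / f i"
      using dm(2) by (simp add: b_def)
  next
    fix b assume "b \<in> {0..\<beta>}"
    then have b: "0 \<le> b" "b \<le> \<beta>" by auto
    define j t where "j = (K - b * int N) div int r" and "t = (K - b * int N) mod int r"
    have jt: "K - b * int N = j * int r + t" by (simp add: j_def t_def)
    have t: "0 \<le> t" "t < int r" using r0 by (auto simp: t_def)
    have E: "K + (- j) * int r = t + b * int N" using jt by (simp add: algebra_simps)
    have dm: "(K + (- j) * int r) div int N = b" "(K + (- j) * int r) mod int N = t"
      unfolding E using euclid[of t "int N" b] t r0 by auto
    show "(K + - ((K - b * int N) div int r) * int r) div int N = b" using dm(1) by (simp add: j_def)
    have "j \<le> q" unfolding j_def q_def using b(1) r0 by (intro zdiv_mono1) auto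
    moreover have "- \<beta> \<le> j"
    proof -
      have "b * int N \<le> \<beta> * int N" using b(2) by (intro mult_right_mono) auto
      moreover have "\<beta> * int N - \<beta> * int r \<le> K" using Kb by (simp add: D_def algebra_simps)
      ultimately have "- \<beta> * int r \<le> K - b * int N" by simp
      then have "(- \<beta> * int r) div int r \<le> j" unfolding j_def using r0 by (intro zdiv_mono1) auto
      moreover have "(- \<beta> * int r) div int r = - \<beta>" using r0 by (intro nonzero_mult_div_cancel_right) auto
      ultimately show ?thesis by simp
    qed
    ultimately show "- ((K - b * int N) div int r) \<in> {i \<in> {- q..\<beta>}. \<sigma> i}"
      using dm(2) t by (simp add: j_def[symmetric] \<sigma>_iff)
  qed
  finally show ?thesis unfolding ends(3) using n by (simp add: lead_def Let_def K_def D_def \<beta>_def)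
qed

end

theorem theorem1p1:
  fixes r s N n :: nat and X :: "face \<Rightarrow> int" and P :: "face set"
  assumes "0 < r" and "r < s" and "2 * s \<le> N" and "gcd r (gcd s N) = 1"
    and "N + 1 \<le> n"
    and "brane_tiling r s N X"
    and "is_pinecone r s N X n P"
  shows "xhat r s N n =
    covering_monomial r s N X P *
    (\<Sum>M | perfect_matching (graph_edges r s N X P) M.
       x_weight r s N X M * y_weight r s N X P M)"
proof -
  interpret gr_params r s N using assms(1-3) by unfold_locales
  have n: "N < n" using assms(5) by simp
  obtain C B c where "drawn_pinecone r s N n X P C B c"
    using drawn_pinecone_exists[OF assms(6,7) n] by blast
  then interpret drawn_pinecone r s N n X P C B c .
  have "xhat r s N n = lead (int n) *
      fpoly (int n) (\<lambda>l. indet (N + nat l + 1) * nbr_mon (\<lambda>i. indet (nat i)) (l + 1))"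
    by (rule xhat_eq_fpoly) (use lead_nz lead_rec n in \<open>auto simp: lead_def\<close>)
  then show ?thesis unfolding matching_sum covering_weight_eq_lead[symmetric] by (simp add: mult.assoc)
qed

end
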